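(* Let $n\ge 3$ and let $(\Omega,u)$ be a solution to the problem $\Delta u=-n$ in $\Omega$, $u=0$ on $\partial\Omega$, where $\Omega\subset\mathbb{R}^n$ is a ring-shaped domain (a bounded domain with smooth boundary whose boundary consists of two connected components), with inner and outer boundary components denoted by $\Gamma_1$ and $\Gamma_2$ respectively. Assume that there exists a smooth hypersurface $\Sigma\subseteq\mathrm{MAX}(u)$ dividing $\Omega$ into two regions $\Omega_1$ and $\Omega_2$ such that $\partial\Omega\cap\overline{\Omega}_1=\Gamma_1$ and $\partial\Omega\cap\overline{\Omega}_2=\Gamma_2$. Then the expected core radii $R_1:=R(u,\Gamma_1)$ and $R_2:=R(u,\Gamma_2)$ are well-defined. Suppose moreover that $\tau(u,\Omega_2)<\sqrt{n}$. Then for every $p\in\Sigma$, $$\frac{n-1}{R_2}\sqrt{(u_{R_2})_{\mathrm{max}}}\;\le\; \mathrm{H}(p)\sqrt{u_{\mathrm{max}}}\;\le\;\frac{n-1}{R_1}\sqrt{(u_{R_1})_{\mathrm{max}}},$$ where $\mathrm{H}(p)$ is the mean curvature of $\Sigma$ at $p$ with respect to the exterior unit normal to $\Omega_1$. Moreover, $R_2\ge R_1$, and $R_1=R_2=:R$ if and only if $(\Omega,u)$ is equivalent to $(\Omega_R,u_R)$.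
   Context: Notation: $u_{\mathrm{max}}:=\max_\Omega u$ and $\mathrm{MAX}(u):=\{x\in\Omega: u(x)=u_{\mathrm{max}}\}$. The mean curvature is the trace of the second fundamental form. The Normalized Wall Shear Stress of $u$ on a connected component $S$ of $\partial\Omega$ is $\tau(u,S):=\max_S|\nabla u|/\sqrt{2u_{\mathrm{max}}}$; for a connected component $N$ of $\Omega\setminus\mathrm{MAX}(u)$, $\tau(u,N):=\max_S\tau(u,S)$ over the connected components $S$ of $\partial\Omega\cap\overline N$. Let $R_{\mathrm{max}}:=\sqrt{(n-2)/n}$. For $R\in(0,R_{\mathrm{max}})$, the ring-shaped model solution is $u_R(x)=\frac{1-|x|^2}{2}-\frac{R^n}{(n-2)|x|^{n-2}}$ on $\Omega_R=\{r_1<|x|<r_2\}$, where $r_1=r_1(R)<r_2=r_2(R)$ are the two positive zeros of $f_R(r)=1-r^2-\frac{2R^n}{(n-2)r^{n-2}}$; its maximum is $(u_R)_{\mathrm{max}}=\frac12\left(1-\frac{n}{n-2}R^2\right)$, attained on $\{|x|=R\}$. The Inner NWSS $\tau_1:(0,R_{\mathrm{max}}]\to[\sqrt n,\infty)$ is $\tau_1(R)=r_1\left(\frac{R^n}{r_1^n}-1\right)/\sqrt{1-\frac{nR^2}{n-2}}$ for $R<R_{\mathrm{max}}$ and $\tau_1(R_{\mathrm{max}})=\sqrt n$ (strictly decreasing); the Outer NWSS $\tau_2:[0,R_{\mathrm{max}})\to[1,\sqrt n)$ is $\tau_2(0)=1$ and $\tau_2(R)=r_2\left(1-\frac{R^n}{r_2^n}\right)/\sqrt{1-\frac{nR^2}{n-2}}$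 for $R>0$ (strictly increasing). The expected core radius of $u$ on a boundary component $S$ is $R(u,S):=\tau_2^{-1}(\tau(u,S))$ if $\tau(u,S)\in[1,\sqrt n)$ and $R(u,S):=\tau_1^{-1}(\tau(u,S))$ if $\tau(u,S)\ge\sqrt n$. Two solutions $(\Omega,u)$, $(\bar\Omega,\bar u)$ are equivalent if there exist $\lambda>0$ and $c$ such that $\bar\Omega=\{\lambda x+c: x\in\Omega\}$ and $\bar u(y)=\lambda^2u\big((y-c)/\lambda\big)$. *)

theory Defs
  imports "HOL-Analysis.Analysis"
begin

definition partial :: "'n::finite \<Rightarrow> (real^'n \<Rightarrow> real) \<Rightarrow> real^'n \<Rightarrow> real" where
  "partial i f x = frechet_derivative f (at x) (axis i 1)"

definition grad :: "(real^'n::finite \<Rightarrow> real) \<Rightarrow> real^'n \<Rightarrow> real^'n" where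
  "grad f x = (\<chi> i. partial i f x)"

definition laplacian :: "(real^'n::finite \<Rightarrow> real) \<Rightarrow> real^'n \<Rightarrow> real" where
  "laplacian f x = (\<Sum>i\<in>UNIV. partial i (partial i f) x)"

definition divergence :: "(real^'n::finite \<Rightarrow> real^'n) \<Rightarrow> real^'n \<Rightarrow> real" where
  "divergence F x = (\<Sum>i\<in>UNIV. partial i (\<lambda>y. F y $ i) x)"

fun Ck_on :: "nat \<Rightarrow> (real^'n::finite) set \<Rightarrow> (real^'n \<Rightarrow> real) \<Rightarrow> bool" where
  "Ck_on 0 S f = continuous_on S f"
| "Ck_on (Suc k) S f = (f differentiable_on S \<and> (\<forall>i. Ck_on k S (partial i f)))"

definition smooth_on :: "(real^'n::finite) set \<Rightarrow> (real^'n \<Rightarrow> real) \<Rightarrow> bool" where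
  "smooth_on S f \<longleftrightarrow> open S \<and> (\<forall>k. Ck_on k S f)"

definition smooth_bounded_domain :: "(real^'n::finite) set \<Rightarrow> bool" where
  "smooth_bounded_domain \<Omega> \<longleftrightarrow> open \<Omega> \<and> connected \<Omega> \<and> bounded \<Omega> \<and> \<Omega> \<noteq> {} \<and>
     (\<forall>p\<in>frontier \<Omega>. \<exists>U \<phi>. p \<in> U \<and> smooth_on U \<phi> \<and> (\<forall>x\<in>U. grad \<phi> x \<noteq> 0) \<and>
        U \<inter> \<Omega> = {x\<in>U. \<phi> x < 0})"

definition smooth_hypersurface :: "(real^'n::finite) set \<Rightarrow> bool" where
  "smooth_hypersurface \<Sigma> \<longleftrightarrow>
     (\<forall>p\<in>\<Sigma>. \<exists>U \<phi>. p \<in> U \<and> smooth_on U \<phi> \<and> (\<forall>x\<in>U. grad \<phi> x \<noteq> 0) \<and>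
        \<Sigma> \<inter> U = {x\<in>U. \<phi> x = 0})"

text \<open>h is the mean curvature (trace of the second fundamental form) of \<Sigma> at p with respect
  to the unit normal pointing out of A: computed as div(grad phi/|grad phi|)(p) for a local
  defining function phi of \<Sigma> at p which is negative exactly on the A side.\<close>
definition mean_curvature_at ::
  "(real^'n::finite) set \<Rightarrow> (real^'n) set \<Rightarrow> real^'n \<Rightarrow> real \<Rightarrow> bool" where
  "mean_curvature_at \<Sigma> A p h \<longleftrightarrow>
     (\<exists>U \<phi>. p \<in> U \<and> smooth_on U \<phi> \<and> (\<forall>x\<in>U. grad \<phi> x \<noteq> 0) \<and>
        \<Sigma> \<inter> U = {x\<in>U. \<phi> x = 0} \<and> A \<inter> U = {x\<in>U. \<phi> x < 0} \<and>
        h = divergence (\<lambda>x. (1 / norm (grad \<phi> x)) *\<^sub>R grad \<phi> x) p)"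

definition umax :: "(real^'n::finite) set \<Rightarrow> (real^'n \<Rightarrow> real) \<Rightarrow> real" where
  "umax \<Omega> u = (SUP x\<in>\<Omega>. u x)"

definition MAXset :: "(real^'n::finite) set \<Rightarrow> (real^'n \<Rightarrow> real) \<Rightarrow> (real^'n) set" where
  "MAXset \<Omega> u = {x\<in>\<Omega>. u x = umax \<Omega> u}"

definition nwss :: "(real^'n::finite) set \<Rightarrow> (real^'n \<Rightarrow> real) \<Rightarrow> (real^'n) set \<Rightarrow> real" where
  "nwss \<Omega> u S = (SUP x\<in>S. norm (grad u x)) / sqrt (2 * umax \<Omega> u)"

definition nwss_region :: "(real^'n::finite) set \<Rightarrow> (real^'n \<Rightarrow> real) \<Rightarrow> (real^'n) set \<Rightarrow> real" where
  "nwss_region \<Omega> u N = (SUP S\<in>{S\<in>components (frontier \<Omega>). S \<subseteq> closure N}. nwss \<Omega> u S)"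

section \<open>Model solutions (dimension n is a real parameter, n = CARD('n))\<close>

definition Rmax :: "real \<Rightarrow> real" where
  "Rmax n = sqrt ((n - 2) / n)"

definition fR :: "real \<Rightarrow> real \<Rightarrow> real \<Rightarrow> real" where
  "fR n R r = 1 - r\<^sup>2 - 2 * R powr n / ((n - 2) * r powr (n - 2))"

text \<open>The two positive zeros of f_R (f_R attains its max at r = R, where it is positive).\<close>
definition r1 :: "real \<Rightarrow> real \<Rightarrow> real" where
  "r1 n R = (THE r. 0 < r \<and> r < R \<and> fR n R r = 0)"

definition r2 :: "real \<Rightarrow> real \<Rightarrow> real" where
  "r2 n R = (THE r. R < r \<and> fR n R r = 0)"

definition uR :: "real \<Rightarrow> real \<Rightarrow> real^'n::finite \<Rightarrow> real" where
  "uR n R x = (1 - (norm x)\<^sup>2) / 2 - R powr n / ((n - 2) * norm x powr (n - 2))"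

definition OmegaR :: "real \<Rightarrow> real \<Rightarrow> (real^'n::finite) set" where
  "OmegaR n R = {x. r1 n R < norm x \<and> norm x < r2 n R}"

definition uRmax :: "real \<Rightarrow> real \<Rightarrow> real" where
  "uRmax n R = (1 - n / (n - 2) * R\<^sup>2) / 2"

definition tau1 :: "real \<Rightarrow> real \<Rightarrow> real" where
  "tau1 n R = (if R = Rmax n then sqrt n
     else r1 n R * (R powr n / r1 n R powr n - 1) / sqrt (1 - n * R\<^sup>2 / (n - 2)))"

definition tau2 :: "real \<Rightarrow> real \<Rightarrow> real" where
  "tau2 n R = (if R = 0 then 1
     else r2 n R * (1 - R powr n / r2 n R powr n) / sqrt (1 - n * R\<^sup>2 / (n - 2)))"

definition core_radius_wd :: "real \<Rightarrow> real \<Rightarrow> bool" where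
  "core_radius_wd n t \<longleftrightarrow>
     (1 \<le> t \<and> t < sqrt n \<and> (\<exists>!R. 0 \<le> R \<and> R < Rmax n \<and> tau2 n R = t)) \<or>
     (sqrt n \<le> t \<and> (\<exists>!R. 0 < R \<and> R \<le> Rmax n \<and> tau1 n R = t))"

definition core_radius :: "real \<Rightarrow> real \<Rightarrow> real" where
  "core_radius n t = (if 1 \<le> t \<and> t < sqrt n
     then (THE R. 0 \<le> R \<and> R < Rmax n \<and> tau2 n R = t)
     else (THE R. 0 < R \<and> R \<le> Rmax n \<and> tau1 n R = t))"

definition equivalent_sol ::
  "(real^'n::finite) set \<Rightarrow> (real^'n \<Rightarrow> real) \<Rightarrow> (real^'n) set \<Rightarrow> (real^'n \<Rightarrow> real) \<Rightarrow> bool" where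
  "equivalent_sol \<Omega> u \<Omega>' u' \<longleftrightarrow> (\<exists>lam c. lam > 0 \<and> \<Omega>' = (\<lambda>x. lam *\<^sub>R x + c) ` \<Omega> \<and>
      (\<forall>y\<in>\<Omega>'. u' y = lam\<^sup>2 * u ((1 / lam) *\<^sub>R (y - c))))"

end

theory Submission
  imports Defs
begin

text \<open>Write \<open>m\<close> for the maximum of \<open>u\<close>. In a region bounded by \<open>\<Sigma>\<close> and one boundary component, \<open>|\<nabla>u|\<^sup>2\<close> is compared with
  \<open>y(u)\<close>, its value for a rescaled radial model with the same maximum, core radius \<open>\<rho>\<close> and the given boundary gradient.
  By Bochner's formula and the Kato-type bound \<open>|D\<^sup>2u|\<^sup>2 \<ge> A\<^sup>2 + (n + A)\<^sup>2 / (n - 1)\<close>, \<open>A = D\<^sup>2u(\<nu>,\<nu>)\<close>, the difference (divided by a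
  positive function of \<open>u\<close> on the inner side) has no positive interior maximum, so \<open>|\<nabla>u|\<^sup>2 \<le> y(u)\<close>. Integrating this
  along the normal at a point of \<open>\<Sigma>\<close> bounds \<open>u\<close> from below by the model, which agrees with \<open>u\<close> to second order there;
  since the third normal derivative of \<open>u\<close> on \<open>\<Sigma>\<close> is \<open>n H\<close>, the bounds on \<open>H\<close> follow. Letting \<open>\<rho>\<close> tend to \<open>0\<close> or to infinity shows that
  the shear stresses exceed \<open>1\<close>, and the inner one exceeds \<open>sqrt n\<close>.

  If the core radii agree, the comparison on the outer side cannot be strict on the level set \<open>u = m / 2\<close>, because
  otherwise a smaller \<open>\<rho>\<close> would do near \<open>\<Sigma>\<close>. The strong maximum principle then gives equality in Bochner's formula on
  an open set, where \<open>u\<close> is therefore radial, and unique continuation for harmonic functions does the rest.\<close>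

section \<open>Gradients and partial derivatives\<close>

text \<open>The maximum set is degenerate for the comparison: |grad u|^2 and y(u) both vanish there,
  and y is not smooth in u because P(1) = 0 makes the inverse of Q behave like a square root. So
  derivatives of y are taken only where u < m, and the expansion along the normal is made for the
  scaled radius, which stays Lipschitz. Equality on the maximum set carries no information; the
  level u = m / 2 is used because it avoids both the maximum set and the boundary, so contact there
  is an interior event. On the inner side the zero-order term has the wrong sign, and a positive
  excess cannot be excluded directly. The equation satisfied by y does not contain the level
  explicitly, so y' = -2 g solves its linearization; y + F g with a constant F then satisfies it up
  to order F^2, where the sign is right. Any model whose boundary gradient is at least the given one
  is admissible. This freedom in the core radius yields the bounds on the stresses and the rigidity.
  A point of the hypersurface with different regions on its two sides is not given; its existence
  follows from the connectedness of the domain.\<close>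

definition has_grad :: "(real^'n::finite \<Rightarrow> real) \<Rightarrow> real^'n \<Rightarrow> real^'n \<Rightarrow> bool" where
  "has_grad f g x \<longleftrightarrow> (f has_derivative (\<lambda>h. g \<bullet> h)) (at x)"

lemma has_grad_partial: "has_grad f g x \<Longrightarrow> partial i f x = g $ i"
  unfolding has_grad_def partial_def
  by (metis frechet_derivative_at inner_axis real_inner_1_right)

lemma has_grad_grad: "has_grad f g x \<Longrightarrow> grad f x = g"
  by (simp add: grad_def has_grad_partial vec_eq_iff)

lemma differentiable_has_grad:
  assumes "f differentiable (at x)" shows "has_grad f (grad f x) x"
proof -
  let ?L = "frechet_derivative f (at x)"
  have d: "(f has_derivative ?L) (at x)" using assms by (simp add: frechet_derivative_works)
  then have lin: "linear ?L" using has_derivative_linear by blast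
  have "?L h = grad f x \<bullet> h" for h
  proof -
    have "h = (\<Sum>i\<in>UNIV. (h $ i) *\<^sub>R axis i 1)"
      using basis_expansion[of h] by (simp add: scalar_mult_eq_scaleR)
    then have "?L h = ?L (\<Sum>i\<in>UNIV. (h $ i) *\<^sub>R axis i 1)" by simp
    also have "\<dots> = (\<Sum>i\<in>UNIV. (h $ i) *\<^sub>R ?L (axis i 1))"
      by (simp add: linear_sum[OF lin] linear_scale[OF lin])
    finally have "?L h = (\<Sum>i\<in>UNIV. (h $ i) *\<^sub>R ?L (axis i 1))" .
    then show ?thesis by (simp add: grad_def partial_def inner_vec_def mult.commute)
  qed
  then show ?thesis unfolding has_grad_def using has_derivative_eq_rhs[OF d] by blast
qed

lemma has_gradI: "(f has_derivative L) (at x) \<Longrightarrow> (\<And>h. L h = g \<bullet> h) \<Longrightarrow> has_grad f g x"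
  unfolding has_grad_def using has_derivative_eq_rhs[of f L "at x" "\<lambda>h. g \<bullet> h"] by blast

lemma has_gradD: "has_grad f g x \<Longrightarrow> (f has_derivative (\<lambda>h. g \<bullet> h)) (at x)"
  by (simp only: has_grad_def)

lemma has_grad_unique: "has_grad f g x \<Longrightarrow> has_grad f h x \<Longrightarrow> g = h"
  using has_grad_grad by blast

lemma has_grad_cong_open:
  assumes "has_grad f g x" "open S" "x \<in> S" "\<And>y. y \<in> S \<Longrightarrow> f y = f' y"
  shows "has_grad f' g x"
  by (rule has_gradI[OF has_derivative_transform_within_open[OF has_gradD[OF assms(1)] assms(2-4)]]) simp_all

text \<open>\<open>frechet_derivative\<close> is a choice among all derivatives, so it agrees for
  two functions as soon as the predicates of being a derivative agree; where no derivative exists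
  both sides are the same default value.\<close>

lemma partial_cong_open:
  assumes "open S" "x \<in> S" "\<And>y. y \<in> S \<Longrightarrow> f y = f' y"
  shows "partial i f x = partial i f' x"
proof -
  have "(f' has_derivative L) (at x)" if "(f has_derivative L) (at x)" for L
    by (rule has_derivative_transform_within_open[OF that assms(1,2)]) (use assms in auto)
  moreover have "(f has_derivative L) (at x)" if "(f' has_derivative L) (at x)" for L
    by (rule has_derivative_transform_within_open[OF that assms(1,2)]) (use assms in auto)
  ultimately have "(\<lambda>L. (f has_derivative L) (at x)) = (\<lambda>L. (f' has_derivative L) (at x))" by blast
  then show ?thesis by (simp add: partial_def frechet_derivative_def)
qed

lemma has_grad_const [simp]: "has_grad (\<lambda>x. c) 0 x"
  by (rule has_gradI[OF has_derivative_const]) simp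

lemma has_grad_add: "has_grad f a x \<Longrightarrow> has_grad g b x \<Longrightarrow> has_grad (\<lambda>y. f y + g y) (a + b) x"
  by (rule has_gradI[OF has_derivative_add[OF has_gradD has_gradD]]) (simp_all add: inner_add_left)

lemma has_grad_diff: "has_grad f a x \<Longrightarrow> has_grad g b x \<Longrightarrow> has_grad (\<lambda>y. f y - g y) (a - b) x"
  by (rule has_gradI[OF has_derivative_diff[OF has_gradD has_gradD]]) (simp_all add: inner_diff_left)

lemma has_grad_mult:
  "has_grad f a x \<Longrightarrow> has_grad g b x \<Longrightarrow> has_grad (\<lambda>y. f y * g y) (f x *\<^sub>R b + g x *\<^sub>R a) x"
  by (rule has_gradI[OF has_derivative_mult[OF has_gradD has_gradD]])
    (simp_all add: inner_add_left mult.commute)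

lemma has_grad_cmult: "has_grad f a x \<Longrightarrow> has_grad (\<lambda>y. c * f y) (c *\<^sub>R a) x"
  using has_grad_mult[of "\<lambda>_. c" 0 x f a] by simp

lemma has_grad_minus: "has_grad f a x \<Longrightarrow> has_grad (\<lambda>y. - f y) (- a) x"
  using has_grad_cmult[of f a x "-1"] by simp

lemma has_grad_sum:
  assumes "\<And>i. i \<in> I \<Longrightarrow> has_grad (f i) (a i) x"
  shows "has_grad (\<lambda>y. \<Sum>i\<in>I. f i y) (\<Sum>i\<in>I. a i) x"
  by (rule has_gradI[OF has_derivative_sum[OF has_gradD[OF assms]]]) (simp_all add: inner_sum_left)

lemma has_grad_compose:
  assumes "has_grad f a x" "(k has_real_derivative k') (at (f x))"
  shows "has_grad (\<lambda>y. k (f y)) (k' *\<^sub>R a) x"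
  using diff_chain_at[OF has_gradD[OF assms(1)] has_field_derivative_imp_has_derivative[OF assms(2)]]
  by (intro has_gradI[of "\<lambda>y. k (f y)"]) (simp_all add: o_def)

lemma has_grad_component: "has_grad (\<lambda>y. y $ i) (axis i 1) x"
  by (rule has_gradI[OF bounded_linear_imp_has_derivative[OF bounded_linear_vec_nth]])
    (simp add: inner_axis')

lemma has_grad_norm_sq: "has_grad (\<lambda>y. (norm (y - a))\<^sup>2) (2 *\<^sub>R (x - a)) x"
proof -
  have "((\<lambda>y. (y - a) \<bullet> (y - a)) has_derivative (\<lambda>h. (x - a) \<bullet> h + h \<bullet> (x - a))) (at x)"
    by (rule derivative_eq_intros refl)+ simp
  then show ?thesis unfolding power2_norm_eq_inner
    by (rule has_gradI) (simp add: inner_commute)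
qed

lemma has_grad_line:
  assumes "has_grad f g (p + t *\<^sub>R e)"
  shows "((\<lambda>s. f (p + s *\<^sub>R e)) has_real_derivative g \<bullet> e) (at t)"
proof -
  have "((\<lambda>s. p + s *\<^sub>R e) has_derivative (\<lambda>h. h *\<^sub>R e)) (at t)"
    by (rule derivative_eq_intros refl)+ simp
  from diff_chain_at[OF this has_gradD[OF assms]]
  show ?thesis unfolding has_field_derivative_def o_def
    by (rule has_derivative_eq_rhs) (simp add: fun_eq_iff mult.commute)
qed

lemma has_grad_continuous: "has_grad f g x \<Longrightarrow> isCont f x"
  unfolding has_grad_def using has_derivative_continuous by blast

lemma has_grad_continuous_on: "(\<And>x. x \<in> S \<Longrightarrow> has_grad f (g x) x) \<Longrightarrow> continuous_on S f"
  by (meson continuous_at_imp_continuous_on has_grad_continuous)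

section \<open>Smooth functions and the symmetry of second derivatives\<close>

lemma Ck_on_cong_open:
  assumes "open S" "\<And>y. y \<in> S \<Longrightarrow> f y = f' y" "Ck_on k S f"
  shows "Ck_on k S f'"
  using assms(2,3)
proof (induction k arbitrary: f f')
  case 0
  then show ?case by (metis Ck_on.simps(1) continuous_on_cong)
next
  case (Suc k)
  have "partial i f y = partial i f' y" if "y \<in> S" for i y
    using partial_cong_open[OF assms(1) that] Suc.prems(1) by blast
  then have "Ck_on k S (partial i f')" for i
    using Suc.IH[of "partial i f" "partial i f'"] Suc.prems(2) by simp
  moreover have "f' differentiable_on S"
    unfolding differentiable_on_def
  proof
    fix x assume x: "x \<in> S"
    have "f differentiable (at x within S)" using Suc.prems(2) x by (simp add: differentiable_on_def)
    then show "f' differentiable (at x within S)"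
      by (rule differentiable_transform_within[OF _ zero_less_one x]) (simp add: Suc.prems(1))
  qed
  ultimately show ?case by simp
qed

lemma smooth_on_has_grad:
  assumes "smooth_on S f" "x \<in> S" shows "has_grad f (grad f x) x"
proof -
  have "Ck_on (Suc 0) S f" "open S" using assms by (auto simp: smooth_on_def)
  then show ?thesis using assms(2)
    by (intro differentiable_has_grad) (auto simp: differentiable_on_eq_differentiable_at)
qed

lemma smooth_on_partial: assumes "smooth_on S f" shows "smooth_on S (partial i f)"
  using assms unfolding smooth_on_def by (metis Ck_on.simps(2))

lemma smooth_on_continuous: "smooth_on S f \<Longrightarrow> continuous_on S f"
  by (metis Ck_on.simps(1) smooth_on_def)

lemma smooth_on_subset: "smooth_on S f \<Longrightarrow> open T \<Longrightarrow> T \<subseteq> S \<Longrightarrow> smooth_on T f"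
proof -
  assume a: "smooth_on S f" "open T" "T \<subseteq> S"
  have "Ck_on k S g \<Longrightarrow> Ck_on k T g" for k g
    by (induction k arbitrary: g) (use a(3) in \<open>auto intro: continuous_on_subset differentiable_on_subset\<close>)
  then show "smooth_on T f" using a by (auto simp: smooth_on_def)
qed

lemma smooth_on_cong: "smooth_on S f \<Longrightarrow> (\<And>y. y \<in> S \<Longrightarrow> f y = f' y) \<Longrightarrow> smooth_on S f'"
  unfolding smooth_on_def using Ck_on_cong_open by blast

lemma smooth_on_lincomb:
  assumes "smooth_on S f" "smooth_on S g"
  shows "smooth_on S (\<lambda>x. a * f x + b * g x)"
proof -
  have o: "open S" using assms by (simp add: smooth_on_def)
  have "Ck_on k S (\<lambda>x. a * f x + b * g x)" if "smooth_on S f" "smooth_on S g" for k f g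
    using that
  proof (induction k arbitrary: f g)
    case 0
    then show ?case by (simp add: continuous_on_add continuous_on_mult_left smooth_on_continuous)
  next
    case (Suc k)
    have hg: "has_grad (\<lambda>x. a * f x + b * g x) (a *\<^sub>R grad f x + b *\<^sub>R grad g x) x" if "x \<in> S" for x
      using that Suc.prems by (intro has_grad_add has_grad_cmult smooth_on_has_grad)
    have "Ck_on k S (partial i (\<lambda>x. a * f x + b * g x))" for i
    proof (rule Ck_on_cong_open[OF o])
      show "Ck_on k S (\<lambda>x. a * partial i f x + b * partial i g x)"
        using Suc smooth_on_partial by blast
      show "a * partial i f y + b * partial i g y = partial i (\<lambda>x. a * f x + b * g x) y" if "y \<in> S" for y
        using has_grad_partial[OF hg[OF that]] by (simp add: grad_def)
    qed
    moreover have "(\<lambda>x. a * f x + b * g x) differentiable_on S"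
      using hg o unfolding has_grad_def differentiable_on_eq_differentiable_at[OF o]
      using differentiable_def by blast
    ultimately show ?case by simp
  qed
  from this[OF assms] o show ?thesis unfolding smooth_on_def by blast
qed

lemma partial_has_real_derivative:
  assumes "smooth_on S f" "p + t *\<^sub>R axis i 1 \<in> S"
  shows "((\<lambda>s. f (p + s *\<^sub>R axis i 1)) has_real_derivative partial i f (p + t *\<^sub>R axis i 1)) (at t)"
  using has_grad_line[OF smooth_on_has_grad[OF assms]] by (simp add: grad_def inner_axis)

text \<open>Two applications of the mean value theorem: in direction \<open>i\<close> to the
  difference taken in direction \<open>j\<close>, and then in direction \<open>j\<close>. The ball
  of radius \<open>2 * h\<close> contains the whole square, since each axis step has length at most
  \<open>h\<close>.\<close>

lemma second_difference:
  fixes f :: "real^'n::finite \<Rightarrow> real"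
  assumes f: "smooth_on S f" and h: "h > 0" and B: "cball x (2 * h) \<subseteq> S"
  obtains z where "z \<in> cball x (2 * h)"
    "f (x + h *\<^sub>R axis i 1 + h *\<^sub>R axis j 1) - f (x + h *\<^sub>R axis i 1) - f (x + h *\<^sub>R axis j 1) + f x
      = h\<^sup>2 * partial j (partial i f) z"
proof -
  let ?a = "axis i 1 :: real^'n" and ?b = "axis j 1 :: real^'n"
  have inB: "x + s *\<^sub>R ?a + t *\<^sub>R ?b \<in> cball x (2 * h)" if "0 \<le> s" "s \<le> h" "0 \<le> t" "t \<le> h" for s t
  proof -
    have "norm (s *\<^sub>R ?a + t *\<^sub>R ?b) \<le> s + t"
      using norm_triangle_ineq[of "s *\<^sub>R ?a" "t *\<^sub>R ?b"] that by (simp add: norm_axis_1)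
    moreover have "dist x (x + (s *\<^sub>R ?a + t *\<^sub>R ?b)) = norm (s *\<^sub>R ?a + t *\<^sub>R ?b)"
      unfolding dist_norm by (metis add_diff_cancel_left' norm_minus_commute)
    ultimately show ?thesis using that unfolding mem_cball add.assoc by linarith
  qed
  define k where "k s = f (x + h *\<^sub>R ?b + s *\<^sub>R ?a) - f (x + s *\<^sub>R ?a)" for s
  have d: "(k has_real_derivative partial i f (x + h *\<^sub>R ?b + s *\<^sub>R ?a) - partial i f (x + s *\<^sub>R ?a)) (at s)"
    if "0 \<le> s" "s \<le> h" for s
    unfolding k_def
    using inB[of s h] inB[of s 0] that h B
    by (intro DERIV_diff partial_has_real_derivative[OF f]) (auto simp: add_ac)
  obtain s where s: "0 < s" "s < h"
    "k h - k 0 = (h - 0) * (partial i f (x + h *\<^sub>R ?b + s *\<^sub>R ?a) - partial i f (x + s *\<^sub>R ?a))"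
    using MVT2[OF h, of k "\<lambda>s. partial i f (x + h *\<^sub>R ?b + s *\<^sub>R ?a) - partial i f (x + s *\<^sub>R ?a)"] d by blast
  have d2: "((\<lambda>t. partial i f (x + s *\<^sub>R ?a + t *\<^sub>R ?b)) has_real_derivative
      partial j (partial i f) (x + s *\<^sub>R ?a + t *\<^sub>R ?b)) (at t)" if "0 \<le> t" "t \<le> h" for t
    using inB[of s t] that h B s
    by (intro partial_has_real_derivative[OF smooth_on_partial[OF f]]) auto
  obtain t where t: "0 < t" "t < h"
    "partial i f (x + s *\<^sub>R ?a + h *\<^sub>R ?b) - partial i f (x + s *\<^sub>R ?a + 0 *\<^sub>R ?b) = 
      (h - 0) * partial j (partial i f) (x + s *\<^sub>R ?a + t *\<^sub>R ?b)"
    using MVT2[OF h, of "\<lambda>t. partial i f (x + s *\<^sub>R ?a + t *\<^sub>R ?b)"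
        "\<lambda>t. partial j (partial i f) (x + s *\<^sub>R ?a + t *\<^sub>R ?b)"] d2 by blast
  have "k h - k 0 = h\<^sup>2 * partial j (partial i f) (x + s *\<^sub>R ?a + t *\<^sub>R ?b)"
    using s(3) t(3) by (simp add: power2_eq_square add_ac)
  then show thesis
    using that[of "x + s *\<^sub>R ?a + t *\<^sub>R ?b"] inB[of s t] s t unfolding k_def by (simp add: add_ac algebra_simps)
qed

text \<open>The mixed second difference is symmetric in \<open>i\<close> and \<open>j\<close>, so
  the two iterated derivatives take equal values at intermediate points that shrink to
  \<open>x\<close>; continuity of the second derivatives finishes.\<close>

lemma partial_commute:
  fixes f :: "real^'n::finite \<Rightarrow> real"
  assumes f: "smooth_on S f" and x: "x \<in> S"
  shows "partial i (partial j f) x = partial j (partial i f) x"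
proof -
  have "open S" using f by (simp add: smooth_on_def)
  then obtain e where e: "e > 0" "cball x e \<subseteq> S" using x open_contains_cball by blast
  define h where "h k = e / (2 * (real k + 1))" for k
  have h0: "h k > 0" "2 * h k \<le> e" for k using e by (auto simp: h_def field_simps)
  have B: "cball x (2 * h k) \<subseteq> S" for k using e h0[of k] by (meson order_trans subset_cball)
  have "\<exists>z. z \<in> cball x (2 * h k) \<and> 
    f (x + h k *\<^sub>R axis i 1 + h k *\<^sub>R axis j 1) - f (x + h k *\<^sub>R axis i 1) - f (x + h k *\<^sub>R axis j 1) + f x
      = (h k)\<^sup>2 * partial j (partial i f) z" for k
    using second_difference[OF f h0(1) B] by blast
  then obtain z where z: "\<And>k. z k \<in> cball x (2 * h k)"
    "\<And>k. f (x + h k *\<^sub>R axis i 1 + h k *\<^sub>R axis j 1) - f (x + h k *\<^sub>R axis i 1) - f (x + h k *\<^sub>R axis j 1) + f x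
      = (h k)\<^sup>2 * partial j (partial i f) (z k)" by metis
  have "\<exists>z. z \<in> cball x (2 * h k) \<and> 
    f (x + h k *\<^sub>R axis j 1 + h k *\<^sub>R axis i 1) - f (x + h k *\<^sub>R axis j 1) - f (x + h k *\<^sub>R axis i 1) + f x
      = (h k)\<^sup>2 * partial i (partial j f) z" for k
    using second_difference[OF f h0(1) B] by blast
  then obtain w where w: "\<And>k. w k \<in> cball x (2 * h k)"
    "\<And>k. f (x + h k *\<^sub>R axis j 1 + h k *\<^sub>R axis i 1) - f (x + h k *\<^sub>R axis j 1) - f (x + h k *\<^sub>R axis i 1) + f x
      = (h k)\<^sup>2 * partial i (partial j f) (w k)" by metis
  have eq: "partial j (partial i f) (z k) = partial i (partial j f) (w k)" for k
  proof -
    have "(h k)\<^sup>2 * partial j (partial i f) (z k) = (h k)\<^sup>2 * partial i (partial j f) (w k)"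
      using z(2)[of k] w(2)[of k] by (simp only: add.assoc add.commute[of "h k *\<^sub>R axis i 1"] diff_conv_add_uminus)
    then show ?thesis using h0(1)[of k] by simp
  qed
  have h2: "(\<lambda>k. 2 * h k) \<longlonglongrightarrow> 0"
  proof -
    have "2 * h k = e / real (Suc k)" for k by (simp add: h_def field_simps)
    then show ?thesis using LIMSEQ_Suc[OF lim_const_over_n[of e]] by simp
  qed
  have lim: "y \<longlonglongrightarrow> x" if "\<And>k. y k \<in> cball x (2 * h k)" for y
    using Lim_null_comparison[OF _ h2, of "\<lambda>k. y k - x"] that LIM_zero_cancel
    by (fastforce simp: dist_norm norm_minus_commute)
  have c: "isCont (partial a (partial b f)) x" for a b
    using smooth_on_continuous[OF smooth_on_partial[OF smooth_on_partial[OF f]]] \<open>open S\<close> x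
    by (simp add: continuous_on_eq_continuous_at)
  have "(\<lambda>k. partial j (partial i f) (z k)) \<longlonglongrightarrow> partial j (partial i f) x"
    using c lim[OF z(1)] isCont_tendsto_compose by blast
  moreover have "(\<lambda>k. partial i (partial j f) (w k)) \<longlonglongrightarrow> partial i (partial j f) x"
    using c lim[OF w(1)] isCont_tendsto_compose by blast
  ultimately show ?thesis using eq LIMSEQ_unique by simp
qed

section \<open>First and second order conditions at a maximum\<close>

lemma second_derivative_at_max:
  fixes k k1 :: "real \<Rightarrow> real"
  assumes d: "d > 0" and k: "\<And>t. \<bar>t\<bar> < d \<Longrightarrow> (k has_real_derivative k1 t) (at t)"
    and k1: "(k1 has_real_derivative k2) (at 0)"
    and mx: "\<And>t. \<bar>t\<bar> < d \<Longrightarrow> k t \<le> k 0"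
  shows "k2 \<le> 0"
proof (rule ccontr)
  assume "\<not> k2 \<le> 0"
  then have "k2 > 0" by simp
  have k10: "k1 0 = 0"
    using DERIV_local_max[OF k d] mx d by simp
  obtain e where e: "e > 0" "\<And>h. 0 < h \<Longrightarrow> h < e \<Longrightarrow> k1 0 < k1 (0 + h)"
    using DERIV_pos_inc_right[OF k1 \<open>k2 > 0\<close>] by blast
  define t where "t = min d e / 2"
  have t: "0 < t" "t < d" "t < e" using d e by (auto simp: t_def)
  obtain z where "0 < z" "z < t" "k t - k 0 = (t - 0) * k1 z"
    using MVT2[OF t(1), of k k1] k t by auto
  moreover have "k1 z > 0" using e(2)[of z] k10 \<open>0 < z\<close> \<open>z < t\<close> t by simp
  ultimately show False using mx[of t] t by (smt (verit) mult_pos_pos)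
qed

text \<open>Restriction to coordinate lines. The diagonal of the second derivatives is all that a
  Laplacian sees, and \<open>H\<close> is given at \<open>x\<close> only, so that the Hessian data
  of a maximum point can be supplied at that point.\<close>

lemma local_max_conditions:
  assumes S: "open S" "x \<in> S" and f: "\<And>y. y \<in> S \<Longrightarrow> has_grad f (\<gamma> y) y"
    and H: "\<And>i. has_grad (\<lambda>y. \<gamma> y $ i) (H i) x"
    and mx: "\<And>y. y \<in> S \<Longrightarrow> f y \<le> f x"
  shows "\<gamma> x = 0" "H i $ i \<le> 0"
proof -
  have "(\<lambda>h. \<gamma> x \<bullet> h) = (\<lambda>v. 0)"
    using differential_zero_maxmin[OF S(2,1) f[OF S(2), unfolded has_grad_def]] mx by blast
  then show "\<gamma> x = 0" by (metis inner_eq_zero_iff)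
  obtain d where d: "d > 0" "ball x d \<subseteq> S" using S open_contains_ball by blast
  let ?a = "axis i 1 :: real^'a"
  have inS: "x + t *\<^sub>R ?a \<in> S" if "\<bar>t\<bar> < d" for t
    using d that by (intro subsetD[OF d(2)]) (simp add: dist_norm norm_axis_1)
  show "H i $ i \<le> 0"
  proof (rule second_derivative_at_max[OF d(1), of "\<lambda>t. f (x + t *\<^sub>R ?a)" "\<lambda>t. \<gamma> (x + t *\<^sub>R ?a) $ i"])
    show "((\<lambda>s. f (x + s *\<^sub>R ?a)) has_real_derivative \<gamma> (x + t *\<^sub>R ?a) $ i) (at t)" if "\<bar>t\<bar> < d" for t
      using has_grad_line[OF f[OF inS[OF that]]] by (simp add: inner_axis)
    show "((\<lambda>t. \<gamma> (x + t *\<^sub>R ?a) $ i) has_real_derivative H i $ i) (at 0)"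
      using has_grad_line[of "\<lambda>y. \<gamma> y $ i" "H i" x 0 ?a] H by (simp add: inner_axis)
    show "f (x + t *\<^sub>R ?a) \<le> f (x + 0 *\<^sub>R ?a)" if "\<bar>t\<bar> < d" for t using mx inS[OF that] by simp
  qed
qed

section \<open>The model profile\<close>

text \<open>In terms of \<open>\<xi> = r / R\<close>, the radial model \<open>u\<^sub>R\<close> is \<open>(u\<^sub>R)\<^sub>m\<^sub>a\<^sub>x - R\<^sup>2 Q(\<xi>) / 2\<close>, and the normalized
  wall shear stress at the zero \<open>r = R \<xi>\<close> is the square root of \<open>T(\<xi>)\<close>.\<close>

definition Qm :: "real \<Rightarrow> real \<Rightarrow> real" where
  "Qm n x = x\<^sup>2 + 2 / (n - 2) * x powr (2 - n) - n / (n - 2)"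

text \<open>Half of the derivative of \<open>Qm n\<close>, so that \<open>R * Pm n (r / R)\<close>
  is minus the radial derivative of the model.\<close>

definition Pm :: "real \<Rightarrow> real \<Rightarrow> real" where
  "Pm n x = x - x powr (1 - n)"

text \<open>The derivative of \<open>Pm n\<close>; minus the second radial derivative of the model,
  with value \<open>n\<close> on the maximum sphere.\<close>

definition Gm :: "real \<Rightarrow> real \<Rightarrow> real" where
  "Gm n x = 1 + (n - 1) * x powr (- n)"

definition Tm :: "real \<Rightarrow> real \<Rightarrow> real" where
  "Tm n x = (Pm n x)\<^sup>2 / Qm n x"

lemma powr_shift: "x > 0 \<Longrightarrow> x powr (1 - n) = x * x powr (- n)"
  "x > 0 \<Longrightarrow> x powr (2 - n) = x\<^sup>2 * x powr (- n)" "x > 0 \<Longrightarrow> x powr (- n - 1) = x powr (- n) / x"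
  for x n :: real
  by (simp_all add: powr_diff powr_minus field_simps)

lemma Qm_deriv: "x > 0 \<Longrightarrow> n > 2 \<Longrightarrow> (Qm n has_real_derivative 2 * Pm n x) (at x)"
  unfolding Qm_def [abs_def] Pm_def
  by (rule derivative_eq_intros refl | simp)+ (simp add: field_simps)

lemma Pm_deriv: "x > 0 \<Longrightarrow> n > 2 \<Longrightarrow> (Pm n has_real_derivative Gm n x) (at x)"
  unfolding Pm_def [abs_def] Gm_def
  by (rule derivative_eq_intros refl | simp)+ (simp add: field_simps)

lemma Gm_deriv: "x > 0 \<Longrightarrow> n > 2 \<Longrightarrow>
    (Gm n has_real_derivative - n * (n - 1) * x powr (- n - 1)) (at x)"
  unfolding Gm_def [abs_def]
  by (rule derivative_eq_intros refl | simp)+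

lemma Qm_1 [simp]: "n > 2 \<Longrightarrow> Qm n 1 = 0"
  by (simp add: Qm_def field_simps)

lemma Pm_1 [simp]: "Pm n 1 = 0"
  by (simp add: Pm_def)

lemma sigma_gt_1: "0 < x \<Longrightarrow> x < 1 \<Longrightarrow> n > 2 \<Longrightarrow> x powr (- n) > 1" for x n :: real
  using powr_less_mono'[of x "-n" 0] by simp

lemma sigma_lt_1: "x > 1 \<Longrightarrow> n > 2 \<Longrightarrow> x powr (- n) < 1" for x n :: real
  using powr_less_mono[of "-n" 0 x] by simp

lemma Pm_eq: "x > 0 \<Longrightarrow> Pm n x = x * (1 - x powr (- n))"
  by (simp add: Pm_def powr_shift algebra_simps)

lemma Pm_neg: "0 < x \<Longrightarrow> x < 1 \<Longrightarrow> n > 2 \<Longrightarrow> Pm n x < 0"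
  using sigma_gt_1[of x n] by (simp add: Pm_eq mult_pos_neg)

lemma Pm_pos: "x > 1 \<Longrightarrow> n > 2 \<Longrightarrow> Pm n x > 0"
  using sigma_lt_1[of x n] by (simp add: Pm_eq)

lemma Gm_ge_1: "n > 2 \<Longrightarrow> Gm n x \<ge> 1"
  by (simp add: Gm_def)

lemma Qm_strict_decreasing: assumes "0 < x" "x < y" "y \<le> 1" "n > 2" shows "Qm n y < Qm n x"
proof -
  obtain z where z: "x < z" "z < y" "Qm n y - Qm n x = (y - x) * (2 * Pm n z)"
    using MVT2[OF assms(2), of "Qm n" "\<lambda>z. 2 * Pm n z"] Qm_deriv assms by fastforce
  then have "Pm n z < 0" using Pm_neg[of z n] assms by simp
  then have "(y - x) * (2 * Pm n z) < 0" using assms by (simp add: mult_pos_neg)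
  then show ?thesis using z by linarith
qed

lemma Qm_strict_increasing: assumes "1 \<le> x" "x < y" "n > 2" shows "Qm n x < Qm n y"
proof -
  obtain z where z: "x < z" "z < y" "Qm n y - Qm n x = (y - x) * (2 * Pm n z)"
    using MVT2[OF assms(2), of "Qm n" "\<lambda>z. 2 * Pm n z"] Qm_deriv assms by fastforce
  then have "Pm n z > 0" using Pm_pos[of z n] assms by simp
  then have "(y - x) * (2 * Pm n z) > 0" using assms by simp
  then show ?thesis using z by linarith
qed

lemma Qm_pos: "x > 0 \<Longrightarrow> x \<noteq> 1 \<Longrightarrow> n > 2 \<Longrightarrow> Qm n x > 0"
  using Qm_strict_decreasing[of x 1 n] Qm_strict_increasing[of 1 x n] by fastforce

lemma continuous_on_Qm: "n > 2 \<Longrightarrow> S \<subseteq> {0<..} \<Longrightarrow> continuous_on S (Qm n)"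
  by (meson DERIV_isCont Qm_deriv continuous_at_imp_continuous_on greaterThan_iff subsetD)

lemma continuous_on_Pm: "n > 2 \<Longrightarrow> S \<subseteq> {0<..} \<Longrightarrow> continuous_on S (Pm n)"
  by (meson DERIV_isCont Pm_deriv continuous_at_imp_continuous_on greaterThan_iff subsetD)

lemma continuous_on_Gm: "n > 2 \<Longrightarrow> S \<subseteq> {0<..} \<Longrightarrow> continuous_on S (Gm n)"
  by (meson DERIV_isCont Gm_deriv continuous_at_imp_continuous_on greaterThan_iff subsetD)

lemma PQ_deriv: "x > 0 \<Longrightarrow> n > 2 \<Longrightarrow>
    ((\<lambda>x. (Pm n x)\<^sup>2 - c * Qm n x) has_real_derivative 2 * Pm n x * (Gm n x - c)) (at x)"
  by (auto intro!: derivative_eq_intros Pm_deriv Qm_deriv simp: algebra_simps)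

text \<open>The sign of \<open>P\<^sup>2 - c Q\<close>, hence of \<open>T - c\<close>, is read off from that of \<open>P (G - c)\<close>.\<close>

lemma PQ_mvt:
  assumes "x > 0" "x \<noteq> 1" "n > 2"
  obtains z where "z > 0" "x < 1 \<Longrightarrow> x < z \<and> z < 1" "x > 1 \<Longrightarrow> 1 < z \<and> z < x"
    "(Pm n x)\<^sup>2 - c * Qm n x = (x - 1) * (2 * Pm n z * (Gm n z - c))"
proof (cases "x < 1")
  case True
  have "\<exists>z>x. z < 1 \<and> ((Pm n 1)\<^sup>2 - c * Qm n 1) - ((Pm n x)\<^sup>2 - c * Qm n x)
     = (1 - x) * (2 * Pm n z * (Gm n z - c))"
    by (rule MVT2[OF True]) (use PQ_deriv assms in auto)
  then obtain z where "x < z" "z < 1" "((Pm n 1)\<^sup>2 - c * Qm n 1) - ((Pm n x)\<^sup>2 - c * Qm n x)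
     = (1 - x) * (2 * Pm n z * (Gm n z - c))" by blast
  then show ?thesis using that[of z] assms True by (simp add: algebra_simps)
next
  case False
  then have "1 < x" using assms by simp
  have "\<exists>z>1. z < x \<and> ((Pm n x)\<^sup>2 - c * Qm n x) - ((Pm n 1)\<^sup>2 - c * Qm n 1)
     = (x - 1) * (2 * Pm n z * (Gm n z - c))"
    by (rule MVT2[OF \<open>1 < x\<close>]) (use PQ_deriv assms in auto)
  then obtain z where "1 < z" "z < x" "((Pm n x)\<^sup>2 - c * Qm n x) - ((Pm n 1)\<^sup>2 - c * Qm n 1)
     = (x - 1) * (2 * Pm n z * (Gm n z - c))" by blast
  then show ?thesis using that[of z] assms False by simp
qed

section \<open>Bounds, monotonicity and range of the squared wall shear stress\<close>

lemma Tm_gt_iff: "x > 0 \<Longrightarrow> x \<noteq> 1 \<Longrightarrow> n > 2 \<Longrightarrow> c < Tm n x \<longleftrightarrow> (Pm n x)\<^sup>2 - c * Qm n x > 0"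
  using Qm_pos[of x n] by (simp add: Tm_def field_simps)

lemma Tm_lt_iff: "x > 0 \<Longrightarrow> x \<noteq> 1 \<Longrightarrow> n > 2 \<Longrightarrow> Tm n x < c \<longleftrightarrow> (Pm n x)\<^sup>2 - c * Qm n x < 0"
  using Qm_pos[of x n] by (simp add: Tm_def field_simps)

text \<open>\<open>T\<close> lies on the same side of \<open>n\<close> as \<open>G\<close>, and
  \<open>G - n = (n - 1) (x powr (-n) - 1)\<close> is positive inside the unit radius. For the
  models this says that inner stresses exceed \<open>sqrt n\<close>.\<close>

lemma Tm_gt_inner: assumes "0 < x" "x < 1" "n > 2" shows "Tm n x > n"
proof -
  obtain z where z: "z > 0" "x < z" "z < 1"
    "(Pm n x)\<^sup>2 - n * Qm n x = (x - 1) * (2 * Pm n z * (Gm n z - n))"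
    using PQ_mvt[of x n n] assms by (metis order_less_irrefl)
  have "Gm n z - n = (n - 1) * (z powr (-n) - 1)" by (simp add: Gm_def algebra_simps)
  then have "Gm n z - n > 0" using sigma_gt_1[OF z(1,3) assms(3)] assms by simp
  then have "(Pm n x)\<^sup>2 - n * Qm n x > 0"
    using z Pm_neg[OF z(1,3) assms(3)] assms by (simp add: mult_neg_neg mult_neg_pos)
  then show ?thesis using Tm_gt_iff[of x n n] assms by simp
qed

lemma Tm_bounds_outer: assumes "1 < x" "n > 2" shows "1 < Tm n x" "Tm n x < n"
proof -
  obtain z where z: "1 < z" "(Pm n x)\<^sup>2 - n * Qm n x = (x - 1) * (2 * Pm n z * (Gm n z - n))"
    using PQ_mvt[of x n n] assms
    by (metis order_less_irrefl order.strict_trans zero_less_one)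
  have "Gm n z - n = (n - 1) * (z powr (-n) - 1)" by (simp add: Gm_def algebra_simps)
  then have "Gm n z - n < 0" using sigma_lt_1[OF z(1) assms(2)] assms by (simp add: mult_pos_neg)
  then have "(Pm n x)\<^sup>2 - n * Qm n x < 0"
    using z Pm_pos[OF z(1) assms(2)] assms by (simp add: mult_pos_neg)
  then show "Tm n x < n" using Tm_lt_iff[of x n n] assms by simp
  obtain z where z: "1 < z" "(Pm n x)\<^sup>2 - 1 * Qm n x = (x - 1) * (2 * Pm n z * (Gm n z - 1))"
    using PQ_mvt[of x n 1] assms
    by (metis order_less_irrefl order.strict_trans zero_less_one)
  have "Gm n z - 1 > 0" using z assms by (simp add: Gm_def)
  then have "(Pm n x)\<^sup>2 - 1 * Qm n x > 0"
    using z Pm_pos[OF z(1) assms(2)] assms by simp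
  then show "1 < Tm n x" using Tm_gt_iff[of x n 1] assms by simp
qed

lemma Tm_deriv: assumes "x > 0" "x \<noteq> 1" "n > 2"
  shows "(Tm n has_real_derivative 2 * Pm n x * (Gm n x * Qm n x - (Pm n x)\<^sup>2) / (Qm n x)\<^sup>2) (at x)"
  unfolding Tm_def [abs_def]
  using Qm_pos[OF assms] Pm_deriv[OF assms(1,3)] Qm_deriv[OF assms(1,3)]
  by (auto intro!: derivative_eq_intros simp: power2_eq_square algebra_simps)

lemma GQ_deriv: "x > 0 \<Longrightarrow> n > 2 \<Longrightarrow> ((\<lambda>x. Gm n x * Qm n x - (Pm n x)\<^sup>2) has_real_derivative
    - n * (n - 1) * x powr (- n - 1) * Qm n x) (at x)"
  by (auto intro!: derivative_eq_intros Gm_deriv Pm_deriv Qm_deriv simp: algebra_simps)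

text \<open>The function \<open>G Q - P^2\<close> vanishes at 1 and has derivative
  \<open>G' Q\<close>, because the terms \<open>2 G P\<close> cancel. Since \<open>G' < 0\<close>
  and \<open>Q > 0\<close> off 1, it decreases through 0 there; multiplied by \<open>P\<close> this
  makes \<open>T' < 0\<close> on both branches.\<close>

lemma GQ_sign:
  assumes "x > 0" "x \<noteq> 1" "n > 2"
  shows "0 < (1 - x) * (Gm n x * Qm n x - (Pm n x)\<^sup>2)"
proof -
  let ?N = "\<lambda>x. Gm n x * Qm n x - (Pm n x)\<^sup>2"
  have neg: "- n * (n - 1) * z powr (- n - 1) * Qm n z < 0" if "z > 0" "z \<noteq> 1" for z
    using Qm_pos[OF that assms(3)] assms that by (simp add: mult_neg_pos)
  show ?thesis
  proof (cases "x < 1")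
    case True
    have "\<exists>z>x. z < 1 \<and> ?N 1 - ?N x = (1 - x) * (- n * (n - 1) * z powr (- n - 1) * Qm n z)"
      by (rule MVT2[OF True]) (rule GQ_deriv, use assms in auto)
    then obtain z where "x < z" "z < 1" "?N 1 - ?N x = (1 - x) * (- n * (n - 1) * z powr (- n - 1) * Qm n z)"
      by blast
    moreover have "(1 - x) * (- n * (n - 1) * z powr (- n - 1) * Qm n z) < 0"
      by (rule mult_pos_neg) (use neg[of z] assms True calculation in auto)
    ultimately have "?N x > 0" using assms(3) by simp
    then show ?thesis using True by simp
  next
    case False
    then have "1 < x" using assms by simp
    have "\<exists>z>1. z < x \<and> ?N x - ?N 1 = (x - 1) * (- n * (n - 1) * z powr (- n - 1) * Qm n z)"
      by (rule MVT2[OF \<open>1 < x\<close>]) (rule GQ_deriv, use assms in auto)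
    then obtain z where "1 < z" "z < x" "?N x - ?N 1 = (x - 1) * (- n * (n - 1) * z powr (- n - 1) * Qm n z)"
      by blast
    moreover have "(x - 1) * (- n * (n - 1) * z powr (- n - 1) * Qm n z) < 0"
      by (rule mult_pos_neg) (use neg[of z] assms \<open>1 < x\<close> calculation in auto)
    ultimately have "?N x < 0" using assms(3) by simp
    then show ?thesis using \<open>1 < x\<close> by (simp add: mult_neg_neg)
  qed
qed

lemma Tm_deriv_neg: assumes "x > 0" "x \<noteq> 1" "n > 2"
  shows "2 * Pm n x * (Gm n x * Qm n x - (Pm n x)\<^sup>2) / (Qm n x)\<^sup>2 < 0"
proof -
  have "Pm n x * (Gm n x * Qm n x - (Pm n x)\<^sup>2) < 0"
    using GQ_sign[OF assms] Pm_neg[OF assms(1) _ assms(3)] Pm_pos[OF _ assms(3), of x] assms(2)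
    by (cases "x < 1") (auto simp: zero_less_mult_iff mult_neg_pos mult_pos_neg)
  then show ?thesis using Qm_pos[OF assms] by (simp add: divide_neg_pos)
qed

lemma Tm_strict_decreasing:
  assumes "0 < x" "x < y" "y < 1 \<or> 1 < x" "n > 2" shows "Tm n y < Tm n x"
proof (rule DERIV_neg_imp_decreasing[OF assms(2)])
  fix z assume "x \<le> z" "z \<le> y"
  then have "z > 0" "z \<noteq> 1" using assms by auto
  then show "\<exists>d. (Tm n has_real_derivative d) (at z) \<and> d < 0"
    using Tm_deriv Tm_deriv_neg assms(4) by blast
qed

lemma continuous_on_Tm: "n > 2 \<Longrightarrow> S \<subseteq> {0<..} - {1} \<Longrightarrow> continuous_on S (Tm n)"
  by (rule continuous_at_imp_continuous_on) (use Tm_deriv DERIV_isCont in blast)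

text \<open>From either side \<open>T\<close> tends to \<open>G(1) = n\<close>; the mean value form
  of \<open>P^2 - c Q\<close> takes the place of l'Hopital's rule.\<close>

lemma Tm_near_1:
  assumes "n > 2"
  shows "c > n \<Longrightarrow> \<exists>x. 0 < x \<and> x < 1 \<and> Tm n x < c" "c < n \<Longrightarrow> \<exists>x. 1 < x \<and> Tm n x > c"
proof -
  have G1: "isCont (Gm n) 1" "Gm n 1 = n" using Gm_deriv[of 1 n] assms DERIV_isCont
    by (fastforce simp: Gm_def)+
  {
    assume "c > n"
    then have "\<forall>\<^sub>F x in at 1. Gm n x < c" using G1 order_tendstoD(2)[of "Gm n" n "at 1" c]
      by (simp add: isCont_def)
    then obtain d where d: "d > 0" "\<And>x. x \<noteq> 1 \<Longrightarrow> dist x 1 < d \<Longrightarrow> Gm n x < c"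
      unfolding eventually_at by auto
    define x where "x = max (1/2) (1 - d/2)"
    have x: "0 < x" "x < 1" using d by (auto simp: x_def)
    obtain z where z: "x < z" "z < 1" "(Pm n x)\<^sup>2 - c * Qm n x = (x - 1) * (2 * Pm n z * (Gm n z - c))"
      using PQ_mvt[of x n c] assms x by (metis order_less_irrefl)
    have "Gm n z < c" using d z by (intro d(2)) (auto simp: dist_real_def x_def)
    then have "(Pm n x)\<^sup>2 - c * Qm n x < 0"
      using z x Pm_neg[of z n] assms by (simp add: mult_neg_neg mult_neg_pos)
    then show "\<exists>x. 0 < x \<and> x < 1 \<and> Tm n x < c" using Tm_lt_iff[of x n c] assms x by auto
  }
  {
    assume "c < n"
    then have "\<forall>\<^sub>F x in at 1. Gm n x > c" using G1 order_tendstoD(1)[of "Gm n" n "at 1" c]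
      by (simp add: isCont_def)
    then obtain d where d: "d > 0" "\<And>x. x \<noteq> 1 \<Longrightarrow> dist x 1 < d \<Longrightarrow> Gm n x > c"
      unfolding eventually_at by auto
    define x where "x = 1 + d/2"
    have x: "1 < x" using d by (auto simp: x_def)
    obtain z where z: "1 < z" "z < x" "(Pm n x)\<^sup>2 - c * Qm n x = (x - 1) * (2 * Pm n z * (Gm n z - c))"
      using PQ_mvt[of x n c] assms x
      by (metis order_less_irrefl order.strict_trans zero_less_one)
    have "Gm n z > c" using d z by (intro d(2)) (auto simp: dist_real_def x_def)
    then have "(Pm n x)\<^sup>2 - c * Qm n x > 0"
      using z x Pm_pos[of z n] assms by simp
    then show "\<exists>x. 1 < x \<and> Tm n x > c" using Tm_gt_iff[of x n c] assms x by auto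
  }
qed

lemma sigma_surj: "n > 2 \<Longrightarrow> B > 1 \<Longrightarrow> \<exists>x. 0 < x \<and> x < 1 \<and> x powr (- n) = B" for n B :: real
  by (rule exI[of _ "B powr (- 1 / n)"]) (auto simp: powr_powr intro: powr_less_one)

lemma Tm_near_0:
  assumes "n > 2" shows "\<exists>x. 0 < x \<and> x < 1 \<and> Tm n x > c"
proof -
  \<comment> \<open>With \<open>x powr (-n) = B\<close> one has \<open>P^2 = x^2 (1 - B)^2\<close>
    and \<open>Q <= x^2 B n / (n - 2)\<close>, so \<open>T\<close> grows at least like a multiple of
    \<open>B\<close>. The choice gives \<open>\<bar>c\<bar> n / (n - 2) < B - 2\<close>, and
    \<open>(B - 2) B <= (1 - B)^2\<close>.\<close>
  define B where "B = max 2 (\<bar>c\<bar> * n / (n - 2) + 3)"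
  have "B > 1" by (simp add: B_def)
  then obtain x where x: "0 < x" "x < 1" "x powr (- n) = B"
    using sigma_surj[OF assms, of B] by blast
  have Q: "Qm n x \<le> x\<^sup>2 * B * (n / (n - 2))"
  proof -
    have "Qm n x \<le> x\<^sup>2 + 2 / (n - 2) * (x\<^sup>2 * B)"
      using assms x by (simp add: Qm_def powr_shift)
    also have "\<dots> \<le> x\<^sup>2 * B + 2 / (n - 2) * (x\<^sup>2 * B)" using \<open>B > 1\<close> by (simp add: mult_le_cancel_left1)
    also have "\<dots> = x\<^sup>2 * B * (n / (n - 2))" using assms by (simp add: field_simps)
    finally show ?thesis .
  qed
  have "\<bar>c\<bar> * (n / (n - 2)) < B - 2" unfolding B_def by (simp add: less_diff_eq less_max_iff_disj)
  then have "\<bar>c\<bar> * (n / (n - 2)) * B < (B - 2) * B" using \<open>B > 1\<close> by (intro mult_strict_right_mono) auto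
  also have "\<dots> \<le> (1 - B)\<^sup>2" by (simp add: power2_eq_square algebra_simps)
  finally have "x\<^sup>2 * (\<bar>c\<bar> * (n / (n - 2)) * B) < x\<^sup>2 * (1 - B)\<^sup>2" using x by (intro mult_strict_left_mono) auto
  moreover have "c * Qm n x \<le> \<bar>c\<bar> * (x\<^sup>2 * B * (n / (n - 2)))"
    using Q Qm_pos[of x n] x assms by (intro mult_mono) auto
  moreover have "x\<^sup>2 * (\<bar>c\<bar> * (n / (n - 2)) * B) = \<bar>c\<bar> * (x\<^sup>2 * B * (n / (n - 2)))" by simp
  moreover have "(Pm n x)\<^sup>2 = x\<^sup>2 * (1 - B)\<^sup>2" using x by (simp add: Pm_eq power_mult_distrib)
  ultimately have "(Pm n x)\<^sup>2 - c * Qm n x > 0" by linarith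
  then show ?thesis using Tm_gt_iff[of x n c] assms x by auto
qed

lemma Tm_near_infinity:
  assumes "n > 2" "c > 1" shows "\<exists>x. b < x \<and> 1 < x \<and> Tm n x < c"
proof -
  \<comment> \<open>Large enough that \<open>(c - 1) x^2\<close> exceeds
    \<open>c n / (n - 2)\<close>; then
    \<open>P^2 <= x^2 < c (x^2 - n / (n - 2)) <= c Q\<close>.\<close>
  define x where "x = max (\<bar>b\<bar> + 2) (c * n / ((n - 2) * (c - 1)) + 1)"
  have x: "1 < x" "b < x" by (auto simp: x_def)
  have "c * (n / (n - 2)) < (c - 1) * x"
  proof -
    have "c * n / ((n - 2) * (c - 1)) < x" by (simp add: x_def)
    then have "c * n < x * ((n - 2) * (c - 1))" using assms by (simp add: pos_divide_less_eq)
    then have "c * n / (n - 2) < (c - 1) * x" using assms by (simp add: pos_divide_less_eq mult_ac)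
    then show ?thesis by simp
  qed
  also have "\<dots> \<le> (c - 1) * x\<^sup>2" using x assms by (simp add: power2_eq_square mult_le_cancel_left1)
  finally have 1: "c * (n / (n - 2)) < (c - 1) * x\<^sup>2" .
  have "(Pm n x)\<^sup>2 \<le> x\<^sup>2"
    using x sigma_lt_1[of x n] assms by (simp add: Pm_eq power_mult_distrib mult_le_cancel_left2 power_le_one)
  moreover have "c * Qm n x \<ge> c * x\<^sup>2 - c * (n / (n - 2))"
  proof -
    have "Qm n x \<ge> x\<^sup>2 - n / (n - 2)" using assms by (simp add: Qm_def)
    then have "c * Qm n x \<ge> c * (x\<^sup>2 - n / (n - 2))" using assms by (intro mult_left_mono) auto
    then show ?thesis by (simp add: right_diff_distrib)
  qed
  ultimately have "(Pm n x)\<^sup>2 - c * Qm n x < 0" using 1 by (simp add: algebra_simps)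
  then show ?thesis using Tm_lt_iff[of x n c] assms x by auto
qed

lemma Tm_surj_inner:
  assumes "n > 2" "c > n" shows "\<exists>x. 0 < x \<and> x < 1 \<and> Tm n x = c"
proof -
  obtain a b where ab: "0 < a" "a < 1" "Tm n a > c" "0 < b" "b < 1" "Tm n b < c"
    using Tm_near_0[OF assms(1), of c] Tm_near_1(1)[OF assms] by auto
  then have "a < b" using Tm_strict_decreasing[of b a n] assms by (smt (verit))
  then obtain x where "a \<le> x" "x \<le> b" "Tm n x = c"
    using IVT2'[of "Tm n" b c a] ab continuous_on_Tm[OF assms(1), of "{a..b}"] by (auto simp: subset_iff)
  then show ?thesis using ab by (intro exI[of _ x]) auto
qed

lemma Tm_surj_outer:
  assumes "n > 2" "1 < c" "c < n" shows "\<exists>x. 1 < x \<and> Tm n x = c"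
proof -
  obtain a b where ab: "1 < a" "Tm n a > c" "1 < b" "Tm n b < c"
    using Tm_near_infinity[OF assms(1,2)] Tm_near_1(2)[OF assms(1,3)] by blast
  then have "a < b" using Tm_strict_decreasing[of b a n] assms by (smt (verit))
  then obtain x where "a \<le> x" "x \<le> b" "Tm n x = c"
    using IVT2'[of "Tm n" b c a] ab continuous_on_Tm[OF assms(1), of "{a..b}"] by (auto simp: subset_iff)
  then show ?thesis using ab by (intro exI[of _ x]) auto
qed

subsection \<open>The two inverse branches of the profile\<close>

text \<open>Both branches contain 1, where \<open>Q\<close> vanishes, so that the inverse
  \<open>chi\<close> also covers the maximum level \<open>s = 0\<close>.\<close>

definition is_branch :: "real set \<Rightarrow> bool" where
  "is_branch J \<longleftrightarrow> J = {0<..1} \<or> J = {1..}"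

definition chi :: "real \<Rightarrow> real set \<Rightarrow> real \<Rightarrow> real" where
  "chi n J s = (THE x. x \<in> J \<and> Qm n x = s)"

lemma branch_pos: "is_branch J \<Longrightarrow> x \<in> J \<Longrightarrow> x > 0"
  by (auto simp: is_branch_def)

lemma Qm_inj_branch:
  assumes "is_branch J" "n > 2" "x \<in> J" "y \<in> J" "Qm n x = Qm n y" shows "x = y"
proof (rule ccontr)
  have *: False if "x < y" "x \<in> J" "y \<in> J" "Qm n x = Qm n y" for x y
    using that assms(1,2) Qm_strict_decreasing[of x y n] Qm_strict_increasing[of x y n]
    by (auto simp: is_branch_def)
  assume "x \<noteq> y"
  then show False using *[of x y] *[of y x] assms(3-5) by linarith
qed

lemma Qm_unbounded_branch:
  assumes "is_branch J" "n > 2" shows "\<exists>x\<in>J. Qm n x \<ge> s"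
proof (cases "J = {1..}")
  case True
  define x where "x = \<bar>s\<bar> + n / (n - 2) + 1"
  have "x \<ge> 1" using assms by (simp add: x_def)
  have "x \<le> x\<^sup>2" using \<open>x \<ge> 1\<close> by (simp add: power2_eq_square mult_le_cancel_left1)
  then have "Qm n x \<ge> x - n / (n - 2)" using assms by (simp add: Qm_def add_increasing2)
  then show ?thesis using True \<open>x \<ge> 1\<close> unfolding x_def by (intro bexI[of _ x]) (auto simp: x_def)
next
  case False
  then have J: "J = {0<..1}" using assms by (simp add: is_branch_def)
  \<comment> \<open>Chosen so that \<open>2 / (n - 2) * B\<close> alone dominates
    \<open>\<bar>s\<bar> + n / (n - 2)\<close>; the surplus 2 makes \<open>B > 1\<close> and thus
    \<open>x < 1\<close>.\<close>
  define B where "B = (n - 2) / 2 * (\<bar>s\<bar> + n / (n - 2)) + 2"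
  have B: "B > 1" using assms by (simp add: B_def add_nonneg_pos)
  define x where "x = B powr (1 / (2 - n))"
  have x0: "x > 0" using B by (simp add: x_def)
  have x1: "x < 1" using B assms unfolding x_def by (intro powr_less_one) (auto simp: divide_pos_neg)
  have "x powr (2 - n) = B" using assms B by (simp add: x_def powr_powr)
  then have "Qm n x = x\<^sup>2 + 2 / (n - 2) * B - n / (n - 2)" by (simp add: Qm_def)
  moreover have "2 / (n - 2) * B \<ge> \<bar>s\<bar> + n / (n - 2)" 
  proof -
    have "2 / (n - 2) * ((n - 2) / 2 * (\<bar>s\<bar> + n / (n - 2))) = \<bar>s\<bar> + n / (n - 2)" using assms by simp
    moreover have "2 / (n - 2) * 2 \<ge> 0" using assms by simp
    ultimately show ?thesis unfolding B_def distrib_left[of "2 / (n - 2)"] by linarith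
  qed
  ultimately have "Qm n x \<ge> \<bar>s\<bar>" by (smt (verit) zero_le_power2)
  then show ?thesis using x0 x1 J by (intro bexI[of _ x]) auto
qed

lemma branch_surj:
  assumes "is_branch J" "n > 2" "s \<ge> 0" shows "\<exists>x\<in>J. Qm n x = s"
proof -
  obtain b where b: "b \<in> J" "Qm n b \<ge> s" using Qm_unbounded_branch[OF assms(1,2)] by blast
  have b0: "b > 0" using branch_pos[OF assms(1) b(1)] .
  show ?thesis
  proof (cases "J = {1..}")
    case True
    moreover have "continuous_on {1..b} (Qm n)" by (rule continuous_on_Qm[OF assms(2)]) auto
    ultimately obtain x where "1 \<le> x" "x \<le> b" "Qm n x = s"
      using IVT'[of "Qm n" 1 s b] assms b by auto
    then show ?thesis using True by auto
  next
    case False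
    then have "J = {0<..1}" using assms by (simp add: is_branch_def)
    moreover have "continuous_on {b..1} (Qm n)" by (rule continuous_on_Qm[OF assms(2)]) (use b0 in auto)
    moreover obtain x where "b \<le> x" "x \<le> 1" "Qm n x = s"
      using IVT2'[of "Qm n" 1 s b] assms b b0 calculation by auto
    ultimately show ?thesis using b0 by auto
  qed
qed

lemma chi_props:
  assumes "is_branch J" "n > 2" "s \<ge> 0" shows "chi n J s \<in> J" "Qm n (chi n J s) = s" "chi n J s > 0"
proof -
  have "\<exists>!x. x \<in> J \<and> Qm n x = s"
    using branch_surj[OF assms] Qm_inj_branch[OF assms(1,2)] by metis
  from theI'[OF this] show *: "chi n J s \<in> J" "Qm n (chi n J s) = s" by (auto simp: chi_def)
  then show "chi n J s > 0" using branch_pos assms(1) by blast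
qed

lemma chi_Qm: assumes "is_branch J" "n > 2" "x \<in> J" shows "chi n J (Qm n x) = x"
proof -
  have "Qm n x \<ge> 0"
    by (metis Qm_1 Qm_pos assms branch_pos less_eq_real_def)
  then show ?thesis using chi_props[OF assms(1,2)] Qm_inj_branch[OF assms(1,2)] assms(3) by blast
qed

lemma chi_0: "is_branch J \<Longrightarrow> n > 2 \<Longrightarrow> chi n J 0 = 1"
  using chi_Qm[of J n 1] by (auto simp: is_branch_def)

text \<open>On the compact interval between 1 and \<open>chi n J s\<close> the inverse of a
  continuous injection is continuous. Continuity at \<open>t\<close> is then read off from the
  interval \<open>{0..t+1}\<close>, which is a neighbourhood of \<open>t\<close> in
  \<open>{0..}\<close>.\<close>

lemma continuous_on_chi: assumes "is_branch J" "n > 2" shows "continuous_on {0..} (chi n J)"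
proof -
  have *: "continuous_on {0..s} (chi n J)" if s: "s \<ge> 0" for s
  proof -
    define b where "b = chi n J s"
    have b: "b \<in> J" "Qm n b = s" "b > 0" using chi_props[OF assms s] by (auto simp: b_def)
    define K where "K = {min b 1..max b 1}"
    have KJ: "K \<subseteq> J" using b assms(1) by (auto simp: K_def is_branch_def)
    have Kpos: "K \<subseteq> {0<..}" using KJ branch_pos[OF assms(1)] by auto
    have "continuous_on (Qm n ` K) (chi n J)"
      by (rule continuous_on_inv) (use KJ chi_Qm[OF assms] continuous_on_Qm[OF assms(2) Kpos] in \<open>auto simp: K_def\<close>)
    moreover have "{0..s} \<subseteq> Qm n ` K"
    proof
      fix t assume t: "t \<in> {0..s}"
      have "\<exists>x. x \<in> K \<and> Qm n x = t"
      proof (cases "b \<le> 1")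
        case True
        then show ?thesis using IVT2'[of "Qm n" 1 t b] t b assms continuous_on_Qm[OF assms(2) Kpos]
          by (auto simp: K_def)
      next
        case False
        then show ?thesis using IVT'[of "Qm n" 1 t b] t b assms continuous_on_Qm[OF assms(2) Kpos]
          by (auto simp: K_def)
      qed
      then show "t \<in> Qm n ` K" by auto
    qed
    ultimately show ?thesis by (rule continuous_on_subset)
  qed
  show ?thesis
  proof (rule continuous_on_eq_continuous_within[THEN iffD2], rule ballI)
    fix t :: real assume "t \<in> {0..}"
    then have t: "t \<in> {0..t+1}" by simp
    have "continuous (at t within {0..t+1}) (chi n J)"
      using *[of "t+1"] t by (auto simp: continuous_on_eq_continuous_within)
    moreover have "at t within {0..t+1} = at t within {0..}"
      by (rule at_within_nhd[of t "{..<t+1}"]) auto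
    ultimately show "continuous (at t within {0..}) (chi n J)" by simp
  qed
qed

lemma chi_ne_1: assumes "is_branch J" "n > 2" "s > 0" shows "chi n J s \<noteq> 1"
  proof
  assume "chi n J s = 1"
  then show False using chi_props(2)[of J n s] assms by simp
qed

lemma Pm_chi_nonzero: assumes "is_branch J" "n > 2" "s > 0" shows "Pm n (chi n J s) \<noteq> 0"
  using chi_ne_1[OF assms] chi_props(3)[of J n s] Pm_neg[of "chi n J s" n] Pm_pos[of "chi n J s" n] assms
  by (cases "chi n J s < 1") auto

text \<open>The level \<open>s = 0\<close> is left out: \<open>P(1) = 0\<close>, so
  \<open>chi\<close> has a square-root singularity at the maximum of the model. This is why later
  arguments differentiate only where \<open>u < m\<close>.\<close>

lemma chi_deriv:
  assumes "is_branch J" "n > 2" "s > 0"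
  shows "(chi n J has_real_derivative 1 / (2 * Pm n (chi n J s))) (at s)"
proof -
  have "(chi n J has_real_derivative inverse (2 * Pm n (chi n J s))) (at s)"
  proof (rule DERIV_inverse_function[where f = "Qm n" and a = 0 and b = "s + 1"])
    show "(Qm n has_real_derivative 2 * Pm n (chi n J s)) (at (chi n J s))"
      using Qm_deriv chi_props(3)[of J n s] assms by simp
    show "isCont (chi n J) s"
      using continuous_on_interior[OF continuous_on_chi[OF assms(1,2)], of s] assms(3) by simp
  qed (use assms Pm_chi_nonzero[OF assms] chi_props in auto)
  then show ?thesis by (simp only: inverse_eq_divide)
qed

section \<open>Hessian identities\<close>

definition dird :: "real^'n::finite \<Rightarrow> (real^'n \<Rightarrow> real) \<Rightarrow> real^'n \<Rightarrow> real" where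
  "dird e f x = grad f x \<bullet> e"

lemma dird_eq_sum: "dird e f x = (\<Sum>i\<in>UNIV. e $ i * partial i f x)"
  by (simp add: dird_def grad_def inner_vec_def mult.commute)

lemma smooth_on_sum:
  assumes "open S" "finite I" "\<And>i. i \<in> I \<Longrightarrow> smooth_on S (f i)"
  shows "smooth_on S (\<lambda>x. \<Sum>i\<in>I. c i * f i x)"
  using assms(2,3)
proof (induction I)
  case empty
  have "Ck_on k S (\<lambda>x. 0)" for k
  proof (induction k)
    case (Suc k)
    have "partial i (\<lambda>x::real^'a. 0::real) = (\<lambda>x. 0)" for i
      using has_grad_partial[OF has_grad_const] by fastforce
    then show ?case using Suc by simp
  qed simp
  then show ?case using assms(1) by (simp add: smooth_on_def)
next
  case (insert j I)
  then have "smooth_on S (\<lambda>x. c j * f j x + 1 * (\<Sum>i\<in>I. c i * f i x))"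
    by (intro smooth_on_lincomb) auto
  then show ?case using insert by simp
qed

lemma smooth_on_dird: "smooth_on S f \<Longrightarrow> smooth_on S (dird e f)"
proof -
  assume f: "smooth_on S f"
  have "dird e f = (\<lambda>x. \<Sum>i\<in>UNIV. e $ i * partial i f x)" by (rule ext) (rule dird_eq_sum)
  moreover have "smooth_on S (\<lambda>x. \<Sum>i\<in>UNIV. e $ i * partial i f x)"
    by (rule smooth_on_sum) (use f in \<open>auto simp: smooth_on_partial smooth_on_def[of S f]\<close>)
  ultimately show ?thesis by simp
qed

lemma dird_line:
  assumes "smooth_on S f" "p + t *\<^sub>R e \<in> S"
  shows "((\<lambda>s. f (p + s *\<^sub>R e)) has_real_derivative dird e f (p + t *\<^sub>R e)) (at t)"
  unfolding dird_def by (rule has_grad_line[OF smooth_on_has_grad[OF assms]])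

lemma partial_laplacian:
  assumes "smooth_on S u" "x \<in> S"
  shows "partial i (laplacian u) x = (\<Sum>k\<in>UNIV. partial k (partial k (partial i u)) x)"
proof -
  have o: "open S" using assms by (simp add: smooth_on_def)
  have "has_grad (laplacian u) (\<Sum>k\<in>UNIV. grad (partial k (partial k u)) x) x"
    unfolding laplacian_def [abs_def]
    by (intro has_grad_sum smooth_on_has_grad[of S] smooth_on_partial assms)
  then have "partial i (laplacian u) x = (\<Sum>k\<in>UNIV. partial i (partial k (partial k u)) x)"
    by (simp add: has_grad_partial grad_def)
  also have "\<dots> = (\<Sum>k\<in>UNIV. partial k (partial k (partial i u)) x)"
  proof (rule sum.cong[OF refl])
    fix k
    have "partial i (partial k (partial k u)) x = partial k (partial i (partial k u)) x"
      by (rule partial_commute[OF smooth_on_partial[OF assms(1)] assms(2)])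
    also have "\<dots> = partial k (partial k (partial i u)) x"
      by (rule partial_cong_open[OF o assms(2)]) (rule partial_commute[OF assms(1)])
    finally show "partial i (partial k (partial k u)) x = partial k (partial k (partial i u)) x" .
  qed
  finally show ?thesis .
qed

text \<open>Removes the third-order terms from Bochner's formula: differentiating the constant
  Laplacian and commuting derivatives shows that each first derivative of \<open>u\<close> is
  harmonic.\<close>

lemma partial_laplacian_const:
  assumes "smooth_on S u" "x \<in> S" "\<And>y. y \<in> S \<Longrightarrow> laplacian u y = c"
  shows "(\<Sum>k\<in>UNIV. partial k (partial k (partial i u)) x) = 0"
proof -
  have o: "open S" using assms by (simp add: smooth_on_def)
  have "partial i (laplacian u) x = partial i (\<lambda>_. c) x"
    by (rule partial_cong_open[OF o assms(2)]) (rule assms(3))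
  then show ?thesis using partial_laplacian[OF assms(1,2)] has_grad_partial[OF has_grad_const[of c x]] by simp
qed

lemma norm_grad_sq: "(norm (grad u x))\<^sup>2 = (\<Sum>i\<in>UNIV. (partial i u x)\<^sup>2)"
  unfolding power2_norm_eq_inner inner_vec_def by (simp add: grad_def power2_eq_square)

lemma norm_grad_sq_grad:
  assumes "smooth_on S u" "x \<in> S"
  shows "has_grad (\<lambda>y. (norm (grad u y))\<^sup>2)
    (\<chi> k. 2 * (\<Sum>i\<in>UNIV. partial i u x * partial k (partial i u) x)) x"
proof -
  have "has_grad (\<lambda>y. \<Sum>i\<in>UNIV. partial i u y * partial i u y)
     (\<Sum>i\<in>UNIV. partial i u x *\<^sub>R grad (partial i u) x + partial i u x *\<^sub>R grad (partial i u) x) x"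
    by (intro has_grad_sum has_grad_mult smooth_on_has_grad[of S] smooth_on_partial assms)
  moreover have "(\<Sum>i\<in>UNIV. partial i u x *\<^sub>R grad (partial i u) x + partial i u x *\<^sub>R grad (partial i u) x)
    = (\<chi> k. 2 * (\<Sum>i\<in>UNIV. partial i u x * partial k (partial i u) x))"
    by (simp add: vec_eq_iff grad_def sum_distrib_left mult_ac)
  ultimately show ?thesis unfolding norm_grad_sq by (simp only: power2_eq_square)
qed

text \<open>Here \<open>\<gamma>\<close> is the gradient and the trace of \<open>H\<close> the Laplacian of \<open>|\<nabla>u|\<^sup>2 - Z(u)\<close> (Bochner's formula).\<close>

lemma bochner_comparison:
  fixes u :: "real^'n::finite \<Rightarrow> real"
  assumes u: "smooth_on S u" and x: "x \<in> S" and lap: "\<And>y. y \<in> S \<Longrightarrow> laplacian u y = c"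
    and Z: "\<And>y. y \<in> S \<Longrightarrow> (Z has_real_derivative Z1 (u y)) (at (u y))"
    and Z1: "(Z1 has_real_derivative Z2) (at (u x))"
  defines "\<gamma> \<equiv> \<lambda>y. \<chi> k. 2 * (\<Sum>i\<in>UNIV. partial i u y * partial k (partial i u) y) - Z1 (u y) * partial k u y"
  shows "\<And>y. y \<in> S \<Longrightarrow> has_grad (\<lambda>y. (norm (grad u y))\<^sup>2 - Z (u y)) (\<gamma> y) y"
    and "\<exists>H. (\<forall>k. has_grad (\<lambda>y. \<gamma> y $ k) (H k) x) \<and>
      (\<Sum>k\<in>UNIV. H k $ k) = 2 * (\<Sum>i\<in>UNIV. \<Sum>k\<in>UNIV. (partial k (partial i u) x)\<^sup>2)
        - Z2 * (norm (grad u x))\<^sup>2 - c * Z1 (u x)"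
proof -
  fix y assume y: "y \<in> S"
  have "has_grad (\<lambda>y. (norm (grad u y))\<^sup>2 - Z (u y))
     ((\<chi> k. 2 * (\<Sum>i\<in>UNIV. partial i u y * partial k (partial i u) y)) - Z1 (u y) *\<^sub>R grad u y) y"
    by (intro has_grad_diff norm_grad_sq_grad[OF u y] has_grad_compose smooth_on_has_grad[OF u y] Z y)
  moreover have "(\<chi> k. 2 * (\<Sum>i\<in>UNIV. partial i u y * partial k (partial i u) y)) - Z1 (u y) *\<^sub>R grad u y = \<gamma> y"
    by (simp add: \<gamma>_def vec_eq_iff grad_def)
  ultimately show "has_grad (\<lambda>y. (norm (grad u y))\<^sup>2 - Z (u y)) (\<gamma> y) y" by simp
next
  define H where "H k = 2 *\<^sub>R (\<Sum>i\<in>UNIV. partial i u x *\<^sub>R grad (partial k (partial i u)) x + 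
      partial k (partial i u) x *\<^sub>R grad (partial i u) x)
      - (Z1 (u x) *\<^sub>R grad (partial k u) x + partial k u x *\<^sub>R (Z2 *\<^sub>R grad u x))" for k
  have "has_grad (\<lambda>y. \<gamma> y $ k) (H k) x" for k
    unfolding \<gamma>_def H_def vec_lambda_beta
    by (intro has_grad_diff has_grad_cmult has_grad_sum has_grad_mult has_grad_compose[where k = Z1 and f = u] Z1
        smooth_on_has_grad[of S] smooth_on_partial u x)
  moreover have "(\<Sum>k\<in>UNIV. H k $ k) = 2 * (\<Sum>i\<in>UNIV. \<Sum>k\<in>UNIV. (partial k (partial i u) x)\<^sup>2)
        - Z2 * (norm (grad u x))\<^sup>2 - c * Z1 (u x)"
  proof -
    have "(\<Sum>k\<in>UNIV. H k $ k) = 2 * (\<Sum>k\<in>UNIV. \<Sum>i\<in>UNIV. partial i u x * partial k (partial k (partial i u)) x)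
       + 2 * (\<Sum>k\<in>UNIV. \<Sum>i\<in>UNIV. (partial k (partial i u) x)\<^sup>2)
       - Z1 (u x) * laplacian u x - Z2 * (norm (grad u x))\<^sup>2"
      unfolding H_def laplacian_def norm_grad_sq
      by (simp add: grad_def sum.distrib sum_subtractf sum_distrib_left power2_eq_square algebra_simps)
    \<comment> \<open>The third-order term of Bochner's formula: grad u paired with the gradient of
      the Laplacian, which is constant.\<close>
    moreover have "(\<Sum>k\<in>UNIV. \<Sum>i\<in>UNIV. partial i u x * partial k (partial k (partial i u)) x) = 0"
      by (subst sum.swap) (simp add: sum_distrib_left[symmetric] partial_laplacian_const[OF u x lap])
    moreover have "(\<Sum>k\<in>UNIV. \<Sum>i\<in>UNIV. (partial k (partial i u) x)\<^sup>2) = (\<Sum>i\<in>UNIV. \<Sum>k\<in>UNIV. (partial k (partial i u) x)\<^sup>2)"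
      by (rule sum.swap)
    ultimately show ?thesis using lap[OF x] by simp
  qed
  ultimately show "\<exists>H. (\<forall>k. has_grad (\<lambda>y. \<gamma> y $ k) (H k) x) \<and>
      (\<Sum>k\<in>UNIV. H k $ k) = 2 * (\<Sum>i\<in>UNIV. \<Sum>k\<in>UNIV. (partial k (partial i u) x)\<^sup>2)
        - Z2 * (norm (grad u x))\<^sup>2 - c * Z1 (u x)" by blast
qed

text \<open>The subtracted matrix has eigenvalue \<open>a\<close> along \<open>v\<close> and
  \<open>b\<close> on the orthogonal complement, with the same trace and the same entry along
  \<open>v\<close> as \<open>M\<close>. It is the orthogonal projection of \<open>M\<close> to the
  span of the identity and the tensor square of \<open>v\<close>, so the formula is Pythagoras. An
  identity is kept instead of the inequality because the vanishing of the left side recovers the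
  Hessian in the rigidity argument.\<close>

lemma matrix_deviation:
  fixes M :: "'n::finite \<Rightarrow> 'n \<Rightarrow> real" and v :: "real^'n"
  assumes v: "v \<noteq> 0" and N: "CARD('n) \<ge> 2"
  defines "w \<equiv> (norm v)\<^sup>2"
  defines "a \<equiv> (\<Sum>i\<in>UNIV. \<Sum>j\<in>UNIV. v $ i * v $ j * M i j) / w"
  defines "tr \<equiv> \<Sum>i\<in>UNIV. M i i"
  defines "b \<equiv> (tr - a) / (real CARD('n) - 1)"
  shows "(\<Sum>i\<in>UNIV. \<Sum>j\<in>UNIV. (M i j - ((a - b) * (v $ i * v $ j / w) + (if i = j then b else 0)))\<^sup>2)
    = (\<Sum>i\<in>UNIV. \<Sum>j\<in>UNIV. (M i j)\<^sup>2) - (a\<^sup>2 + (tr - a)\<^sup>2 / (real CARD('n) - 1))"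
proof -
  let ?n = "real CARD('n)" and ?K = "\<lambda>i j. (a - b) * (v $ i * v $ j / w) + (if i = j then b else 0)"
  have w: "w > 0" "w = (\<Sum>i\<in>UNIV. v $ i * v $ i)" using v
    unfolding w_def by simp (simp add: power2_norm_eq_inner inner_vec_def)
  have 1: "(\<Sum>i\<in>UNIV. \<Sum>j\<in>UNIV. M i j * ?K i j) = (a - b) * a + b * tr"
  proof -
    have "(\<Sum>i\<in>UNIV. \<Sum>j\<in>UNIV. M i j * ?K i j) =
      (\<Sum>i\<in>UNIV. (\<Sum>j\<in>UNIV. (a - b) / w * (v $ i * v $ j * M i j)) + b * M i i)"
    proof (rule sum.cong[OF refl])
      fix i :: 'n
      have "M i j * ?K i j = (a - b) / w * (v $ i * v $ j * M i j) + (if i = j then b * M i i else 0)" for j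
        by (simp add: algebra_simps)
      then show "(\<Sum>j\<in>UNIV. M i j * ?K i j) = (\<Sum>j\<in>UNIV. (a - b) / w * (v $ i * v $ j * M i j)) + b * M i i"
        by (simp add: sum.distrib)
    qed
    also have "\<dots> = (a - b) * a + b * tr"
    proof -
      have "(\<Sum>i\<in>UNIV. \<Sum>j\<in>UNIV. c * (v $ i * v $ j * M i j)) = c * (w * a)" for c
      proof -
        have "w * a = (\<Sum>i\<in>UNIV. \<Sum>j\<in>UNIV. v $ i * v $ j * M i j)" unfolding a_def using w(1) by simp
        then show ?thesis by (simp only: sum_distrib_left)
      qed
      then show ?thesis using w(1) by (simp only: sum.distrib sum_distrib_left[symmetric] tr_def) simp
    qed
    finally show ?thesis .
  qed
  have 2: "(\<Sum>i\<in>UNIV. \<Sum>j\<in>UNIV. (?K i j)\<^sup>2) = (a - b)\<^sup>2 + 2 * (a - b) * b + ?n * b\<^sup>2"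
  proof -
    have "(\<Sum>i\<in>UNIV. \<Sum>j\<in>UNIV. (?K i j)\<^sup>2) =
      (\<Sum>i\<in>UNIV. (\<Sum>j\<in>UNIV. ((a - b)/w)\<^sup>2 * (v $ i * v $ i) * (v $ j * v $ j)) + 2 * (a - b) * b / w * (v $ i * v $ i) + b\<^sup>2)"
    proof (rule sum.cong[OF refl])
      fix i :: 'n
      have "(?K i j)\<^sup>2 = ((a - b)/w)\<^sup>2 * (v $ i * v $ i) * (v $ j * v $ j) + 
         (if i = j then 2 * (a - b) * b / w * (v $ i * v $ i) + b\<^sup>2 else 0)" for j
        by (simp add: power2_eq_square algebra_simps)
      then show "(\<Sum>j\<in>UNIV. (?K i j)\<^sup>2) = (\<Sum>j\<in>UNIV. ((a - b)/w)\<^sup>2 * (v $ i * v $ i) * (v $ j * v $ j)) + 2 * (a - b) * b / w * (v $ i * v $ i) + b\<^sup>2"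
        by (simp add: sum.distrib)
    qed
    also have "\<dots> = ((a - b)/w)\<^sup>2 * w * w + 2 * (a - b) * b / w * w + ?n * b\<^sup>2"
      by (simp only: sum.distrib sum_distrib_left[symmetric] sum_distrib_right[symmetric] w(2)[symmetric]
          sum_constant)
    also have "\<dots> = (a - b)\<^sup>2 + 2 * (a - b) * b + ?n * b\<^sup>2" using w(1) by (simp add: power2_eq_square)
    finally show ?thesis .
  qed
  have "(\<Sum>i\<in>UNIV. \<Sum>j\<in>UNIV. (M i j - ?K i j)\<^sup>2) = (\<Sum>i\<in>UNIV. \<Sum>j\<in>UNIV. (M i j)\<^sup>2)
     - 2 * (\<Sum>i\<in>UNIV. \<Sum>j\<in>UNIV. M i j * ?K i j) + (\<Sum>i\<in>UNIV. \<Sum>j\<in>UNIV. (?K i j)\<^sup>2)"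
    unfolding power2_diff by (simp only: sum.distrib sum_subtractf sum_distrib_left mult.assoc)
  also have "\<dots> = (\<Sum>i\<in>UNIV. \<Sum>j\<in>UNIV. (M i j)\<^sup>2) - (a\<^sup>2 + 2 * b * (tr - a) - (?n - 1) * b\<^sup>2)"
    unfolding 1 2 by (simp add: power2_eq_square algebra_simps)
  also have "a\<^sup>2 + 2 * b * (tr - a) - (?n - 1) * b\<^sup>2 = a\<^sup>2 + (tr - a)\<^sup>2 / (?n - 1)"
  proof -
    have "2 * (t / d) * t - d * (t / d)\<^sup>2 = t\<^sup>2 / d" if "d > 0" for t d :: real
      using that by (simp add: power2_eq_square)
    from this[of "?n - 1" "tr - a"] show ?thesis using N unfolding b_def by simp
  qed
  finally show ?thesis .
qed

lemma hessian_lower_bound: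
  fixes M :: "'n::finite \<Rightarrow> 'n \<Rightarrow> real" and v :: "real^'n"
  assumes v: "v \<noteq> 0" and N: "CARD('n) \<ge> 2"
    and a: "a * (norm v)\<^sup>2 = (\<Sum>i\<in>UNIV. \<Sum>j\<in>UNIV. v $ i * v $ j * M i j)"
  shows "a\<^sup>2 + ((\<Sum>i\<in>UNIV. M i i) - a)\<^sup>2 / (real CARD('n) - 1) \<le> (\<Sum>i\<in>UNIV. \<Sum>j\<in>UNIV. (M i j)\<^sup>2)"
proof -
  have "a = (\<Sum>i\<in>UNIV. \<Sum>j\<in>UNIV. v $ i * v $ j * M i j) / (norm v)\<^sup>2"
    using a v by (simp add: field_simps)
  note a = this
  have "(\<Sum>i\<in>UNIV. \<Sum>j\<in>UNIV. (M i j)\<^sup>2) - (a\<^sup>2 + ((\<Sum>i\<in>UNIV. M i i) - a)\<^sup>2 / (real CARD('n) - 1)) \<ge> 0"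
    unfolding a matrix_deviation[OF v N, of M, symmetric] by (intro sum_nonneg zero_le_power2)
  then show ?thesis by simp
qed

text \<open>The first-order condition reads \<open>D^2 u (grad u) = (Z' / 2) grad u\<close>, so the
  entry \<open>a\<close> of the Kato-type bound is \<open>Z1 (u x) / 2\<close>. The second-order
  condition bounds the trace in Bochner's formula by 0, and what remains involves \<open>u\<close>
  only through its value and its gradient norm at \<open>x\<close>.\<close>

lemma local_max_comparison:
  fixes u :: "real^'n::finite \<Rightarrow> real"
  assumes N: "CARD('n) \<ge> 2" and u: "smooth_on S u" and x: "x \<in> S"
    and lap: "\<And>y. y \<in> S \<Longrightarrow> laplacian u y = - real CARD('n)"
    and Z: "\<And>y. y \<in> S \<Longrightarrow> (Z has_real_derivative Z1 (u y)) (at (u y))"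
    and Z1: "(Z1 has_real_derivative Z2) (at (u x))"
    and g0: "grad u x \<noteq> 0"
    and mx: "\<And>y. y \<in> S \<Longrightarrow> (norm (grad u y))\<^sup>2 - Z (u y) \<le> (norm (grad u x))\<^sup>2 - Z (u x)"
  shows "2 * ((Z1 (u x) / 2)\<^sup>2 + (real CARD('n) + Z1 (u x) / 2)\<^sup>2 / (real CARD('n) - 1))
    \<le> Z2 * (norm (grad u x))\<^sup>2 - real CARD('n) * Z1 (u x)"
proof -
  let ?n = "real CARD('n)"
  define \<gamma> where "\<gamma> = (\<lambda>y. \<chi> k. 2 * (\<Sum>i\<in>UNIV. partial i u y * partial k (partial i u) y) - Z1 (u y) * partial k u y)"
  have g: "\<And>y. y \<in> S \<Longrightarrow> has_grad (\<lambda>y. (norm (grad u y))\<^sup>2 - Z (u y)) (\<gamma> y) y"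
    using bochner_comparison(1)[OF u x lap Z Z1] by (simp add: \<gamma>_def)
  obtain H where H: "\<And>k. has_grad (\<lambda>y. \<gamma> y $ k) (H k) x"
    "(\<Sum>k\<in>UNIV. H k $ k) = 2 * (\<Sum>i\<in>UNIV. \<Sum>k\<in>UNIV. (partial k (partial i u) x)\<^sup>2)
        - Z2 * (norm (grad u x))\<^sup>2 + ?n * Z1 (u x)"
    using bochner_comparison(2)[OF u x lap Z Z1] by (auto simp: \<gamma>_def)
  have o: "open S" using u by (simp add: smooth_on_def)
  note lm = local_max_conditions[OF o x g H(1) mx]
  have tr: "(\<Sum>i\<in>UNIV. partial i (partial i u) x) = - ?n" using lap[OF x] by (simp add: laplacian_def)
  have "Z1 (u x) / 2 * (norm (grad u x))\<^sup>2 = 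
    (\<Sum>i\<in>UNIV. \<Sum>j\<in>UNIV. grad u x $ i * grad u x $ j * partial j (partial i u) x)"
  proof -
    have e: "2 * (\<Sum>i\<in>UNIV. partial i u x * partial k (partial i u) x) = Z1 (u x) * partial k u x" for k
    proof -
      have "\<gamma> x $ k = 0" using lm(1) by simp
      then show ?thesis by (simp add: \<gamma>_def)
    qed
    have "(\<Sum>i\<in>UNIV. \<Sum>j\<in>UNIV. grad u x $ i * grad u x $ j * partial j (partial i u) x) 
      = (\<Sum>j\<in>UNIV. partial j u x * (\<Sum>i\<in>UNIV. partial i u x * partial j (partial i u) x))"
      by (subst sum.swap) (simp add: grad_def sum_distrib_left mult_ac)
    also have "\<dots> = (\<Sum>j\<in>UNIV. partial j u x * (Z1 (u x) * partial j u x / 2))"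
      using e by (intro sum.cong refl) (simp add: field_simps)
    also have "\<dots> = Z1 (u x) / 2 * (norm (grad u x))\<^sup>2"
      unfolding norm_grad_sq by (simp add: sum_distrib_left power2_eq_square mult_ac)
    finally show ?thesis by simp
  qed
  from hessian_lower_bound[OF g0 N this]
  have "(Z1 (u x) / 2)\<^sup>2 + (?n + Z1 (u x) / 2)\<^sup>2 / (?n - 1) \<le> (\<Sum>i\<in>UNIV. \<Sum>k\<in>UNIV. (partial k (partial i u) x)\<^sup>2)"
    unfolding tr by (simp add: power2_commute[of "- ?n"] power2_eq_square algebra_simps)
  moreover have "(\<Sum>k\<in>UNIV. H k $ k) \<le> 0" by (rule sum_nonpos) (use lm(2) in simp)
  moreover have "2 * a \<le> z - b" if "a \<le> s" "h \<le> 0" "h = 2 * s - z + b" for a s h z b :: real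
    using that by linarith
  ultimately show ?thesis using H(2) by blast
qed

section \<open>Comparison with the model\<close>

text \<open>At scaled radius \<open>\<xi>\<close> the model with maximum \<open>m\<close> and core
  radius \<open>\<rho>\<close> has value \<open>m - \<rho>^2 Q(\<xi>) / 2\<close> and gradient norm
  \<open>\<rho> |P(\<xi>)|\<close>; \<open>ym\<close> is the square of the latter as a function of
  the value \<open>c\<close>.\<close>

definition ym :: "real \<Rightarrow> real set \<Rightarrow> real \<Rightarrow> real \<Rightarrow> real \<Rightarrow> real" where
  "ym n J \<rho> m c = \<rho>\<^sup>2 * (Pm n (chi n J (2 * (m - c) / \<rho>\<^sup>2)))\<^sup>2"

definition gm :: "real \<Rightarrow> real set \<Rightarrow> real \<Rightarrow> real \<Rightarrow> real \<Rightarrow> real" where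
  "gm n J \<rho> m c = Gm n (chi n J (2 * (m - c) / \<rho>\<^sup>2))"

text \<open>The derivative of \<open>gm\<close> in \<open>c\<close>, as \<open>g2m\<close> is the
  second derivative; written explicitly so that the signs can be computed.\<close>

definition g1m :: "real \<Rightarrow> real set \<Rightarrow> real \<Rightarrow> real \<Rightarrow> real \<Rightarrow> real" where
  "g1m n J \<rho> m c = (let \<xi> = chi n J (2 * (m - c) / \<rho>\<^sup>2) in n * (n - 1) * \<xi> powr (- n - 1) / (\<rho>\<^sup>2 * Pm n \<xi>))"

definition g2m :: "real \<Rightarrow> real set \<Rightarrow> real \<Rightarrow> real \<Rightarrow> real \<Rightarrow> real" where
  "g2m n J \<rho> m c = (let \<xi> = chi n J (2 * (m - c) / \<rho>\<^sup>2) in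
     n * (n - 1) * \<xi> powr (- n - 2) * ((n + 1) * Pm n \<xi> + \<xi> * Gm n \<xi>) / (\<rho>\<^sup>2 * \<rho>\<^sup>2 * Pm n \<xi> ^ 3))"

context
  fixes n \<rho> m c :: real and J :: "real set"
  assumes J: "is_branch J" and n: "n > 2" and \<rho>: "\<rho> > 0" and c: "c < m"
begin

lemma s_pos: "2 * (m - c) / \<rho>\<^sup>2 > 0" using \<rho> c by simp

lemma chi_u_deriv: "((\<lambda>c. chi n J (2 * (m - c) / \<rho>\<^sup>2)) has_real_derivative
    - 1 / (\<rho>\<^sup>2 * Pm n (chi n J (2 * (m - c) / \<rho>\<^sup>2)))) (at c)"
proof -
  have d: "((\<lambda>c. 2 * (m - c) / \<rho>\<^sup>2) has_real_derivative - 2 / \<rho>\<^sup>2) (at c)"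
    by (rule DERIV_cdivide) (auto intro!: derivative_eq_intros)
  have "1 / (2 * P) * (- 2 / r) = - 1 / (r * P)" for P r :: real by (cases "P = 0"; cases "r = 0") (auto simp: field_simps)
  from DERIV_chain2[OF chi_deriv[OF J n s_pos] d, unfolded this] show ?thesis .
qed

lemma ym_deriv: "(ym n J \<rho> m has_real_derivative - 2 * gm n J \<rho> m c) (at c)"
proof -
  define x where "x = chi n J (2 * (m - c) / \<rho>\<^sup>2)"
  have x: "x > 0" "Pm n x \<noteq> 0" unfolding x_def
    using Pm_chi_nonzero[OF J n s_pos] chi_props(3)[OF J n less_imp_le[OF s_pos]] by auto
  have "((\<lambda>\<xi>. \<rho>\<^sup>2 * (Pm n \<xi>)\<^sup>2) has_real_derivative \<rho>\<^sup>2 * (2 * Pm n x * Gm n x)) (at x)"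
    by (auto intro!: derivative_eq_intros Pm_deriv x n)
  from DERIV_chain2[OF this[unfolded x_def] chi_u_deriv, folded x_def]
  show ?thesis unfolding ym_def [abs_def] gm_def x_def[symmetric] using x \<rho> by (simp add: field_simps)
qed

lemma gm_deriv: "(gm n J \<rho> m has_real_derivative g1m n J \<rho> m c) (at c)"
proof -
  define x where "x = chi n J (2 * (m - c) / \<rho>\<^sup>2)"
  have x: "x > 0" unfolding x_def using chi_props(3)[OF J n less_imp_le[OF s_pos]] by auto
  from DERIV_chain2[OF Gm_deriv[OF x n, unfolded x_def] chi_u_deriv, folded x_def]
  show ?thesis unfolding gm_def [abs_def] g1m_def Let_def x_def[symmetric] by simp
qed

lemma g1m_deriv: "(g1m n J \<rho> m has_real_derivative g2m n J \<rho> m c) (at c)"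
proof -
  define x where "x = chi n J (2 * (m - c) / \<rho>\<^sup>2)"
  have x: "x > 0" "Pm n x \<noteq> 0" unfolding x_def
    using Pm_chi_nonzero[OF J n s_pos] chi_props(3)[OF J n less_imp_le[OF s_pos]] by auto
  define a b where "a = x powr (- n - 2)" and "b = n * (n - 1)"
  have xa: "x powr (- n - 1) = a * x" "x powr (- n - 1 - 1) = a"
    using x by (auto simp: a_def powr_diff field_simps power2_eq_square)
  have "((\<lambda>\<xi>. n * (n - 1) * \<xi> powr (- n - 1) / (\<rho>\<^sup>2 * Pm n \<xi>)) has_real_derivative
     ((n * (n - 1) * ((- n - 1) * x powr (- n - 1 - 1))) * (\<rho>\<^sup>2 * Pm n x) - n * (n - 1) * x powr (- n - 1) * (\<rho>\<^sup>2 * Gm n x))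
      / ((\<rho>\<^sup>2 * Pm n x) * (\<rho>\<^sup>2 * Pm n x))) (at x)"
    using x \<rho> n by (auto intro!: derivative_eq_intros Pm_deriv)
  from DERIV_chain2[OF this[unfolded x_def] chi_u_deriv, folded x_def]
  have d: "(g1m n J \<rho> m has_real_derivative (((b * ((- n - 1) * a)) * (\<rho>\<^sup>2 * Pm n x) - b * (a * x) * (\<rho>\<^sup>2 * Gm n x))
      / ((\<rho>\<^sup>2 * Pm n x) * (\<rho>\<^sup>2 * Pm n x))) * (- 1 / (\<rho>\<^sup>2 * Pm n x))) (at c)"
    unfolding g1m_def [abs_def] Let_def xa b_def[symmetric] .
  have "(((b * ((- n - 1) * a)) * (r * P) - b * (a * x) * (r * G))
      / ((r * P) * (r * P))) * (- 1 / (r * P)) = b * a * ((n + 1) * P + x * G) / (r * r * P ^ 3)"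
    if "r \<noteq> 0" "P \<noteq> 0" for r P G
    using that by (simp add: divide_simps power3_eq_cube) (simp add: algebra_simps)
  from this[of "\<rho>\<^sup>2" "Pm n x" "Gm n x"] d show ?thesis
    unfolding g2m_def Let_def x_def[symmetric] a_def[symmetric] b_def[symmetric] using x \<rho> by simp
qed

text \<open>With \<open>\<sigma> = \<xi>\<^sup>-\<^sup>n\<close> and \<open>L = \<rho>\<^sup>2 \<xi>\<^sup>2\<close>, all the quantities are rational.\<close>

lemma model_rational:
  obtains \<sigma> L where "\<sigma> > 0" "L > 0" "J = {1..} \<longrightarrow> \<sigma> < 1" "J \<noteq> {1..} \<longrightarrow> \<sigma> > 1"
    "ym n J \<rho> m c = L * (1 - \<sigma>)\<^sup>2" "gm n J \<rho> m c = 1 + (n - 1) * \<sigma>"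
    "g1m n J \<rho> m c * (L * (1 - \<sigma>)) = n * (n - 1) * \<sigma>"
    "g2m n J \<rho> m c * (L * (1 - \<sigma>)\<^sup>2) = g1m n J \<rho> m c * (n + 2 - 2 * \<sigma>)"
proof -
  define x where "x = chi n J (2 * (m - c) / \<rho>\<^sup>2)"
  define \<sigma> where "\<sigma> = x powr (- n)"
  define L where "L = \<rho>\<^sup>2 * x\<^sup>2"
  have x: "x > 0" "x \<in> J" unfolding x_def using chi_props[OF J n less_imp_le[OF s_pos]] by simp_all
  have x1: "x \<noteq> 1" unfolding x_def using chi_ne_1[OF J n s_pos] .
  have s1: "\<sigma> < 1" if "J = {1..}"
    unfolding \<sigma>_def by (rule sigma_lt_1) (use that x x1 n in auto)
  have s2: "\<sigma> > 1" if "J \<noteq> {1..}"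
    unfolding \<sigma>_def by (rule sigma_gt_1) (use that x x1 n J in \<open>auto simp: is_branch_def\<close>)
  have P: "Pm n x = x * (1 - \<sigma>)" using x by (simp add: Pm_eq \<sigma>_def)
  have G: "Gm n x = 1 + (n - 1) * \<sigma>" by (simp add: Gm_def \<sigma>_def)
  have p1: "x powr (- n - 1) = \<sigma> / x" using x by (simp add: powr_shift \<sigma>_def)
  have p2: "x powr (- n - 2) = \<sigma> / x\<^sup>2" using x by (simp add: \<sigma>_def powr_diff)
  define k where "k = 1 - \<sigma>"
  have k: "k \<noteq> 0" using s1 s2 by (force simp: k_def)
  have g1: "g1m n J \<rho> m c = n * (n - 1) * \<sigma> / (L * k)"
    unfolding g1m_def Let_def x_def[symmetric] P p1 L_def k_def[symmetric] using x \<rho> by (simp add: power2_eq_square)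
  have "g2m n J \<rho> m c = n * (n - 1) * \<sigma> * (n + 2 - 2 * \<sigma>) / (L * L * k ^ 3)"
  proof -
    have "(n + 1) * Pm n x + x * Gm n x = x * (n + 2 - 2 * \<sigma>)"
      unfolding P G by (simp add: algebra_simps)
    moreover have "b * (\<sigma> / x\<^sup>2) * (x * t) / (\<rho>\<^sup>2 * \<rho>\<^sup>2 * (x * k) ^ 3) = b * \<sigma> * t / (L * L * k ^ 3)" for b t
      unfolding L_def using x \<rho> k by (simp add: divide_simps power2_eq_square power3_eq_cube)
    ultimately show ?thesis unfolding g2m_def Let_def x_def[symmetric] p2 by (simp only: P k_def[symmetric])
  qed
  then have g2: "g2m n J \<rho> m c * (L * k\<^sup>2) = g1m n J \<rho> m c * (n + 2 - 2 * \<sigma>)"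
  proof -
    have "L > 0" using x \<rho> by (simp add: L_def)
    then have "b * t / (L * L * k ^ 3) * (L * k\<^sup>2) = b / (L * k) * t" for b t
      using k by (simp add: divide_simps power2_eq_square power3_eq_cube)
    then show ?thesis unfolding g1 \<open>g2m n J \<rho> m c = _\<close> .
  qed
  show thesis
  proof (rule that[of \<sigma> L])
    show "\<sigma> > 0" "L > 0" using x \<rho> by (auto simp: \<sigma>_def L_def)
    show "ym n J \<rho> m c = L * (1 - \<sigma>)\<^sup>2" unfolding ym_def x_def[symmetric] P L_def by (simp add: power_mult_distrib)
    show "gm n J \<rho> m c = 1 + (n - 1) * \<sigma>" unfolding gm_def x_def[symmetric] G ..
    show "g1m n J \<rho> m c * (L * (1 - \<sigma>)) = n * (n - 1) * \<sigma>" unfolding g1 k_def[symmetric] using x \<rho> k by (simp add: L_def)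
  qed (use s1 s2 g2[unfolded k_def] in auto)
qed

text \<open>The radial model has equality both in Bochner's comparison and in the Kato-type bound:
  this is the inequality of \<open>local_max_comparison\<close> for
  \<open>Z = ym n J \<rho> m\<close>, with equality.\<close>

lemma model_ode:
  "2 * ((gm n J \<rho> m c)\<^sup>2 + (n - gm n J \<rho> m c)\<^sup>2 / (n - 1)) = - 2 * g1m n J \<rho> m c * ym n J \<rho> m c + 2 * n * gm n J \<rho> m c"
proof -
  obtain \<sigma> L where R: "\<sigma> > 0" "L > 0" "J = {1..} \<longrightarrow> \<sigma> < 1" "J \<noteq> {1..} \<longrightarrow> \<sigma> > 1"
    "ym n J \<rho> m c = L * (1 - \<sigma>)\<^sup>2" "gm n J \<rho> m c = 1 + (n - 1) * \<sigma>"
    "g1m n J \<rho> m c * (L * (1 - \<sigma>)) = n * (n - 1) * \<sigma>"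
    "g2m n J \<rho> m c * (L * (1 - \<sigma>)\<^sup>2) = g1m n J \<rho> m c * (n + 2 - 2 * \<sigma>)"
    by (rule model_rational)
  note r = R(5,6,7)
  have "g1m n J \<rho> m c * ym n J \<rho> m c = (g1m n J \<rho> m c * (L * (1 - \<sigma>))) * (1 - \<sigma>)"
    unfolding r(1) by (simp add: power2_eq_square)
  then have 1: "g1m n J \<rho> m c * ym n J \<rho> m c = n * (n - 1) * \<sigma> * (1 - \<sigma>)" unfolding r(3) .
  have "(n - gm n J \<rho> m c)\<^sup>2 / (n - 1) = (n - 1) * (1 - \<sigma>)\<^sup>2"
  proof -
    have "n - gm n J \<rho> m c = (n - 1) * (1 - \<sigma>)" unfolding r(2) by (simp add: algebra_simps)
    then show ?thesis using n by (simp add: power2_eq_square)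
  qed
  moreover have "(gm n J \<rho> m c)\<^sup>2 + (n - 1) * (1 - \<sigma>)\<^sup>2 = - (n * (n - 1) * \<sigma> * (1 - \<sigma>)) + n * gm n J \<rho> m c"
    unfolding r(2) by (simp add: power2_eq_square algebra_simps)
  ultimately show ?thesis using 1 by simp
qed

text \<open>The sign that lets a positive constant be added to \<open>ym\<close> on the outer
  branch. On the inner branch \<open>1 - \<sigma> < 0\<close> reverses it, which forces the quotient
  by \<open>gm\<close> there.\<close>

lemma g1m_pos: "J = {1..} \<Longrightarrow> g1m n J \<rho> m c > 0"
proof -
  assume J1: "J = {1..}"
  obtain \<sigma> L where R: "\<sigma> > 0" "L > 0" "J = {1..} \<longrightarrow> \<sigma> < 1" "J \<noteq> {1..} \<longrightarrow> \<sigma> > 1"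
    "ym n J \<rho> m c = L * (1 - \<sigma>)\<^sup>2" "gm n J \<rho> m c = 1 + (n - 1) * \<sigma>"
    "g1m n J \<rho> m c * (L * (1 - \<sigma>)) = n * (n - 1) * \<sigma>"
    "g2m n J \<rho> m c * (L * (1 - \<sigma>)\<^sup>2) = g1m n J \<rho> m c * (n + 2 - 2 * \<sigma>)"
    by (rule model_rational)
  note r = R(1,2) R(3)[rule_format, OF J1] R(7)
  have "g1m n J \<rho> m c * (L * (1 - \<sigma>)) > 0" unfolding r(4) using r(1) n by simp
  moreover have "L * (1 - \<sigma>) > 0" using r by simp
  ultimately show ?thesis by (rule zero_less_mult_pos2)
qed

text \<open>Expand in \<open>F\<close>. The terms without \<open>F\<close> cancel by the model
  equation, and the linear ones because \<open>gm\<close> solves its linearization. The quadratic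
  coefficient \<open>n / (2 (n - 1)) g1^2 - g2 g\<close> remains, and on the inner branch it is
  positive.\<close>

lemma inner_contradiction:
  assumes J1: "J \<noteq> {1..}" and F: "F > 0"
  defines "Z1 \<equiv> - 2 * gm n J \<rho> m c + F * g1m n J \<rho> m c"
    and "Z2 \<equiv> - 2 * g1m n J \<rho> m c + F * g2m n J \<rho> m c"
  shows "2 * ((Z1 / 2)\<^sup>2 + (n + Z1 / 2)\<^sup>2 / (n - 1)) > Z2 * (ym n J \<rho> m c + F * gm n J \<rho> m c) - n * Z1"
proof -
  obtain \<sigma> L where R: "\<sigma> > 0" "L > 0" "J = {1..} \<longrightarrow> \<sigma> < 1" "J \<noteq> {1..} \<longrightarrow> \<sigma> > 1"
    "ym n J \<rho> m c = L * (1 - \<sigma>)\<^sup>2" "gm n J \<rho> m c = 1 + (n - 1) * \<sigma>"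
    "g1m n J \<rho> m c * (L * (1 - \<sigma>)) = n * (n - 1) * \<sigma>"
    "g2m n J \<rho> m c * (L * (1 - \<sigma>)\<^sup>2) = g1m n J \<rho> m c * (n + 2 - 2 * \<sigma>)"
    by (rule model_rational)
  note r = R(1,2) R(4)[rule_format, OF J1] R(5-8)
  define y g g1 g2 where "y = ym n J \<rho> m c" and "g = gm n J \<rho> m c" and "g1 = g1m n J \<rho> m c" and "g2 = g2m n J \<rho> m c"
  note d = y_def[symmetric] g_def[symmetric] g1_def[symmetric] g2_def[symmetric]
  note r = r[unfolded d]
  have g1y: "g1 * y = n * (n - 1) * \<sigma> * (1 - \<sigma>)"
  proof -
    have "g1 * y = (g1 * (L * (1 - \<sigma>))) * (1 - \<sigma>)" unfolding r(4) by (simp add: power2_eq_square)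
    then show ?thesis unfolding r(6) .
  qed
  have g2y: "g2 * y = g1 * (n + 2 - 2 * \<sigma>)" unfolding r(4) r(7) ..
  have ng: "n - g = (n - 1) * (1 - \<sigma>)" unfolding r(5) by (simp add: algebra_simps)
  have nZ: "(n + Z1 / 2)\<^sup>2 / (n - 1) = (n - 1) * (1 - \<sigma>)\<^sup>2 + F * g1 * (1 - \<sigma>) + F\<^sup>2 * g1\<^sup>2 / (4 * (n - 1))"
  proof -
    have "n + Z1 / 2 = (n - 1) * (1 - \<sigma>) + F * g1 / 2" unfolding Z1_def d ng[symmetric] by (simp add: field_simps)
    moreover have "(d * k + t / 2)\<^sup>2 / d = d * k\<^sup>2 + t * k + t\<^sup>2 / (4 * d)" if "d > 0" for d k t :: real
      using that by (simp add: power2_eq_square field_simps)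
    from this[of "n - 1" "1 - \<sigma>" "F * g1"] have
      "((n - 1) * (1 - \<sigma>) + F * g1 / 2)\<^sup>2 / (n - 1) = (n - 1) * (1 - \<sigma>)\<^sup>2 + F * g1 * (1 - \<sigma>) + (F * g1)\<^sup>2 / (4 * (n - 1))"
      using n by linarith
    ultimately show ?thesis by (simp add: power_mult_distrib)
  qed
  have "2 * ((Z1 / 2)\<^sup>2 + (n + Z1 / 2)\<^sup>2 / (n - 1)) - (Z2 * (y + F * g) - n * Z1)
    = F\<^sup>2 * (n / (2 * (n - 1)) * g1\<^sup>2 - g2 * g)"
  proof -
    have "2 * (Z1 / 2)\<^sup>2 = 2 * g\<^sup>2 - 2 * F * (g * g1) + F\<^sup>2 * g1\<^sup>2 / 2"
      unfolding Z1_def d by (simp add: power2_eq_square field_simps)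
    moreover have "Z2 * (y + F * g) = - 2 * (g1 * y) + F * (g2 * y) - 2 * F * (g * g1) + F\<^sup>2 * (g2 * g)"
      unfolding Z2_def d by (simp add: power2_eq_square algebra_simps)
    moreover have "n * Z1 = - 2 * n * g + n * F * g1" unfolding Z1_def d by (simp add: algebra_simps)
    moreover have "g\<^sup>2 + (n - 1) * (1 - \<sigma>)\<^sup>2 + n * (n - 1) * \<sigma> * (1 - \<sigma>) - n * g = 0"
      unfolding r(5) by (simp add: power2_eq_square algebra_simps)
    moreover have "F\<^sup>2 * (n / (2 * (n - 1)) * g1\<^sup>2) = F\<^sup>2 * g1\<^sup>2 / 2 + 2 * (F\<^sup>2 * g1\<^sup>2 / (4 * (n - 1)))"
      using n by (simp add: field_simps)
    moreover have "F * (g1 * (n + 2 - 2 * \<sigma>)) = n * F * g1 + 2 * (F * g1 * (1 - \<sigma>))" by (simp add: algebra_simps)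
    ultimately show ?thesis unfolding nZ g1y g2y by (simp add: right_diff_distrib)
  qed
  moreover have "n / (2 * (n - 1)) * g1\<^sup>2 - g2 * g > 0"
  proof -
    have g1n: "g1 < 0"
    proof -
      have "g1 * (L * (1 - \<sigma>)) > 0" unfolding r(6) using r(1) n by simp
      moreover have "L * (1 - \<sigma>) < 0" using r(2,3) by (simp add: mult_pos_neg)
      ultimately show ?thesis by (metis mult_nonneg_nonpos not_less less_imp_le)
    qed
    \<comment> \<open>After multiplication by \<open>L (1 - \<sigma>)^2\<close> the quadratic
      coefficient equals \<open>g1 q\<close>, and both factors are negative.\<close>
    define q where "q = n\<^sup>2 * \<sigma> * (1 - \<sigma>) / 2 - (n + 2 - 2 * \<sigma>) * (1 + (n - 1) * \<sigma>)"
    have "q < 0"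
    proof -
      have "- q = ((n - 2)\<^sup>2 * \<sigma>\<^sup>2) / 2 + (n\<^sup>2 / 2 + n - 4) * \<sigma> + (n + 2)"
        by (simp add: q_def power2_eq_square field_simps)
      moreover have "n\<^sup>2 \<ge> 2 * n" using n by (simp add: power2_eq_square)
      then have "(n\<^sup>2 / 2 + n - 4) * \<sigma> \<ge> 0" using n r by simp
      moreover have "((n - 2)\<^sup>2 * \<sigma>\<^sup>2) / 2 \<ge> 0" by simp
      ultimately show ?thesis using n by linarith
    qed
    have k: "L * (1 - \<sigma>)\<^sup>2 > 0" using r by simp
    have "(n / (2 * (n - 1)) * g1\<^sup>2 - g2 * g) * (L * (1 - \<sigma>)\<^sup>2) = g1 * q"
    proof -
      have "(n / (2 * (n - 1)) * g1\<^sup>2) * (L * (1 - \<sigma>)\<^sup>2) = n / (2 * (n - 1)) * g1 * (1 - \<sigma>) * (g1 * (L * (1 - \<sigma>)))"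
        by (simp add: power2_eq_square mult_ac)
      also have "\<dots> = g1 * (n\<^sup>2 * \<sigma> * (1 - \<sigma>) / 2)" unfolding r(6) using n by (simp add: power2_eq_square field_simps)
      finally have a: "(n / (2 * (n - 1)) * g1\<^sup>2) * (L * (1 - \<sigma>)\<^sup>2) = g1 * (n\<^sup>2 * \<sigma> * (1 - \<sigma>) / 2)" .
      have b: "(g2 * g) * (L * (1 - \<sigma>)\<^sup>2) = g1 * ((n + 2 - 2 * \<sigma>) * (1 + (n - 1) * \<sigma>))"
        
      proof -
        have "(g2 * g) * (L * (1 - \<sigma>)\<^sup>2) = (g2 * (L * (1 - \<sigma>)\<^sup>2)) * g" by (simp only: mult_ac)
        then show ?thesis unfolding r(7) r(5) by (simp only: mult_ac)
      qed
      show ?thesis unfolding left_diff_distrib a b q_def by (simp add: right_diff_distrib)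
    qed
    moreover have "g1 * q > 0" using g1n \<open>q < 0\<close> by (simp add: mult_neg_neg)
    ultimately have "(n / (2 * (n - 1)) * g1\<^sup>2 - g2 * g) * (L * (1 - \<sigma>)\<^sup>2) > 0" by (simp only:)
    then show ?thesis by (rule zero_less_mult_pos2[OF _ k])
  qed
  ultimately have "2 * ((Z1 / 2)\<^sup>2 + (n + Z1 / 2)\<^sup>2 / (n - 1)) - (Z2 * (y + F * g) - n * Z1) > 0"
    using F by simp
  then show ?thesis unfolding d by simp
qed

end

section \<open>Continuity up to the maximum level and the comparison principle\<close>

lemma ym_nonneg: "ym n J \<rho> m c \<ge> 0"
  by (simp add: ym_def)

lemma continuous_on_chi_u:
  assumes "is_branch J" "n > 2" "\<rho> > 0"
  shows "continuous_on {..m} (\<lambda>c. chi n J (2 * (m - c) / \<rho>\<^sup>2))"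
  by (rule continuous_on_compose2[OF continuous_on_chi[OF assms(1,2)]])
    (use assms(3) in \<open>auto intro!: continuous_intros divide_nonneg_pos\<close>)

lemma chi_u_pos:
  assumes "is_branch J" "n > 2" "\<rho> > 0" "c \<le> m"
  shows "chi n J (2 * (m - c) / \<rho>\<^sup>2) > 0"
  by (rule chi_props(3)[OF assms(1,2)]) (use assms in simp)

lemma continuous_on_ym:
  assumes "is_branch J" "n > 2" "\<rho> > 0" shows "continuous_on {..m} (ym n J \<rho> m)"
  unfolding ym_def [abs_def]
  by (intro continuous_intros continuous_on_compose2[OF continuous_on_Pm[OF assms(2) subset_refl] continuous_on_chi_u[OF assms]])
    (use chi_u_pos[OF assms] in auto)

lemma continuous_on_gm:
  assumes "is_branch J" "n > 2" "\<rho> > 0" shows "continuous_on {..m} (gm n J \<rho> m)"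
  unfolding gm_def [abs_def]
  by (intro continuous_on_compose2[OF continuous_on_Gm[OF assms(2) subset_refl] continuous_on_chi_u[OF assms]])
    (use chi_u_pos[OF assms] in auto)

lemma grad_zero_at_max:
  assumes "open N" "x \<in> N" "has_grad u g x" "\<And>y. y \<in> N \<Longrightarrow> u y \<le> u x"
  shows "g = 0"
proof -
  have "(\<lambda>h. g \<bullet> h) = (\<lambda>v. 0)"
    using differential_zero_maxmin[OF assms(2,1) has_gradD[OF assms(3)]] assms(4) by blast
  then show ?thesis by (metis inner_eq_zero_iff)
qed

text \<open>In the outer branch \<open>|\<nabla>u|\<^sup>2 - y(u)\<close> has no positive interior maximum; in the inner
  branch one divides by \<open>g\<close>, a solution of the linearized equation coming from the translations of \<open>u\<close>.\<close>

lemma comparison: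
  fixes u :: "real^'n::finite \<Rightarrow> real"
  defines "n \<equiv> real CARD('n)"
  assumes N3: "CARD('n) \<ge> 3" and J: "is_branch J" and \<rho>: "\<rho> > 0"
    and u: "smooth_on V u" and N: "open N" "bounded N" "closure N \<subseteq> V"
    and lap: "\<And>x. x \<in> N \<Longrightarrow> laplacian u x = - n"
    and le: "\<And>x. x \<in> closure N \<Longrightarrow> u x \<le> m"
    and bd: "\<And>x. x \<in> frontier N \<Longrightarrow> (norm (grad u x))\<^sup>2 \<le> ym n J \<rho> m (u x)"
    and x: "x \<in> N"
  shows "(norm (grad u x))\<^sup>2 \<le> ym n J \<rho> m (u x)"
proof (rule ccontr)
  assume neg: "\<not> ?thesis"
  have n: "n > 2" using N3 by (simp add: n_def)
  define W where "W y = (norm (grad u y))\<^sup>2" for y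
  define \<gamma> where "\<gamma> c = (if J = {1..} then 1 else gm n J \<rho> m c)" for c
  define F where "F y = (W y - ym n J \<rho> m (u y)) / \<gamma> (u y)" for y
  have \<gamma>pos: "\<gamma> c > 0" for c
    using Gm_ge_1[OF n, of "chi n J (2 * (m - c) / \<rho>\<^sup>2)"] by (simp add: \<gamma>_def gm_def)
  have gr: "has_grad W (\<chi> k. 2 * (\<Sum>i\<in>UNIV. partial i u y * partial k (partial i u) y)) y" if "y \<in> V" for y
    unfolding W_def using norm_grad_sq_grad[OF u that] .
  have cu: "continuous_on (closure N) u" using smooth_on_continuous[OF u] N(3) continuous_on_subset by blast
  have im: "u ` closure N \<subseteq> {..m}" using le by auto
  have "continuous_on (closure N) F"
    unfolding F_def
  proof (intro continuous_on_divide continuous_on_diff ballI)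
    show "continuous_on (closure N) W" by (rule has_grad_continuous_on[OF gr]) (use N in auto)
    show "continuous_on (closure N) (\<lambda>x. ym n J \<rho> m (u x))"
      by (rule continuous_on_compose2[OF continuous_on_ym[OF J n \<rho>] cu im])
    show "continuous_on (closure N) (\<lambda>x. \<gamma> (u x))"
      unfolding \<gamma>_def using continuous_on_compose2[OF continuous_on_gm[OF J n \<rho>] cu im]
      by (cases "J = {1..}") simp_all
    show "\<gamma> (u y) \<noteq> 0" for y using \<gamma>pos[of "u y"] by simp
  qed
  moreover have "compact (closure N)" "closure N \<noteq> {}" using N x by auto
  ultimately obtain x0 where x0: "x0 \<in> closure N" "\<And>y. y \<in> closure N \<Longrightarrow> F y \<le> F x0"
    using continuous_attains_sup[of "closure N" F] by blast
  have "F x > 0" using neg \<gamma>pos by (simp add: F_def W_def)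
  then have F0: "F x0 > 0" using x0(2)[of x] x closure_subset by fastforce
  have "x0 \<notin> frontier N"
  proof
    assume "x0 \<in> frontier N"
    then have "F x0 \<le> 0" using bd[of x0] \<gamma>pos[of "u x0"] by (simp add: F_def W_def divide_nonpos_pos)
    then show False using F0 by simp
  qed
  then have x0N: "x0 \<in> N" using x0(1) N(1) by (simp add: frontier_def interior_open)
  have Weq: "W y = ym n J \<rho> m (u y) + F y * \<gamma> (u y)" for y using \<gamma>pos[of "u y"] by (simp add: F_def)
  have Wpos: "W x0 > 0"
    unfolding Weq using ym_nonneg[of n J \<rho> m "u x0"] F0 \<gamma>pos[of "u x0"] by (simp add: add_nonneg_pos)
  then have g0: "grad u x0 \<noteq> 0" by (auto simp: W_def)
  have NV: "N \<subseteq> V" using N(3) closure_subset by blast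
  \<comment> \<open>On the maximum level the gradient would vanish, against \<open>g0\<close>. So
    \<open>x0\<close> lies where \<open>ym\<close> is differentiable in the level.\<close>
  have um: "u x0 < m"
  proof (rule ccontr)
    assume "\<not> u x0 < m"
    then have "u y \<le> u x0" if "y \<in> N" for y using le[of y] that closure_subset[of N] by fastforce
    then show False using grad_zero_at_max[OF N(1) x0N smooth_on_has_grad[OF u]] g0 x0N NV by blast
  qed
  define S where "S = N \<inter> u -` {..<m}"
  have oS: "open S" unfolding S_def
    by (rule continuous_open_preimage[OF continuous_on_subset[OF cu closure_subset] N(1)]) simp
  have uS: "smooth_on S u" using smooth_on_subset[OF u oS] NV by (auto simp: S_def)
  \<comment> \<open>\<open>q\<close> switches between the branches, so that one pair
    \<open>Z1\<close>, \<open>Z2\<close> serves both: the derivative of \<open>\<gamma>\<close> is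
    \<open>q\<close> times \<open>g1m\<close>.\<close>
  define q where "q = (if J = {1..} then 0 else (1::real))"
  define Z where "Z c = ym n J \<rho> m c + F x0 * \<gamma> c" for c
  define Z1 where "Z1 c = - 2 * gm n J \<rho> m c + F x0 * (q * g1m n J \<rho> m c)" for c
  define Z2 where "Z2 = - 2 * g1m n J \<rho> m (u x0) + F x0 * (q * g2m n J \<rho> m (u x0))"
  have dZ: "(Z has_real_derivative Z1 c) (at c)" if "c < m" for c
  proof -
    have "(\<gamma> has_real_derivative q * g1m n J \<rho> m c) (at c)"
      using gm_deriv[OF J n \<rho> that] by (cases "J = {1..}") (simp_all add: \<gamma>_def [abs_def] q_def)
    then show ?thesis unfolding Z_def [abs_def] Z1_def
      by (intro DERIV_add DERIV_cmult ym_deriv[OF J n \<rho> that])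
  qed
  have dZ1: "(Z1 has_real_derivative Z2) (at (u x0))"
    unfolding Z1_def [abs_def] Z2_def
    by (intro DERIV_add DERIV_cmult gm_deriv[OF J n \<rho> um] g1m_deriv[OF J n \<rho> um])
  have "2 * ((Z1 (u x0) / 2)\<^sup>2 + (real CARD('n) + Z1 (u x0) / 2)\<^sup>2 / (real CARD('n) - 1))
    \<le> Z2 * (norm (grad u x0))\<^sup>2 - real CARD('n) * Z1 (u x0)"
  proof (rule local_max_comparison[OF _ uS _ _ _ dZ1 g0, where Z = Z])
    show "CARD('n) \<ge> 2" using N3 by simp
    show "x0 \<in> S" using x0N um by (simp add: S_def)
    show "laplacian u y = - real CARD('n)" if "y \<in> S" for y using lap[of y] that by (simp add: S_def n_def)
    show "(Z has_real_derivative Z1 (u y)) (at (u y))" if "y \<in> S" for y using dZ that by (simp add: S_def)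
    show "(norm (grad u y))\<^sup>2 - Z (u y) \<le> (norm (grad u x0))\<^sup>2 - Z (u x0)" if "y \<in> S" for y
    proof -
      have "F y \<le> F x0" using x0(2)[of y] that closure_subset[of N] by (auto simp: S_def)
      then have "F y * \<gamma> (u y) \<le> F x0 * \<gamma> (u y)" using \<gamma>pos[of "u y"] by simp
      then have "W y \<le> Z (u y)" unfolding Z_def Weq by simp
      moreover have "W x0 = Z (u x0)" unfolding Z_def Weq ..
      ultimately show ?thesis by (simp add: W_def)
    qed
  qed
  then have ineq: "2 * ((Z1 (u x0) / 2)\<^sup>2 + (n + Z1 (u x0) / 2)\<^sup>2 / (n - 1)) \<le> Z2 * W x0 - n * Z1 (u x0)"
    by (simp only: n_def[symmetric] W_def)
  show False
  proof (cases "J = {1..}")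
    case True
    have z: "Z1 (u x0) / 2 = - gm n J \<rho> m (u x0)" "Z2 = - 2 * g1m n J \<rho> m (u x0)"
      "Z1 (u x0) = - 2 * gm n J \<rho> m (u x0)"
      using True by (auto simp: Z1_def Z2_def q_def)
    have w: "W x0 = ym n J \<rho> m (u x0) + F x0" unfolding Weq using True by (simp add: \<gamma>_def)
    have key: "2 * ((gm n J \<rho> m (u x0))\<^sup>2 + (n - gm n J \<rho> m (u x0))\<^sup>2 / (n - 1))
       \<le> - 2 * g1m n J \<rho> m (u x0) * (ym n J \<rho> m (u x0) + F x0) + 2 * n * gm n J \<rho> m (u x0)"
      using ineq[unfolded z(1,2) w] unfolding z(3) by simp
    have "0 \<le> - 2 * g1m n J \<rho> m (u x0) * F x0"
    proof -
      have gen: "0 \<le> b" if "L \<le> M" "L = y + G" "M = y + b + G" for L M y G b :: real using that by linarith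
      have "- 2 * g1m n J \<rho> m (u x0) * (ym n J \<rho> m (u x0) + F x0) + 2 * n * gm n J \<rho> m (u x0)
        = - 2 * g1m n J \<rho> m (u x0) * ym n J \<rho> m (u x0) + - 2 * g1m n J \<rho> m (u x0) * F x0 + 2 * n * gm n J \<rho> m (u x0)"
        by (simp only: distrib_left)
      from gen[OF key model_ode[OF J n \<rho> um] this] show ?thesis .
    qed
    moreover have "g1m n J \<rho> m (u x0) * F x0 > 0" using g1m_pos[OF J n \<rho> um True] F0 by simp
    ultimately show False by (simp add: mult.commute)
  next
    case False
    have z: "Z1 (u x0) = - 2 * gm n J \<rho> m (u x0) + F x0 * g1m n J \<rho> m (u x0)" 
      "Z2 = - 2 * g1m n J \<rho> m (u x0) + F x0 * g2m n J \<rho> m (u x0)"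
      "W x0 = ym n J \<rho> m (u x0) + F x0 * gm n J \<rho> m (u x0)"
      using False by (auto simp: Z1_def Z2_def q_def Weq \<gamma>_def)
    show False using inner_contradiction[OF J n \<rho> um False F0] ineq unfolding z by linarith
  qed
qed

section \<open>Third order comparison along the normal\<close>

lemma third_order_nonneg:
  fixes k k1 k2 :: "real \<Rightarrow> real"
  assumes d: "d > 0" and k: "\<And>t. 0 \<le> t \<Longrightarrow> t < d \<Longrightarrow> (k has_real_derivative k1 t) (at t)"
    and k1: "\<And>t. 0 \<le> t \<Longrightarrow> t < d \<Longrightarrow> (k1 has_real_derivative k2 t) (at t)"
    and k2: "(k2 has_real_derivative k3) (at 0)" and z: "k 0 = 0" "k1 0 = 0" "k2 0 = 0"
    and nn: "\<And>t. 0 < t \<Longrightarrow> t < d \<Longrightarrow> k t \<ge> 0"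
  shows "k3 \<ge> 0"
proof (rule ccontr)
  assume "\<not> k3 \<ge> 0"
  then have "k3 < 0" by simp
  then obtain e where e: "e > 0" "\<And>h. 0 < h \<Longrightarrow> h < e \<Longrightarrow> k2 (0 + h) < k2 0"
    using DERIV_neg_dec_right[OF k2] by blast
  define t where "t = min d e / 2"
  have t: "0 < t" "t < d" "t < e" using d e by (auto simp: t_def)
  have "\<exists>x>0. x < t \<and> k t - k 0 = (t - 0) * k1 x"
    by (rule MVT2[OF t(1)]) (use k t in auto)
  then obtain x where x: "0 < x" "x < t" "k t = t * k1 x" using z by auto
  have "\<exists>y>0. y < x \<and> k1 x - k1 0 = (x - 0) * k2 y"
    by (rule MVT2[OF x(1)]) (use k1 t x in auto)
  then obtain y where y: "0 < y" "y < x" "k1 x = x * k2 y" using z by auto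
  have "k2 y < 0" using e(2)[of y] y x t z by simp
  then have "k t < 0" using x y t by (simp add: mult_pos_neg)
  then show False using nn[of t] t by simp
qed

text \<open>Pass from the level to the scaled radius \<open>G\<close>: the gradient bound becomes
  \<open>\<bar>G'\<bar> <= 1 / \<rho>\<close>, which has no singularity at the maximum and
  integrates to \<open>\<bar>G t - 1\<bar> <= t / \<rho>\<close>. Hence \<open>u\<close> lies above
  the model at scaled radius \<open>1 + s * t / \<rho>\<close>, where \<open>s\<close> is the
  direction of the branch. The third derivative of the model at \<open>t = 0\<close> comes from the
  derivative \<open>- n (n - 1)\<close> of \<open>Gm n\<close> at 1.\<close>

lemma third_derivative_bound:
  fixes u :: "real^'n::finite \<Rightarrow> real"
  defines "n \<equiv> real CARD('n)"
  assumes N3: "CARD('n) \<ge> 3" and J: "is_branch J" and \<rho>: "\<rho> > 0"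
    and u: "smooth_on V u" and p: "p \<in> V" and e: "norm e = 1" and um: "u p = m"
    and u1: "dird e u p = 0" and u2: "dird e (dird e u) p = - n"
    and d0: "d0 > 0" "\<And>t. 0 < t \<Longrightarrow> t < d0 \<Longrightarrow>
       (norm (grad u (p + t *\<^sub>R e)))\<^sup>2 \<le> ym n J \<rho> m (u (p + t *\<^sub>R e))"
  defines "s \<equiv> (if J = {1..} then 1 else - 1)"
  shows "dird e (dird e (dird e u)) p \<ge> s * n * (n - 1) / \<rho>"
proof -
  have n: "n > 2" using N3 by (simp add: n_def)
  have "open V" using u by (simp add: smooth_on_def)
  then obtain d1 where d1: "d1 > 0" "ball p d1 \<subseteq> V" using p open_contains_ball by blast
  have inV: "p + t *\<^sub>R e \<in> V" if "\<bar>t\<bar> < d1" for t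
    using that e by (intro subsetD[OF d1(2)]) (simp add: dist_norm)
  define f where "f t = u (p + t *\<^sub>R e)" for t
  define f1 where "f1 t = dird e u (p + t *\<^sub>R e)" for t
  define f2 where "f2 t = dird e (dird e u) (p + t *\<^sub>R e)" for t
  define f3 where "f3 = dird e (dird e (dird e u)) p"
  have df: "(f has_real_derivative f1 t) (at t)" if "\<bar>t\<bar> < d1" for t
    unfolding f_def [abs_def] f1_def by (rule dird_line[OF u inV[OF that]])
  have df1: "(f1 has_real_derivative f2 t) (at t)" if "\<bar>t\<bar> < d1" for t
    unfolding f1_def [abs_def] f2_def by (rule dird_line[OF smooth_on_dird[OF u] inV[OF that]])
  have df2: "(f2 has_real_derivative f3) (at 0)"
    unfolding f2_def [abs_def] f3_def
    using dird_line[OF smooth_on_dird[OF smooth_on_dird[OF u]] inV[of 0]] d1(1) by simp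
  have f0: "f 0 = m" "f1 0 = 0" "f2 0 = - n" using um u1 u2 by (auto simp: f_def f1_def f2_def)
  obtain d2 where d2: "d2 > 0" "\<And>h. 0 < h \<Longrightarrow> h < d2 \<Longrightarrow> f1 (0 + h) < f1 0"
    using DERIV_neg_dec_right[OF df1[of 0]] d1(1) f0 n by force
  \<comment> \<open>The bound by \<open>\<rho>\<close> keeps \<open>1 + s * t / \<rho>\<close>
    positive when \<open>s = - 1\<close>, and the bound by \<open>d2\<close> keeps the ray below the
    maximum level.\<close>
  define d where "d = min (min d0 d1) (min d2 \<rho>)"
  have d: "d > 0" "d \<le> d0" "d \<le> d1" "d \<le> d2" "d \<le> \<rho>" using d0 d1 d2 \<rho> by (auto simp: d_def)
  have flt: "f t < m" if "0 < t" "t < d" for t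
  proof -
    have "\<exists>x>0. x < t \<and> f t - f 0 = (t - 0) * f1 x"
      by (rule MVT2[OF that(1)]) (use df d that in auto)
    then obtain x where x: "0 < x" "x < t" "f t - m = t * f1 x" using f0 by auto
    have "f1 x < 0" using d2(2)[of x] x that d f0 by simp
    then have "t * f1 x < 0" using that by (simp add: mult_pos_neg)
    then show ?thesis using x(3) by linarith
  qed
  define G where "G t = chi n J (2 * (m - f t) / \<rho>\<^sup>2)" for t
  have G0: "G 0 = 1" using chi_0[OF J n] f0 by (simp add: G_def)
  have dG: "(G has_real_derivative - 1 / (\<rho>\<^sup>2 * Pm n (G z)) * f1 z) (at z)" if "0 < z" "z < d" for z
    unfolding G_def [abs_def]
    by (rule DERIV_chain2[OF chi_u_deriv[OF J n \<rho> flt[OF that]] df]) (use that d in auto)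
  have G1: "\<bar>- 1 / (\<rho>\<^sup>2 * Pm n (G z)) * f1 z\<bar> \<le> 1 / \<rho>" if "0 < z" "z < d" for z
  proof -
    have P0: "Pm n (G z) \<noteq> 0" unfolding G_def
      by (rule Pm_chi_nonzero[OF J n]) (use flt[OF that] \<rho> in simp)
    have "(norm (grad u (p + z *\<^sub>R e)))\<^sup>2 \<le> (\<rho> * \<bar>Pm n (G z)\<bar>)\<^sup>2"
      using d0(2)[of z] that d by (simp add: ym_def G_def f_def power_mult_distrib)
    then have "norm (grad u (p + z *\<^sub>R e)) \<le> \<rho> * \<bar>Pm n (G z)\<bar>"
      by (rule power2_le_imp_le) (use \<rho> in simp)
    moreover have "\<bar>f1 z\<bar> \<le> norm (grad u (p + z *\<^sub>R e))"
      using Cauchy_Schwarz_ineq2[of "grad u (p + z *\<^sub>R e)" e] e by (simp add: f1_def dird_def)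
    ultimately have "\<bar>f1 z\<bar> \<le> \<rho> * \<bar>Pm n (G z)\<bar>" by simp
    then have "\<bar>f1 z\<bar> / (\<rho>\<^sup>2 * \<bar>Pm n (G z)\<bar>) \<le> (\<rho> * \<bar>Pm n (G z)\<bar>) / (\<rho>\<^sup>2 * \<bar>Pm n (G z)\<bar>)"
      using \<rho> by (intro divide_right_mono) auto
    also have "\<dots> = 1 / \<rho>" using P0 \<rho> by (simp add: power2_eq_square)
    finally show ?thesis by (simp add: abs_mult)
  qed
  have GJ: "G t \<in> J" if "0 < t" "t < d" for t
    unfolding G_def by (rule chi_props(1)[OF J n]) (use flt[OF that] \<rho> in simp)
  \<comment> \<open>\<open>chi\<close> is not differentiable at 0, so the mean value theorem is
    applied with mere continuity at the endpoint \<open>t = 0\<close>.\<close>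
  have Gt: "\<bar>G t - 1\<bar> \<le> t / \<rho>" if t: "0 < t" "t < d" for t
  proof -
    have cf: "continuous_on {0..t} f"
    proof (rule continuous_at_imp_continuous_on, rule ballI)
      fix r assume "r \<in> {0..t}"
      then have "\<bar>r\<bar> < d1" using t d by simp
      then show "isCont f r" by (rule DERIV_isCont[OF df])
    qed
    have "continuous_on {0..t} G" unfolding G_def
    proof (rule continuous_on_compose2[OF continuous_on_chi_u[OF J n \<rho>, of m] cf])
      show "f ` {0..t} \<subseteq> {..m}"
      proof
        fix y assume "y \<in> f ` {0..t}"
        then obtain r where r: "y = f r" "0 \<le> r" "r \<le> t" by auto
        show "y \<in> {..m}" using flt[of r] f0 r t by (cases "r = 0") auto
      qed
    qed
    moreover have "G differentiable (at z)" if "0 < z" "z < t" for z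
      using dG[of z] that t real_differentiable_def by auto
    ultimately obtain l z where z: "0 < z" "z < t" "(G has_real_derivative l) (at z)" "G t - G 0 = (t - 0) * l"
      using MVT[OF t(1), of G] by blast
    have "l = - 1 / (\<rho>\<^sup>2 * Pm n (G z)) * f1 z" using DERIV_unique[OF z(3) dG] z t by simp
    then have "\<bar>l\<bar> \<le> 1 / \<rho>" using G1[of z] z t by simp
    then have "t * \<bar>l\<bar> \<le> t * (1 / \<rho>)" using t by (intro mult_left_mono) auto
    then show ?thesis using z(4) G0 t by (simp add: abs_mult)
  qed
  have s2: "s * s = 1" by (simp add: s_def)
  have pos: "1 + s * t / \<rho> > 0" if "0 \<le> t" "t < d" for t
  proof -
    have "t / \<rho> < 1" using that d \<rho> by simp
    moreover have "t / \<rho> \<ge> 0" using that \<rho> by simp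
    ultimately show ?thesis by (simp add: s_def)
  qed
  have Qle: "2 * (m - f t) / \<rho>\<^sup>2 \<le> Qm n (1 + s * t / \<rho>)" if t: "0 < t" "t < d" for t
  proof -
    have QG: "Qm n (G t) = 2 * (m - f t) / \<rho>\<^sup>2"
      unfolding G_def by (rule chi_props(2)[OF J n]) (use flt[OF t] \<rho> in simp)
    show ?thesis
    proof (cases "J = {1..}")
      case True
      then have "1 \<le> G t" "G t \<le> 1 + s * t / \<rho>" using GJ[OF t] Gt[OF t] by (auto simp: s_def)
      then have "Qm n (G t) \<le> Qm n (1 + s * t / \<rho>)"
        using Qm_strict_increasing[OF _ _ n, of "G t" "1 + s * t / \<rho>"] by fastforce
      then show ?thesis using QG by simp
    next
      case False
      then have "G t \<le> 1" "1 + s * t / \<rho> \<le> G t" using GJ[OF t] Gt[OF t] J by (auto simp: s_def is_branch_def)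
      then have "Qm n (G t) \<le> Qm n (1 + s * t / \<rho>)"
        using Qm_strict_decreasing[OF pos[of t] _ _ n, of "G t"] t by fastforce
      then show ?thesis using QG by simp
    qed
  qed
  define k where "k t = f t - m + \<rho>\<^sup>2 / 2 * Qm n (1 + s * t / \<rho>)" for t
  define k1 where "k1 t = f1 t + s * \<rho> * Pm n (1 + s * t / \<rho>)" for t
  define k2 where "k2 t = f2 t + Gm n (1 + s * t / \<rho>)" for t
  have lin: "((\<lambda>t. 1 + s * t / \<rho>) has_real_derivative s / \<rho>) (at t)" for t
    using \<rho> by (auto intro!: derivative_eq_intros)
  have "f3 - s * n * (n - 1) / \<rho> \<ge> 0"
  proof (rule third_order_nonneg[OF d(1), of k k1 k2])
    fix t assume t: "0 \<le> t" "t < d"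
    have ft: "\<bar>t\<bar> < d1" using t d by simp
    show "(k has_real_derivative k1 t) (at t)"
    proof -
      have "(k has_real_derivative f1 t - 0 + \<rho>\<^sup>2 / 2 * (2 * Pm n (1 + s * t / \<rho>) * (s / \<rho>))) (at t)"
        unfolding k_def [abs_def]
        by (intro DERIV_add DERIV_diff DERIV_const DERIV_cmult df[OF ft] DERIV_chain2[OF Qm_deriv[OF pos[OF t] n] lin])
      moreover have "f1 t - 0 + \<rho>\<^sup>2 / 2 * (2 * Pm n (1 + s * t / \<rho>) * (s / \<rho>)) = k1 t"
        using \<rho> by (simp add: k1_def power2_eq_square)
      ultimately show ?thesis by simp
    qed
    show "(k1 has_real_derivative k2 t) (at t)"
    proof -
      have "(k1 has_real_derivative f2 t + s * \<rho> * (Gm n (1 + s * t / \<rho>) * (s / \<rho>))) (at t)"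
        unfolding k1_def [abs_def]
        by (intro DERIV_add DERIV_cmult df1[OF ft] DERIV_chain2[OF Pm_deriv[OF pos[OF t] n] lin])
      moreover have "f2 t + s * \<rho> * (Gm n (1 + s * t / \<rho>) * (s / \<rho>)) = k2 t"
      proof -
        have "s * \<rho> * (Gm n (1 + s * t / \<rho>) * (s / \<rho>)) = (s * s) * Gm n (1 + s * t / \<rho>)" using \<rho> by simp
        then show ?thesis by (simp only: s2 k2_def mult_1_left)
      qed
      ultimately show ?thesis by simp
    qed
  next
    show "(k2 has_real_derivative f3 - s * n * (n - 1) / \<rho>) (at 0)"
    proof -
      have "(Gm n has_real_derivative - n * (n - 1) * (1 + s * 0 / \<rho>) powr (- n - 1)) (at (1 + s * 0 / \<rho>))"
        by (rule Gm_deriv) (use n in auto)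
      then have "(k2 has_real_derivative f3 + - n * (n - 1) * (1 + s * 0 / \<rho>) powr (- n - 1) * (s / \<rho>)) (at 0)"
        unfolding k2_def [abs_def] by (intro DERIV_add df2 DERIV_chain2[OF _ lin])
      moreover have "f3 + - n * (n - 1) * (1 + s * 0 / \<rho>) powr (- n - 1) * (s / \<rho>) = f3 - s * n * (n - 1) / \<rho>" by simp
      ultimately show ?thesis by (simp only:)
    qed
    show "k 0 = 0" "k1 0 = 0" "k2 0 = 0" using f0 n by (auto simp: k_def k1_def k2_def Gm_def)
    show "k t \<ge> 0" if "0 < t" "t < d" for t
    proof -
      have "\<rho>\<^sup>2 / 2 * (2 * (m - f t) / \<rho>\<^sup>2) \<le> \<rho>\<^sup>2 / 2 * Qm n (1 + s * t / \<rho>)"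
        using Qle[OF that] by (intro mult_left_mono) auto
      moreover have "\<rho>\<^sup>2 / 2 * (2 * (m - f t) / \<rho>\<^sup>2) = m - f t" using \<rho> by simp
      ultimately show ?thesis unfolding k_def by linarith
    qed
  qed
  then show ?thesis by (simp add: f3_def)
qed

section \<open>Hypersurfaces contained in the maximum set\<close>

lemma has_grad_approx:
  assumes "has_grad f g p" "\<epsilon> > 0"
  obtains d where "d > 0" "\<And>h. norm h < d \<Longrightarrow> \<bar>f (p + h) - f p - g \<bullet> h\<bar> \<le> \<epsilon> * norm h"
proof -
  obtain d where d: "d > 0" "\<And>y. norm (y - p) < d \<Longrightarrow> norm (f y - f p - g \<bullet> (y - p)) \<le> \<epsilon> * norm (y - p)"
    using has_gradD[OF assms(1)] assms(2) unfolding has_derivative_at_alt by blast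
  show thesis
  proof (rule that[OF d(1)])
    fix h :: "real^'a" assume "norm h < d"
    then show "\<bar>f (p + h) - f p - g \<bullet> h\<bar> \<le> \<epsilon> * norm h" using d(2)[of "p + h"] by simp
  qed
qed

text \<open>A step \<open>s *\<^sub>R \<tau>\<close> in a tangent direction leaves the hypersurface
  only to higher order. Normal corrections \<open>\<sigma> *\<^sub>R a\<close> with
  \<open>\<bar>\<sigma>\<bar> <= \<epsilon> * s\<close> suffice to change the sign of
  \<open>\<phi>\<close>, so the intermediate value theorem yields a point of the hypersurface. There
  \<open>f\<close> vanishes, and its first-order expansion bounds \<open>g \<bullet> \<tau>\<close>
  by a fixed multiple of \<open>\<epsilon>\<close>.\<close>

lemma tangential_derivative_zero:
  fixes f \<phi> :: "real^'n::finite \<Rightarrow> real"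
  assumes U: "p \<in> U" and \<phi>: "smooth_on U \<phi>" and \<phi>p: "\<phi> p = 0" and a0: "grad \<phi> p \<noteq> 0"
    and f: "has_grad f g p" and f0: "\<And>x. x \<in> U \<Longrightarrow> \<phi> x = 0 \<Longrightarrow> f x = 0"
    and \<tau>: "grad \<phi> p \<bullet> \<tau> = 0"
  shows "g \<bullet> \<tau> = 0"
proof -
  define a where "a = grad \<phi> p"
  have aa: "a \<bullet> a > 0" using a0 by (simp add: a_def)
  define C where "C = \<bar>g \<bullet> a\<bar> + norm \<tau> + norm a + 1"
  have C: "C > 0" unfolding C_def using norm_ge_zero[of \<tau>] norm_ge_zero[of a] by linarith
  have key: "\<bar>g \<bullet> \<tau>\<bar> \<le> \<epsilon> * C" if eps: "0 < \<epsilon>" "\<epsilon> < 1" for \<epsilon>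
  proof -
    have "open U" using \<phi> by (simp add: smooth_on_def)
    then obtain d0 where d0: "d0 > 0" "ball p d0 \<subseteq> U" using U open_contains_ball by blast
    obtain d1 where d1: "d1 > 0" "\<And>h. norm h < d1 \<Longrightarrow> \<bar>f (p + h) - f p - g \<bullet> h\<bar> \<le> \<epsilon> * norm h"
      using has_grad_approx[OF f eps(1)] by blast
    \<comment> \<open>Makes the remainder of \<open>\<phi>\<close> at most half of the change
      \<open>\<epsilon> * s * (a \<bullet> a)\<close> produced by the extreme normal
      corrections.\<close>
    define \<eta> where "\<eta> = \<epsilon> * (a \<bullet> a) / (2 * C)"
    have \<eta>: "\<eta> > 0" using eps aa C by (simp add: \<eta>_def)
    obtain d2 where d2: "d2 > 0" "\<And>h. norm h < d2 \<Longrightarrow> \<bar>\<phi> (p + h) - \<phi> p - grad \<phi> p \<bullet> h\<bar> \<le> \<eta> * norm h"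
      using has_grad_approx[OF smooth_on_has_grad[OF \<phi> U] \<eta>] by blast
    define d where "d = min d0 (min d1 d2)"
    have d: "d > 0" "d \<le> d0" "d \<le> d1" "d \<le> d2" using d0 d1 d2 by (auto simp: d_def)
    define s where "s = d / (2 * C)"
    have s: "s > 0" "s * C < d" using d C by (auto simp: s_def)
    have nh: "norm (s *\<^sub>R \<tau> + \<sigma> *\<^sub>R a) \<le> s * C" if "\<bar>\<sigma>\<bar> \<le> \<epsilon> * s" for \<sigma>
    proof -
      have "norm (s *\<^sub>R \<tau> + \<sigma> *\<^sub>R a) \<le> s * norm \<tau> + \<bar>\<sigma>\<bar> * norm a"
        using norm_triangle_ineq[of "s *\<^sub>R \<tau>" "\<sigma> *\<^sub>R a"] s by simp
      also have "\<dots> \<le> s * norm \<tau> + s * norm a"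
      proof -
        have "\<epsilon> * s \<le> 1 * s" using eps s by (intro mult_right_mono) auto
        then have "\<bar>\<sigma>\<bar> * norm a \<le> s * norm a" using that by (intro mult_right_mono) auto
        then show ?thesis by simp
      qed
      also have "\<dots> \<le> s * C" using s by (simp add: C_def distrib_left)
      finally show ?thesis .
    qed
    define h where "h \<sigma> = s *\<^sub>R \<tau> + \<sigma> *\<^sub>R a" for \<sigma>
    have hU: "p + h \<sigma> \<in> U" if "\<bar>\<sigma>\<bar> \<le> \<epsilon> * s" for \<sigma>
    proof -
      have "dist p (p + h \<sigma>) = norm (h \<sigma>)" by (simp add: dist_norm)
      then show ?thesis using nh[OF that] s d by (intro subsetD[OF d0(2)]) (simp add: h_def)
    qed
    have ph: "\<bar>\<phi> (p + h \<sigma>) - \<sigma> * (a \<bullet> a)\<bar> \<le> \<epsilon> * s * (a \<bullet> a) / 2" if "\<bar>\<sigma>\<bar> \<le> \<epsilon> * s" for \<sigma>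
    proof -
      have "\<bar>\<phi> (p + h \<sigma>) - \<phi> p - grad \<phi> p \<bullet> h \<sigma>\<bar> \<le> \<eta> * norm (h \<sigma>)"
        by (rule d2(2)) (use nh[OF that] s d in \<open>simp add: h_def\<close>)
      also have "\<dots> \<le> \<eta> * (s * C)" using nh[OF that] \<eta> by (intro mult_left_mono) (auto simp: h_def)
      also have "\<dots> = \<epsilon> * s * (a \<bullet> a) / 2" using C by (simp add: \<eta>_def)
      finally have "\<bar>\<phi> (p + h \<sigma>) - \<phi> p - grad \<phi> p \<bullet> h \<sigma>\<bar> \<le> \<epsilon> * s * (a \<bullet> a) / 2" .
      moreover have "grad \<phi> p \<bullet> h \<sigma> = \<sigma> * (a \<bullet> a)" using \<tau> by (simp add: h_def a_def inner_add_right)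
      ultimately show ?thesis using \<phi>p by simp
    qed
    have es: "\<epsilon> * s > 0" using eps s by simp
    have pos: "\<epsilon> * s * (a \<bullet> a) > 0" using es aa by simp
    have "\<phi> (p + h (\<epsilon> * s)) \<ge> 0"
      using ph[of "\<epsilon> * s"] es pos by (simp only: abs_le_iff) linarith
    moreover have "\<phi> (p + h (- (\<epsilon> * s))) \<le> 0"
      using ph[of "- (\<epsilon> * s)"] es pos by (simp only: abs_le_iff abs_minus_cancel mult_minus_left) linarith
    moreover have "continuous_on {- (\<epsilon> * s)..\<epsilon> * s} (\<lambda>\<sigma>. \<phi> (p + h \<sigma>))"
      by (rule continuous_on_compose2[OF smooth_on_continuous[OF \<phi>]])
        (use hU in \<open>auto simp: h_def intro!: continuous_intros\<close>)
    ultimately obtain \<sigma> where \<sigma>: "- (\<epsilon> * s) \<le> \<sigma>" "\<sigma> \<le> \<epsilon> * s" "\<phi> (p + h \<sigma>) = 0"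
      using IVT'[of "\<lambda>\<sigma>. \<phi> (p + h \<sigma>)" "- (\<epsilon> * s)" 0 "\<epsilon> * s"] es by auto
    have \<sigma>1: "\<bar>\<sigma>\<bar> \<le> \<epsilon> * s" using \<sigma> by auto
    have "\<bar>f (p + h \<sigma>) - f p - g \<bullet> h \<sigma>\<bar> \<le> \<epsilon> * norm (h \<sigma>)"
      by (rule d1(2)) (use nh[OF \<sigma>1] s d in \<open>simp add: h_def\<close>)
    moreover have "f (p + h \<sigma>) = 0" "f p = 0" using f0 hU[OF \<sigma>1] \<sigma> U \<phi>p by auto
    ultimately have "\<bar>g \<bullet> h \<sigma>\<bar> \<le> \<epsilon> * norm (h \<sigma>)" by simp
    moreover have "g \<bullet> h \<sigma> = s * (g \<bullet> \<tau>) + \<sigma> * (g \<bullet> a)" by (simp add: h_def inner_add_right)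
    moreover have "norm (h \<sigma>) \<le> s * (norm \<tau> + norm a)"
    proof -
      have "norm (h \<sigma>) \<le> s * norm \<tau> + \<bar>\<sigma>\<bar> * norm a"
        using norm_triangle_ineq[of "s *\<^sub>R \<tau>" "\<sigma> *\<^sub>R a"] s by (simp add: h_def)
      moreover have "\<epsilon> * s \<le> 1 * s" using eps s by (intro mult_right_mono) auto
      then have "\<bar>\<sigma>\<bar> * norm a \<le> s * norm a" using \<sigma>1 by (intro mult_right_mono) auto
      ultimately show ?thesis by (simp add: distrib_left)
    qed
    then have "\<epsilon> * norm (h \<sigma>) \<le> \<epsilon> * (s * (norm \<tau> + norm a))" using eps by (intro mult_left_mono) auto
    moreover have "\<bar>\<sigma> * (g \<bullet> a)\<bar> \<le> \<epsilon> * s * \<bar>g \<bullet> a\<bar>"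
      unfolding abs_mult using \<sigma>1 by (intro mult_right_mono) auto
    ultimately have "\<bar>s * (g \<bullet> \<tau>)\<bar> \<le> \<epsilon> * s * \<bar>g \<bullet> a\<bar> + \<epsilon> * (s * (norm \<tau> + norm a))" by linarith
    also have "\<dots> \<le> s * (\<epsilon> * C)" using eps s by (simp add: C_def algebra_simps)
    finally have "s * \<bar>g \<bullet> \<tau>\<bar> \<le> s * (\<epsilon> * C)" using s by (simp add: abs_mult)
    then show ?thesis using s by simp
  qed
  show ?thesis
  proof (rule ccontr)
    assume "g \<bullet> \<tau> \<noteq> 0"
    define \<epsilon> where "\<epsilon> = min (1/2) (\<bar>g \<bullet> \<tau>\<bar> / (2 * C))"
    have "0 < \<epsilon>" "\<epsilon> < 1" using \<open>g \<bullet> \<tau> \<noteq> 0\<close> C by (auto simp: \<epsilon>_def)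
    from key[OF this] have "\<bar>g \<bullet> \<tau>\<bar> \<le> \<epsilon> * C" .
    also have "\<dots> \<le> \<bar>g \<bullet> \<tau>\<bar> / (2 * C) * C" using C by (intro mult_right_mono) (auto simp: \<epsilon>_def)
    also have "\<dots> = \<bar>g \<bullet> \<tau>\<bar> / 2" using C by simp
    finally show False using \<open>g \<bullet> \<tau> \<noteq> 0\<close> by simp
  qed
qed

lemma grad_parallel_normal:
  fixes f \<phi> :: "real^'n::finite \<Rightarrow> real"
  assumes "p \<in> U" "smooth_on U \<phi>" "\<phi> p = 0" "grad \<phi> p \<noteq> 0"
    and "has_grad f g p" "\<And>x. x \<in> U \<Longrightarrow> \<phi> x = 0 \<Longrightarrow> f x = 0"
  shows "\<exists>c. g = c *\<^sub>R grad \<phi> p"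
proof -
  define a where "a = grad \<phi> p"
  have aa: "a \<bullet> a > 0" using assms by (simp add: a_def)
  define \<tau> where "\<tau> = g - ((g \<bullet> a) / (a \<bullet> a)) *\<^sub>R a"
  have ta: "a \<bullet> \<tau> = 0" using aa by (simp add: \<tau>_def inner_diff_right inner_commute)
  then have "g \<bullet> \<tau> = 0" using tangential_derivative_zero[OF assms] by (simp add: a_def)
  then have "\<tau> \<bullet> \<tau> = 0" using ta by (simp add: \<tau>_def inner_diff_left inner_diff_right)
  then have "\<tau> = 0" by simp
  then show ?thesis by (auto simp: \<tau>_def a_def)
qed

text \<open>Each first derivative of \<open>u\<close> vanishes on the hypersurface, so every row of
  the Hessian is a multiple of the normal. Symmetry makes the matrix a multiple of the tensor square
  of the normal, and the trace fixes the factor.\<close>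

lemma hessian_on_max_hypersurface:
  fixes u \<phi> :: "real^'n::finite \<Rightarrow> real"
  assumes q: "q \<in> U" and \<phi>: "smooth_on U \<phi>" "\<phi> q = 0" "grad \<phi> q \<noteq> 0"
    and u: "smooth_on V u" "U \<subseteq> V" and g0: "\<And>x. x \<in> U \<Longrightarrow> \<phi> x = 0 \<Longrightarrow> grad u x = 0"
    and lap: "laplacian u q = - n"
  shows "partial j (partial i u) q = - n * (grad \<phi> q $ i * grad \<phi> q $ j / (norm (grad \<phi> q))\<^sup>2)"
proof -
  define a where "a = grad \<phi> q"
  have qV: "q \<in> V" using q u by auto
  have "\<exists>c. grad (partial i u) q = c *\<^sub>R a" for i
    unfolding a_def
  proof (rule grad_parallel_normal[OF q \<phi>])
    show "has_grad (partial i u) (grad (partial i u) q) q" by (rule smooth_on_has_grad[OF smooth_on_partial[OF u(1)] qV])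
    show "partial i u x = 0" if "x \<in> U" "\<phi> x = 0" for x
      using g0[OF that] by (simp add: grad_def vec_eq_iff)
  qed
  then obtain c where c: "\<And>i. grad (partial i u) q = c i *\<^sub>R a" by metis
  have uij: "partial j (partial i u) q = c i * a $ j" for i j
    using arg_cong[OF c[of i], of "\<lambda>v. v $ j"] by (simp add: grad_def)
  have sym: "c i * a $ j = c j * a $ i" for i j
    using partial_commute[OF u(1) qV, of j i] uij by simp
  have tr: "(\<Sum>i\<in>UNIV. c i * a $ i) = - n" using lap uij by (simp add: laplacian_def)
  have na: "(norm a)\<^sup>2 = (\<Sum>j\<in>UNIV. a $ j * a $ j)" unfolding power2_norm_eq_inner inner_vec_def by simp
  have ci: "c i * (norm a)\<^sup>2 = - n * a $ i"
  proof -
    have "c i * (norm a)\<^sup>2 = (\<Sum>j\<in>UNIV. (c i * a $ j) * a $ j)" unfolding na by (simp add: sum_distrib_left mult.assoc)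
    also have "\<dots> = (\<Sum>j\<in>UNIV. (c j * a $ i) * a $ j)" using sym by simp
    also have "\<dots> = a $ i * (\<Sum>j\<in>UNIV. c j * a $ j)" by (simp add: sum_distrib_left mult_ac)
    finally show ?thesis unfolding tr by simp
  qed
  have "(norm a)\<^sup>2 \<noteq> 0" using \<phi>(3) by (simp add: a_def)
  then have "c i = - n * a $ i / (norm a)\<^sup>2" using ci by (simp add: field_simps)
  then show ?thesis unfolding uij a_def[symmetric] by simp
qed

lemma dird3_eq_sum:
  assumes u: "smooth_on V u" and p: "p \<in> V"
  shows "dird e (dird e u) p = (\<Sum>i\<in>UNIV. \<Sum>j\<in>UNIV. e $ i * e $ j * partial j (partial i u) p)"
    and "dird e (dird e (dird e u)) p =
      (\<Sum>i\<in>UNIV. \<Sum>j\<in>UNIV. \<Sum>k\<in>UNIV. e $ i * e $ j * e $ k * partial k (partial j (partial i u)) p)"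
proof -
  have d2: "dird e (dird e u) x = (\<Sum>i\<in>UNIV. \<Sum>j\<in>UNIV. e $ i * e $ j * partial j (partial i u) x)" if x: "x \<in> V" for x
  proof -
    have "has_grad (dird e u) (\<Sum>i\<in>UNIV. e $ i *\<^sub>R grad (partial i u) x) x"
      unfolding dird_eq_sum [abs_def]
      by (intro has_grad_sum has_grad_cmult smooth_on_has_grad[of V] smooth_on_partial u x)
    then have "grad (dird e u) x = (\<Sum>i\<in>UNIV. e $ i *\<^sub>R grad (partial i u) x)" by (rule has_grad_grad)
    then show ?thesis unfolding dird_def[of e "dird e u"]
      by (simp add: inner_sum_left sum_distrib_left mult_ac dird_def[symmetric] dird_eq_sum)
  qed
  then show "dird e (dird e u) p = (\<Sum>i\<in>UNIV. \<Sum>j\<in>UNIV. e $ i * e $ j * partial j (partial i u) p)" using p by blast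
  have "has_grad (\<lambda>x. \<Sum>i\<in>UNIV. \<Sum>j\<in>UNIV. e $ i * e $ j * partial j (partial i u) x)
     (\<Sum>i\<in>UNIV. \<Sum>j\<in>UNIV. (e $ i * e $ j) *\<^sub>R grad (partial j (partial i u)) p) p"
    by (intro has_grad_sum has_grad_cmult smooth_on_has_grad[of V] smooth_on_partial u p)
  then have "has_grad (dird e (dird e u)) (\<Sum>i\<in>UNIV. \<Sum>j\<in>UNIV. (e $ i * e $ j) *\<^sub>R grad (partial j (partial i u)) p) p"
    by (rule has_grad_cong_open[of _ _ _ V]) (use u p d2 in \<open>auto simp: smooth_on_def\<close>)
  then have "grad (dird e (dird e u)) p = (\<Sum>i\<in>UNIV. \<Sum>j\<in>UNIV. (e $ i * e $ j) *\<^sub>R grad (partial j (partial i u)) p)"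
    by (rule has_grad_grad)
  then show "dird e (dird e (dird e u)) p =
      (\<Sum>i\<in>UNIV. \<Sum>j\<in>UNIV. \<Sum>k\<in>UNIV. e $ i * e $ j * e $ k * partial k (partial j (partial i u)) p)"
    unfolding dird_def[of e "dird e (dird e u)"]
    by (simp add: inner_sum_left sum_distrib_left mult_ac dird_def[symmetric] dird_eq_sum)
qed

lemma unit_normal_grad:
  assumes \<phi>: "smooth_on U \<phi>" and x: "x \<in> U" and g: "grad \<phi> x \<noteq> 0"
  shows "\<exists>N. has_grad (\<lambda>y. ((1 / norm (grad \<phi> y)) *\<^sub>R grad \<phi> y) $ i) N x"
proof -
  have "((\<lambda>w. 1 / sqrt w) has_real_derivative - (inverse (sqrt ((norm (grad \<phi> x))\<^sup>2)) / 2) / (sqrt ((norm (grad \<phi> x))\<^sup>2))\<^sup>2) (at ((norm (grad \<phi> x))\<^sup>2))"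
    using g by (auto intro!: derivative_eq_intros simp: power2_eq_square)
  from has_grad_mult[OF has_grad_compose[OF norm_grad_sq_grad[OF \<phi> x] this] smooth_on_has_grad[OF smooth_on_partial[OF \<phi>, of i] x]]
  show ?thesis by (auto simp: grad_def)
qed

text \<open>Differentiating \<open>u\<^sub>i\<^sub>j + n \<nu>\<^sub>i \<nu>\<^sub>j = 0\<close> along the hypersurface and taking traces gives \<open>u\<^sub>\<nu>\<^sub>\<nu>\<^sub>\<nu> = n H\<close>.\<close>

lemma third_derivative_mean_curvature:
  fixes u \<phi> :: "real^'n::finite \<Rightarrow> real"
  assumes p: "p \<in> U" and \<phi>: "smooth_on U \<phi>" "\<phi> p = 0" "\<And>x. x \<in> U \<Longrightarrow> grad \<phi> x \<noteq> 0"
    and u: "smooth_on V u" "U \<subseteq> V" and g0: "\<And>x. x \<in> U \<Longrightarrow> \<phi> x = 0 \<Longrightarrow> grad u x = 0"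
    and lap: "\<And>x. x \<in> U \<Longrightarrow> laplacian u x = - n"
  defines "e \<equiv> (1 / norm (grad \<phi> p)) *\<^sub>R grad \<phi> p"
  shows "norm e = 1" "dird e (dird e u) p = - n"
    "dird e (dird e (dird e u)) p = n * divergence (\<lambda>x. (1 / norm (grad \<phi> x)) *\<^sub>R grad \<phi> x) p"
proof -
  define \<nu> where "\<nu> x = (1 / norm (grad \<phi> x)) *\<^sub>R grad \<phi> x" for x
  have oU: "open U" using \<phi> by (simp add: smooth_on_def)
  have pV: "p \<in> V" using p u by auto
  have nn: "norm (\<nu> x) = 1" if "x \<in> U" for x using \<phi>(3)[OF that] by (simp add: \<nu>_def)
  have e: "e = \<nu> p" by (simp add: e_def \<nu>_def)
  show ne: "norm e = 1" unfolding e by (rule nn[OF p])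
  have see: "(\<Sum>i\<in>UNIV. e $ i * e $ i) = 1"
    using ne by (metis inner_real_def inner_vec_def norm_eq_1)
  have uij: "partial j (partial i u) x = - n * (\<nu> x $ i * \<nu> x $ j)" if "x \<in> U" "\<phi> x = 0" for x i j
    using hessian_on_max_hypersurface[OF that(1) \<phi>(1) that(2) \<phi>(3)[OF that(1)] u g0 lap[OF that(1)], of j i]
    by (simp add: \<nu>_def power2_eq_square)
  show "dird e (dird e u) p = - n"
  proof -
    have "dird e (dird e u) p = (\<Sum>i\<in>UNIV. \<Sum>j\<in>UNIV. - n * ((e $ i * e $ i) * (e $ j * e $ j)))"
      unfolding dird3_eq_sum(1)[OF u(1) pV] uij[OF p \<phi>(2)] e[symmetric] by (simp add: mult_ac)
    also have "\<dots> = - n * ((\<Sum>i\<in>UNIV. e $ i * e $ i) * (\<Sum>j\<in>UNIV. e $ j * e $ j))"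
      unfolding sum_product by (simp only: sum_distrib_left)
    finally show ?thesis unfolding see by simp
  qed
  have "\<exists>N. has_grad (\<lambda>y. \<nu> y $ i) N p" for i
    unfolding \<nu>_def by (rule unit_normal_grad[OF \<phi>(1) p \<phi>(3)[OF p]])
  then obtain N where N: "\<And>i. has_grad (\<lambda>y. \<nu> y $ i) (N i) p" by metis
  \<comment> \<open>Obtained by differentiating the constant length of \<open>\<nu>\<close>.\<close>
  have eN: "(\<Sum>i\<in>UNIV. e $ i * N i $ k) = 0" for k
  proof -
    have "has_grad (\<lambda>y. \<Sum>i\<in>UNIV. \<nu> y $ i * \<nu> y $ i) (\<Sum>i\<in>UNIV. \<nu> p $ i *\<^sub>R N i + \<nu> p $ i *\<^sub>R N i) p"
      by (intro has_grad_sum has_grad_mult N)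
    moreover have "has_grad (\<lambda>y. \<Sum>i\<in>UNIV. \<nu> y $ i * \<nu> y $ i) 0 p"
    proof (rule has_grad_cong_open[OF has_grad_const[of 1] oU p])
      fix y assume "y \<in> U"
      show "1 = (\<Sum>i\<in>UNIV. \<nu> y $ i * \<nu> y $ i)"
        using nn[OF \<open>y \<in> U\<close>] by (metis inner_real_def inner_vec_def norm_eq_1)
    qed
    ultimately have "(\<Sum>i\<in>UNIV. \<nu> p $ i *\<^sub>R N i + \<nu> p $ i *\<^sub>R N i) = 0" by (rule has_grad_unique)
    then have "(\<Sum>i\<in>UNIV. \<nu> p $ i *\<^sub>R N i + \<nu> p $ i *\<^sub>R N i) $ k = 0" by simp
    then have "2 * (\<Sum>i\<in>UNIV. \<nu> p $ i * N i $ k) = 0"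
      by (simp add: sum.distrib sum_distrib_left mult_ac)
    then show ?thesis by (simp add: e)
  qed
  define h where "h = divergence (\<lambda>x. (1 / norm (grad \<phi> x)) *\<^sub>R grad \<phi> x) p"
  have h: "h = (\<Sum>i\<in>UNIV. N i $ i)"
    unfolding h_def divergence_def using has_grad_partial[OF N] by (simp add: \<nu>_def)
  \<comment> \<open>The function u_ij + n nu_i nu_j vanishes on the hypersurface, so its gradient is
    normal there. The unknown multiples will enter only through their contraction
    \<open>T\<close>.\<close>
  have "\<exists>B. grad (partial j (partial i u)) p + n *\<^sub>R (\<nu> p $ i *\<^sub>R N j + \<nu> p $ j *\<^sub>R N i) = B *\<^sub>R grad \<phi> p" for i j
  proof (rule grad_parallel_normal[OF p \<phi>(1,2) \<phi>(3)[OF p]])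
    show "has_grad (\<lambda>x. partial j (partial i u) x + n * (\<nu> x $ i * \<nu> x $ j))
      (grad (partial j (partial i u)) p + n *\<^sub>R (\<nu> p $ i *\<^sub>R N j + \<nu> p $ j *\<^sub>R N i)) p"
      by (intro has_grad_add has_grad_cmult has_grad_mult N smooth_on_has_grad[of V] smooth_on_partial u(1) pV)
    show "partial j (partial i u) x + n * (\<nu> x $ i * \<nu> x $ j) = 0" if "x \<in> U" "\<phi> x = 0" for x
      using uij[OF that] by simp
  qed
  note ex = this
  define B0 where "B0 i j = (SOME B. grad (partial j (partial i u)) p + n *\<^sub>R (\<nu> p $ i *\<^sub>R N j + \<nu> p $ j *\<^sub>R N i) = B *\<^sub>R grad \<phi> p)" for i j
  have B0: "grad (partial j (partial i u)) p + n *\<^sub>R (\<nu> p $ i *\<^sub>R N j + \<nu> p $ j *\<^sub>R N i) = B0 i j *\<^sub>R grad \<phi> p" for i j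
    unfolding B0_def by (rule someI_ex[OF ex])
  define B where "B i j = B0 i j * norm (grad \<phi> p)" for i j
  have B: "partial k (partial j (partial i u)) p = B i j * e $ k - n * (e $ i * N j $ k + e $ j * N i $ k)" for i j k
  proof -
    have "B0 i j *\<^sub>R grad \<phi> p = B i j *\<^sub>R e" using \<phi>(3)[OF p] by (simp add: B_def e_def)
    then have "(grad (partial j (partial i u)) p + n *\<^sub>R (e $ i *\<^sub>R N j + e $ j *\<^sub>R N i)) $ k = (B i j *\<^sub>R e) $ k"
      using B0[of j i] unfolding e by simp
    then show ?thesis by (simp add: grad_def algebra_simps)
  qed
  define T where "T = (\<Sum>i\<in>UNIV. \<Sum>j\<in>UNIV. B i j * e $ i * e $ j)"
  have "dird e (dird e (dird e u)) p = (\<Sum>i\<in>UNIV. \<Sum>j\<in>UNIV. B i j * e $ i * e $ j * (\<Sum>k\<in>UNIV. e $ k * e $ k)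
      - n * (e $ i * e $ i * (\<Sum>k\<in>UNIV. e $ k * (e $ j * N j $ k)) + e $ j * e $ j * (\<Sum>k\<in>UNIV. e $ k * (e $ i * N i $ k))))"
    unfolding dird3_eq_sum(2)[OF u(1) pV] B
    by (simp add: sum_distrib_left sum.distrib sum_subtractf algebra_simps)
  also have "\<dots> = T - n * (\<Sum>i\<in>UNIV. \<Sum>j\<in>UNIV. e $ i * e $ i * (\<Sum>k\<in>UNIV. e $ k * (e $ j * N j $ k)))
       - n * (\<Sum>i\<in>UNIV. \<Sum>j\<in>UNIV. e $ j * e $ j * (\<Sum>k\<in>UNIV. e $ k * (e $ i * N i $ k)))"
    unfolding see T_def
    by (simp add: sum.distrib sum_subtractf sum_distrib_left[symmetric] distrib_left)
  also have "(\<Sum>i\<in>UNIV. \<Sum>j\<in>UNIV. e $ i * e $ i * (\<Sum>k\<in>UNIV. e $ k * (e $ j * N j $ k))) = 0"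
  proof -
    have "(\<Sum>j\<in>UNIV. \<Sum>k\<in>UNIV. e $ k * (e $ j * N j $ k)) = (\<Sum>k\<in>UNIV. e $ k * (\<Sum>j\<in>UNIV. e $ j * N j $ k))"
      by (subst sum.swap) (simp only: sum_distrib_left)
    then have "(\<Sum>j\<in>UNIV. \<Sum>k\<in>UNIV. e $ k * (e $ j * N j $ k)) = 0" by (simp add: eN)
    then show ?thesis by (simp only: sum_distrib_left[symmetric]) simp
  qed
  also have "(\<Sum>i\<in>UNIV. \<Sum>j\<in>UNIV. e $ j * e $ j * (\<Sum>k\<in>UNIV. e $ k * (e $ i * N i $ k))) = 0"
  proof -
    have "(\<Sum>i\<in>UNIV. \<Sum>k\<in>UNIV. e $ k * (e $ i * N i $ k)) = (\<Sum>k\<in>UNIV. e $ k * (\<Sum>i\<in>UNIV. e $ i * N i $ k))"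
      by (subst sum.swap) (simp only: sum_distrib_left)
    then have "(\<Sum>i\<in>UNIV. \<Sum>k\<in>UNIV. e $ k * (e $ i * N i $ k)) = 0" by (simp add: eN)
    then show ?thesis by (simp only: sum_distrib_right[symmetric] see) simp
  qed
  finally have T: "dird e (dird e (dird e u)) p = T" by simp
  \<comment> \<open>Contracting two of the indices by the trace instead of the normal gives the same
    \<open>T\<close>, now together with the divergence of the normal.\<close>
  have "0 = (\<Sum>i\<in>UNIV. e $ i * (\<Sum>k\<in>UNIV. partial k (partial k (partial i u)) p))"
    using partial_laplacian_const[OF smooth_on_subset[OF u(1) oU u(2)] p lap] by simp
  also have "\<dots> = (\<Sum>i\<in>UNIV. \<Sum>k\<in>UNIV. B i k * e $ i * e $ k - n * (e $ i * e $ i * N k $ k + e $ k * (e $ i * N i $ k)))"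
    unfolding B by (simp add: sum_distrib_left algebra_simps)
  also have "\<dots> = T - n * ((\<Sum>i\<in>UNIV. e $ i * e $ i) * (\<Sum>k\<in>UNIV. N k $ k)) - n * (\<Sum>i\<in>UNIV. \<Sum>k\<in>UNIV. e $ k * (e $ i * N i $ k))"
    unfolding T_def sum_product
    by (simp add: sum.distrib sum_subtractf sum_distrib_left[symmetric] distrib_left)
  also have "(\<Sum>i\<in>UNIV. \<Sum>k\<in>UNIV. e $ k * (e $ i * N i $ k)) = (\<Sum>k\<in>UNIV. e $ k * (\<Sum>i\<in>UNIV. e $ i * N i $ k))"
    by (subst sum.swap) (simp only: sum_distrib_left)
  finally have "T = n * h" unfolding see eN h by simp
  then show "dird e (dird e (dird e u)) p = n * divergence (\<lambda>x. (1 / norm (grad \<phi> x)) *\<^sub>R grad \<phi> x) p"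
    using T by (simp add: h_def)
qed

lemma dird_minus3:
  assumes "smooth_on V u" "p \<in> V"
  shows "dird (- e) u p = - dird e u p" "dird (- e) (dird (- e) u) p = dird e (dird e u) p"
    "dird (- e) (dird (- e) (dird (- e) u)) p = - dird e (dird e (dird e u)) p"
  unfolding dird3_eq_sum[OF assms] by (simp_all add: dird_def sum_negf)

lemma smooth_on_uminus: "smooth_on S f \<Longrightarrow> smooth_on S (\<lambda>x. - f x)"
  using smooth_on_lincomb[of S f f "-1" 0] by simp

lemma grad_uminus: "smooth_on S f \<Longrightarrow> x \<in> S \<Longrightarrow> grad (\<lambda>x. - f x) x = - grad f x"
  by (rule has_grad_grad[OF has_grad_minus[OF smooth_on_has_grad]])

text \<open>Points near \<open>p\<close> with \<open>\<phi> > 0\<close> are pushed along \<open>\<nabla>\<phi>(p)\<close> into a fixed ball on which \<open>\<phi> > 0\<close>.\<close>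

lemma positive_side_connected:
  fixes \<phi> :: "real^'n::finite \<Rightarrow> real"
  assumes \<phi>: "smooth_on U \<phi>" "p \<in> U" "\<phi> p = 0" "grad \<phi> p \<noteq> 0"
  obtains \<delta> C where "\<delta> > 0" "connected C" "C \<subseteq> {x\<in>U. \<phi> x > 0}" "{x\<in>ball p \<delta>. \<phi> x > 0} \<subseteq> C" "ball p \<delta> \<subseteq> U"
    "\<And>\<epsilon>. \<epsilon> > 0 \<Longrightarrow> \<exists>x\<in>ball p \<epsilon>. x \<in> C"
proof -
  define a where "a = grad \<phi> p"
  have a0: "norm a > 0" using \<phi> by (simp add: a_def)
  have oU: "open U" using \<phi> by (simp add: smooth_on_def)
  have "smooth_on U (dird a \<phi>)" by (rule smooth_on_dird[OF \<phi>(1)])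
  then have "continuous_on U (dird a \<phi>)" by (rule smooth_on_continuous)
  then have oS: "open (U \<inter> dird a \<phi> -` {0<..})" by (rule continuous_open_preimage[OF _ oU]) simp
  moreover have "p \<in> U \<inter> dird a \<phi> -` {0<..}" using \<phi> by (simp add: dird_def a_def)
  ultimately obtain r0 where r0: "r0 > 0" "ball p r0 \<subseteq> U \<inter> dird a \<phi> -` {0<..}"
    using open_contains_ball by blast
  \<comment> \<open>Half of \<open>r0\<close>, since a point within \<open>r\<close> of
    \<open>p\<close> is pushed by a further distance of up to \<open>s * norm a = r\<close>.\<close>
  define r where "r = r0 / 2"
  have r: "r > 0" and inB: "\<And>x. dist p x < 2 * r \<Longrightarrow> x \<in> U \<and> dird a \<phi> x > 0" using r0 by (auto simp: r_def)
  define s where "s = r / norm a"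
  have s: "s > 0" "s * norm a = r" using r a0 by (auto simp: s_def)
  have inc: "\<phi> (x + t *\<^sub>R a) > \<phi> x" if x: "dist p x < r" and t: "0 < t" "t \<le> s" for x t
  proof -
    have "\<exists>z>0. z < t \<and> \<phi> (x + t *\<^sub>R a) - \<phi> (x + 0 *\<^sub>R a) = (t - 0) * dird a \<phi> (x + z *\<^sub>R a)"
    proof (rule MVT2[OF t(1)])
      fix z assume z: "0 \<le> z" "z \<le> t"
      have "x + z *\<^sub>R a \<in> U"
      proof -
        have "z * norm a \<le> r" using z t s(2) a0 by (metis less_imp_le mult_right_mono order_trans)
        then have "dist p (x + z *\<^sub>R a) < 2 * r"
          using x z norm_triangle_ineq[of "x - p" "z *\<^sub>R a"] by (simp add: dist_norm norm_minus_commute algebra_simps)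
        then show ?thesis using inB by blast
      qed
      then show "((\<lambda>t. \<phi> (x + t *\<^sub>R a)) has_real_derivative dird a \<phi> (x + z *\<^sub>R a)) (at z)"
        by (rule dird_line[OF \<phi>(1)])
    qed
    then obtain z where z: "0 < z" "z < t" "\<phi> (x + t *\<^sub>R a) - \<phi> x = t * dird a \<phi> (x + z *\<^sub>R a)" by auto
    have "z * norm a \<le> r" using z t s(2) a0 by (metis less_imp_le mult_right_mono order_trans)
    then have "dist p (x + z *\<^sub>R a) < 2 * r"
      using x z norm_triangle_ineq[of "x - p" "z *\<^sub>R a"] by (simp add: dist_norm norm_minus_commute algebra_simps)
    then have "t * dird a \<phi> (x + z *\<^sub>R a) > 0" using inB t by simp
    then show ?thesis using z by linarith
  qed
  have "continuous_on U \<phi>" by (rule smooth_on_continuous[OF \<phi>(1)])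
  then have "open (U \<inter> \<phi> -` {0<..})" by (rule continuous_open_preimage[OF _ oU]) simp
  moreover have "p + s *\<^sub>R a \<in> U \<inter> \<phi> -` {0<..}"
  proof -
    have "dist p (p + s *\<^sub>R a) < 2 * r" using s r by (simp add: dist_norm)
    then show ?thesis using inB inc[of p s] r s \<phi>(3) by simp
  qed
  ultimately obtain \<delta>0 where \<delta>0: "\<delta>0 > 0" "ball (p + s *\<^sub>R a) \<delta>0 \<subseteq> U \<inter> \<phi> -` {0<..}"
    using open_contains_ball by blast
  define \<delta> where "\<delta> = min r \<delta>0"
  have \<delta>: "\<delta> > 0" "\<delta> \<le> r" "\<delta> \<le> \<delta>0" using r \<delta>0 by (auto simp: \<delta>_def)
  define P where "P = {x\<in>ball p \<delta>. \<phi> x > 0}"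
  define L where "L x = (\<lambda>t. x + t *\<^sub>R a) ` {0..s}" for x
  \<comment> \<open>The fixed ball together with the segments leading to it from all positive points
    near \<open>p\<close>; every segment meets the ball, which gives connectedness.\<close>
  define C where "C = ball (p + s *\<^sub>R a) \<delta> \<union> \<Union>(L ` P)"
  have Lconn: "connected (L x)" for x unfolding L_def
    by (intro connected_continuous_image continuous_intros) (simp add: connected_Icc)
  have Lmeet: "ball (p + s *\<^sub>R a) \<delta> \<inter> L x \<noteq> {}" if "x \<in> P" for x
  proof -
    have "x + s *\<^sub>R a \<in> L x" unfolding L_def using s by auto
    moreover have "x + s *\<^sub>R a \<in> ball (p + s *\<^sub>R a) \<delta>" using that by (simp add: P_def dist_norm)
    ultimately show ?thesis by blast
  qed
  have conn: "connected C" unfolding C_def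
    by (rule connected_Un_UN) (use Lconn Lmeet in auto)
  have sub: "C \<subseteq> {x\<in>U. \<phi> x > 0}"
  proof
    fix y assume "y \<in> C"
    then consider "y \<in> ball (p + s *\<^sub>R a) \<delta>" | x t where "x \<in> P" "0 \<le> t" "t \<le> s" "y = x + t *\<^sub>R a"
      by (auto simp: C_def L_def)
    then show "y \<in> {x\<in>U. \<phi> x > 0}"
    proof cases
      case 1
      then have "y \<in> ball (p + s *\<^sub>R a) \<delta>0" using \<delta> by simp
      then show ?thesis using \<delta>0 by auto
    next
      case 2
      have x: "dist p x < r" "\<phi> x > 0" using 2 \<delta> by (auto simp: P_def)
      have "t * norm a \<le> r" using 2 s(2) a0 by (metis less_imp_le mult_right_mono)
      then have "dist p y < 2 * r"
        using x 2 norm_triangle_ineq[of "x - p" "t *\<^sub>R a"] by (simp add: dist_norm norm_minus_commute algebra_simps)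
      moreover have "\<phi> y > 0" using inc[OF x(1), of t] x 2 by (cases "t = 0") auto
      ultimately show ?thesis using inB by simp
    qed
  qed
  have "P \<subseteq> C"
  proof
    fix x assume x: "x \<in> P"
    have "x + 0 *\<^sub>R a \<in> L x" unfolding L_def using s by (intro imageI) auto
    then show "x \<in> C" using x by (auto simp: C_def)
  qed
  moreover have "\<exists>x\<in>ball p \<epsilon>. x \<in> C" if "\<epsilon> > 0" for \<epsilon>
  proof -
    define t where "t = min s (min \<delta> \<epsilon> / (2 * norm a))"
    have t: "t > 0" "t \<le> s" using s \<delta> that a0 by (auto simp: t_def)
    have "t * norm a \<le> min \<delta> \<epsilon> / (2 * norm a) * norm a" using a0 by (intro mult_right_mono) (auto simp: t_def)
    also have "\<dots> = min \<delta> \<epsilon> / 2" using a0 by simp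
    finally have "t * norm a < \<delta>" "t * norm a < \<epsilon>" using \<delta> that by auto
    then have "p + t *\<^sub>R a \<in> ball p \<delta>" "p + t *\<^sub>R a \<in> ball p \<epsilon>" using t by (auto simp: dist_norm)
    moreover have "\<phi> (p + t *\<^sub>R a) > 0" using inc[of p t] t r \<phi>(3) by simp
    ultimately have "p + t *\<^sub>R a \<in> P" by (simp add: P_def)
    then show ?thesis using \<open>P \<subseteq> C\<close> \<open>p + t *\<^sub>R a \<in> ball p \<epsilon>\<close> by blast
  qed
  moreover have "ball p \<delta> \<subseteq> U" using inB \<delta> r by auto
  ultimately show thesis using that[OF \<delta>(1) conn sub] by (auto simp: P_def)
qed

section \<open>The ring problem: sign of the solution, regions and curvature bounds\<close>

locale ring_problem =
  fixes \<Omega> \<Sigma> \<Omega>1 \<Omega>2 \<Gamma>1 \<Gamma>2 :: "(real^'n::finite) set"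
    and u :: "real^'n \<Rightarrow> real" and V :: "(real^'n) set" and n m :: real
  assumes n_eq: "n = real CARD('n)" and m_eq: "m = umax \<Omega> u"
    and n3: "CARD('n) \<ge> 3"
    and dom: "open \<Omega>" "connected \<Omega>" "bounded \<Omega>"
    and comps: "components (frontier \<Omega>) = {\<Gamma>1, \<Gamma>2}" "\<Gamma>1 \<noteq> \<Gamma>2"
    and u_smooth: "closure \<Omega> \<subseteq> V" "smooth_on V u"
    and pde: "\<And>x. x \<in> \<Omega> \<Longrightarrow> laplacian u x = - n"
    and bc: "\<And>x. x \<in> frontier \<Omega> \<Longrightarrow> u x = 0"
    and Sigma: "smooth_hypersurface \<Sigma>" "\<Sigma> \<subseteq> MAXset \<Omega> u"
    and divide: "\<Omega> - \<Sigma> = \<Omega>1 \<union> \<Omega>2" "\<Omega>1 \<inter> \<Omega>2 = {}"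
      "open \<Omega>1" "open \<Omega>2" "connected \<Omega>1" "connected \<Omega>2" "\<Omega>1 \<noteq> {}" "\<Omega>2 \<noteq> {}"
    and sides: "frontier \<Omega> \<inter> closure \<Omega>1 = \<Gamma>1" "frontier \<Omega> \<inter> closure \<Omega>2 = \<Gamma>2"
begin

lemma n_gt_2: "n > 2" using n3 n_eq by simp

lemma Omega_V: "\<Omega> \<subseteq> V" using u_smooth(1) closure_subset by blast

lemma compact_closure: "compact (closure \<Omega>)" using dom by simp

lemma u_cont: "continuous_on (closure \<Omega>) u"
  using smooth_on_continuous[OF u_smooth(2)] u_smooth(1) continuous_on_subset by blast

lemma W_cont: "continuous_on (closure \<Omega>) (\<lambda>x. (norm (grad u x))\<^sup>2)"
  by (rule has_grad_continuous_on[OF norm_grad_sq_grad[OF u_smooth(2)]]) (use u_smooth in auto)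

lemma Sigma_sub: "\<Sigma> \<subseteq> \<Omega>" "x \<in> \<Sigma> \<Longrightarrow> u x = m"
  using Sigma(2) by (auto simp: MAXset_def m_eq)

lemma Omega_not_frontier: "x \<in> \<Omega> \<Longrightarrow> x \<notin> frontier \<Omega>"
  using dom(1) by (simp add: frontier_def interior_open)

lemma closure_cases: "x \<in> closure \<Omega> \<Longrightarrow> x \<in> \<Omega> \<or> x \<in> frontier \<Omega>"
  using dom(1) by (simp add: frontier_def interior_open)

lemma u_le_m: assumes "x \<in> \<Omega>" shows "u x \<le> m"
proof -
  have "compact (u ` closure \<Omega>)" by (rule compact_continuous_image[OF u_cont compact_closure])
  then have "bdd_above (u ` closure \<Omega>)" by (intro bounded_imp_bdd_above compact_imp_bounded)
  then have "bdd_above (u ` \<Omega>)" by (rule bdd_above_mono) (use closure_subset in auto)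
  then show ?thesis unfolding m_eq umax_def using assms by (intro cSUP_upper)
qed

text \<open>At a minimum all pure second derivatives would be nonnegative, against the negative
  Laplacian.\<close>

lemma no_interior_min: assumes "x \<in> \<Omega>" shows "\<exists>y\<in>\<Omega>. u y < u x"
proof (rule ccontr)
  assume "\<not> ?thesis"
  then have mx: "- u y \<le> - u x" if "y \<in> \<Omega>" for y using that by fastforce
  have "(- grad (partial i u) x) $ i \<le> 0" for i
  proof (rule local_max_conditions(2)[OF dom(1) assms, where f = "\<lambda>y. - u y" and \<gamma> = "\<lambda>y. - grad u y"
        and H = "\<lambda>i. - grad (partial i u) x"])
    show "has_grad (\<lambda>y. - u y) (- grad u y) y" if "y \<in> \<Omega>" for y
      by (rule has_grad_minus[OF smooth_on_has_grad[OF u_smooth(2)]]) (use that Omega_V in auto)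
    show "has_grad (\<lambda>y. (- grad u y) $ j) (- grad (partial j u) x) x" for j
      using has_grad_minus[OF smooth_on_has_grad[OF smooth_on_partial[OF u_smooth(2), of j], of x]] assms Omega_V
      by (auto simp: grad_def)
  qed (use mx in auto)
  then have "partial i (partial i u) x \<ge> 0" for i by (simp add: grad_def)
  then have "laplacian u x \<ge> 0" unfolding laplacian_def by (intro sum_nonneg) auto
  then show False using pde[OF assms] n_gt_2 by simp
qed

lemma Omega_closure: "x \<in> \<Omega> \<Longrightarrow> x \<in> closure \<Omega>"
  using closure_subset by (rule subsetD)

text \<open>The minimum over the closure is attained on the frontier, where \<open>u = 0\<close>;
  strictness comes from applying \<open>no_interior_min\<close> once more, at
  \<open>x\<close>.\<close>

lemma u_pos: assumes "x \<in> \<Omega>" shows "u x > 0"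
proof -
  have "closure \<Omega> \<noteq> {}" using assms by auto
  then obtain z where z: "z \<in> closure \<Omega>" "\<And>y. y \<in> closure \<Omega> \<Longrightarrow> u z \<le> u y"
    using continuous_attains_inf[OF compact_closure _ u_cont] by blast
  have "z \<notin> \<Omega>"
  proof
    assume "z \<in> \<Omega>"
    then obtain y where "y \<in> \<Omega>" "u y < u z" using no_interior_min by blast
    then show False using z(2)[OF Omega_closure, of y] by simp
  qed
  then have z0: "u z = 0" using bc closure_cases[OF z(1)] by simp
  obtain y where "y \<in> \<Omega>" "u y < u x" using no_interior_min[OF assms] by blast
  then show ?thesis using z(2)[OF Omega_closure, of y] z0 by simp
qed

lemma Sigma_nonempty: "\<Sigma> \<noteq> {}"
proof
  assume "\<Sigma> = {}"
  then have "\<Omega> = \<Omega>1 \<union> \<Omega>2" using divide by auto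
  then show False using dom(2) divide unfolding connected_def by blast
qed

lemma m_pos: "m > 0"
proof -
  obtain x where "x \<in> \<Sigma>" using Sigma_nonempty by blast
  then show ?thesis using Sigma_sub(1) Sigma_sub(2)[of x] u_pos[of x] by auto
qed

lemma u_le_m_closure: "x \<in> closure \<Omega> \<Longrightarrow> u x \<le> m"
  using closure_cases[of x] u_le_m[of x] bc[of x] m_pos by auto

lemma grad_zero: assumes "x \<in> \<Omega>" "u x = m" shows "grad u x = 0"
  by (rule grad_zero_at_max[OF dom(1) assms(1) smooth_on_has_grad[OF u_smooth(2)]])
    (use assms Omega_V u_le_m in auto)

text \<open>The other region is open and disjoint from \<open>N\<close>, hence misses
  \<open>closure N\<close>; inside \<open>\<Omega>\<close> only \<open>\<Sigma>\<close> is left for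
  the frontier.\<close>

lemma frontier_region:
  assumes "open N" "N \<subseteq> \<Omega> - \<Sigma>" "N' = (\<Omega> - \<Sigma>) - N" "open N'" "x \<in> frontier N"
  shows "x \<in> \<Sigma> \<or> (x \<in> frontier \<Omega> \<and> x \<in> closure N)"
proof -
  have x: "x \<in> closure N" "x \<notin> N" using assms(1,5) by (auto simp: frontier_def interior_open)
  have "closure N \<subseteq> closure \<Omega>" using assms(2) by (intro closure_mono) auto
  then consider "x \<in> \<Omega>" | "x \<in> frontier \<Omega>" using closure_cases x by blast
  then show ?thesis
  proof cases
    case 1
    have "N' \<inter> N = {}" using assms(3) by auto
    then have "N' \<inter> closure N = {}" using open_Int_closure_eq_empty[OF assms(4)] by blast
    then show ?thesis using 1 x assms(3) by auto
  qed (use x in auto)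
qed

lemma frontier_1: "x \<in> frontier \<Omega>1 \<Longrightarrow> x \<in> \<Sigma> \<or> x \<in> \<Gamma>1"
  using frontier_region[of \<Omega>1 \<Omega>2 x] divide sides(1) by blast

lemma frontier_2: "x \<in> frontier \<Omega>2 \<Longrightarrow> x \<in> \<Sigma> \<or> x \<in> \<Gamma>2"
  using frontier_region[of \<Omega>2 \<Omega>1 x] divide sides(2) by blast

text \<open>On \<open>\<Sigma>\<close> the gradient vanishes and the boundary condition is
  automatic. \<open>N\<close> is an arbitrary open subset because the comparison is also run on a
  superlevel set of \<open>u\<close> inside \<open>\<Omega>2\<close>.\<close>

lemma region_comparison:
  assumes N: "open N" "N \<subseteq> \<Omega>" and J: "is_branch J" "\<rho> > 0"
    and bd: "\<And>x. x \<in> frontier N \<Longrightarrow> x \<in> \<Sigma> \<or> (norm (grad u x))\<^sup>2 \<le> ym n J \<rho> m (u x)"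
    and x: "x \<in> N"
  shows "(norm (grad u x))\<^sup>2 \<le> ym n J \<rho> m (u x)"
  unfolding n_eq
proof (rule comparison[OF n3 J u_smooth(2) N(1) _ _ _ _ _ x])
  have c: "closure N \<subseteq> closure \<Omega>" using N by (intro closure_mono)
  show "bounded N" using N dom bounded_subset by blast
  show "closure N \<subseteq> V" using c u_smooth by blast
  show "laplacian u y = - real CARD('n)" if "y \<in> N" for y using pde N that n_eq by auto
  show "u y \<le> m" if "y \<in> closure N" for y using u_le_m_closure c that by auto
  show "(norm (grad u y))\<^sup>2 \<le> ym (real CARD('n)) J \<rho> m (u y)" if "y \<in> frontier N" for y
  proof -
    have "(norm (grad u y))\<^sup>2 = 0" if "y \<in> \<Sigma>" using grad_zero[of y] Sigma_sub(1) Sigma_sub(2)[OF that] that by auto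
    then show ?thesis using bd[OF that] ym_nonneg[of n J \<rho> m "u y"] unfolding n_eq[symmetric] by linarith
  qed
qed

text \<open>\<open>e\<close> is the unit normal of \<open>\<Sigma>\<close> pointing from
  \<open>\<Omega>1\<close> to \<open>\<Omega>2\<close>. The short rays are kept in
  \<open>{u > m / 2}\<close> so that a comparison known only there can be used.\<close>

lemma curvature_data:
  assumes "p \<in> \<Sigma>" "mean_curvature_at \<Sigma> \<Omega>1 p h"
  obtains e d where "norm e = 1" "d > 0" "dird e u p = 0" "dird e (dird e u) p = - n"
    "dird e (dird e (dird e u)) p = n * h"
    "\<And>t. 0 < t \<Longrightarrow> t < d \<Longrightarrow> p + t *\<^sub>R e \<in> \<Omega>2 \<and> u (p + t *\<^sub>R e) > m / 2"
    "\<And>t. 0 < t \<Longrightarrow> t < d \<Longrightarrow> p + t *\<^sub>R (- e) \<in> \<Omega>1 \<and> u (p + t *\<^sub>R (- e)) > m / 2"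
proof -
  obtain U \<phi> where U: "p \<in> U" "smooth_on U \<phi>" "\<And>x. x \<in> U \<Longrightarrow> grad \<phi> x \<noteq> 0" 
    "\<Sigma> \<inter> U = {x\<in>U. \<phi> x = 0}" "\<Omega>1 \<inter> U = {x\<in>U. \<phi> x < 0}"
    "h = divergence (\<lambda>x. (1 / norm (grad \<phi> x)) *\<^sub>R grad \<phi> x) p"
    using assms(2) unfolding mean_curvature_at_def by blast
  have oU: "open U" using U by (simp add: smooth_on_def)
  define U' where "U' = U \<inter> (\<Omega> \<inter> u -` {m/2<..})"
  have oU': "open U'" unfolding U'_def
    by (intro open_Int oU continuous_open_preimage dom(1) continuous_on_subset[OF u_cont closure_subset]) simp
  have pU': "p \<in> U'" using assms U Sigma_sub m_pos by (auto simp: U'_def)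
  have \<phi>': "smooth_on U' \<phi>" by (rule smooth_on_subset[OF U(2) oU']) (auto simp: U'_def)
  have \<phi>p: "\<phi> p = 0" using U assms by auto
  have UV: "U' \<subseteq> V" using Omega_V by (auto simp: U'_def)
  have g0: "grad u x = 0" if "x \<in> U'" "\<phi> x = 0" for x
  proof -
    have "x \<in> \<Sigma>" using that U by (auto simp: U'_def)
    then show ?thesis using grad_zero Sigma_sub by auto
  qed
  define e where "e = (1 / norm (grad \<phi> p)) *\<^sub>R grad \<phi> p"
  have gU: "grad \<phi> x \<noteq> 0" if "x \<in> U'" for x using U(3) that by (auto simp: U'_def)
  have lU: "laplacian u x = - n" if "x \<in> U'" for x using pde that by (auto simp: U'_def)
  note T = third_derivative_mean_curvature[OF pU' \<phi>' \<phi>p gU u_smooth(2) UV g0 lU]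
  have e1: "norm e = 1" unfolding e_def using T(1) by blast
  have pV: "p \<in> V" using pU' UV by auto
  obtain d1 where d1: "d1 > 0" "ball p d1 \<subseteq> U'" using oU' pU' open_contains_ball by blast
  have "((\<lambda>s. \<phi> (p + s *\<^sub>R e)) has_real_derivative dird e \<phi> (p + 0 *\<^sub>R e)) (at 0)"
    by (rule dird_line[OF \<phi>']) (use pU' in simp)
  moreover have "dird e \<phi> (p + 0 *\<^sub>R e) = norm (grad \<phi> p)"
    using gU[OF pU'] by (simp add: dird_def e_def power2_norm_eq_inner[symmetric] power2_eq_square)
  ultimately have dphi: "((\<lambda>s. \<phi> (p + s *\<^sub>R e)) has_real_derivative norm (grad \<phi> p)) (at 0)" by simp
  have ng: "norm (grad \<phi> p) > 0" using gU[OF pU'] by simp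
  obtain d2 where d2: "d2 > 0" "\<And>t. 0 < t \<Longrightarrow> t < d2 \<Longrightarrow> \<phi> (p + 0 *\<^sub>R e) < \<phi> (p + (0 + t) *\<^sub>R e)"
    using DERIV_pos_inc_right[OF dphi ng] by blast
  obtain d3 where d3: "d3 > 0" "\<And>t. 0 < t \<Longrightarrow> t < d3 \<Longrightarrow> \<phi> (p + (0 - t) *\<^sub>R e) < \<phi> (p + 0 *\<^sub>R e)"
    using DERIV_pos_inc_left[OF dphi ng] by blast
  define d where "d = min d1 (min d2 d3)"
  have d: "d > 0" "d \<le> d1" "d \<le> d2" "d \<le> d3" using d1 d2 d3 by (auto simp: d_def)
  have inU: "p + t *\<^sub>R e \<in> U'" "p + t *\<^sub>R (- e) \<in> U'" if "0 < t" "t < d" for t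
  proof -
    have "dist p (p + t *\<^sub>R e) < d1" "dist p (p + t *\<^sub>R (- e)) < d1" using that d e1 by (simp_all add: dist_norm)
    then show "p + t *\<^sub>R e \<in> U'" "p + t *\<^sub>R (- e) \<in> U'" using d1(2) by (auto simp: subset_iff)
  qed
  have side: "x \<in> \<Sigma> \<longleftrightarrow> \<phi> x = 0" "x \<in> \<Omega>1 \<longleftrightarrow> \<phi> x < 0" if "x \<in> U" for x using U(4,5) that by blast+
  show thesis
  proof (rule that[OF e1 d(1)])
    show "dird e u p = 0" using g0[OF pU' \<phi>p] by (simp add: dird_def)
    show "dird e (dird e u) p = - n" unfolding e_def using T(2) by blast
    show "dird e (dird e (dird e u)) p = n * h" unfolding e_def U(6) using T(3) by blast
    show "p + t *\<^sub>R e \<in> \<Omega>2 \<and> u (p + t *\<^sub>R e) > m / 2" if t: "0 < t" "t < d" for t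
    proof -
      have "\<phi> (p + t *\<^sub>R e) > 0" using d2(2)[of t] t d \<phi>p by simp
      moreover have "p + t *\<^sub>R e \<in> U" using inU(1)[OF t] by (simp add: U'_def)
      ultimately have "p + t *\<^sub>R e \<notin> \<Sigma>" "p + t *\<^sub>R e \<notin> \<Omega>1" using side[of "p + t *\<^sub>R e"] by auto
      then show ?thesis using inU(1)[OF t] divide(1) by (auto simp: U'_def)
    qed
    show "p + t *\<^sub>R (- e) \<in> \<Omega>1 \<and> u (p + t *\<^sub>R (- e)) > m / 2" if t: "0 < t" "t < d" for t
    proof -
      have "\<phi> (p + t *\<^sub>R (- e)) < 0" using d3(2)[of t] t d \<phi>p by simp
      moreover have "p + t *\<^sub>R (- e) \<in> U" using inU(2)[OF t] by (simp add: U'_def)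
      ultimately have "p + t *\<^sub>R (- e) \<in> \<Omega>1" using side[of "p + t *\<^sub>R (- e)"] by auto
      then show ?thesis using inU(2)[OF t] by (auto simp: U'_def)
    qed
  qed
qed

text \<open>One moves into \<open>\<Omega>2\<close> along \<open>e\<close> and into
  \<open>\<Omega>1\<close> along \<open>- e\<close>; the third derivative is odd in the direction,
  which turns the second bound into one for \<open>- h\<close>.\<close>

lemma curvature_bounds:
  assumes p: "p \<in> \<Sigma>" "mean_curvature_at \<Sigma> \<Omega>1 p h" and J: "is_branch J" "\<rho> > 0"
  defines "s \<equiv> (if J = {1..} then 1 else - 1)"
  shows "(\<And>x. x \<in> \<Omega>2 \<Longrightarrow> u x > m / 2 \<Longrightarrow> (norm (grad u x))\<^sup>2 \<le> ym n J \<rho> m (u x)) \<Longrightarrow> h \<ge> s * (n - 1) / \<rho>"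
    and "(\<And>x. x \<in> \<Omega>1 \<Longrightarrow> u x > m / 2 \<Longrightarrow> (norm (grad u x))\<^sup>2 \<le> ym n J \<rho> m (u x)) \<Longrightarrow> - h \<ge> s * (n - 1) / \<rho>"
proof -
  obtain e d where e: "norm e = 1" "d > 0" "dird e u p = 0" "dird e (dird e u) p = - n"
    "dird e (dird e (dird e u)) p = n * h"
    "\<And>t. 0 < t \<Longrightarrow> t < d \<Longrightarrow> p + t *\<^sub>R e \<in> \<Omega>2 \<and> u (p + t *\<^sub>R e) > m / 2"
    "\<And>t. 0 < t \<Longrightarrow> t < d \<Longrightarrow> p + t *\<^sub>R (- e) \<in> \<Omega>1 \<and> u (p + t *\<^sub>R (- e)) > m / 2"
    using curvature_data[OF p] by blast
  have pV: "p \<in> V" "u p = m" using p Sigma_sub Omega_V by auto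
  have canc: "x \<ge> s * (n - 1) / \<rho>" if "n * x \<ge> s * n * (n - 1) / \<rho>" for x
  proof -
    have "n * (s * (n - 1) / \<rho>) \<le> n * x" using that by (simp add: mult_ac)
    then show ?thesis by (rule mult_left_le_imp_le) (use n_gt_2 in simp)
  qed
  {
    assume *: "\<And>x. x \<in> \<Omega>2 \<Longrightarrow> u x > m / 2 \<Longrightarrow> (norm (grad u x))\<^sup>2 \<le> ym n J \<rho> m (u x)"
    have "dird e (dird e (dird e u)) p \<ge> s * n * (n - 1) / \<rho>"
      unfolding s_def n_eq
      by (rule third_derivative_bound[OF n3 J u_smooth(2) pV(1) e(1) pV(2) e(3) _ e(2)])
        (use e(4) e(6) * in \<open>auto simp: n_eq\<close>)
    then show "h \<ge> s * (n - 1) / \<rho>" using e(5) canc by simp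
  }
  {
    assume *: "\<And>x. x \<in> \<Omega>1 \<Longrightarrow> u x > m / 2 \<Longrightarrow> (norm (grad u x))\<^sup>2 \<le> ym n J \<rho> m (u x)"
    note dm = dird_minus3[OF u_smooth(2) pV(1), of e]
    have "dird (- e) (dird (- e) (dird (- e) u)) p \<ge> s * n * (n - 1) / \<rho>"
      unfolding s_def n_eq
    proof (rule third_derivative_bound[OF n3 J u_smooth(2) pV(1) _ pV(2) _ _ e(2)])
      show "norm (- e) = 1" "dird (- e) u p = 0" "dird (- e) (dird (- e) u) p = - real CARD('n)"
        using e dm n_eq by auto
      show "(norm (grad u (p + t *\<^sub>R - e)))\<^sup>2 \<le> ym (real CARD('n)) J \<rho> m (u (p + t *\<^sub>R - e))" if "0 < t" "t < d" for t
        using e(7)[OF that] * n_eq by simp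
    qed
    then show "- h \<ge> s * (n - 1) / \<rho>" using dm(3) e(5) canc[of "- h"] by simp
  }
qed

text \<open>\<open>mean_curvature_at\<close> asks that \<open>\<Omega>1\<close> be exactly one local
  side of \<open>\<Sigma>\<close>, whereas a piece of \<open>\<Sigma>\<close> may have the same
  region on both sides. If that happened everywhere, each point of \<open>\<Sigma>\<close> could be
  absorbed in the region around it, and two disjoint nonempty open sets would cover the connected
  \<open>\<Omega>\<close>. The statements about stresses and radii, which mention no point of
  \<open>\<Sigma>\<close>, are derived at such a point.\<close>

lemma good_point: "\<exists>p\<in>\<Sigma>. \<exists>h. mean_curvature_at \<Sigma> \<Omega>1 p h"
proof (rule ccontr)
  assume neg: "\<not> ?thesis"
  define A where "A N = {p\<in>\<Sigma>. \<exists>\<delta>>0. ball p \<delta> \<subseteq> N \<union> \<Sigma>}" for N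
  have key: "(p \<in> A \<Omega>1 \<or> p \<in> A \<Omega>2) \<and> \<not> (p \<in> A \<Omega>1 \<and> p \<in> A \<Omega>2)" if p: "p \<in> \<Sigma>" for p
  proof -
    obtain U0 \<phi> where U0: "p \<in> U0" "smooth_on U0 \<phi>" "\<And>x. x \<in> U0 \<Longrightarrow> grad \<phi> x \<noteq> 0" "\<Sigma> \<inter> U0 = {x\<in>U0. \<phi> x = 0}"
      using bspec[OF Sigma(1)[unfolded smooth_hypersurface_def] p] by (elim exE conjE) metis
    define U where "U = U0 \<inter> \<Omega>"
    have oU: "open U" using U0 dom by (simp add: U_def smooth_on_def open_Int)
    have pU: "p \<in> U" using U0 p Sigma_sub by (auto simp: U_def)
    have \<phi>: "smooth_on U \<phi>" by (rule smooth_on_subset[OF U0(2) oU]) (auto simp: U_def)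
    have \<phi>p: "\<phi> p = 0" using U0 p by auto
    have gU: "grad \<phi> x \<noteq> 0" if "x \<in> U" for x using U0(3) that by (auto simp: U_def)
    have SU: "\<Sigma> \<inter> U = {x\<in>U. \<phi> x = 0}" using U0(4) by (auto simp: U_def)
    have UO: "U - \<Sigma> \<subseteq> \<Omega>1 \<union> \<Omega>2" using divide(1) by (auto simp: U_def)
    obtain \<delta>1 C1 where C1: "\<delta>1 > 0" "connected C1" "C1 \<subseteq> {x\<in>U. \<phi> x > 0}" "{x\<in>ball p \<delta>1. \<phi> x > 0} \<subseteq> C1" "ball p \<delta>1 \<subseteq> U"
      "\<And>\<epsilon>. \<epsilon> > 0 \<Longrightarrow> \<exists>x\<in>ball p \<epsilon>. x \<in> C1"
      using positive_side_connected[OF \<phi> pU \<phi>p gU[OF pU]] by blast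
    \<comment> \<open>The side \<open>\<phi> < 0\<close> is treated as the positive side of
      \<open>- \<phi>\<close>.\<close>
    have \<phi>m: "smooth_on U (\<lambda>x. - \<phi> x)" by (rule smooth_on_uminus[OF \<phi>])
    have gm: "grad (\<lambda>x. - \<phi> x) x = - grad \<phi> x" if "x \<in> U" for x by (rule grad_uminus[OF \<phi> that])
    have "- \<phi> p = 0" "grad (\<lambda>x. - \<phi> x) p \<noteq> 0" using \<phi>p gm[OF pU] gU[OF pU] by auto
    then obtain \<delta>2 C2 where C2: "\<delta>2 > 0" "connected C2" "C2 \<subseteq> {x\<in>U. - \<phi> x > 0}" "{x\<in>ball p \<delta>2. - \<phi> x > 0} \<subseteq> C2" "ball p \<delta>2 \<subseteq> U"
      "\<And>\<epsilon>. \<epsilon> > 0 \<Longrightarrow> \<exists>x\<in>ball p \<epsilon>. x \<in> C2"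
      using positive_side_connected[OF \<phi>m pU] by blast
    define \<delta> where "\<delta> = min \<delta>1 \<delta>2"
    have \<delta>: "\<delta> > 0" "\<delta> \<le> \<delta>1" "\<delta> \<le> \<delta>2" using C1 C2 by (auto simp: \<delta>_def)
    have bU: "ball p \<delta> \<subseteq> U" using C1(5) \<delta> by (auto simp: subset_iff)
    have one: "C \<subseteq> \<Omega>1 \<or> C \<subseteq> \<Omega>2" if "connected C" "C \<subseteq> U - \<Sigma>" for C
      using connectedD[OF that(1) divide(3,4)] that(2) UO divide(2) by blast
    have zU: "x \<in> \<Sigma> \<longleftrightarrow> \<phi> x = 0" if "x \<in> U" for x using SU that by blast
    have c1: "C1 \<subseteq> U - \<Sigma>" using C1(3) zU by fastforce
    have c2: "C2 \<subseteq> U - \<Sigma>" using C2(3) zU by fastforce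
    have pos: "x \<in> C1" if "x \<in> ball p \<delta>" "\<phi> x > 0" for x using C1(4) that \<delta> by auto
    have ngt: "x \<in> C2" if "x \<in> ball p \<delta>" "\<phi> x < 0" for x using C2(4) that \<delta> by auto
    have zero: "x \<in> \<Sigma> \<longleftrightarrow> \<phi> x = 0" if "x \<in> ball p \<delta>" for x using zU bU that by blast
    have bb: "smooth_on (ball p \<delta>) \<phi>" "smooth_on (ball p \<delta>) (\<lambda>x. - \<phi> x)"
      using smooth_on_subset[OF \<phi> open_ball bU] smooth_on_subset[OF \<phi>m open_ball bU] by auto
    have pb: "p \<in> ball p \<delta>" using \<delta> by simp
    have x1: False if "C2 \<subseteq> \<Omega>1" "C1 \<subseteq> \<Omega>2"
    proof -
      have "mean_curvature_at \<Sigma> \<Omega>1 p (divergence (\<lambda>x. (1 / norm (grad \<phi> x)) *\<^sub>R grad \<phi> x) p)"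
        unfolding mean_curvature_at_def
      proof (intro exI[of _ "ball p \<delta>"] exI[of _ \<phi>] conjI refl pb bb(1))
        show "\<forall>x\<in>ball p \<delta>. grad \<phi> x \<noteq> 0" using gU bU by blast
        show "\<Sigma> \<inter> ball p \<delta> = {x\<in>ball p \<delta>. \<phi> x = 0}" using zero by blast
        show "\<Omega>1 \<inter> ball p \<delta> = {x\<in>ball p \<delta>. \<phi> x < 0}"
        proof (intro equalityI subsetI)
          fix x assume x: "x \<in> \<Omega>1 \<inter> ball p \<delta>"
          then have "x \<notin> \<Sigma>" "x \<notin> \<Omega>2" using divide(1,2) by blast+
          then have "\<phi> x \<noteq> 0" "\<not> \<phi> x > 0" using x zero[of x] pos[of x] that(2) by auto
          then show "x \<in> {x\<in>ball p \<delta>. \<phi> x < 0}" using x by auto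
        next
          fix x assume "x \<in> {x\<in>ball p \<delta>. \<phi> x < 0}"
          then show "x \<in> \<Omega>1 \<inter> ball p \<delta>" using ngt[of x] that(1) by auto
        qed
      qed
      then show False using neg p by blast
    qed
    have x2: False if "C1 \<subseteq> \<Omega>1" "C2 \<subseteq> \<Omega>2"
    proof -
      have "mean_curvature_at \<Sigma> \<Omega>1 p (divergence (\<lambda>x. (1 / norm (grad (\<lambda>x. - \<phi> x) x)) *\<^sub>R grad (\<lambda>x. - \<phi> x) x) p)"
        unfolding mean_curvature_at_def
      proof (intro exI[of _ "ball p \<delta>"] exI[of _ "\<lambda>x. - \<phi> x"] conjI refl pb bb(2))
        show "\<forall>x\<in>ball p \<delta>. grad (\<lambda>x. - \<phi> x) x \<noteq> 0" 
        proof
          fix x assume "x \<in> ball p \<delta>"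
          then have "x \<in> U" using bU by blast
          then show "grad (\<lambda>x. - \<phi> x) x \<noteq> 0" using gU[of x] gm[of x] by simp
        qed
        show "\<Sigma> \<inter> ball p \<delta> = {x\<in>ball p \<delta>. - \<phi> x = 0}" using zero by fastforce
        show "\<Omega>1 \<inter> ball p \<delta> = {x\<in>ball p \<delta>. - \<phi> x < 0}"
        proof (intro equalityI subsetI)
          fix x assume x: "x \<in> \<Omega>1 \<inter> ball p \<delta>"
          then have "x \<notin> \<Sigma>" "x \<notin> \<Omega>2" using divide(1,2) by blast+
          then have "\<phi> x \<noteq> 0" "\<not> \<phi> x < 0" using x zero[of x] ngt[of x] that(2) by auto
          then show "x \<in> {x\<in>ball p \<delta>. - \<phi> x < 0}" using x by auto
        next
          fix x assume "x \<in> {x\<in>ball p \<delta>. - \<phi> x < 0}"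
          then show "x \<in> \<Omega>1 \<inter> ball p \<delta>" using pos[of x] that(1) by auto
        qed
      qed
      then show False using neg p by blast
    qed
    have "ball p \<delta> \<subseteq> N \<union> \<Sigma>" if "C1 \<subseteq> N" "C2 \<subseteq> N" for N
    proof
      fix x assume x: "x \<in> ball p \<delta>"
      show "x \<in> N \<union> \<Sigma>" using pos[OF x] ngt[OF x] zero[OF x] that by (cases "\<phi> x" "0::real" rule: linorder_cases) auto
    qed
    then have "p \<in> A \<Omega>1 \<or> p \<in> A \<Omega>2"
      using one[OF C1(2) c1] one[OF C2(2) c2] x1 x2 p \<delta>(1) unfolding A_def by blast
    \<comment> \<open>\<open>C1\<close> comes arbitrarily close to \<open>p\<close>, so a point of
      it off \<open>\<Sigma>\<close> would lie in both regions.\<close>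
    moreover have "\<not> (p \<in> A \<Omega>1 \<and> p \<in> A \<Omega>2)"
    proof
      assume "p \<in> A \<Omega>1 \<and> p \<in> A \<Omega>2"
      then obtain a b where ab: "a > 0" "b > 0" "ball p a \<subseteq> \<Omega>1 \<union> \<Sigma>" "ball p b \<subseteq> \<Omega>2 \<union> \<Sigma>" unfolding A_def by blast
      then obtain x where "x \<in> ball p (min a b)" "x \<in> C1" using C1(6)[of "min a b"] by auto
      moreover have "x \<in> ball p a" "x \<in> ball p b" using calculation by auto
      ultimately show False using ab(3,4) c1 divide(2) by blast
    qed
    ultimately show ?thesis by blast
  qed
  have opn: "open (N \<union> A N)" if "open N" for N
  proof (rule openI)
    fix x assume "x \<in> N \<union> A N"
    then consider "x \<in> N" | "x \<in> A N" by blast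
    then show "\<exists>e>0. ball x e \<subseteq> N \<union> A N"
    proof cases
      case 1
      then show ?thesis using that open_contains_ball by blast
    next
      case 2
      then obtain d where d: "d > 0" "ball x d \<subseteq> N \<union> \<Sigma>" by (auto simp: A_def)
      have "ball x d \<subseteq> N \<union> A N"
      proof
        fix y assume y: "y \<in> ball x d"
        have "ball y (d - dist x y) \<subseteq> ball x d"
        proof
          fix z assume "z \<in> ball y (d - dist x y)"
          then show "z \<in> ball x d" using dist_triangle[of x z y] by simp
        qed
        then show "y \<in> N \<union> A N" using d y unfolding A_def
          by (cases "y \<in> N") (auto intro!: exI[of _ "d - dist x y"])
      qed
      then show ?thesis using d by blast
    qed
  qed
  have "\<Omega> \<subseteq> (\<Omega>1 \<union> A \<Omega>1) \<union> (\<Omega>2 \<union> A \<Omega>2)" using divide(1) key by blast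
  moreover have "(\<Omega>1 \<union> A \<Omega>1) \<inter> (\<Omega>2 \<union> A \<Omega>2) \<inter> \<Omega> = {}"
    using key divide(1,2) unfolding A_def by blast
  ultimately have "(\<Omega>1 \<union> A \<Omega>1) \<inter> \<Omega> = {} \<or> (\<Omega>2 \<union> A \<Omega>2) \<inter> \<Omega> = {}"
    using connectedD[OF dom(2) opn[OF divide(3)] opn[OF divide(4)]] by blast
  then show False using divide(1,7,8) by blast
qed

end

section \<open>Strong maximum principle and rigidity\<close>

text \<open>Hopf's boundary point lemma at \<open>y1\<close>, for an inequality with a drift and a
  zero-order term. The barrier \<open>z\<close> is positive only inside the ball around
  \<open>x0\<close> and is a strict subsolution near \<open>y1\<close>; so
  \<open>f + \<epsilon> z\<close> stays nonpositive near \<open>y1\<close> and has a maximum there.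
  Then the gradients of \<open>f\<close> and of \<open>f + \<epsilon> z\<close> vanish at
  \<open>y1\<close>, but that of \<open>z\<close> does not.\<close>

lemma hopf_strict:
  fixes f :: "real^'n::finite \<Rightarrow> real"
  assumes f: "\<And>y. y \<in> ball q r \<Longrightarrow> has_grad f (\<gamma> y) y"
    and H: "\<And>y k. y \<in> ball q r \<Longrightarrow> has_grad (\<lambda>y. \<gamma> y $ k) (H y k) y"
    and nonpos: "\<And>y. y \<in> ball q r \<Longrightarrow> f y \<le> 0"
    and K: "K \<ge> 0" and sub: "\<And>y. y \<in> ball q r \<Longrightarrow> (\<Sum>k\<in>UNIV. H y k $ k) \<ge> - K * norm (\<gamma> y) + K * f y"
    and \<rho>: "\<rho> > 0" and B: "cball x0 \<rho> \<subseteq> ball q r" and y1: "dist x0 y1 = \<rho>" "f y1 = 0"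
    and neg: "\<And>y. y \<in> cball x0 \<rho> \<Longrightarrow> y \<noteq> y1 \<Longrightarrow> f y < 0"
  shows False
proof -
  let ?n = "real CARD('n)"
  have y1b: "y1 \<in> ball q r" using B y1 by (auto simp: subset_iff)
  obtain s0 where s0: "s0 > 0" "ball y1 s0 \<subseteq> ball q r" using openE[OF open_ball y1b] by blast
  define s where "s = min (s0 / 2) (\<rho> / 2)"
  have s: "s > 0" "s \<le> \<rho> / 2" "s < s0" using s0 \<rho> by (auto simp: s_def)
  have cs: "cball y1 s \<subseteq> ball q r" using s s0 by (auto simp: subset_iff)
  \<comment> \<open>Within \<open>s <= \<rho> / 2\<close> of \<open>y1\<close> the distance
    \<open>d\<close> to \<open>x0\<close> is at least \<open>\<rho> / 2\<close>, so
    \<open>4 \<alpha>^2 d^2 >= \<alpha>^2 \<rho>^2\<close>. The choice of \<open>\<alpha>\<close>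
    makes this exceed \<open>2 \<alpha> n + 2 \<alpha> K d + K\<close>.\<close>
  define \<alpha> where "\<alpha> = max 1 ((2 * ?n + 3 * K * \<rho> + K + 1) / \<rho>\<^sup>2)"
  have \<alpha>: "\<alpha> \<ge> 1" "\<alpha> * \<rho>\<^sup>2 > 2 * ?n + 3 * K * \<rho> + K"
  proof -
    show "\<alpha> \<ge> 1" by (simp add: \<alpha>_def)
    have "(2 * ?n + 3 * K * \<rho> + K + 1) / \<rho>\<^sup>2 \<le> \<alpha>" by (simp add: \<alpha>_def)
    then have "2 * ?n + 3 * K * \<rho> + K + 1 \<le> \<alpha> * \<rho>\<^sup>2" using \<rho> by (simp add: pos_divide_le_eq)
    then show "\<alpha> * \<rho>\<^sup>2 > 2 * ?n + 3 * K * \<rho> + K" by simp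
  qed
  define E where "E y = exp (- \<alpha> * (norm (y - x0))\<^sup>2)" for y
  define z where "z y = E y - exp (- \<alpha> * \<rho>\<^sup>2)" for y
  have gE: "has_grad E ((- 2 * \<alpha> * E y) *\<^sub>R (y - x0)) y" for y
  proof -
    have "((\<lambda>t. exp (- \<alpha> * t)) has_real_derivative exp (- \<alpha> * (norm (y - x0))\<^sup>2) * (- \<alpha>)) (at ((norm (y - x0))\<^sup>2))"
      by (auto intro!: derivative_eq_intros)
    from has_grad_compose[OF has_grad_norm_sq[of x0 y] this] show ?thesis by (simp add: E_def [abs_def] mult_ac)
  qed
  define \<gamma>z where "\<gamma>z y = (- 2 * \<alpha> * E y) *\<^sub>R (y - x0)" for y
  have gz: "has_grad z (\<gamma>z y) y" for y
    unfolding z_def [abs_def] \<gamma>z_def using has_grad_diff[OF gE has_grad_const] by simp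
  define Hz where "Hz y k = (- 2 * \<alpha>) *\<^sub>R (E y *\<^sub>R axis k 1 + (y - x0) $ k *\<^sub>R \<gamma>z y)" for y k
  have gz2: "has_grad (\<lambda>y. \<gamma>z y $ k) (Hz y k) y" for y k
  proof -
    have dz: "has_grad (\<lambda>y. (y - x0) $ k) (axis k 1) y"
      using has_grad_diff[OF has_grad_component[of k y] has_grad_const[of "x0 $ k" y]] by simp
    have "has_grad (\<lambda>y. (- 2 * \<alpha>) * (E y * (y - x0) $ k)) (Hz y k) y"
      unfolding Hz_def \<gamma>z_def by (intro has_grad_cmult has_grad_mult gE dz)
    moreover have "(\<lambda>y. (- 2 * \<alpha>) * (E y * (y - x0) $ k)) = (\<lambda>y. \<gamma>z y $ k)" by (rule ext) (simp add: \<gamma>z_def)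
    ultimately show ?thesis by simp
  qed
  have lapz: "(\<Sum>k\<in>UNIV. Hz y k $ k) = E y * (4 * \<alpha>\<^sup>2 * (norm (y - x0))\<^sup>2 - 2 * \<alpha> * ?n)" for y
  proof -
    have nn: "(norm (y - x0))\<^sup>2 = (\<Sum>k\<in>UNIV. (y - x0) $ k * (y - x0) $ k)"
      unfolding power2_norm_eq_inner inner_vec_def by simp
    have "Hz y k $ k = 4 * \<alpha>\<^sup>2 * E y * ((y - x0) $ k * (y - x0) $ k) - 2 * \<alpha> * E y" for k
      unfolding Hz_def \<gamma>z_def by (simp add: axis_def power2_eq_square algebra_simps)
    then have "(\<Sum>k\<in>UNIV. Hz y k $ k) = 4 * \<alpha>\<^sup>2 * E y * (norm (y - x0))\<^sup>2 - ?n * (2 * \<alpha> * E y)"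
      unfolding nn by (simp add: sum_subtractf sum_distrib_left)
    then show ?thesis by (simp add: algebra_simps)
  qed
  have Epos: "E y > 0" for y by (simp add: E_def)
  have nz: "norm (\<gamma>z y) = 2 * \<alpha> * E y * norm (y - x0)" for y
    using \<alpha> Epos[of y] by (simp add: \<gamma>z_def abs_mult)
  have zE: "z y \<le> E y" for y by (simp add: z_def)
  have z1: "z y \<le> 1" for y using \<alpha> zE[of y] by (simp add: E_def) (smt (verit) exp_le_one_iff mult_nonneg_nonneg zero_le_power2)
  have zpos: "norm (y - x0) < \<rho>" if "z y > 0" for y
  proof -
    have "- \<alpha> * (norm (y - x0))\<^sup>2 > - \<alpha> * \<rho>\<^sup>2" using that by (simp add: z_def E_def)
    then have "(norm (y - x0))\<^sup>2 < \<rho>\<^sup>2" using \<alpha> by simp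
    then show ?thesis by (rule power2_less_imp_less) (use \<rho> in simp)
  qed
  have barrier: "(\<Sum>k\<in>UNIV. Hz y k $ k) > K * norm (\<gamma>z y) + K * z y" if y: "y \<in> cball y1 s" "z y > 0" for y
  proof -
    define d where "d = norm (y - x0)"
    have d1: "d < \<rho>" using zpos[OF y(2)] by (simp add: d_def)
    have "dist x0 y1 \<le> dist x0 y + dist y y1" by (rule dist_triangle)
    then have d2: "d \<ge> \<rho> / 2" using y(1) s y1(1) by (simp add: d_def dist_norm norm_minus_commute)
    have "4 * d\<^sup>2 \<ge> \<rho>\<^sup>2"
    proof -
      have "(\<rho> / 2)\<^sup>2 \<le> d\<^sup>2" using d2 \<rho> by (intro power_mono) auto
      then show ?thesis by (simp add: power_divide)
    qed
    then have a1: "\<alpha>\<^sup>2 * \<rho>\<^sup>2 \<le> 4 * \<alpha>\<^sup>2 * d\<^sup>2" using mult_left_mono[of "\<rho>\<^sup>2" "4 * d\<^sup>2" "\<alpha>\<^sup>2"] by simp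
    have "\<alpha> * (\<alpha> * \<rho>\<^sup>2) > \<alpha> * (2 * ?n + 3 * K * \<rho> + K)" using \<alpha> by (intro mult_strict_left_mono) auto
    moreover have "\<alpha> * K \<ge> 1 * K" using \<alpha> K by (intro mult_right_mono) auto
    moreover have "\<alpha> * (3 * K * \<rho>) \<ge> 2 * \<alpha> * (K * d)"
    proof -
      have "K * d \<le> K * \<rho>" using d1 K by (intro mult_left_mono) auto
      moreover have "K * \<rho> \<ge> 0" using K \<rho> by simp
      ultimately have "2 * (K * d) \<le> 3 * K * \<rho>" by linarith
      then have "\<alpha> * (2 * (K * d)) \<le> \<alpha> * (3 * K * \<rho>)" using \<alpha> by (intro mult_left_mono) auto
      then show ?thesis by (simp add: mult_ac)
    qed
    moreover have "\<alpha> * (\<alpha> * \<rho>\<^sup>2) = \<alpha>\<^sup>2 * \<rho>\<^sup>2" by (simp add: power2_eq_square)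
    moreover have "\<alpha> * (2 * ?n + 3 * K * \<rho> + K) = 2 * \<alpha> * ?n + \<alpha> * (3 * K * \<rho>) + \<alpha> * K" by (simp add: algebra_simps)
    ultimately have "4 * \<alpha>\<^sup>2 * d\<^sup>2 - 2 * \<alpha> * ?n > 2 * \<alpha> * (K * d) + K" using a1 by linarith
    then have "E y * (4 * \<alpha>\<^sup>2 * d\<^sup>2 - 2 * \<alpha> * ?n) > E y * (2 * \<alpha> * (K * d) + K)" using Epos[of y] by simp
    moreover have "K * z y \<le> K * E y" using zE K by (intro mult_left_mono)
    moreover have "E y * (2 * \<alpha> * (K * d) + K) = K * (2 * \<alpha> * E y * d) + K * E y" by (simp add: algebra_simps)
    ultimately show ?thesis unfolding lapz nz d_def[symmetric] by linarith
  qed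
  \<comment> \<open>The part of the small sphere where \<open>z\<close> can be positive. It avoids
    \<open>y1\<close>, so \<open>f\<close> is negative there with a margin
    \<open>\<epsilon>\<close>, and \<open>z <= 1\<close> lets \<open>\<epsilon> z\<close> fit into
    the margin.\<close>
  define P where "P = sphere y1 s \<inter> cball x0 \<rho>"
  have cP: "compact P" unfolding P_def by (intro compact_Int_closed compact_sphere closed_cball)
  have fneg: "f y < 0" if "y \<in> P" for y
  proof (rule neg)
    show "y \<in> cball x0 \<rho>" using that by (simp add: P_def)
    show "y \<noteq> y1" using that s by (auto simp: P_def)
  qed
  have cf: "continuous_on (ball q r) f" by (rule has_grad_continuous_on[OF f])
  have "\<exists>c>0. \<forall>y\<in>P. f y \<le> - c"
  proof (cases "P = {}")
    case False
    have "continuous_on P f" by (rule continuous_on_subset[OF cf]) (use B in \<open>auto simp: P_def\<close>)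
    then obtain y where "y \<in> P" "\<And>x. x \<in> P \<Longrightarrow> f x \<le> f y" using continuous_attains_sup[OF cP False] by blast
    then show ?thesis using fneg[of y] by (intro exI[of _ "- f y"]) auto
  qed (auto intro!: exI[of _ 1])
  then obtain \<epsilon> where \<epsilon>: "\<epsilon> > 0" "\<And>y. y \<in> P \<Longrightarrow> f y \<le> - \<epsilon>" by blast
  define \<Phi> where "\<Phi> y = f y + \<epsilon> * z y" for y
  have gP: "has_grad \<Phi> (\<gamma> y + \<epsilon> *\<^sub>R \<gamma>z y) y" if "y \<in> ball q r" for y
    unfolding \<Phi>_def [abs_def] by (intro has_grad_add has_grad_cmult f gz that)
  have gP2: "has_grad (\<lambda>y. (\<gamma> y + \<epsilon> *\<^sub>R \<gamma>z y) $ k) (H y k + \<epsilon> *\<^sub>R Hz y k) y" if "y \<in> ball q r" for y k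
    unfolding vector_add_component vector_scaleR_component real_scaleR_def by (intro has_grad_add has_grad_cmult H gz2 that)
  have Ple: "\<Phi> y \<le> 0" if yc: "y \<in> cball y1 s" for y
  proof (rule ccontr)
    assume pos: "\<not> \<Phi> y \<le> 0"
    have "continuous_on (cball y1 s) \<Phi>" by (rule has_grad_continuous_on[OF gP]) (use cs in auto)
    then obtain x where x: "x \<in> cball y1 s" "\<And>y. y \<in> cball y1 s \<Longrightarrow> \<Phi> y \<le> \<Phi> x"
      using continuous_attains_sup[of "cball y1 s" \<Phi>] s by auto
    have px: "\<Phi> x > 0" using x(2)[OF yc] pos by simp
    have xq: "x \<in> ball q r" using x cs by auto
    have zx: "z x > 0"
    proof (rule ccontr)
      assume "\<not> z x > 0"
      then have "\<epsilon> * z x \<le> 0" using \<epsilon> by (simp add: mult_le_0_iff)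
      then show False using px nonpos[OF xq] by (simp add: \<Phi>_def)
    qed
    have "dist y1 x \<noteq> s"
    proof
      assume "dist y1 x = s"
      then have "x \<in> P" using zpos[OF zx] by (simp add: P_def dist_norm norm_minus_commute)
      then have "f x \<le> - \<epsilon>" by (rule \<epsilon>(2))
      moreover have "\<epsilon> * z x \<le> \<epsilon> * 1" using z1 \<epsilon> by (intro mult_left_mono) auto
      ultimately show False using px by (simp add: \<Phi>_def)
    qed
    then have xb: "x \<in> ball y1 s" using x(1) by simp
    have bq: "ball y1 s \<subseteq> ball q r" using cs by auto
    note lm = local_max_conditions[OF open_ball xb, of \<Phi> "\<lambda>y. \<gamma> y + \<epsilon> *\<^sub>R \<gamma>z y" "\<lambda>k. H x k + \<epsilon> *\<^sub>R Hz x k"]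
    have g0: "\<gamma> x + \<epsilon> *\<^sub>R \<gamma>z x = 0" by (rule lm(1)) (use gP bq gP2[OF xq] x(2) in auto)
    have "(H x k + \<epsilon> *\<^sub>R Hz x k) $ k \<le> 0" for k by (rule lm(2)) (use gP bq gP2[OF xq] x(2) in auto)
    then have "(\<Sum>k\<in>UNIV. (H x k + \<epsilon> *\<^sub>R Hz x k) $ k) \<le> 0" by (rule sum_nonpos)
    then have "(\<Sum>k\<in>UNIV. H x k $ k) + \<epsilon> * (\<Sum>k\<in>UNIV. Hz x k $ k) \<le> 0" by (simp add: sum.distrib sum_distrib_left)
    moreover have "\<epsilon> * (\<Sum>k\<in>UNIV. Hz x k $ k) > \<epsilon> * (K * norm (\<gamma>z x) + K * z x)"
      using barrier[OF x(1) zx] \<epsilon> by simp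
    moreover have "norm (\<gamma> x) = \<epsilon> * norm (\<gamma>z x)"
    proof -
      have "\<gamma> x = - (\<epsilon> *\<^sub>R \<gamma>z x)" using g0 by (simp add: add_eq_0_iff2)
      then show ?thesis using \<epsilon> by simp
    qed
    moreover have "K * f x \<ge> - (K * (\<epsilon> * z x))"
    proof -
      have "f x \<ge> - (\<epsilon> * z x)" using px by (simp add: \<Phi>_def)
      then have "K * f x \<ge> K * - (\<epsilon> * z x)" using K by (intro mult_left_mono)
      then show ?thesis by simp
    qed
    moreover have "- K * norm (\<gamma> x) + K * f x \<le> (\<Sum>k\<in>UNIV. H x k $ k)" by (rule sub[OF xq])
    moreover have "\<epsilon> * (K * norm (\<gamma>z x) + K * z x) = K * (\<epsilon> * norm (\<gamma>z x)) + K * (\<epsilon> * z x)" by (simp add: algebra_simps)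
    ultimately show False by simp
  qed
  have zy1: "z y1 = 0" using y1 by (simp add: z_def E_def dist_norm norm_minus_commute)
  have bq: "ball y1 s \<subseteq> ball q r" using cs by auto
  have y1s: "y1 \<in> ball y1 s" using s by simp
  have "\<gamma> y1 + \<epsilon> *\<^sub>R \<gamma>z y1 = 0"
    by (rule grad_zero_at_max[OF open_ball y1s gP[OF y1b]]) (use Ple zy1 y1 in \<open>auto simp: \<Phi>_def\<close>)
  moreover have "\<gamma> y1 = 0"
    by (rule grad_zero_at_max[OF open_ball y1b f[OF y1b]]) (use nonpos y1 in auto)
  ultimately have "\<gamma>z y1 = 0" using \<epsilon> by simp
  then have "norm (\<gamma>z y1) = 0" by simp
  then show False unfolding nz using \<alpha> Epos[of y1] y1 \<rho> by (auto simp: dist_norm norm_minus_commute)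
qed

text \<open>Take the zero \<open>y1\<close> of \<open>f\<close> nearest to \<open>x1\<close>. The
  ball with diameter from \<open>x1\<close> to \<open>y1\<close> touches the zero set only at
  \<open>y1\<close>, which is the configuration excluded by \<open>hopf_strict\<close>. As
  \<open>f q = 0\<close>, that diameter is below \<open>r / 4\<close>, and the ball remains in the
  domain.\<close>

lemma strong_maximum_principle:
  fixes f :: "real^'n::finite \<Rightarrow> real"
  assumes f: "\<And>y. y \<in> ball q r \<Longrightarrow> has_grad f (\<gamma> y) y"
    and H: "\<And>y k. y \<in> ball q r \<Longrightarrow> has_grad (\<lambda>y. \<gamma> y $ k) (H y k) y"
    and nonpos: "\<And>y. y \<in> ball q r \<Longrightarrow> f y \<le> 0"
    and K: "K \<ge> 0" and sub: "\<And>y. y \<in> ball q r \<Longrightarrow> (\<Sum>k\<in>UNIV. H y k $ k) \<ge> - K * norm (\<gamma> y) + K * f y"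
    and r: "r > 0" and q: "f q = 0" and x1: "x1 \<in> ball q (r / 4)"
  shows "f x1 = 0"
proof (rule ccontr)
  assume ne: "f x1 \<noteq> 0"
  have cf: "continuous_on (ball q r) f" by (rule has_grad_continuous_on[OF f])
  have cb: "cball q (r / 2) \<subseteq> ball q r" using r by (auto simp: subset_iff)
  define Z where "Z = {y\<in>cball q (r / 2). f y = 0}"
  have "closed Z" unfolding Z_def
    by (rule continuous_closed_preimage_constant[OF continuous_on_subset[OF cf cb] closed_cball])
  moreover have qZ: "q \<in> Z" using q r by (simp add: Z_def)
  ultimately obtain y1 where y1: "y1 \<in> Z" "\<And>y. y \<in> Z \<Longrightarrow> dist x1 y1 \<le> dist x1 y"
    using distance_attains_inf[of Z x1] by blast
  define R where "R = dist x1 y1"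
  have R: "R > 0" using ne y1(1) by (auto simp: R_def Z_def)
  have Rr: "R < r / 4" using y1(2)[OF qZ] x1 by (simp add: R_def dist_commute)
  define x0 where "x0 = (1/2) *\<^sub>R (x1 + y1)"
  have d0: "dist x0 y1 = R / 2"
  proof -
    have "x0 - y1 = (1/2) *\<^sub>R (x1 - y1)" by (simp add: x0_def algebra_simps scaleR_2[symmetric] flip: scaleR_add_left)
    then show ?thesis by (simp add: R_def dist_norm)
  qed
  have near: "dist x1 y \<le> R \<and> (y \<noteq> y1 \<longrightarrow> dist x1 y < R)" if "y \<in> cball x0 (R / 2)" for y
  proof -
    define v where "v = y - x0"
    define d where "d = (1/2) *\<^sub>R (y1 - x1)"
    have nv: "norm v \<le> R / 2" using that by (simp add: v_def dist_norm norm_minus_commute)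
    have nd: "norm d = R / 2" by (simp add: d_def R_def dist_norm norm_minus_commute)
    have e1: "y - x1 = v + d" "y - y1 = v - d"
      by (simp_all add: v_def d_def x0_def vec_eq_iff field_simps)
    \<comment> \<open>The parallelogram law yields both the inclusion in the ball around
      \<open>x1\<close> and, as the case of equality, that only \<open>y1\<close> lies on its
      sphere.\<close>
    have par: "(norm (v + d))\<^sup>2 + (norm (v - d))\<^sup>2 = 2 * (norm v)\<^sup>2 + 2 * (norm d)\<^sup>2"
      unfolding power2_norm_eq_inner by (simp add: inner_add_left inner_add_right inner_diff_left inner_diff_right)
    have "(norm v)\<^sup>2 \<le> (R / 2)\<^sup>2" using nv by (intro power_mono) auto
    then have le: "(norm (v + d))\<^sup>2 + (norm (v - d))\<^sup>2 \<le> R\<^sup>2" unfolding par nd by (simp add: power_divide)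
    then have "(norm (v + d))\<^sup>2 \<le> R\<^sup>2" using zero_le_power2[of "norm (v - d)"] by linarith
    then have a: "norm (v + d) \<le> R" by (rule power2_le_imp_le) (use R in simp)
    have "norm (v + d) < R" if "y \<noteq> y1"
    proof (rule ccontr)
      assume "\<not> norm (v + d) < R"
      then have "norm (v + d) = R" using a by simp
      then have "(norm (v - d))\<^sup>2 \<le> 0" using le by simp
      then have "v - d = 0" by simp
      then show False using e1(2) that by simp
    qed
    moreover have "dist x1 y = norm (v + d)" unfolding e1(1)[symmetric] by (simp add: dist_norm norm_minus_commute)
    ultimately show ?thesis using a by simp
  qed
  have inb: "dist q y < r / 2" if "dist x1 y \<le> R" for y
    using that Rr x1 dist_triangle[of q y x1] by simp
  show False
  proof (rule hopf_strict[where \<rho> = "R / 2" and ?x0.0 = x0 and ?y1.0 = y1, OF f H nonpos K sub])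
    show "R / 2 > 0" using R by simp
    show "cball x0 (R / 2) \<subseteq> ball q r" using near inb r by fastforce
    show "dist x0 y1 = R / 2" by (rule d0)
    show "f y1 = 0" using y1 by (simp add: Z_def)
    show "f y < 0" if "y \<in> cball x0 (R / 2)" "y \<noteq> y1" for y
    proof -
      have y: "dist x1 y < R" using near[OF that(1)] that(2) by blast
      have "dist q y < r / 2" using inb[of y] y by simp
      moreover have "y \<notin> Z" using y1(2)[of y] y by (auto simp: R_def)
      ultimately have "f y \<noteq> 0" by (simp add: Z_def)
      moreover have "f y \<le> 0" using nonpos[of y] \<open>dist q y < r / 2\<close> r by simp
      ultimately show ?thesis by simp
    qed
  qed
qed

section \<open>Harmonic functions: interior gradient estimate and unique continuation\<close>

text \<open>Bernstein's method: \<open>\<zeta>\<^sup>2 |\<nabla>w|\<^sup>2 + \<kappa> w\<^sup>2\<close> with \<open>\<zeta> = r\<^sup>2 - |x - z|\<^sup>2\<close> has no interior maximum at which \<open>\<nabla>w \<noteq> 0\<close>.\<close>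

lemma harmonic_gradient_bound:
  fixes w :: "real^'n::finite \<Rightarrow> real"
  assumes w: "smooth_on S w" and B: "cball z r \<subseteq> S" and r: "r > 0"
    and lap: "\<And>x. x \<in> S \<Longrightarrow> laplacian w x = 0" and M: "\<And>x. x \<in> cball z r \<Longrightarrow> \<bar>w x\<bar> \<le> M"
  shows "norm (grad w z) \<le> sqrt (2 * real CARD('n) + 13) * M / r"
proof -
  let ?n = "real CARD('n)"
  \<comment> \<open>At a maximum the factor
    \<open>2 \<kappa> - 4 n \<zeta> - 6 (norm \<eta>)^2\<close> has to be positive; with
    \<open>\<zeta> <= r^2\<close> and \<open>(norm \<eta>)^2 <= 4 r^2\<close> it suffices that
    \<open>\<kappa>\<close> exceeds \<open>(2 n + 12) r^2\<close>.\<close>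
  define \<kappa> where "\<kappa> = (2 * ?n + 13) * r\<^sup>2"
  define \<zeta> where "\<zeta> y = r\<^sup>2 - (norm (y - z))\<^sup>2" for y
  define W where "W y = (norm (grad w y))\<^sup>2" for y
  define \<Phi> where "\<Phi> y = \<zeta> y * \<zeta> y * W y + \<kappa> * (w y * w y)" for y
  have z1: "has_grad \<zeta> (- 2 *\<^sub>R (y - z)) y" for y
    unfolding \<zeta>_def using has_grad_diff[OF has_grad_const[of "r\<^sup>2"] has_grad_norm_sq[of z y]] by simp
  define V where "V y = (\<chi> k. 2 * (\<Sum>i\<in>UNIV. partial i w y * partial k (partial i w) y))" for y
  have W1: "has_grad W (V y) y" if "y \<in> S" for y
    unfolding W_def V_def by (rule norm_grad_sq_grad[OF w that])
  have w1: "has_grad w (grad w y) y" if "y \<in> S" for y by (rule smooth_on_has_grad[OF w that])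
  define \<gamma> where "\<gamma> y = ((\<zeta> y * \<zeta> y) *\<^sub>R V y + W y *\<^sub>R (\<zeta> y *\<^sub>R (- 2 *\<^sub>R (y - z)) + \<zeta> y *\<^sub>R (- 2 *\<^sub>R (y - z))))
     + \<kappa> *\<^sub>R (w y *\<^sub>R grad w y + w y *\<^sub>R grad w y)" for y
  have P1: "has_grad \<Phi> (\<gamma> y) y" if "y \<in> S" for y
    unfolding \<Phi>_def \<gamma>_def by (intro has_grad_add has_grad_mult has_grad_cmult z1 W1[OF that] w1[OF that])
  have lam: "\<kappa> > 0" using r by (simp add: \<kappa>_def)
  have "continuous_on (cball z r) \<Phi>" by (rule has_grad_continuous_on[OF P1]) (use B in auto)
  then obtain x where x: "x \<in> cball z r" "\<And>y. y \<in> cball z r \<Longrightarrow> \<Phi> y \<le> \<Phi> x"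
    using continuous_attains_sup[of "cball z r" \<Phi>] r by auto
  have M0: "M \<ge> 0" using M[of z] r by auto
  have wM: "w y * w y \<le> M\<^sup>2" if "y \<in> cball z r" for y
    using M[OF that] M0 by (metis abs_le_square_iff abs_of_nonneg power2_eq_square)
  have "\<Phi> x \<le> \<kappa> * M\<^sup>2"
  proof (rule ccontr)
    assume neg: "\<not> \<Phi> x \<le> \<kappa> * M\<^sup>2"
    have lw: "\<kappa> * (w x * w x) \<le> \<kappa> * M\<^sup>2" using wM[OF x(1)] lam by simp
    have "\<zeta> x * \<zeta> x * W x \<noteq> 0" using neg lw by (auto simp: \<Phi>_def)
    then have zx: "\<zeta> x \<noteq> 0" "W x \<noteq> 0" by auto
    have Wpos: "W x > 0" using zx by (simp add: W_def)
    have "norm (x - z) \<noteq> r" using zx by (auto simp: \<zeta>_def)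
    then have xb: "x \<in> ball z r" using x(1) by (simp add: dist_norm norm_minus_commute)
    have xS: "x \<in> S" using x B by auto
    have bS: "ball z r \<subseteq> S" using B by auto
    define V1 where "V1 k = 2 *\<^sub>R (\<Sum>i\<in>UNIV. partial i w x *\<^sub>R grad (partial k (partial i w)) x + 
        partial k (partial i w) x *\<^sub>R grad (partial i w) x)" for k
    have dV: "has_grad (\<lambda>y. V y $ k) (V1 k) x" for k
      unfolding V_def V1_def vec_lambda_beta
      by (intro has_grad_cmult has_grad_sum has_grad_mult smooth_on_has_grad[of S] smooth_on_partial w xS)
    have dz: "has_grad (\<lambda>y. (y - z) $ k) (axis k 1) x" for k
      using has_grad_diff[OF has_grad_component[of k x] has_grad_const[of "z $ k" x]] by simp
    have dw: "has_grad (\<lambda>y. grad w y $ k) (grad (partial k w) x) x" for k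
      using smooth_on_has_grad[OF smooth_on_partial[OF w, of k] xS] by (simp add: grad_def)
    define \<eta> where "\<eta> = - 2 *\<^sub>R (x - z)"
    define H where "H k = (((\<zeta> x * \<zeta> x) *\<^sub>R V1 k + V x $ k *\<^sub>R (\<zeta> x *\<^sub>R \<eta> + \<zeta> x *\<^sub>R \<eta>))
       + (W x *\<^sub>R (2 *\<^sub>R (\<zeta> x *\<^sub>R ((- 2) *\<^sub>R axis k 1) + (- 2 * (x - z) $ k) *\<^sub>R \<eta>)) 
          + (2 * (\<zeta> x * (- 2 * (x - z) $ k))) *\<^sub>R V x))
       + (2 * \<kappa>) *\<^sub>R (w x *\<^sub>R grad (partial k w) x + grad w x $ k *\<^sub>R grad w x)" for k
    have "has_grad (\<lambda>y. (\<zeta> y * \<zeta> y) * V y $ k + W y * (2 * (\<zeta> y * (- 2 * (y - z) $ k))) + (2 * \<kappa>) * (w y * grad w y $ k)) (H k) x" for k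
      unfolding H_def \<eta>_def
      by (intro has_grad_add has_grad_mult has_grad_cmult z1 W1[OF xS] w1[OF xS] dV dz dw)
    moreover have "(\<lambda>y. (\<zeta> y * \<zeta> y) * V y $ k + W y * (2 * (\<zeta> y * (- 2 * (y - z) $ k))) + (2 * \<kappa>) * (w y * grad w y $ k)) = (\<lambda>y. \<gamma> y $ k)" for k
      unfolding \<gamma>_def by (rule ext) (simp add: algebra_simps)
    ultimately have dH: "has_grad (\<lambda>y. \<gamma> y $ k) (H k) x" for k by simp
    have H0: "H k $ k \<le> 0" for k
      by (rule local_max_conditions(2)[OF open_ball xb, of \<Phi> \<gamma> H]) (use P1 bS dH x(2) in auto)
    define hs where "hs i k = partial k (partial i w) x" for i k
    define g where "g i = partial i w x" for i
    have Hk: "H k $ k = \<zeta> x * \<zeta> x * (2 * (\<Sum>i\<in>UNIV. g i * partial k (partial k (partial i w)) x + hs i k * hs i k))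
       + 8 * (\<zeta> x * (\<eta> $ k * (\<Sum>i\<in>UNIV. g i * hs i k))) + W x * (2 * (\<eta> $ k * \<eta> $ k)) - 4 * (\<zeta> x * W x)
       + 2 * \<kappa> * (w x * partial k (partial k w) x + g k * g k)" for k
    proof -
      have ek: "- 2 * (x - z) $ k = \<eta> $ k" by (simp add: \<eta>_def)
      show ?thesis unfolding H_def ek V1_def
        by (simp add: V_def grad_def hs_def g_def axis_def algebra_simps)
    qed
    have s1: "(\<Sum>k\<in>UNIV. \<Sum>i\<in>UNIV. g i * partial k (partial k (partial i w)) x) = 0"
      by (subst sum.swap) (simp add: sum_distrib_left[symmetric] partial_laplacian_const[OF w xS lap])
    have s2: "(\<Sum>k\<in>UNIV. partial k (partial k w) x) = 0" using lap[OF xS] by (simp add: laplacian_def)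
    have sg: "(\<Sum>k\<in>UNIV. g k * g k) = W x"
      unfolding W_def norm_grad_sq by (simp add: g_def power2_eq_square)
    have s\<eta>: "(\<Sum>k\<in>UNIV. \<eta> $ k * \<eta> $ k) = (norm \<eta>)\<^sup>2"
      unfolding power2_norm_eq_inner inner_vec_def by simp
    have "(\<Sum>k\<in>UNIV. H k $ k) = 2 * (\<zeta> x * \<zeta> x) * (\<Sum>k\<in>UNIV. \<Sum>i\<in>UNIV. hs i k * hs i k)
      + 8 * \<zeta> x * (\<Sum>k\<in>UNIV. \<Sum>i\<in>UNIV. \<eta> $ k * g i * hs i k) + 2 * W x * (norm \<eta>)\<^sup>2 - 4 * ?n * (\<zeta> x * W x) + 2 * \<kappa> * W x"
    proof -
      have "(\<Sum>k\<in>UNIV. H k $ k) = 2 * (\<zeta> x * \<zeta> x) * ((\<Sum>k\<in>UNIV. \<Sum>i\<in>UNIV. g i * partial k (partial k (partial i w)) x) + (\<Sum>k\<in>UNIV. \<Sum>i\<in>UNIV. hs i k * hs i k))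
        + 8 * \<zeta> x * (\<Sum>k\<in>UNIV. \<Sum>i\<in>UNIV. \<eta> $ k * g i * hs i k) + 2 * W x * (\<Sum>k\<in>UNIV. \<eta> $ k * \<eta> $ k) - 4 * ?n * (\<zeta> x * W x) 
        + 2 * \<kappa> * (w x * (\<Sum>k\<in>UNIV. partial k (partial k w) x) + (\<Sum>k\<in>UNIV. g k * g k))"
        unfolding Hk by (simp add: sum.distrib sum_subtractf sum_distrib_left algebra_simps)
      then show ?thesis unfolding s1 s2 sg s\<eta> by simp
    qed
    moreover have "2 * (\<zeta> x * \<zeta> x) * (\<Sum>k\<in>UNIV. \<Sum>i\<in>UNIV. hs i k * hs i k)
      + 8 * \<zeta> x * (\<Sum>k\<in>UNIV. \<Sum>i\<in>UNIV. \<eta> $ k * g i * hs i k) + 8 * ((norm \<eta>)\<^sup>2 * W x) \<ge> 0"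
    proof -
      \<comment> \<open>Completing the square absorbs the mixed term into the Hessian term; the
        price \<open>8 (norm \<eta>)^2 W\<close> turns the coefficient 2 of
        \<open>(norm \<eta>)^2 W\<close> into -6.\<close>
      have "0 \<le> (\<Sum>k\<in>UNIV. \<Sum>i\<in>UNIV. 2 * (\<zeta> x * hs i k + 2 * (\<eta> $ k * g i))\<^sup>2)" by (intro sum_nonneg) simp
      also have "\<dots> = (\<Sum>k\<in>UNIV. \<Sum>i\<in>UNIV. 2 * (\<zeta> x * \<zeta> x) * (hs i k * hs i k) + 8 * \<zeta> x * (\<eta> $ k * g i * hs i k) + 8 * ((\<eta> $ k * \<eta> $ k) * (g i * g i)))"
        by (simp add: power2_eq_square algebra_simps)
      also have "\<dots> = 2 * (\<zeta> x * \<zeta> x) * (\<Sum>k\<in>UNIV. \<Sum>i\<in>UNIV. hs i k * hs i k)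
        + 8 * \<zeta> x * (\<Sum>k\<in>UNIV. \<Sum>i\<in>UNIV. \<eta> $ k * g i * hs i k) + 8 * ((\<Sum>k\<in>UNIV. \<eta> $ k * \<eta> $ k) * (\<Sum>i\<in>UNIV. g i * g i))"
        unfolding sum_product by (simp only: sum.distrib sum_distrib_left)
      finally show ?thesis unfolding sg s\<eta> .
    qed
    moreover have "(\<Sum>k\<in>UNIV. H k $ k) \<le> 0" by (rule sum_nonpos) (use H0 in simp)
    ultimately have "W x * (2 * \<kappa> - 4 * ?n * \<zeta> x - 6 * (norm \<eta>)\<^sup>2) \<le> 0" by (simp add: algebra_simps)
    moreover have "2 * \<kappa> - 4 * ?n * \<zeta> x - 6 * (norm \<eta>)\<^sup>2 > 0"
    proof -
      have d: "(norm (x - z))\<^sup>2 \<le> r\<^sup>2" using x(1) by (intro power_mono) (auto simp: dist_norm norm_minus_commute)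
      have "(norm \<eta>)\<^sup>2 = 4 * (norm (x - z))\<^sup>2" unfolding \<eta>_def norm_scaleR power_mult_distrib by simp
      then have e: "(norm \<eta>)\<^sup>2 \<le> 4 * r\<^sup>2" using d by simp
      have "?n * \<zeta> x \<le> ?n * r\<^sup>2" by (intro mult_left_mono) (auto simp: \<zeta>_def)
      moreover have "2 * \<kappa> = 4 * (?n * r\<^sup>2) + 26 * r\<^sup>2" by (simp add: \<kappa>_def algebra_simps)
      moreover have "r\<^sup>2 > 0" using r by simp
      ultimately show ?thesis using e by linarith
    qed
    ultimately show False using Wpos by (simp add: mult_le_0_iff)
  qed
  then have "\<Phi> z \<le> \<kappa> * M\<^sup>2" using x(2)[of z] r by simp
  then have "r\<^sup>2 * r\<^sup>2 * W z + \<kappa> * (w z * w z) \<le> \<kappa> * M\<^sup>2" by (simp add: \<Phi>_def \<zeta>_def)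
  moreover have "\<kappa> * (w z * w z) \<ge> 0" using lam by simp
  ultimately have "r\<^sup>2 * r\<^sup>2 * W z \<le> \<kappa> * M\<^sup>2" by linarith
  then have "r\<^sup>2 * (r\<^sup>2 * W z) \<le> r\<^sup>2 * ((2 * ?n + 13) * M\<^sup>2)" by (simp add: \<kappa>_def mult_ac)
  then have "r\<^sup>2 * W z \<le> (2 * ?n + 13) * M\<^sup>2" by (rule mult_left_le_imp_le) (use r in simp)
  then have "(r * norm (grad w z))\<^sup>2 \<le> (sqrt (2 * ?n + 13) * M)\<^sup>2" by (simp add: power_mult_distrib W_def)
  then have "r * norm (grad w z) \<le> sqrt (2 * ?n + 13) * M"
    by (rule power2_le_imp_le) (use M0 in simp)
  then show ?thesis using r by (simp add: field_simps)
qed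

lemma laplacian_dird:
  assumes f: "smooth_on S f" and lap: "\<And>x. x \<in> S \<Longrightarrow> laplacian f x = 0" and x: "x \<in> S"
  shows "laplacian (dird e f) x = 0"
proof -
  have o: "open S" using f by (simp add: smooth_on_def)
  have p1: "partial k (dird e f) y = (\<Sum>i\<in>UNIV. e $ i * partial k (partial i f) y)" if "y \<in> S" for k y
  proof -
    have "has_grad (dird e f) (\<Sum>i\<in>UNIV. e $ i *\<^sub>R grad (partial i f) y) y"
      unfolding dird_eq_sum [abs_def]
      by (intro has_grad_sum has_grad_cmult smooth_on_has_grad[of S] smooth_on_partial f that)
    from has_grad_partial[OF this, of k] show ?thesis by (simp add: grad_def)
  qed
  have p2: "partial k (partial k (dird e f)) x = (\<Sum>i\<in>UNIV. e $ i * partial k (partial k (partial i f)) x)" for k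
  proof -
    have "partial k (partial k (dird e f)) x = partial k (\<lambda>y. \<Sum>i\<in>UNIV. e $ i * partial k (partial i f) y) x"
      by (rule partial_cong_open[OF o x]) (rule p1)
    moreover have "has_grad (\<lambda>y. \<Sum>i\<in>UNIV. e $ i * partial k (partial i f) y) (\<Sum>i\<in>UNIV. e $ i *\<^sub>R grad (partial k (partial i f)) x) x"
      by (intro has_grad_sum has_grad_cmult smooth_on_has_grad[of S] smooth_on_partial f x)
    from has_grad_partial[OF this, of k]
    have "partial k (\<lambda>y. \<Sum>i\<in>UNIV. e $ i * partial k (partial i f) y) x = (\<Sum>i\<in>UNIV. e $ i * partial k (partial k (partial i f)) x)"
      by (simp add: grad_def)
    ultimately show ?thesis by simp
  qed
  show ?thesis unfolding laplacian_def p2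
    by (subst sum.swap) (simp add: sum_distrib_left[symmetric] partial_laplacian_const[OF f x lap])
qed

lemma iterated_dird:
  assumes "smooth_on S w" "\<And>x. x \<in> S \<Longrightarrow> laplacian w x = 0"
  shows "smooth_on S ((dird e ^^ j) w) \<and> (\<forall>x\<in>S. laplacian ((dird e ^^ j) w) x = 0)"
  by (induction j) (auto simp: assms intro: smooth_on_dird laplacian_dird)

text \<open>Each derivative applies the gradient estimate on balls of radius \<open>\<rho>\<close>,
  so \<open>j\<close> derivatives use up \<open>j * \<rho>\<close> of the radius and cost a factor
  \<open>sqrt (2 n + 13) / \<rho>\<close> each.\<close>

lemma iterated_dird_bound:
  fixes w :: "real^'n::finite \<Rightarrow> real"
  assumes w: "smooth_on S w" "\<And>x. x \<in> S \<Longrightarrow> laplacian w x = 0" and e: "norm e = 1"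
    and B: "cball z R \<subseteq> S" and M: "\<And>x. x \<in> cball z R \<Longrightarrow> \<bar>w x\<bar> \<le> M" and \<rho>: "\<rho> > 0"
    and x: "x \<in> cball z (R - real j * \<rho>)"
  shows "\<bar>(dird e ^^ j) w x\<bar> \<le> (sqrt (2 * real CARD('n) + 13) / \<rho>) ^ j * M"
  using x
proof (induction j arbitrary: x)
  case 0
  then show ?case using M by simp
next
  case (Suc j)
  let ?K = "sqrt (2 * real CARD('n) + 13)" and ?f = "(dird e ^^ j) w"
  have f: "smooth_on S ?f" "\<And>x. x \<in> S \<Longrightarrow> laplacian ?f x = 0" using iterated_dird[OF w] by auto
  have sub: "cball x \<rho> \<subseteq> cball z (R - real j * \<rho>)"
  proof
    fix y assume "y \<in> cball x \<rho>"
    then show "y \<in> cball z (R - real j * \<rho>)"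
      using Suc.prems dist_triangle[of z y x] by (simp add: algebra_simps)
  qed
  also have "\<dots> \<subseteq> cball z R" using \<rho> by (intro subset_cball) simp
  finally have "cball x \<rho> \<subseteq> S" using B by blast
  have "norm (grad ?f x) \<le> ?K * ((?K / \<rho>) ^ j * M) / \<rho>"
    by (rule harmonic_gradient_bound[OF f(1) \<open>cball x \<rho> \<subseteq> S\<close> \<rho> f(2)]) (use Suc.IH sub in auto)
  moreover have "\<bar>dird e ?f x\<bar> \<le> norm (grad ?f x)"
    using Cauchy_Schwarz_ineq2[of "grad ?f x" e] e by (simp add: dird_def)
  ultimately show ?case by (simp add: mult_ac)
qed

lemma power_le_fact_exp: "real k ^ k / fact k \<le> exp (real k)"
proof -
  have "(\<Sum>i\<in>{k}. real k ^ i /\<^sub>R fact i) \<le> exp (real k)"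
    unfolding exp_def by (rule sum_le_suminf[OF summable_exp_generic]) auto
  then show ?thesis by (simp add: divide_inverse mult.commute)
qed

text \<open>All iterated directional derivatives vanish at \<open>z\<close>, so only the Taylor
  remainder along the ray to \<open>x\<close> is left, and it tends to 0 as the order grows. The
  point is that the radius reached depends on \<open>R\<close> but not on the size of
  \<open>T\<close>.\<close>

lemma zero_spreads:
  fixes w :: "real^'n::finite \<Rightarrow> real"
  assumes w: "smooth_on S w" "\<And>x. x \<in> S \<Longrightarrow> laplacian w x = 0"
    and B: "cball z R \<subseteq> S" and R: "R > 0" and T: "open T" "z \<in> T" "T \<subseteq> S" "\<And>x. x \<in> T \<Longrightarrow> w x = 0"
    and x: "dist z x < R / (4 * exp 1 * sqrt (2 * real CARD('n) + 13))"
  shows "w x = 0"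
proof (cases "x = z")
  case True then show ?thesis using T by simp
next
  case False
  let ?K = "sqrt (2 * real CARD('n) + 13)"
  have K: "?K \<ge> 1" by simp
  have E: "exp 1 \<ge> (1::real)" using exp_ge_add_one_self[of 1] by simp
  define h where "h = dist z x"
  define e where "e = (1 / h) *\<^sub>R (x - z)"
  have h: "h > 0" "h * (4 * exp 1 * ?K) < R"
  proof -
    show "h > 0" using False by (simp add: h_def)
    have "4 * exp 1 * ?K > 0" using K by (intro mult_pos_pos) auto
    then show "h * (4 * exp 1 * ?K) < R" using x by (simp add: h_def pos_less_divide_eq)
  qed
  have e: "norm e = 1" "z + h *\<^sub>R e = x"
    using False by (auto simp: e_def h_def dist_norm norm_minus_commute)
  have "compact (w ` cball z R)"
    by (rule compact_continuous_image[OF continuous_on_subset[OF smooth_on_continuous[OF w(1)] B] compact_cball])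
  then obtain M where M: "\<And>y. y \<in> cball z R \<Longrightarrow> \<bar>w y\<bar> \<le> M"
    using compact_imp_bounded bounded_iff by (metis imageI real_norm_def)
  have M0: "M \<ge> 0" using M[of z] R by auto
  have hR: "h \<le> R / 2"
  proof -
    have "1 \<le> exp 1 * ?K" using E K by (metis mult_mono mult_1 zero_le_one order_trans)
    then have "h * 4 \<le> h * (4 * exp 1 * ?K)" using h(1) by (simp add: mult.assoc)
    then show ?thesis using h by linarith
  qed
  have zero: "(dird e ^^ j) w y = 0" if "y \<in> T" for j y
    using that
  proof (induction j arbitrary: y)
    case (Suc j)
    have "has_grad ((dird e ^^ j) w) 0 y"
      by (rule has_grad_cong_open[OF has_grad_const[of 0] T(1) Suc.prems]) (simp add: Suc.IH)
    then have "grad ((dird e ^^ j) w) y = 0" by (rule has_grad_grad)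
    then show ?case by (simp add: dird_def[of e "(dird e ^^ j) w"])
  qed (use T in simp)
  have bound: "\<bar>w x\<bar> \<le> M * (1/2) ^ k" if k: "k > 0" for k :: nat
  proof -
    \<comment> \<open>Sharing half of the radius among \<open>k\<close> derivatives bounds the last
      one by \<open>(2 k K / R)^k M\<close>, with \<open>K\<close> the square root above. Since
      \<open>k^k / fact k <= exp k\<close>, the remainder is at most
      \<open>M (2 exp 1 K h / R)^k\<close>, and the restriction on \<open>x\<close> makes the base
      at most 1/2.\<close>
    define \<rho> where "\<rho> = R / (2 * real k)"
    have \<rho>: "\<rho> > 0" using R k by (simp add: \<rho>_def)
    define diff where "diff j t = (dird e ^^ j) w (z + t *\<^sub>R e)" for j t
    have inB: "z + t *\<^sub>R e \<in> cball z (R / 2)" if "0 \<le> t" "t \<le> h" for t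
      using that hR e by (simp add: dist_norm)
    have inS: "z + t *\<^sub>R e \<in> S" if "0 \<le> t" "t \<le> h" for t
    proof -
      have "cball z (R/2) \<subseteq> cball z R" using R by (intro subset_cball) simp
      then show ?thesis using inB[OF that] B by blast
    qed
    have "\<exists>t>0. t < h \<and> w (z + h *\<^sub>R e) = (\<Sum>m<k. diff m 0 / fact m * h ^ m) + diff k t / fact k * h ^ k"
    proof (rule Maclaurin[OF h(1) k])
      show "diff 0 = (\<lambda>t. w (z + t *\<^sub>R e))" by (rule ext) (simp add: diff_def)
      show "\<forall>m t. m < k \<and> 0 \<le> t \<and> t \<le> h \<longrightarrow> (diff m has_real_derivative diff (Suc m) t) (at t)"
      proof (intro allI impI)
        fix j t assume "j < k \<and> 0 \<le> t \<and> t \<le> h"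
        then have "z + t *\<^sub>R e \<in> S" using inS by blast
        moreover have "smooth_on S ((dird e ^^ j) w)" using iterated_dird[OF w] by blast
        ultimately show "(diff j has_real_derivative diff (Suc j) t) (at t)"
          unfolding diff_def [abs_def] using dird_line by fastforce
      qed
    qed
    moreover have "(\<Sum>m<k. diff m 0 / fact m * h ^ m) = 0" using zero[OF T(2)] by (simp add: diff_def)
    ultimately obtain t where t: "0 < t" "t < h" "w x = diff k t / fact k * h ^ k" using e(2) by auto
    have "real k * \<rho> = R / 2" using k by (simp add: \<rho>_def)
    then have "z + t *\<^sub>R e \<in> cball z (R - real k * \<rho>)" using inB[of t] t by simp
    from iterated_dird_bound[OF w e(1) B M \<rho> this]
    have d: "\<bar>diff k t\<bar> \<le> (?K / \<rho>) ^ k * M" by (simp add: diff_def)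
    have "\<bar>w x\<bar> = \<bar>diff k t\<bar> / fact k * h ^ k" using t h by (simp add: abs_mult)
    also have "\<dots> \<le> ((?K / \<rho>) ^ k * M) / fact k * h ^ k"
      using d h by (intro mult_right_mono divide_right_mono) auto
    also have "\<dots> = M * (real k ^ k / fact k) * (2 * ?K * h / R) ^ k"
      using R k by (simp add: \<rho>_def power_mult_distrib power_divide mult_ac)
    also have "\<dots> \<le> M * exp (real k) * (2 * ?K * h / R) ^ k"
      using power_le_fact_exp[of k] M0 h R by (intro mult_right_mono mult_left_mono) auto
    also have "\<dots> = M * (exp 1 * (2 * ?K * h / R)) ^ k"
    proof -
      have "exp (real k) = (exp 1 :: real) ^ k" using exp_of_nat_mult[of k "1::real"] by simp
      then show ?thesis by (simp only: power_mult_distrib mult.assoc)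
    qed
    also have "\<dots> \<le> M * (1/2) ^ k"
    proof (intro mult_left_mono power_mono M0)
      have "exp 1 * (2 * ?K * h) \<le> R / 2" using h(2) by (simp add: mult_ac)
      then have "exp 1 * (2 * ?K * h) / R \<le> (R / 2) / R" using R by (intro divide_right_mono) auto
      then show "exp 1 * (2 * ?K * h / R) \<le> 1/2" using R by simp
      show "0 \<le> exp 1 * (2 * ?K * h / R)" using h R by simp
    qed
    finally show ?thesis .
  qed
  have "(\<lambda>k. M * (1/2::real) ^ k) \<longlonglongrightarrow> M * 0"
    by (intro tendsto_intros LIMSEQ_realpow_zero) auto
  then have "\<bar>w x\<bar> \<le> M * 0"
    by (rule LIMSEQ_le_const) (use bound in \<open>auto intro!: exI[of _ 1]\<close>)
  then show ?thesis by simp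
qed

text \<open>The interior \<open>Z\<close> of the zero set is closed in \<open>S\<close>: near a
  limit point \<open>y\<close> the radius supplied by \<open>zero_spreads\<close> is bounded below,
  so a point of \<open>Z\<close> close enough to \<open>y\<close> reaches beyond it.\<close>

lemma harmonic_unique_continuation:
  fixes w :: "real^'n::finite \<Rightarrow> real"
  assumes w: "smooth_on S w" "\<And>x. x \<in> S \<Longrightarrow> laplacian w x = 0" and conn: "connected S"
    and T: "open T" "T \<noteq> {}" "T \<subseteq> S" "\<And>x. x \<in> T \<Longrightarrow> w x = 0" and x: "x \<in> S"
  shows "w x = 0"
proof -
  have o: "open S" using w by (simp add: smooth_on_def)
  define Z where "Z = interior {x\<in>S. w x = 0}"
  have ZS: "Z \<subseteq> S" "\<And>x. x \<in> Z \<Longrightarrow> w x = 0" using interior_subset[of "{x\<in>S. w x = 0}"] by (auto simp: Z_def)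
  have oZ: "open Z" by (simp add: Z_def)
  have TZ: "T \<subseteq> Z" unfolding Z_def using T by (intro interior_maximal) auto
  let ?c = "4 * exp 1 * sqrt (2 * real CARD('n) + 13)"
  have c: "?c > 0" by (intro mult_pos_pos) auto
  have cl: "y \<in> Z" if y: "y \<in> closure Z" "y \<in> S" for y
  proof -
    obtain R where R: "R > 0" "cball y (2 * R) \<subseteq> S"
    proof -
      obtain d where "d > 0" "cball y d \<subseteq> S" using o y(2) open_contains_cball by blast
      then show thesis using that[of "d / 2"] by simp
    qed
    define \<delta> where "\<delta> = min R (R / ?c)"
    have \<delta>: "\<delta> > 0" using R c by (simp add: \<delta>_def)
    obtain z where z: "z \<in> Z" "dist z y < \<delta>" using y(1) \<delta> closure_approachable by blast
    have zB: "cball z R \<subseteq> S"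
    proof
      fix v assume "v \<in> cball z R"
      then have "dist y v \<le> 2 * R" using z dist_triangle[of y v z] by (simp add: \<delta>_def dist_commute)
      then show "v \<in> S" using R by auto
    qed
    have "ball z (R / ?c) \<inter> S \<subseteq> {x\<in>S. w x = 0}"
      using zero_spreads[OF w zB R(1) oZ z(1) ZS] by auto
    moreover have "open (ball z (R / ?c) \<inter> S)" using o by auto
    ultimately have "ball z (R / ?c) \<inter> S \<subseteq> Z" unfolding Z_def by (intro interior_maximal)
    then show ?thesis using z y by (auto simp: \<delta>_def)
  qed
  have "S \<subseteq> Z \<union> - closure Z" using cl by auto
  moreover have "Z \<inter> - closure Z \<inter> S = {}" using closure_subset by auto
  moreover have "open (- closure Z)" by auto
  ultimately have "Z \<inter> S = {} \<or> - closure Z \<inter> S = {}" using connectedD[OF conn oZ] by blast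
  then have "- closure Z \<inter> S = {}" using T TZ ZS by blast
  then have "x \<in> Z" using cl x by blast
  then show ?thesis by (rule ZS)
qed

section \<open>Local rigidity at a contact point\<close>

context ring_problem
begin

text \<open>The function \<open>D = |grad u|^2 - y(u) <= 0\<close> satisfies a linear differential
  inequality and is 0 at \<open>q\<close>, so it vanishes nearby; then
  \<open>matrix_deviation\<close> with zero deviation determines the Hessian. In the model
  \<open>grad u = - \<beta>(u) (x - x0)\<close>. Accordingly the field
  \<open>- grad u / \<beta>(u) - x\<close> is shown to have zero derivative, and its constant value
  determines the centre.\<close>

lemma rigidity_near_contact:
  assumes \<rho>: "\<rho> > 0"
    and le: "\<And>x. x \<in> \<Omega>2 \<Longrightarrow> (norm (grad u x))\<^sup>2 \<le> ym n {1..} \<rho> m (u x)"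
    and q: "q \<in> \<Omega>2" "u q < m" "(norm (grad u q))\<^sup>2 = ym n {1..} \<rho> m (u q)"
  shows "\<exists>x0 \<delta>. \<delta> > 0 \<and> ball q \<delta> \<subseteq> \<Omega> \<and>
    (\<forall>x\<in>ball q \<delta>. x \<noteq> x0 \<and> u x = m - \<rho>\<^sup>2 / 2 * Qm n (norm (x - x0) / \<rho>))"
proof -
  let ?J = "{1::real..}"
  have J: "is_branch ?J" by (simp add: is_branch_def)
  note n = n_gt_2
  define W where "W y = (norm (grad u y))\<^sup>2" for y
  \<comment> \<open>Away from the maximum level and from critical points, so that \<open>ym\<close>
    is smooth and one may divide by \<open>W\<close>.\<close>
  define S where "S = \<Omega>2 \<inter> u -` {..<m} \<inter> (\<Omega>2 \<inter> W -` {0<..})"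
  have O2: "\<Omega>2 \<subseteq> \<Omega>" using divide(1) by auto
  have O2c: "\<Omega>2 \<subseteq> closure \<Omega>" using O2 closure_subset by blast
  have oS: "open S" unfolding S_def W_def
    by (intro open_Int continuous_open_preimage divide(4) continuous_on_subset[OF u_cont O2c]
        continuous_on_subset[OF W_cont O2c]) auto
  have SV: "S \<subseteq> V" using O2 Omega_V by (auto simp: S_def)
  have uS: "smooth_on S u" by (rule smooth_on_subset[OF u_smooth(2) oS SV])
  have lapS: "laplacian u y = - n" if "y \<in> S" for y using pde that O2 by (auto simp: S_def)
  have lt: "u y < m" if "y \<in> S" for y using that by (simp add: S_def)
  have Wp: "W y > 0" if "y \<in> S" for y using that by (simp add: S_def)
  have g0: "grad u y \<noteq> 0" if "y \<in> S" for y using Wp[OF that] by (auto simp: W_def)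
  have Wq: "W q > 0"
  proof -
    have "Pm n (chi n ?J (2 * (m - u q) / \<rho>\<^sup>2)) \<noteq> 0"
      by (rule Pm_chi_nonzero[OF J n]) (use q \<rho> in simp)
    then show ?thesis unfolding W_def q(3) ym_def using \<rho> by simp
  qed
  have qS: "q \<in> S" using q Wq by (simp add: S_def)
  obtain r where r: "r > 0" "cball q r \<subseteq> S" using oS qS open_contains_cball by blast
  define g where "g y = gm n ?J \<rho> m (u y)" for y
  define g1 where "g1 y = g1m n ?J \<rho> m (u y)" for y
  define Z1 where "Z1 c = - 2 * gm n ?J \<rho> m c" for c
  define D where "D y = W y - ym n ?J \<rho> m (u y)" for y
  have D0: "D y \<le> 0" if "y \<in> S" for y using le[of y] that by (auto simp: S_def D_def W_def)
  have dZ: "(ym n ?J \<rho> m has_real_derivative Z1 (u y)) (at (u y))" if "y \<in> S" for y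
    unfolding Z1_def by (rule ym_deriv[OF J n \<rho> lt[OF that]])
  have dZ1: "(Z1 has_real_derivative - 2 * g1 y) (at (u y))" if "y \<in> S" for y
    unfolding Z1_def [abs_def] g1_def by (intro DERIV_cmult gm_deriv[OF J n \<rho> lt[OF that]])
  define \<gamma> where "\<gamma> = (\<lambda>y. \<chi> k. 2 * (\<Sum>i\<in>UNIV. partial i u y * partial k (partial i u) y) - Z1 (u y) * partial k u y)"
  have dD: "has_grad D (\<gamma> y) y" if "y \<in> S" for y
    unfolding D_def [abs_def] W_def \<gamma>_def by (rule bochner_comparison(1)[OF uS that lapS dZ dZ1[OF that] that])
  have "\<exists>H. (\<forall>k. has_grad (\<lambda>y. \<gamma> y $ k) (H k) y) \<and>
      (\<Sum>k\<in>UNIV. H k $ k) = 2 * (\<Sum>i\<in>UNIV. \<Sum>k\<in>UNIV. (partial k (partial i u) y)\<^sup>2)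
        - (- 2 * g1 y) * (norm (grad u y))\<^sup>2 - (- n) * Z1 (u y)" if "y \<in> S" for y
    unfolding \<gamma>_def by (rule bochner_comparison(2)[OF uS that lapS dZ dZ1[OF that]])
  then have "\<forall>y\<in>S. \<exists>H. (\<forall>k. has_grad (\<lambda>y. \<gamma> y $ k) (H k) y) \<and>
      (\<Sum>k\<in>UNIV. H k $ k) = 2 * (\<Sum>i\<in>UNIV. \<Sum>k\<in>UNIV. (partial k (partial i u) y)\<^sup>2)
        - (- 2 * g1 y) * (norm (grad u y))\<^sup>2 - (- n) * Z1 (u y)" by blast
  from bchoice[OF this] obtain H where H': "\<forall>y\<in>S. (\<forall>k. has_grad (\<lambda>y. \<gamma> y $ k) (H y k) y) \<and>
      (\<Sum>k\<in>UNIV. H y k $ k) = 2 * (\<Sum>i\<in>UNIV. \<Sum>k\<in>UNIV. (partial k (partial i u) y)\<^sup>2)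
        - (- 2 * g1 y) * (norm (grad u y))\<^sup>2 - (- n) * Z1 (u y)" ..
  have H: "has_grad (\<lambda>y. \<gamma> y $ k) (H y k) y" if "y \<in> S" for y k using H' that by blast
  have Hs: "(\<Sum>k\<in>UNIV. H y k $ k) = 2 * (\<Sum>i\<in>UNIV. \<Sum>k\<in>UNIV. (partial k (partial i u) y)\<^sup>2) + 2 * g1 y * W y - 2 * n * g y"
    if "y \<in> S" for y using H' that by (simp add: W_def g_def Z1_def)
  have N2: "CARD('n) \<ge> 2" using n3 by simp
  have ode: "2 * ((g y)\<^sup>2 + (n - g y)\<^sup>2 / (n - 1)) = - 2 * g1 y * ym n ?J \<rho> m (u y) + 2 * n * g y" if "y \<in> S" for y
    unfolding g_def g1_def by (rule model_ode[OF J n \<rho> lt[OF that]])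
  have tr: "(\<Sum>i\<in>UNIV. partial i (partial i u) y) = - n" if "y \<in> S" for y
    using lapS[OF that] by (simp add: laplacian_def)
  have quad: "(\<Sum>i\<in>UNIV. \<Sum>j\<in>UNIV. grad u y $ i * grad u y $ j * partial j (partial i u) y) = (\<gamma> y \<bullet> grad u y) / 2 - g y * W y" for y
  proof -
    have "\<gamma> y \<bullet> grad u y = (\<Sum>k\<in>UNIV. (2 * (\<Sum>i\<in>UNIV. partial i u y * partial k (partial i u) y) + 2 * g y * partial k u y) * partial k u y)"
      by (simp add: \<gamma>_def inner_vec_def grad_def Z1_def g_def)
    also have "\<dots> = 2 * (\<Sum>k\<in>UNIV. \<Sum>i\<in>UNIV. partial i u y * partial k u y * partial k (partial i u) y) + 2 * g y * W y"
      unfolding W_def norm_grad_sq by (simp add: sum.distrib sum_distrib_left sum_distrib_right algebra_simps power2_eq_square)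
    finally have "\<gamma> y \<bullet> grad u y = 2 * (\<Sum>i\<in>UNIV. \<Sum>k\<in>UNIV. partial i u y * partial k u y * partial k (partial i u) y) + 2 * g y * W y"
      by (subst (asm) sum.swap)
    moreover have "grad u y $ i = partial i u y" for i by (simp add: grad_def)
    ultimately show ?thesis by (simp add: add_divide_distrib)
  qed
  \<comment> \<open>The coefficient of the linear term when the Kato-type bound is expanded at
    \<open>a = - g y + t\<close>. As \<open>t\<close> is proportional to the component of
    \<open>\<gamma>\<close> along the gradient, this term becomes the drift in the inequality for
    \<open>D\<close>.\<close>
  define c where "c y = - 2 * g y + 2 * (n - g y) / (n - 1)" for y
  have lower: "(\<Sum>k\<in>UNIV. H y k $ k) \<ge> c y * (\<gamma> y \<bullet> grad u y) / W y + 2 * g1 y * D y" if y: "y \<in> S" for y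
  proof -
    define t where "t = (\<gamma> y \<bullet> grad u y) / (2 * W y)"
    define a where "a = - g y + t"
    have "a * (norm (grad u y))\<^sup>2 = (\<Sum>i\<in>UNIV. \<Sum>j\<in>UNIV. grad u y $ i * grad u y $ j * partial j (partial i u) y)"
      unfolding quad a_def t_def using Wp[OF y] by (simp add: W_def field_simps)
    from hessian_lower_bound[OF g0[OF y] N2 this]
    have "a\<^sup>2 + (- n - a)\<^sup>2 / (n - 1) \<le> (\<Sum>i\<in>UNIV. \<Sum>j\<in>UNIV. (partial j (partial i u) y)\<^sup>2)"
      unfolding tr[OF y] by (simp only: n_eq)
    moreover have "a\<^sup>2 + (- n - a)\<^sup>2 / (n - 1) \<ge> (g y)\<^sup>2 + (n - g y)\<^sup>2 / (n - 1) + c y * t"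
    proof -
      have "a\<^sup>2 = (g y)\<^sup>2 - 2 * g y * t + t\<^sup>2" by (simp add: a_def power2_eq_square algebra_simps)
      moreover have "(- n - a)\<^sup>2 = (n - g y)\<^sup>2 + 2 * (n - g y) * t + t\<^sup>2" by (simp add: a_def power2_eq_square algebra_simps)
      then have "(- n - a)\<^sup>2 / (n - 1) = (n - g y)\<^sup>2 / (n - 1) + 2 * (n - g y) / (n - 1) * t + t\<^sup>2 / (n - 1)"
        by (simp add: add_divide_distrib)
      moreover have "t\<^sup>2 / (n - 1) \<ge> 0" using n by simp
      moreover have "t\<^sup>2 \<ge> 0" by simp
      moreover have "c y * t = - 2 * g y * t + 2 * (n - g y) / (n - 1) * t" by (simp add: c_def algebra_simps)
      ultimately show ?thesis by linarith
    qed
    moreover have gen: "h \<ge> 2 * ct + 2 * g1 y * D y" if "A \<le> M" "A \<ge> G + ct" "h = 2 * M + 2 * g1 y * W y - 2 * n * g y"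
      "2 * G = - 2 * g1 y * ym n ?J \<rho> m (u y) + 2 * n * g y" for h ct A M G
      using that by (simp add: D_def algebra_simps)
    ultimately have "(\<Sum>k\<in>UNIV. H y k $ k) \<ge> 2 * (c y * t) + 2 * g1 y * D y"
      using gen[OF _ _ Hs[OF y] ode[OF y]] by blast
    moreover have "2 * (c y * t) = c y * (\<gamma> y \<bullet> grad u y) / W y" by (simp add: t_def)
    ultimately show ?thesis by simp
  qed
  have cont_u: "continuous_on (cball q r) u"
    by (rule continuous_on_subset[OF smooth_on_continuous[OF uS] r(2)])
  have ucm: "u ` cball q r \<subseteq> {..m}" "u ` cball q r \<subseteq> {..<m}" using lt r(2) by (auto simp: less_imp_le subset_iff)
  have cg: "continuous_on (cball q r) g"
    unfolding g_def by (rule continuous_on_compose2[OF continuous_on_gm[OF J n \<rho>] cont_u ucm(1)])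
  have "continuous_on {..<m} (g1m n ?J \<rho> m)"
    by (rule continuous_at_imp_continuous_on) (use g1m_deriv[OF J n \<rho>] DERIV_isCont in blast)
  then have cg1: "continuous_on (cball q r) g1"
    unfolding g1_def by (rule continuous_on_compose2[OF _ cont_u ucm(2)])
  have cW: "continuous_on (cball q r) W"
    unfolding W_def by (rule has_grad_continuous_on[OF norm_grad_sq_grad[OF uS]]) (use r in auto)
  \<comment> \<open>Majorizes the drift and the zero-order coefficient; it is continuous because
    \<open>W\<close> does not vanish on the compact ball.\<close>
  define k where "k y = \<bar>c y\<bar> / sqrt (W y) + 2 * \<bar>g1 y\<bar>" for y
  have Wr: "W y > 0" if "y \<in> cball q r" for y using Wp r(2) that by blast
  have "continuous_on (cball q r) k"
    unfolding k_def c_def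
    by (intro continuous_intros cg cg1 cW) (use Wr n in \<open>auto simp: less_imp_neq[symmetric]\<close>)
  then have "compact (k ` cball q r)" by (rule compact_continuous_image[OF _ compact_cball])
  then obtain K where K: "\<And>y. y \<in> cball q r \<Longrightarrow> \<bar>k y\<bar> \<le> K"
    using compact_imp_bounded bounded_iff by (metis imageI real_norm_def)
  have K0: "K \<ge> 0" using K[of q] r by auto
  have bS: "ball q r \<subseteq> S" using r(2) by auto
  have Dz: "D y = 0" if "y \<in> ball q (r / 4)" for y
  proof (rule strong_maximum_principle[where f = D and \<gamma> = \<gamma> and H = H and K = K, OF dD H D0 K0 _ r(1) _ that])
    show "D q = 0" using q by (simp add: D_def W_def)
    show "(\<Sum>k\<in>UNIV. H y k $ k) \<ge> - K * norm (\<gamma> y) + K * D y" if yb: "y \<in> ball q r" for y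
    proof -
      have y: "y \<in> S" using bS yb by blast
      have kK: "\<bar>c y\<bar> / sqrt (W y) + 2 * \<bar>g1 y\<bar> \<le> K" using K[of y] yb by (simp add: k_def)
      have sW: "sqrt (W y) = norm (grad u y)" by (simp add: W_def)
      have "\<bar>c y * (\<gamma> y \<bullet> grad u y) / W y\<bar> \<le> \<bar>c y\<bar> * (norm (\<gamma> y) * norm (grad u y)) / W y"
        using Cauchy_Schwarz_ineq2[of "\<gamma> y" "grad u y"] Wp[OF y]
        by (auto simp: abs_mult intro!: divide_right_mono mult_left_mono)
      also have "\<dots> = \<bar>c y\<bar> / sqrt (W y) * norm (\<gamma> y)"
        unfolding sW using g0[OF y] by (simp add: W_def power2_eq_square)
      also have "\<dots> \<le> K * norm (\<gamma> y)" using kK by (intro mult_right_mono) auto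
      finally have "c y * (\<gamma> y \<bullet> grad u y) / W y \<ge> - (K * norm (\<gamma> y))" by linarith
      moreover have "2 * g1 y * D y \<ge> K * D y"
      proof -
        have "\<bar>c y\<bar> / sqrt (W y) \<ge> 0" using Wp[OF y] by simp
        then have "2 * g1 y \<le> K" using kK by linarith
        then show ?thesis using D0[OF y] by (intro mult_right_mono_neg)
      qed
      ultimately show ?thesis using lower[OF y] by simp
    qed
  qed (use bS in auto)
  define B where "B = ball q (r / 4)"
  have BS: "B \<subseteq> S" using bS r by (auto simp: B_def subset_iff)
  have oB: "open B" by (simp add: B_def)
  have \<gamma>0: "\<gamma> y = 0" if "y \<in> B" for y
  proof -
    have "has_grad D 0 y" by (rule has_grad_cong_open[OF has_grad_const[of 0] oB that]) (simp add: Dz B_def)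
    then show ?thesis using has_grad_unique[OF dD] that BS by blast
  qed
  have H0: "H y k = 0" if "y \<in> B" for y k
  proof -
    have "has_grad (\<lambda>y. \<gamma> y $ k) 0 y" by (rule has_grad_cong_open[OF has_grad_const[of 0] oB that]) (simp add: \<gamma>0)
    then show ?thesis using has_grad_unique[OF H] that BS by blast
  qed
  \<comment> \<open>In the model this is \<open>1 - \<xi> powr (-n)\<close>, the ratio of the
    gradient norm to the distance from the centre.\<close>
  define \<beta> where "\<beta> c = (n - gm n ?J \<rho> m c) / (n - 1)" for c
  have hess: "partial j (partial i u) y = (- g y + \<beta> (u y)) * (partial i u y * partial j u y / W y) + (if i = j then - \<beta> (u y) else 0)"
    if y: "y \<in> B" for y i j
  proof -
    have yS: "y \<in> S" using y BS by blast
    let ?M = "\<lambda>i j. partial j (partial i u) y"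
    have a: "(\<Sum>i\<in>UNIV. \<Sum>j\<in>UNIV. grad u y $ i * grad u y $ j * partial j (partial i u) y) / (norm (grad u y))\<^sup>2 = - g y"
      unfolding quad \<gamma>0[OF y] using Wp[OF yS] by (simp add: W_def)
    have b: "(- n - - g y) / (real CARD('n) - 1) = - \<beta> (u y)"
      unfolding n_eq[symmetric] \<beta>_def g_def by (simp add: minus_divide_left)
    have "(\<Sum>k\<in>UNIV. H y k $ k) = 0" using H0[OF y] by simp
    then have two: "2 * (\<Sum>i\<in>UNIV. \<Sum>j\<in>UNIV. (?M i j)\<^sup>2) = - 2 * g1 y * ym n ?J \<rho> m (u y) + 2 * n * g y"
      using Hs[OF yS] Dz[of y] y by (simp add: B_def D_def)
    have sq: "(\<Sum>i\<in>UNIV. \<Sum>j\<in>UNIV. (?M i j)\<^sup>2) = (g y)\<^sup>2 + (n - g y)\<^sup>2 / (n - 1)"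
    proof -
      have "A = B" if "2 * A = C" "2 * B = C" for A B C :: real using that by simp
      then show ?thesis using ode[OF yS] two by blast
    qed
    have "(\<Sum>i\<in>UNIV. \<Sum>j\<in>UNIV. (?M i j - ((- g y - - \<beta> (u y)) * (grad u y $ i * grad u y $ j / (norm (grad u y))\<^sup>2) + (if i = j then - \<beta> (u y) else 0)))\<^sup>2) = 0"
      using matrix_deviation[OF g0[OF yS] N2, of ?M] unfolding a tr[OF yS] b sq
      by (simp add: n_eq power2_commute)
    then have "\<forall>i\<in>UNIV. (\<Sum>j\<in>UNIV. (?M i j - ((- g y - - \<beta> (u y)) * (grad u y $ i * grad u y $ j / (norm (grad u y))\<^sup>2) + (if i = j then - \<beta> (u y) else 0)))\<^sup>2) = 0"
      by (subst (asm) sum_nonneg_eq_0_iff) (auto intro: sum_nonneg)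
    then have "\<forall>j\<in>UNIV. (?M i j - ((- g y - - \<beta> (u y)) * (grad u y $ i * grad u y $ j / (norm (grad u y))\<^sup>2) + (if i = j then - \<beta> (u y) else 0)))\<^sup>2 = 0"
      by (subst (asm) sum_nonneg_eq_0_iff) auto
    then show ?thesis by (simp add: grad_def W_def)
  qed
  have \<beta>': "(\<beta> has_real_derivative - g1 y / (n - 1)) (at (u y))" if "y \<in> S" for y
    unfolding \<beta>_def [abs_def] g1_def
    using DERIV_cdivide[OF DERIV_diff[OF DERIV_const[of n] gm_deriv[OF J n \<rho> lt[OF that]]], of "n - 1"] by simp
  define \<xi> where "\<xi> y = chi n ?J (2 * (m - u y) / \<rho>\<^sup>2)" for y
  have \<xi>: "\<xi> y > 1" if "y \<in> S" for y
  proof -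
    have s: "2 * (m - u y) / \<rho>\<^sup>2 > 0" using lt[OF that] \<rho> by simp
    show ?thesis using chi_props(1)[OF J n less_imp_le[OF s]] chi_ne_1[OF J n s] by (simp add: \<xi>_def)
  qed
  have \<beta>\<xi>: "\<beta> (u y) = 1 - \<xi> y powr (- n)" if "y \<in> S" for y
  proof -
    have "n - gm n ?J \<rho> m (u y) = (n - 1) * (1 - \<xi> y powr (- n))" by (simp add: gm_def \<xi>_def Gm_def algebra_simps)
    then show ?thesis using n by (simp add: \<beta>_def)
  qed
  have \<beta>p: "\<beta> (u y) > 0" if "y \<in> S" for y using \<beta>\<xi>[OF that] sigma_lt_1[OF \<xi>[OF that] n] by simp
  \<comment> \<open>Matches the rank-one part of the Hessian with the derivative of
    \<open>1 / \<beta>\<close>; the two cancel in \<open>const\<close>.\<close>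
  have coef: "(- g y + \<beta> (u y)) / (W y * \<beta> (u y)) = - g1 y / ((n - 1) * (\<beta> (u y))\<^sup>2)" if y: "y \<in> B" for y
  proof -
    have yS: "y \<in> S" using y BS by blast
    obtain \<sigma> L where R: "\<sigma> > 0" "L > 0" "?J = {1..} \<longrightarrow> \<sigma> < 1" "?J \<noteq> {1..} \<longrightarrow> \<sigma> > 1"
      "ym n ?J \<rho> m (u y) = L * (1 - \<sigma>)\<^sup>2" "gm n ?J \<rho> m (u y) = 1 + (n - 1) * \<sigma>"
      "g1m n ?J \<rho> m (u y) * (L * (1 - \<sigma>)) = n * (n - 1) * \<sigma>"
      "g2m n ?J \<rho> m (u y) * (L * (1 - \<sigma>)\<^sup>2) = g1m n ?J \<rho> m (u y) * (n + 2 - 2 * \<sigma>)"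
      by (rule model_rational[OF J n \<rho> lt[OF yS]])
    have b: "\<beta> (u y) = 1 - \<sigma>" unfolding \<beta>_def R(6) using n by (simp add: field_simps)
    have w: "W y = L * (1 - \<sigma>)\<^sup>2" using Dz[of y] y R(5) by (simp add: B_def D_def)
    have s1: "1 - \<sigma> > 0" using R(3) by simp
    have g1e: "g1 y = n * (n - 1) * \<sigma> / (L * (1 - \<sigma>))"
      using R(7) R(2) s1 by (simp add: g1_def eq_divide_eq)
    have ge: "- g y + \<beta> (u y) = - n * \<sigma>" unfolding b g_def R(6) by (simp add: algebra_simps)
    show ?thesis unfolding ge unfolding g1e w b using R(2) s1 n
      by (simp add: divide_simps power2_eq_square)
  qed
  have const: "has_grad (\<lambda>y. partial i u y * (- 1 / \<beta> (u y)) - y $ i) 0 y" if y: "y \<in> B" for y i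
  proof -
    have yS: "y \<in> S" using y BS by blast
    have "((\<lambda>c. - 1 / \<beta> c) has_real_derivative (- g1 y / (n - 1)) / (\<beta> (u y))\<^sup>2) (at (u y))"
    proof -
      have "((\<lambda>c. - 1 / \<beta> c) has_real_derivative (0 * \<beta> (u y) - (- 1) * (- g1 y / (n - 1))) / (\<beta> (u y) * \<beta> (u y))) (at (u y))"
        by (rule DERIV_divide[OF DERIV_const \<beta>'[OF yS]]) (use \<beta>p[OF yS] in simp)
      then show ?thesis by (simp add: power2_eq_square)
    qed
    note k = this
    have "has_grad (\<lambda>y. partial i u y * (- 1 / \<beta> (u y)) - y $ i)
      ((partial i u y *\<^sub>R (((- g1 y / (n - 1)) / (\<beta> (u y))\<^sup>2) *\<^sub>R grad u y) + (- 1 / \<beta> (u y)) *\<^sub>R grad (partial i u) y) - axis i 1) y"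
      by (intro has_grad_diff has_grad_mult has_grad_compose[where k = "\<lambda>c. - 1 / \<beta> c" and f = u] k
          has_grad_component smooth_on_has_grad[OF uS yS] smooth_on_has_grad[OF smooth_on_partial[OF uS] yS])
    moreover have "(partial i u y *\<^sub>R (((- g1 y / (n - 1)) / (\<beta> (u y))\<^sup>2) *\<^sub>R grad u y) + (- 1 / \<beta> (u y)) *\<^sub>R grad (partial i u) y) - axis i 1 = 0"
    proof -
      have "partial i u y * ((- g1 y / (n - 1)) / (\<beta> (u y))\<^sup>2 * partial j u y) + (- 1 / \<beta> (u y)) * partial j (partial i u) y
         - (if i = j then 1 else 0) = 0" for j
      proof -
        have "(- 1 / \<beta> (u y)) * partial j (partial i u) y = - (((- g y + \<beta> (u y)) / (W y * \<beta> (u y))) * (partial i u y * partial j u y)) + (if i = j then 1 else 0)"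
          unfolding hess[OF y] using \<beta>p[OF yS] by (simp add: distrib_left)
        then show ?thesis unfolding coef[OF y] by simp
      qed
      note comp = this
      show ?thesis
      proof (rule vec_eq_iff[THEN iffD2], rule allI)
        fix j
        have ax: "axis i 1 $ j = (if i = j then 1 else (0::real))" by (auto simp: axis_def)
        show "(partial i u y *\<^sub>R (((- g1 y / (n - 1)) / (\<beta> (u y))\<^sup>2) *\<^sub>R grad u y) + (- 1 / \<beta> (u y)) *\<^sub>R grad (partial i u) y - axis i 1) $ j = 0 $ j"
          using comp[of j] unfolding vector_minus_component vector_add_component vector_scaleR_component
            real_scaleR_def ax zero_index by (simp only: grad_def vec_lambda_beta)
      qed
    qed
    ultimately show ?thesis by simp
  qed
  have "\<exists>b. \<forall>y\<in>B. partial i u y * (- 1 / \<beta> (u y)) - y $ i = b" for i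
  proof (rule has_derivative_zero_constant)
    show "convex B" by (simp add: B_def)
    show "((\<lambda>y. partial i u y * (- 1 / \<beta> (u y)) - y $ i) has_derivative (\<lambda>h. 0)) (at y within B)" if "y \<in> B" for y
      using has_gradD[OF const[OF that, of i]] has_derivative_at_withinI by fastforce
  qed
  then obtain b where b: "\<And>i y. y \<in> B \<Longrightarrow> partial i u y * (- 1 / \<beta> (u y)) - y $ i = b i" by metis
  define x0 where "x0 = (\<chi> i. - b i)"
  have form: "norm (y - x0) = \<rho> * \<xi> y" if y: "y \<in> B" for y
  proof -
    have yS: "y \<in> S" using y BS by blast
    have "y - x0 = (- 1 / \<beta> (u y)) *\<^sub>R grad u y"
      using b[OF y] by (simp add: x0_def vec_eq_iff grad_def) (simp add: algebra_simps eq_diff_eq)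
    then have "norm (y - x0) = norm (grad u y) / \<beta> (u y)" using \<beta>p[OF yS] by simp
    moreover have "norm (grad u y) = \<rho> * (\<xi> y * \<beta> (u y))"
    proof -
      have "(norm (grad u y))\<^sup>2 = (\<rho> * (\<xi> y * \<beta> (u y)))\<^sup>2"
      proof -
        have "(norm (grad u y))\<^sup>2 = ym n ?J \<rho> m (u y)" using Dz[of y] y by (simp add: B_def D_def W_def)
        also have "\<dots> = \<rho>\<^sup>2 * (Pm n (\<xi> y))\<^sup>2" by (simp only: ym_def \<xi>_def)
        also have "Pm n (\<xi> y) = \<xi> y * \<beta> (u y)" unfolding \<beta>\<xi>[OF yS] using \<xi>[OF yS] by (simp add: Pm_eq)
        finally show ?thesis by (simp add: power_mult_distrib)
      qed
      then show ?thesis using \<rho> \<xi>[OF yS] \<beta>p[OF yS] by (simp add: power2_eq_iff_nonneg)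
    qed
    ultimately show ?thesis using \<beta>p[OF yS] by simp
  qed
  show ?thesis
  proof (intro exI[of _ x0] exI[of _ "r / 4"] conjI ballI)
    show "r / 4 > 0" using r by simp
    show "ball q (r / 4) \<subseteq> \<Omega>" using BS O2 by (auto simp: B_def S_def)
    fix x assume "x \<in> ball q (r / 4)"
    then have x: "x \<in> B" "x \<in> S" using BS by (auto simp: B_def)
    show "x \<noteq> x0" using form[OF x(1)] \<rho> \<xi>[OF x(2)] by auto
    have "Qm n (\<xi> x) = 2 * (m - u x) / \<rho>\<^sup>2"
      unfolding \<xi>_def by (rule chi_props(2)[OF J n]) (use lt[OF x(2)] \<rho> in simp)
    then show "u x = m - \<rho>\<^sup>2 / 2 * Qm n (norm (x - x0) / \<rho>)" unfolding form[OF x(1)] using \<rho> by (simp add: field_simps)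
  qed
qed

end

section \<open>Global rigidity\<close>

lemma Ck_on_Suc_D:
  assumes "open S" shows "Ck_on (Suc k) S f \<Longrightarrow> Ck_on k S f"
proof (induction k arbitrary: f)
  case 0
  then show ?case by (simp add: differentiable_imp_continuous_on)
next
  case (Suc k)
  then show ?case by (metis Ck_on.simps(2))
qed

lemma Ck_on_has_grad:
  assumes "open S" "Ck_on (Suc k) S f" "x \<in> S" shows "has_grad f (grad f x) x"
  using assms by (intro differentiable_has_grad) (auto simp: differentiable_on_eq_differentiable_at)

lemma has_grad_differentiable_on:
  assumes "open S" "\<And>x. x \<in> S \<Longrightarrow> has_grad f (g x) x" shows "f differentiable_on S"
  unfolding differentiable_on_eq_differentiable_at[OF assms(1)]
  using has_gradD[OF assms(2)] by (auto simp: differentiable_def)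

lemma Ck_on_add:
  assumes o: "open S" shows "Ck_on k S f \<Longrightarrow> Ck_on k S g \<Longrightarrow> Ck_on k S (\<lambda>x. f x + g x)"
proof (induction k arbitrary: f g)
  case 0
  then show ?case by (simp add: continuous_on_add)
next
  case (Suc k)
  have hg: "has_grad (\<lambda>x. f x + g x) (grad f x + grad g x) x" if "x \<in> S" for x
    by (rule has_grad_add[OF Ck_on_has_grad[OF o Suc.prems(1) that] Ck_on_has_grad[OF o Suc.prems(2) that]])
  have "Ck_on k S (partial i (\<lambda>x. f x + g x))" for i
  proof (rule Ck_on_cong_open[OF o])
    show "Ck_on k S (\<lambda>x. partial i f x + partial i g x)" using Suc.prems by (intro Suc.IH) auto
    show "partial i f y + partial i g y = partial i (\<lambda>x. f x + g x) y" if "y \<in> S" for y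
      using has_grad_partial[OF hg[OF that], of i] by (simp add: grad_def)
  qed
  then show ?case using has_grad_differentiable_on[OF o hg] by simp
qed

lemma Ck_on_mult:
  assumes o: "open S" shows "Ck_on k S f \<Longrightarrow> Ck_on k S g \<Longrightarrow> Ck_on k S (\<lambda>x. f x * g x)"
proof (induction k arbitrary: f g)
  case 0
  then show ?case by (simp add: continuous_on_mult)
next
  case (Suc k)
  have hg: "has_grad (\<lambda>x. f x * g x) (f x *\<^sub>R grad g x + g x *\<^sub>R grad f x) x" if "x \<in> S" for x
    by (rule has_grad_mult[OF Ck_on_has_grad[OF o Suc.prems(1) that] Ck_on_has_grad[OF o Suc.prems(2) that]])
  have lower: "Ck_on k S f" "Ck_on k S g" using Suc.prems Ck_on_Suc_D[OF o] by blast+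
  have "Ck_on k S (partial i (\<lambda>x. f x * g x))" for i
  proof (rule Ck_on_cong_open[OF o])
    show "Ck_on k S (\<lambda>x. f x * partial i g x + g x * partial i f x)"
      using Suc.prems lower by (intro Ck_on_add[OF o] Suc.IH) auto
    show "f y * partial i g y + g y * partial i f y = partial i (\<lambda>x. f x * g x) y" if "y \<in> S" for y
      using has_grad_partial[OF hg[OF that], of i] by (simp add: grad_def)
  qed
  then show ?case using has_grad_differentiable_on[OF o hg] by simp
qed

lemma Ck_on_const: "Ck_on k S (\<lambda>x. c)"
proof (induction k arbitrary: c)
  case (Suc k)
  have "partial i (\<lambda>x::real^'a. c) = (\<lambda>x. 0)" for i
    by (rule ext) (simp add: has_grad_partial[OF has_grad_const])
  then show ?case using Suc by simp
qed simp

lemma Ck_on_coordinate: "open S \<Longrightarrow> Ck_on k S (\<lambda>x. (x - a) $ i)"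
proof (cases k)
  case 0
  then show ?thesis by (simp add: continuous_intros)
next
  case (Suc l)
  assume o: "open S"
  have hg: "has_grad (\<lambda>y. (y - a) $ i) (axis i 1) x" for x
    using has_grad_diff[OF has_grad_component[of i x] has_grad_const[of "a $ i" x]] by simp
  have "partial j (\<lambda>y. (y - a) $ i) = (\<lambda>x. axis i 1 $ j)" for j
    by (rule ext) (rule has_grad_partial[OF hg])
  then show ?thesis using Suc has_grad_differentiable_on[OF o hg] by (simp add: Ck_on_const)
qed

text \<open>Powers of the squared distance reproduce themselves, up to coordinate factors, under
  partial derivatives off the centre; this drives the smoothness induction over all
  exponents.\<close>

definition radial_power :: "real^'n::finite \<Rightarrow> real \<Rightarrow> real^'n \<Rightarrow> real" where
  "radial_power x0 a x = ((norm (x - x0))\<^sup>2) powr a"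

lemma radial_power_grad:
  assumes "x \<noteq> x0"
  shows "has_grad (radial_power x0 a) ((2 * a * radial_power x0 (a - 1) x) *\<^sub>R (x - x0)) x"
proof -
  have "((\<lambda>t. t powr a) has_real_derivative a * ((norm (x - x0))\<^sup>2) powr (a - 1)) (at ((norm (x - x0))\<^sup>2))"
    by (rule has_real_derivative_powr) (use assms in simp)
  from has_grad_compose[OF has_grad_norm_sq this]
  show ?thesis by (simp add: radial_power_def [abs_def] mult_ac)
qed

lemma radial_power_partial:
  "x \<noteq> x0 \<Longrightarrow> partial i (radial_power x0 a) x = (2 * a) * ((x - x0) $ i * radial_power x0 (a - 1) x)"
  using has_grad_partial[OF radial_power_grad, of x x0 i a] by simp

lemma smooth_on_radial_power: "smooth_on (- {x0}) (radial_power x0 a)"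
proof -
  have o: "open (- {x0})" by auto
  have "Ck_on k (- {x0}) (radial_power x0 a)" for k
  proof (induction k arbitrary: a)
    case 0
    have "continuous_on (- {x0}) (radial_power x0 a)"
      by (rule has_grad_continuous_on[OF radial_power_grad]) auto
    then show ?case by simp
  next
    case (Suc k)
    have "Ck_on k (- {x0}) (partial i (radial_power x0 a))" for i
    proof (rule Ck_on_cong_open[OF o])
      show "Ck_on k (- {x0}) (\<lambda>x. (2 * a) * ((x - x0) $ i * radial_power x0 (a - 1) x))"
        by (intro Ck_on_mult[OF o] Ck_on_const Ck_on_coordinate[OF o] Suc)
      show "(2 * a) * ((x - x0) $ i * radial_power x0 (a - 1) x) = partial i (radial_power x0 a) x" if "x \<in> - {x0}" for x
        using radial_power_partial[of x x0 i a] that by simp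
    qed
    moreover have "radial_power x0 a differentiable_on - {x0}"
      by (rule has_grad_differentiable_on[OF o radial_power_grad]) auto
    ultimately show ?case by simp
  qed
  then show ?thesis using o by (simp add: smooth_on_def)
qed

lemma laplacian_radial_power:
  fixes x :: "real^'n::finite"
  assumes "x \<noteq> x0"
  shows "laplacian (radial_power x0 a) x = 2 * a * (real CARD('n) + 2 * a - 2) * radial_power x0 (a - 1) x"
proof -
  have o: "open (- {x0})" by auto
  define N where "N = (norm (x - x0))\<^sup>2"
  have N: "N > 0" using assms by (simp add: N_def)
  have NN: "N = (\<Sum>i\<in>UNIV. (x - x0) $ i * (x - x0) $ i)" unfolding N_def power2_norm_eq_inner inner_vec_def by simp
  have "partial i (partial i (radial_power x0 a)) x =
     (2 * a) * (radial_power x0 (a - 1) x + (2 * (a - 1) * radial_power x0 (a - 1 - 1) x) * ((x - x0) $ i * (x - x0) $ i))" for i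
  proof -
    have "partial i (partial i (radial_power x0 a)) x = partial i (\<lambda>y. (2 * a) * ((y - x0) $ i * radial_power x0 (a - 1) y)) x"
      by (rule partial_cong_open[OF o]) (use assms radial_power_partial in auto)
    moreover have "has_grad (\<lambda>y. (y - x0) $ i) (axis i 1) x"
      using has_grad_diff[OF has_grad_component[of i x] has_grad_const[of "x0 $ i" x]] by simp
    from has_grad_cmult[OF has_grad_mult[OF this radial_power_grad[OF assms, of "a - 1"]], of "2 * a"]
    have "partial i (\<lambda>y. (2 * a) * ((y - x0) $ i * radial_power x0 (a - 1) y)) x = 
      ((2 * a) *\<^sub>R ((x - x0) $ i *\<^sub>R ((2 * (a - 1) * radial_power x0 (a - 1 - 1) x) *\<^sub>R (x - x0)) + radial_power x0 (a - 1) x *\<^sub>R axis i 1)) $ i"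
      by (rule has_grad_partial)
    ultimately show ?thesis by (simp add: axis_def mult_ac)
  qed
  then have "laplacian (radial_power x0 a) x = (2 * a) * (real CARD('n) * radial_power x0 (a - 1) x + (2 * (a - 1) * radial_power x0 (a - 1 - 1) x) * N)"
    unfolding laplacian_def NN by (simp add: sum.distrib sum_distrib_left[symmetric])
  moreover have "radial_power x0 (a - 1 - 1) x * N = radial_power x0 (a - 1) x"
    unfolding radial_power_def N_def[symmetric] using N powr_add[of N "a - 1 - 1" 1] by simp
  ultimately have "laplacian (radial_power x0 a) x = (2 * a) * (real CARD('n) * radial_power x0 (a - 1) x + 2 * (a - 1) * radial_power x0 (a - 1) x)"
    by (simp only: mult.assoc)
  then show ?thesis by (simp add: algebra_simps)
qed

lemma laplacian_lincomb:
  assumes f: "smooth_on S f" and g: "smooth_on S g" and x: "x \<in> S"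
  shows "laplacian (\<lambda>x. a * f x + b * g x) x = a * laplacian f x + b * laplacian g x"
proof -
  have o: "open S" using f by (simp add: smooth_on_def)
  have p: "partial i (\<lambda>x. a * f x + b * g x) y = a * partial i f y + b * partial i g y"
    if "y \<in> S" "smooth_on S f" "smooth_on S g" for i y f g
    using has_grad_partial[OF has_grad_add[OF has_grad_cmult[OF smooth_on_has_grad[OF that(2,1)], of a] has_grad_cmult[OF smooth_on_has_grad[OF that(3,1)], of b]], of i]
    by (simp add: grad_def)
  have "partial i (partial i (\<lambda>x. a * f x + b * g x)) x = a * partial i (partial i f) x + b * partial i (partial i g) x" for i
  proof -
    have "partial i (partial i (\<lambda>x. a * f x + b * g x)) x = partial i (\<lambda>y. a * partial i f y + b * partial i g y) x"
      by (rule partial_cong_open[OF o x]) (rule p[OF _ f g])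
    then show ?thesis using p[OF x smooth_on_partial[OF f] smooth_on_partial[OF g]] by simp
  qed
  then show ?thesis by (simp add: laplacian_def sum.distrib sum_distrib_left)
qed

definition model_profile :: "real \<Rightarrow> real \<Rightarrow> real \<Rightarrow> real^'n::finite \<Rightarrow> real^'n \<Rightarrow> real" where
  "model_profile n m \<rho> x0 x = m - \<rho>\<^sup>2 / 2 * Qm n (norm (x - x0) / \<rho>)"

text \<open>The three radial powers are the constant, the squared distance and the fundamental
  solution of the Laplacian. The factor \<open>1 *\<close> gives the left side the shape of
  \<open>smooth_on_lincomb\<close>.\<close>

lemma model_profile_eq:
  assumes "n > 2" "\<rho> > 0" "x \<noteq> x0"
  shows "1 * ((m + \<rho>\<^sup>2 * n / (2 * (n - 2))) * radial_power x0 0 x + (- 1/2) * radial_power x0 1 x)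
     + (- (\<rho>\<^sup>2 / (n - 2) / \<rho> powr (2 - n))) * radial_power x0 ((2 - n) / 2) x = model_profile n m \<rho> x0 x"
proof -
  define t where "t = norm (x - x0)"
  have t: "t > 0" using assms by (simp add: t_def)
  have f1: "(t\<^sup>2) powr ((2 - n) / 2) = t powr (2 - n)"
  proof -
    have "(t\<^sup>2) powr ((2 - n) / 2) = (t powr 2) powr ((2 - n) / 2)" using t by simp
    also have "\<dots> = t powr (2 * ((2 - n) / 2))" by (rule powr_powr)
    also have "2 * ((2 - n) / 2) = 2 - n" by simp
    finally show ?thesis .
  qed
  have f2: "(t / \<rho>) powr (2 - n) = t powr (2 - n) / \<rho> powr (2 - n)" using t assms by (simp add: powr_divide)
  have f3: "(t\<^sup>2) powr 0 = 1" "(t\<^sup>2) powr 1 = t\<^sup>2" using t by auto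
  have gen: "1 * ((m + r * n / (2 * k)) * 1 + (- 1/2) * t2) + (- (r / k / B)) * A = m - r / 2 * (t2 / r + 2 / k * (A / B) - n / k)"
    if "r \<noteq> 0" "k \<noteq> 0" "B \<noteq> 0" for r k A B t2 :: real
    using that by (simp add: field_simps)
  show ?thesis
    unfolding radial_power_def model_profile_def Qm_def t_def[symmetric] power_divide f1 f2 f3
    by (rule gen) (use assms in auto)
qed

lemma model_profile_smooth:
  fixes x0 :: "real^'n::finite"
  assumes n: "n = real CARD('n)" "n > 2" and \<rho>: "\<rho> > 0"
  shows "smooth_on (- {x0}) (model_profile n m \<rho> x0)"
    and "x \<noteq> x0 \<Longrightarrow> laplacian (model_profile n m \<rho> x0) x = - n"
proof -
  let ?f = "\<lambda>x. (m + \<rho>\<^sup>2 * n / (2 * (n - 2))) * radial_power x0 0 x + (- 1/2) * radial_power x0 1 x"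
  let ?C = "- (\<rho>\<^sup>2 / (n - 2) / \<rho> powr (2 - n))"
  let ?h = "\<lambda>x. 1 * ?f x + ?C * radial_power x0 ((2 - n) / 2) x"
  have f: "smooth_on (- {x0}) ?f" by (intro smooth_on_lincomb smooth_on_radial_power)
  have h: "smooth_on (- {x0}) ?h" by (intro smooth_on_lincomb[OF f] smooth_on_radial_power)
  show "smooth_on (- {x0}) (model_profile n m \<rho> x0)"
    by (rule smooth_on_cong[OF h]) (use model_profile_eq[OF n(2) \<rho>] in auto)
  assume x: "x \<noteq> x0"
  have xs: "x \<in> - {x0}" using x by simp
  have "laplacian (model_profile n m \<rho> x0) x = laplacian ?h x"
  proof -
    have o: "open (- {x0})" by auto
    have e: "model_profile n m \<rho> x0 y = ?h y" if "y \<in> - {x0}" for y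
      using model_profile_eq[OF n(2) \<rho>, of y x0 m] that by simp
    have "partial i (model_profile n m \<rho> x0) y = partial i ?h y" if "y \<in> - {x0}" for i y
      by (rule partial_cong_open[OF o that]) (rule e)
    then have "partial i (partial i (model_profile n m \<rho> x0)) x = partial i (partial i ?h) x" for i
      by (intro partial_cong_open[OF o xs])
    then show ?thesis by (simp only: laplacian_def)
  qed
  also have "\<dots> = 1 * laplacian ?f x + ?C * laplacian (radial_power x0 ((2 - n) / 2)) x"
    by (rule laplacian_lincomb[OF f smooth_on_radial_power xs])
  also have "laplacian ?f x = (m + \<rho>\<^sup>2 * n / (2 * (n - 2))) * laplacian (radial_power x0 0) x + (- 1/2) * laplacian (radial_power x0 1) x"
    by (rule laplacian_lincomb[OF smooth_on_radial_power smooth_on_radial_power xs])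
  also have "laplacian (radial_power x0 0) x = 0" using laplacian_radial_power[OF x, of 0] by simp
  also have "laplacian (radial_power x0 1) x = 2 * n"
    using laplacian_radial_power[OF x, of 1] x n by (simp add: radial_power_def)
  also have "laplacian (radial_power x0 ((2 - n) / 2)) x = 0"
    using laplacian_radial_power[OF x, of "(2 - n) / 2"] n by (simp add: field_simps)
  finally show "laplacian (model_profile n m \<rho> x0) x = - n" by simp
qed

lemma Qm_less_iff:
  assumes n: "n > 2" and s: "s > 0" and t: "t > 0"
  shows "Qm n t < s \<longleftrightarrow> chi n {0<..1} s < t \<and> t < chi n {1..} s"
proof -
  have J: "is_branch {0<..1}" "is_branch {1..}" by (auto simp: is_branch_def)
  note a = chi_props[OF J(1) n less_imp_le[OF s]] chi_ne_1[OF J(1) n s]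
  note b = chi_props[OF J(2) n less_imp_le[OF s]] chi_ne_1[OF J(2) n s]
  define x y where "x = chi n {0<..1} s" and "y = chi n {1..} s"
  have x: "0 < x" "x < 1" "Qm n x = s" using a by (auto simp: x_def)
  have y: "1 < y" "Qm n y = s" using b by (auto simp: y_def)
  have "Qm n t < s \<longleftrightarrow> x < t \<and> t < y"
  proof (cases "t \<le> 1")
    case True
    then show ?thesis using x y t Qm_strict_decreasing[of x t n] Qm_strict_decreasing[of t x n] n
      by (cases t x rule: linorder_cases) auto
  next
    case False
    then show ?thesis using x y t Qm_strict_increasing[of y t n] Qm_strict_increasing[of t y n] n
      by (cases t y rule: linorder_cases) auto
  qed
  then show ?thesis by (simp add: x_def y_def)
qed

section \<open>Identification of the domain and of the solution\<close>

context ring_problem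
begin

text \<open>\<open>u\<close> minus the model is harmonic on \<open>\<Omega>\<close> without the
  centre, which is connected, so unique continuation applies. The centre cannot lie in
  \<open>\<Omega>\<close>, because the model is nonpositive near it while \<open>u > 0\<close>. The
  annulus where the model is positive is connected and contains no frontier point, as
  \<open>u\<close> would vanish there; hence it is all of \<open>\<Omega>\<close>.\<close>

lemma rigidity_global:
  assumes \<rho>: "\<rho> > 0" and \<delta>: "\<delta> > 0" "ball q \<delta> \<subseteq> \<Omega>"
    and loc: "\<And>x. x \<in> ball q \<delta> \<Longrightarrow> x \<noteq> x0 \<and> u x = model_profile n m \<rho> x0 x"
  defines "s \<equiv> 2 * m / \<rho>\<^sup>2"
  shows "\<Omega> = {x. \<rho> * chi n {0<..1} s < norm (x - x0) \<and> norm (x - x0) < \<rho> * chi n {1..} s}"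
    and "x \<in> \<Omega> \<Longrightarrow> u x = model_profile n m \<rho> x0 x"
proof -
  have s: "s > 0" using m_pos \<rho> by (simp add: s_def)
  have D2: "2 \<le> DIM(real^'n)" using n3 by simp
  define S where "S = \<Omega> - {x0}"
  have oS: "open S" using dom(1) by (simp add: S_def open_delete)
  have conn: "connected S" unfolding S_def by (rule connected_open_delete[OF dom(1,2) D2])
  have mp: "smooth_on S (model_profile n m \<rho> x0)"
    by (rule smooth_on_subset[OF model_profile_smooth(1)[OF n_eq n_gt_2 \<rho>] oS]) (auto simp: S_def)
  have us: "smooth_on S u" by (rule smooth_on_subset[OF u_smooth(2) oS]) (use Omega_V in \<open>auto simp: S_def\<close>)
  have eq: "u x = model_profile n m \<rho> x0 x" if "x \<in> S" for x
  proof -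
    have "1 * u x + (- 1) * model_profile n m \<rho> x0 x = 0"
    proof (rule harmonic_unique_continuation[OF smooth_on_lincomb[OF us mp] _ conn])
      show "laplacian (\<lambda>x. 1 * u x + (- 1) * model_profile n m \<rho> x0 x) y = 0" if "y \<in> S" for y
      proof -
        have "laplacian (model_profile n m \<rho> x0) y = - n"
          by (rule model_profile_smooth(2)[OF n_eq n_gt_2 \<rho>]) (use that in \<open>auto simp: S_def\<close>)
        moreover have "laplacian u y = - n" using pde that by (auto simp: S_def)
        ultimately show ?thesis unfolding laplacian_lincomb[OF us mp that] by simp
      qed
      show "open (ball q \<delta>)" "ball q \<delta> \<noteq> {}" using \<delta> by auto
      show "ball q \<delta> \<subseteq> S" using \<delta> loc[of x0] by (auto simp: S_def)
      show "1 * u y + (- 1) * model_profile n m \<rho> x0 y = 0" if "y \<in> ball q \<delta>" for y using loc[OF that] by simp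
      show "x \<in> S" by (rule that)
    qed
    then show ?thesis by simp
  qed
  have posiff: "model_profile n m \<rho> x0 x > 0 \<longleftrightarrow> \<rho> * chi n {0<..1} s < norm (x - x0) \<and> norm (x - x0) < \<rho> * chi n {1..} s" if "x \<noteq> x0" for x
  proof -
    have t: "norm (x - x0) / \<rho> > 0" using that \<rho> by simp
    have "model_profile n m \<rho> x0 x > 0 \<longleftrightarrow> Qm n (norm (x - x0) / \<rho>) < s"
      using \<rho> by (simp add: model_profile_def s_def field_simps)
    also have "\<dots> \<longleftrightarrow> chi n {0<..1} s < norm (x - x0) / \<rho> \<and> norm (x - x0) / \<rho> < chi n {1..} s"
      by (rule Qm_less_iff[OF n_gt_2 s t])
    finally show ?thesis using \<rho> by (simp add: field_simps)
  qed
  have x1: "\<rho> * chi n {0<..1} s > 0"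
    using chi_props(3)[of "{0<..1}" n s] s \<rho> n_gt_2 by (simp add: is_branch_def)
  have nx0: "x0 \<notin> \<Omega>"
  proof
    assume "x0 \<in> \<Omega>"
    then obtain d where d: "d > 0" "ball x0 d \<subseteq> \<Omega>" using dom(1) open_contains_ball by blast
    define t where "t = min (d / 2) (\<rho> * chi n {0<..1} s)"
    have t: "0 < t" "t < d" "t \<le> \<rho> * chi n {0<..1} s" using d x1 by (auto simp: t_def)
    obtain e :: "real^'n" where e: "norm e = 1" using norm_axis_1 by blast
    have y: "x0 + t *\<^sub>R e \<in> S" "norm (x0 + t *\<^sub>R e - x0) = t" using d(2) t e by (auto simp: S_def dist_norm subset_iff)
    have "model_profile n m \<rho> x0 (x0 + t *\<^sub>R e) > 0" using eq[OF y(1)] u_pos[of "x0 + t *\<^sub>R e"] y(1) by (auto simp: S_def)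
    then show False using posiff[of "x0 + t *\<^sub>R e"] y t by (auto simp: S_def)
  qed
  then have SO: "S = \<Omega>" by (auto simp: S_def)
  show eqO: "u x = model_profile n m \<rho> x0 x" if "x \<in> \<Omega>" for x using eq that SO by simp
  define Ann where "Ann = {x. \<rho> * chi n {0<..1} s < norm (x - x0) \<and> norm (x - x0) < \<rho> * chi n {1..} s}"
  have sub: "\<Omega> \<subseteq> Ann"
  proof
    fix x assume x: "x \<in> \<Omega>"
    then have "x \<noteq> x0" using nx0 by auto
    then show "x \<in> Ann" using posiff[of x] u_pos[OF x] eqO[OF x] by (simp add: Ann_def)
  qed
  have "Ann \<inter> frontier \<Omega> = {}"
  proof (rule ccontr)
    assume "Ann \<inter> frontier \<Omega> \<noteq> {}"
    then obtain y where y: "y \<in> Ann" "y \<in> frontier \<Omega>" by blast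
    have yn: "y \<noteq> x0" using y(1) x1 by (auto simp: Ann_def)
    have yc: "y \<in> closure \<Omega>" using y(2) by (simp add: frontier_def)
    obtain z where z: "\<And>k. z k \<in> \<Omega>" "z \<longlonglongrightarrow> y" using yc closure_sequential by blast
    have "isCont u y" using smooth_on_has_grad[OF u_smooth(2)] u_smooth(1) yc has_grad_continuous by blast
    then have "(\<lambda>k. u (z k)) \<longlonglongrightarrow> u y" by (rule isCont_tendsto_compose[OF _ z(2)])
    moreover have "isCont (model_profile n m \<rho> x0) y"
      using smooth_on_has_grad[OF model_profile_smooth(1)[OF n_eq n_gt_2 \<rho>]] yn has_grad_continuous by blast
    then have "(\<lambda>k. model_profile n m \<rho> x0 (z k)) \<longlonglongrightarrow> model_profile n m \<rho> x0 y" by (rule isCont_tendsto_compose[OF _ z(2)])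
    then have "(\<lambda>k. u (z k)) \<longlonglongrightarrow> model_profile n m \<rho> x0 y" using eqO[OF z(1)] by simp
    ultimately have "u y = model_profile n m \<rho> x0 y" by (rule LIMSEQ_unique)
    moreover have "model_profile n m \<rho> x0 y > 0" using posiff[OF yn] y(1) by (simp add: Ann_def)
    ultimately show False using bc[OF y(2)] by simp
  qed
  moreover have "connected Ann"
  proof -
    have "connected {x. \<rho> * chi n {0<..1} s < norm (x - x0) \<and> norm (x - x0) < \<rho> * chi n {1..} s}"
      using connected_annulus(1)[OF D2, of "\<rho> * chi n {0<..1} s" x0 "\<rho> * chi n {1..} s"] by simp
    then show ?thesis by (simp add: Ann_def)
  qed
  moreover have "q \<in> \<Omega>" using \<delta> by (meson centre_in_ball subsetD)
  then have "Ann \<inter> \<Omega> \<noteq> {}" using sub by auto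
  ultimately have "Ann - \<Omega> = {}" using connected_Int_frontier[of Ann \<Omega>] by blast
  then show "\<Omega> = {x. \<rho> * chi n {0<..1} s < norm (x - x0) \<and> norm (x - x0) < \<rho> * chi n {1..} s}"
    using sub by (auto simp: Ann_def)
qed

end

section \<open>Expected core radii\<close>

abbreviation outer_branch :: "real set" where "outer_branch \<equiv> {1..}"
abbreviation inner_branch :: "real set" where "inner_branch \<equiv> {0<..1}"

text \<open>Equals \<open>2 * uRmax n R / R^2\<close>, the value of \<open>Qm n\<close> at both
  scaled zeros \<open>r1 n R / R\<close> and \<open>r2 n R / R\<close>. It decreases in
  \<open>R > 0\<close>, and core radii are compared through it.\<close>

definition core_param :: "real \<Rightarrow> real \<Rightarrow> real" where
  "core_param n R = 1 / R\<^sup>2 - n / (n - 2)"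

lemma is_branch_inner: "is_branch inner_branch" and is_branch_outer: "is_branch outer_branch"
  by (auto simp: is_branch_def)

lemma Rmax_pos: "n > 2 \<Longrightarrow> Rmax n > 0" by (simp add: Rmax_def)

lemma core_param_pos: assumes "n > 2" "0 < R" "R < Rmax n" shows "core_param n R > 0"
proof -
  have "R\<^sup>2 < (Rmax n)\<^sup>2" using assms by (intro power_strict_mono) auto
  then have "R\<^sup>2 < (n - 2) / n" using assms by (simp add: Rmax_def)
  then have "R\<^sup>2 * n < n - 2" using assms by (simp add: field_simps)
  then show ?thesis using assms by (simp add: core_param_def field_simps)
qed

lemma core_param_surj:
  assumes "n > 2" "s > 0" obtains R where "0 < R" "R < Rmax n" "core_param n R = s"
proof -
  define R where "R = 1 / sqrt (s + n / (n - 2))"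
  have p: "s + n / (n - 2) > 0" using assms by (simp add: add_pos_pos)
  have R: "R > 0" using p by (simp add: R_def)
  have R2: "1 / R\<^sup>2 = s + n / (n - 2)" using p by (simp add: R_def power_divide)
  have "n / (n - 2) < 1 / R\<^sup>2" using R2 assms by simp
  then have "R\<^sup>2 < (n - 2) / n" using R assms by (simp add: field_simps)
  then have "R < Rmax n" unfolding Rmax_def using R by (simp add: real_less_rsqrt)
  then show thesis using that R R2 by (simp add: core_param_def)
qed

lemma core_param_inj: "0 < R \<Longrightarrow> 0 < R' \<Longrightarrow> core_param n R = core_param n R' \<Longrightarrow> R = R'"
  by (simp add: core_param_def power2_eq_iff_nonneg)

lemma core_param_le_iff: "0 < R \<Longrightarrow> 0 < R' \<Longrightarrow> core_param n R' \<le> core_param n R \<longleftrightarrow> R \<le> R'"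
  by (simp add: core_param_def field_simps power2_le_iff_abs_le)

lemma scaled_power:
  fixes R x n :: real
  assumes "R > 0" "x > 0" shows "R powr n / ((n - 2) * (R * x) powr (n - 2)) = R\<^sup>2 / (n - 2) * x powr (2 - n)"
proof -
  have "R powr n = R powr (n - 2) * R\<^sup>2" using assms powr_add[of R "n - 2" 2] by simp
  moreover have "(R * x) powr (n - 2) = R powr (n - 2) * x powr (n - 2)" using assms by (simp add: powr_mult)
  moreover have "x powr (2 - n) = 1 / x powr (n - 2)" using powr_minus_divide[of x "n - 2"] by simp
  ultimately show ?thesis using assms by simp
qed

lemma fR_eq:
  assumes "n > 2" "R > 0" "x > 0" shows "fR n R (R * x) = R\<^sup>2 * (core_param n R - Qm n x)"
proof -
  have "2 * R powr n / ((n - 2) * (R * x) powr (n - 2)) = 2 * (R\<^sup>2 / (n - 2) * x powr (2 - n))"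
    using scaled_power[OF assms(2,3), of n] by simp
  then have "fR n R (R * x) = 1 - R\<^sup>2 * x\<^sup>2 - 2 * (R\<^sup>2 / (n - 2) * x powr (2 - n))" by (simp add: fR_def power_mult_distrib)
  moreover have "R\<^sup>2 * (1 / R\<^sup>2) = 1" using assms by simp
  ultimately show ?thesis unfolding core_param_def Qm_def by (simp add: algebra_simps)
qed

lemma uR_eq:
  assumes "n > 2" "R > 0" "y \<noteq> 0" shows "uR n R y = R\<^sup>2 / 2 * (core_param n R - Qm n (norm y / R))"
proof -
  have y: "norm y = R * (norm y / R)" "norm y / R > 0" using assms by auto
  have "fR n R (norm y) = R\<^sup>2 * (core_param n R - Qm n (norm y / R))"
    using fR_eq[OF assms(1,2) y(2)] assms by simp
  moreover have "uR n R y = fR n R (norm y) / 2" by (simp add: uR_def fR_def field_simps)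
  ultimately show ?thesis by simp
qed

lemma r1_eq:
  assumes "n > 2" "0 < R" "R < Rmax n" shows "r1 n R = R * chi n inner_branch (core_param n R)"
  unfolding r1_def
proof (rule the_equality)
  note s = core_param_pos[OF assms]
  note c = chi_props[OF is_branch_inner assms(1) less_imp_le[OF s]] chi_ne_1[OF is_branch_inner assms(1) s]
  show "0 < R * chi n inner_branch (core_param n R) \<and> R * chi n inner_branch (core_param n R) < R \<and> fR n R (R * chi n inner_branch (core_param n R)) = 0"
    using c assms fR_eq[OF assms(1,2) c(3)] by auto
  fix r assume r: "0 < r \<and> r < R \<and> fR n R r = 0"
  then have p: "r / R > 0" "r / R < 1" "R * (r / R) = r" using assms by auto
  then have "Qm n (r / R) = core_param n R" using fR_eq[OF assms(1,2) p(1)] r assms by simp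
  then have "chi n inner_branch (core_param n R) = r / R"
    using chi_Qm[OF is_branch_inner assms(1), of "r / R"] p by simp
  then show "r = R * chi n inner_branch (core_param n R)" using assms by simp
qed

lemma r2_eq:
  assumes "n > 2" "0 < R" "R < Rmax n" shows "r2 n R = R * chi n outer_branch (core_param n R)"
  unfolding r2_def
proof (rule the_equality)
  note s = core_param_pos[OF assms]
  note c = chi_props[OF is_branch_outer assms(1) less_imp_le[OF s]] chi_ne_1[OF is_branch_outer assms(1) s]
  show "R < R * chi n outer_branch (core_param n R) \<and> fR n R (R * chi n outer_branch (core_param n R)) = 0"
    using c assms fR_eq[OF assms(1,2) c(3)] by auto
  fix r assume r: "R < r \<and> fR n R r = 0"
  then have p: "r / R > 1" "r / R > 0" "R * (r / R) = r" using assms by auto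
  then have "Qm n (r / R) = core_param n R" using fR_eq[OF assms(1,2) p(2)] r assms by simp
  then have "chi n outer_branch (core_param n R) = r / R"
    using chi_Qm[OF is_branch_outer assms(1), of "r / R"] p by simp
  then show "r = R * chi n outer_branch (core_param n R)" using assms by simp
qed

text \<open>The two stresses are the same expression up to the sign of
  \<open>1 - x powr (-n)\<close>; the absolute value covers both branches.\<close>

lemma tau_value:
  assumes "n > 2" "0 < R" "x > 0" "Qm n x = core_param n R" "core_param n R > 0"
  shows "\<bar>R * x * (R powr n / (R * x) powr n - 1) / sqrt (1 - n * R\<^sup>2 / (n - 2))\<bar> = sqrt (Tm n x)"
proof -
  have q: "Qm n x > 0" using assms by simp
  have "R powr n / (R * x) powr n = x powr (- n)" using assms by (simp add: powr_mult powr_minus_divide)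
  then have "R * x * (R powr n / (R * x) powr n - 1) = - (R * Pm n x)" using assms by (simp add: Pm_eq algebra_simps)
  moreover have "1 - n * R\<^sup>2 / (n - 2) = R\<^sup>2 * Qm n x"
    unfolding assms(4) core_param_def using assms by (simp add: right_diff_distrib)
  moreover have "sqrt (R\<^sup>2 * Qm n x) = R * sqrt (Qm n x)" using assms by (simp add: real_sqrt_mult)
  ultimately have "\<bar>R * x * (R powr n / (R * x) powr n - 1) / sqrt (1 - n * R\<^sup>2 / (n - 2))\<bar> = \<bar>Pm n x\<bar> / sqrt (Qm n x)"
    using assms q by (simp add: abs_mult)
  also have "\<dots> = sqrt (Tm n x)" by (simp add: Tm_def real_sqrt_divide)
  finally show ?thesis .
qed

lemma tau1_eq:
  assumes "n > 2" "0 < R" "R < Rmax n" shows "tau1 n R = sqrt (Tm n (chi n inner_branch (core_param n R)))"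
proof -
  note s = core_param_pos[OF assms]
  define x where "x = chi n inner_branch (core_param n R)"
  note c = chi_props[OF is_branch_inner assms(1) less_imp_le[OF s]] chi_ne_1[OF is_branch_inner assms(1) s]
  have x: "0 < x" "x < 1" "Qm n x = core_param n R" using c by (auto simp: x_def)
  have "tau1 n R = R * x * (R powr n / (R * x) powr n - 1) / sqrt (1 - n * R\<^sup>2 / (n - 2))"
    unfolding tau1_def r1_eq[OF assms] x_def[symmetric] using assms by simp
  moreover have "R * x * (R powr n / (R * x) powr n - 1) / sqrt (1 - n * R\<^sup>2 / (n - 2)) \<ge> 0"
  proof -
    have "R powr n / (R * x) powr n = x powr (- n)" using assms x by (simp add: powr_mult powr_minus_divide)
    then have "R powr n / (R * x) powr n - 1 \<ge> 0" using sigma_gt_1[OF x(1,2) assms(1)] by simp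
    moreover have "1 - n * R\<^sup>2 / (n - 2) \<ge> 0"
    proof -
      have "1 - n * R\<^sup>2 / (n - 2) = R\<^sup>2 * core_param n R" unfolding core_param_def using assms by (simp add: right_diff_distrib)
      then show ?thesis using s by simp
    qed
    ultimately show ?thesis using assms x by simp
  qed
  ultimately show ?thesis using tau_value[OF assms(1,2) x(1,3) s] unfolding x_def[symmetric] by (metis abs_of_nonneg)
qed

lemma tau2_eq:
  assumes "n > 2" "0 < R" "R < Rmax n" shows "tau2 n R = sqrt (Tm n (chi n outer_branch (core_param n R)))"
proof -
  note s = core_param_pos[OF assms]
  define x where "x = chi n outer_branch (core_param n R)"
  note c = chi_props[OF is_branch_outer assms(1) less_imp_le[OF s]] chi_ne_1[OF is_branch_outer assms(1) s]
  have x: "0 < x" "1 < x" "Qm n x = core_param n R" using c by (auto simp: x_def)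
  have "tau2 n R = R * x * (1 - R powr n / (R * x) powr n) / sqrt (1 - n * R\<^sup>2 / (n - 2))"
    unfolding tau2_def r2_eq[OF assms] x_def[symmetric] using assms by simp
  also have "\<dots> = - (R * x * (R powr n / (R * x) powr n - 1) / sqrt (1 - n * R\<^sup>2 / (n - 2)))"
  proof -
    have "A * (1 - a) / s = - (A * (a - 1) / s)" for A a s :: real by (simp add: algebra_simps diff_divide_distrib)
    then show ?thesis .
  qed
  finally have "tau2 n R = - (R * x * (R powr n / (R * x) powr n - 1) / sqrt (1 - n * R\<^sup>2 / (n - 2)))" .
  moreover have "R * x * (R powr n / (R * x) powr n - 1) / sqrt (1 - n * R\<^sup>2 / (n - 2)) \<le> 0"
  proof -
    have "R powr n / (R * x) powr n = x powr (- n)" using assms x by (simp add: powr_mult powr_minus_divide)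
    then have "R powr n / (R * x) powr n - 1 \<le> 0" using sigma_lt_1[OF x(2) assms(1)] by simp
    moreover have "1 - n * R\<^sup>2 / (n - 2) \<ge> 0"
    proof -
      have "1 - n * R\<^sup>2 / (n - 2) = R\<^sup>2 * core_param n R" unfolding core_param_def using assms by (simp add: right_diff_distrib)
      then show ?thesis using s by simp
    qed
    ultimately show ?thesis using assms x by (simp add: divide_nonpos_nonneg mult_nonneg_nonpos)
  qed
  ultimately show ?thesis using tau_value[OF assms(1,2) x(1,3) s] unfolding x_def[symmetric] by (metis abs_of_nonpos)
qed

lemma Tm_inj:
  assumes "n > 2" "0 < x" "0 < y" "x < 1 \<and> y < 1 \<or> 1 < x \<and> 1 < y" "Tm n x = Tm n y" shows "x = y"
  using assms Tm_strict_decreasing[of x y n] Tm_strict_decreasing[of y x n] by (cases x y rule: linorder_cases) auto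

lemma chi_inner_range: "n > 2 \<Longrightarrow> s > 0 \<Longrightarrow> 0 < chi n inner_branch s \<and> chi n inner_branch s < 1"
  using chi_props[OF is_branch_inner, of n s] chi_ne_1[OF is_branch_inner, of n s] by auto

lemma chi_outer_range: "n > 2 \<Longrightarrow> s > 0 \<Longrightarrow> 1 < chi n outer_branch s"
  using chi_props[OF is_branch_outer, of n s] chi_ne_1[OF is_branch_outer, of n s] by auto

lemma inner_core_radius:
  assumes n: "n > 2" and x: "0 < x" "x < 1" and R: "0 < R" "R < Rmax n" "core_param n R = Qm n x"
    and t: "t = sqrt (Tm n x)"
  shows "core_radius_wd n t" "core_radius n t = R"
proof -
  have tn: "t > sqrt n" using Tm_gt_inner[OF x n] t by simp
  have chix: "chi n inner_branch (core_param n R) = x"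
    unfolding R(3) by (rule chi_Qm[OF is_branch_inner n]) (use x in simp)
  have tau: "tau1 n R = t" unfolding tau1_eq[OF n R(1,2)] chix t ..
  have uniq: "R' = R" if "0 < R' \<and> R' \<le> Rmax n \<and> tau1 n R' = t" for R'
  proof -
    have "R' \<noteq> Rmax n" using that tn by (auto simp: tau1_def)
    then have R': "0 < R'" "R' < Rmax n" using that by auto
    let ?y = "chi n inner_branch (core_param n R')"
    have y: "0 < ?y" "?y < 1" using chi_inner_range[OF n core_param_pos[OF n R']] by auto
    have "sqrt (Tm n ?y) = sqrt (Tm n x)" using that tau1_eq[OF n R'] t by simp
    then have "?y = x" using Tm_inj[OF n y(1) x(1)] y x by simp
    moreover have "Qm n ?y = core_param n R'"
      by (rule chi_props(2)[OF is_branch_inner n less_imp_le[OF core_param_pos[OF n R']]])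
    ultimately show ?thesis using core_param_inj[OF R'(1) R(1), of n] R(3) by simp
  qed
  then have ex: "\<exists>!R. 0 < R \<and> R \<le> Rmax n \<and> tau1 n R = t" using R tau by (intro ex1I[of _ R]) auto
  then show "core_radius_wd n t" unfolding core_radius_wd_def using tn by auto
  show "core_radius n t = R" unfolding core_radius_def using tn R tau uniq by (auto intro!: the_equality)
qed

lemma outer_core_radius:
  assumes n: "n > 2" and x: "1 < x" and R: "0 < R" "R < Rmax n" "core_param n R = Qm n x"
    and t: "t = sqrt (Tm n x)"
  shows "core_radius_wd n t" "core_radius n t = R"
proof -
  have tn: "1 < t" "t < sqrt n" using Tm_bounds_outer[OF x n] t by auto
  have chix: "chi n outer_branch (core_param n R) = x"
    unfolding R(3) by (rule chi_Qm[OF is_branch_outer n]) (use x in simp)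
  have tau: "tau2 n R = t" unfolding tau2_eq[OF n R(1,2)] chix t ..
  have uniq: "R' = R" if "0 \<le> R' \<and> R' < Rmax n \<and> tau2 n R' = t" for R'
  proof -
    have "R' \<noteq> 0" using that tn by (auto simp: tau2_def)
    then have R': "0 < R'" "R' < Rmax n" using that by auto
    let ?y = "chi n outer_branch (core_param n R')"
    have y: "1 < ?y" using chi_outer_range[OF n core_param_pos[OF n R']] by auto
    have "sqrt (Tm n ?y) = sqrt (Tm n x)" using that tau2_eq[OF n R'] t by simp
    then have "?y = x" using Tm_inj[OF n, of ?y x] y x by simp
    moreover have "Qm n ?y = core_param n R'"
      by (rule chi_props(2)[OF is_branch_outer n less_imp_le[OF core_param_pos[OF n R']]])
    ultimately show ?thesis using core_param_inj[OF R'(1) R(1), of n] R(3) by simp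
  qed
  then have ex: "\<exists>!R. 0 \<le> R \<and> R < Rmax n \<and> tau2 n R = t" using R tau by (intro ex1I[of _ R]) auto
  then show "core_radius_wd n t" unfolding core_radius_wd_def using tn by auto
  show "core_radius n t = R" unfolding core_radius_def using tn R tau uniq by (auto intro!: the_equality)
qed

lemma inner_core_radius_ex:
  assumes n: "n > 2" and t: "t > sqrt n"
  obtains x R where "0 < x" "x < 1" "Tm n x = t\<^sup>2" "0 < R" "R < Rmax n" "core_param n R = Qm n x"
    "core_radius_wd n t" "core_radius n t = R"
proof -
  have sn: "sqrt n > 0" using n by simp
  have "(sqrt n)\<^sup>2 < t\<^sup>2" using t sn by (intro power_strict_mono) auto
  then have "t\<^sup>2 > n" using n by simp
  then obtain x where x: "0 < x" "x < 1" "Tm n x = t\<^sup>2" using Tm_surj_inner[OF n] by blast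
  have "Qm n x > 0" using Qm_pos[of x n] x n by simp
  then obtain R where R: "0 < R" "R < Rmax n" "core_param n R = Qm n x" using core_param_surj[OF n] by blast
  have "t > 0" using t sn by linarith
  then have "t = sqrt (Tm n x)" using x(3) by simp
  from inner_core_radius[OF n x(1,2) R this] show thesis using that[OF x R] by blast
qed

lemma outer_core_radius_ex:
  assumes n: "n > 2" and t: "1 < t" "t < sqrt n"
  obtains x R where "1 < x" "Tm n x = t\<^sup>2" "0 < R" "R < Rmax n" "core_param n R = Qm n x"
    "core_radius_wd n t" "core_radius n t = R"
proof -
  have "t\<^sup>2 < (sqrt n)\<^sup>2" using t by (intro power_strict_mono) auto
  then have "t\<^sup>2 < n" using n by simp
  moreover have "1 < t\<^sup>2" using t by (simp add: one_less_power)
  ultimately obtain x where x: "1 < x" "Tm n x = t\<^sup>2" using Tm_surj_outer[OF n] by blast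
  have "Qm n x > 0" using Qm_pos[of x n] x n by simp
  then obtain R where R: "0 < R" "R < Rmax n" "core_param n R = Qm n x" using core_param_surj[OF n] by blast
  have "t = sqrt (Tm n x)" using x(2) t by simp
  from outer_core_radius[OF n x(1) R this] show thesis using that[OF x R] by blast
qed

text \<open>The borderline stress belongs to \<open>Rmax n\<close> through the special value of
  \<open>tau1\<close>; smaller radii give \<open>T > n\<close>.\<close>

lemma core_radius_wd_sqrt: assumes n: "n > 2" shows "core_radius_wd n (sqrt n)"
proof -
  have uniq: "R = Rmax n" if "0 < R \<and> R \<le> Rmax n \<and> tau1 n R = sqrt n" for R
  proof (rule ccontr)
    assume "R \<noteq> Rmax n"
    then have R: "0 < R" "R < Rmax n" using that by auto
    have "Tm n (chi n inner_branch (core_param n R)) > n"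
      using Tm_gt_inner chi_inner_range[OF n core_param_pos[OF n R]] n by blast
    then show False using tau1_eq[OF n R] that by simp
  qed
  have "0 < Rmax n \<and> Rmax n \<le> Rmax n \<and> tau1 n (Rmax n) = sqrt n" using Rmax_pos[OF n] by (simp add: tau1_def)
  then have "\<exists>!R. 0 < R \<and> R \<le> Rmax n \<and> tau1 n R = sqrt n" by (rule ex1I) (rule uniq)
  then show ?thesis by (simp add: core_radius_wd_def)
qed

lemma core_radius_wd_gt_1: assumes "n > 2" "t > 1" shows "core_radius_wd n t"
proof (cases t "sqrt n" rule: linorder_cases)
  case less
  then show ?thesis using outer_core_radius_ex[OF assms(1,2)] by blast
next
  case equal
  then show ?thesis using core_radius_wd_sqrt[OF assms(1)] by simp
next
  case greater
  then show ?thesis using inner_core_radius_ex[OF assms(1)] by blast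
qed

text \<open>The normalized curvature of the model sphere is scale invariant and depends only on the
  boundary value \<open>q\<close> of \<open>Qm n\<close>. Both bounds of the theorem are compared in
  this form.\<close>

lemma model_curvature:
  assumes "n > 2" "0 < R" "core_param n R = q"
  shows "(n - 1) / R * sqrt (uRmax n R) = (n - 1) * sqrt (q / 2)"
proof -
  have "uRmax n R = R\<^sup>2 * (q / 2)"
    unfolding uRmax_def assms(3)[symmetric] core_param_def using assms by (simp add: field_simps)
  then have "sqrt (uRmax n R) = R * sqrt (q / 2)" using assms by (simp only: real_sqrt_mult real_sqrt_abs)
  then show ?thesis using assms by simp
qed

section \<open>Curvature bounds and core radii\<close>

lemma Qm_nonneg: "n > 2 \<Longrightarrow> x > 0 \<Longrightarrow> Qm n x \<ge> 0"
  using Qm_pos[of x n] Qm_1[of n] by (cases "x = 1") auto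

context ring_problem
begin

text \<open>The core radius for which the model with maximum \<open>m\<close> has its zero at scaled
  radius \<open>\<xi>\<close>.\<close>

definition model_scale :: "real \<Rightarrow> real" where
  "model_scale \<xi> = sqrt (2 * m / Qm n \<xi>)"

lemma model_scale_props:
  assumes "\<xi> > 0" "\<xi> \<noteq> 1"
  shows "model_scale \<xi> > 0" "2 * m / (model_scale \<xi>)\<^sup>2 = Qm n \<xi>"
    "(n - 1) / model_scale \<xi> * sqrt m = (n - 1) * sqrt (Qm n \<xi> / 2)"
proof -
  have Q: "Qm n \<xi> > 0" by (rule Qm_pos[OF assms n_gt_2])
  show "model_scale \<xi> > 0" using Q m_pos by (simp add: model_scale_def)
  have s2: "(model_scale \<xi>)\<^sup>2 = 2 * m / Qm n \<xi>" using Q m_pos by (simp add: model_scale_def)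
  show "2 * m / (model_scale \<xi>)\<^sup>2 = Qm n \<xi>" unfolding s2 using Q m_pos by simp
  have "sqrt m / model_scale \<xi> = sqrt (Qm n \<xi> / 2)"
    unfolding model_scale_def real_sqrt_divide[symmetric] using Q m_pos by simp
  moreover have "(n - 1) / model_scale \<xi> * sqrt m = (n - 1) * (sqrt m / model_scale \<xi>)" by simp
  ultimately show "(n - 1) / model_scale \<xi> * sqrt m = (n - 1) * sqrt (Qm n \<xi> / 2)" by (simp only:)
qed

text \<open>Translates the boundary hypothesis of the comparison into a bound of the squared wall
  shear stress by \<open>Tm n \<xi>\<close>.\<close>

lemma ym_zero:
  assumes "is_branch J" "\<xi> \<in> J" "\<xi> \<noteq> 1"
  shows "ym n J (model_scale \<xi>) m 0 = 2 * m * Tm n \<xi>"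
proof -
  have x: "\<xi> > 0" by (rule branch_pos[OF assms(1,2)])
  note sp = model_scale_props[OF x assms(3)]
  have Q: "Qm n \<xi> > 0" by (rule Qm_pos[OF x assms(3) n_gt_2])
  have "chi n J (2 * (m - 0) / (model_scale \<xi>)\<^sup>2) = \<xi>"
    using chi_Qm[OF assms(1) n_gt_2 assms(2)] sp(2) by simp
  then have "ym n J (model_scale \<xi>) m 0 = (model_scale \<xi>)\<^sup>2 * (Pm n \<xi>)\<^sup>2" by (simp add: ym_def)
  also have "(model_scale \<xi>)\<^sup>2 = 2 * m / Qm n \<xi>" using Q m_pos by (simp add: model_scale_def)
  finally show ?thesis by (simp add: Tm_def)
qed

lemma Omega_i: "\<Omega>1 \<subseteq> \<Omega>" "\<Omega>2 \<subseteq> \<Omega>" using divide(1) by auto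

lemma Gamma_frontier: "\<Gamma>1 \<subseteq> frontier \<Omega>" "\<Gamma>2 \<subseteq> frontier \<Omega>" using sides by auto

lemma Gamma_closure: "\<Gamma>1 \<subseteq> closure \<Omega>" "\<Gamma>2 \<subseteq> closure \<Omega>"
  using Gamma_frontier by (auto simp: frontier_def)

lemma comparison_1:
  assumes "is_branch J" "\<xi> \<in> J" "\<xi> \<noteq> 1" "\<And>x. x \<in> \<Gamma>1 \<Longrightarrow> (norm (grad u x))\<^sup>2 \<le> 2 * m * Tm n \<xi>" "x \<in> \<Omega>1"
  shows "(norm (grad u x))\<^sup>2 \<le> ym n J (model_scale \<xi>) m (u x)"
proof (rule region_comparison[OF divide(3) Omega_i(1) assms(1) model_scale_props(1)[OF branch_pos[OF assms(1,2)] assms(3)] _ assms(5)])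
  fix y assume "y \<in> frontier \<Omega>1"
  then consider "y \<in> \<Sigma>" | "y \<in> \<Gamma>1" using frontier_1 by blast
  then show "y \<in> \<Sigma> \<or> (norm (grad u y))\<^sup>2 \<le> ym n J (model_scale \<xi>) m (u y)"
  proof cases
    case 2
    then have "u y = 0" using bc Gamma_frontier by auto
    then show ?thesis using assms(4)[OF 2] ym_zero[OF assms(1-3)] by simp
  qed simp
qed

lemma comparison_2:
  assumes "is_branch J" "\<xi> \<in> J" "\<xi> \<noteq> 1" "\<And>x. x \<in> \<Gamma>2 \<Longrightarrow> (norm (grad u x))\<^sup>2 \<le> 2 * m * Tm n \<xi>" "x \<in> \<Omega>2"
  shows "(norm (grad u x))\<^sup>2 \<le> ym n J (model_scale \<xi>) m (u x)"
proof (rule region_comparison[OF divide(4) Omega_i(2) assms(1) model_scale_props(1)[OF branch_pos[OF assms(1,2)] assms(3)] _ assms(5)])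
  fix y assume "y \<in> frontier \<Omega>2"
  then consider "y \<in> \<Sigma>" | "y \<in> \<Gamma>2" using frontier_2 by blast
  then show "y \<in> \<Sigma> \<or> (norm (grad u y))\<^sup>2 \<le> ym n J (model_scale \<xi>) m (u y)"
  proof cases
    case 2
    then have "u y = 0" using bc Gamma_frontier by auto
    then show ?thesis using assms(4)[OF 2] ym_zero[OF assms(1-3)] by simp
  qed simp
qed

text \<open>The pairings of side and branch that are used: outer models on \<open>\<Omega>2\<close>,
  and both kinds of models on \<open>\<Omega>1\<close>. The middle one serves to refute a wall shear
  stress of at most 1 on \<open>\<Gamma>1\<close>.\<close>

lemma curvature_claims:
  assumes p: "p \<in> \<Sigma>" "mean_curvature_at \<Sigma> \<Omega>1 p h"
  shows "1 < \<xi> \<Longrightarrow> (\<And>x. x \<in> \<Gamma>2 \<Longrightarrow> (norm (grad u x))\<^sup>2 \<le> 2 * m * Tm n \<xi>) \<Longrightarrow> (n - 1) * sqrt (Qm n \<xi> / 2) \<le> h * sqrt m"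
    and "1 < \<xi> \<Longrightarrow> (\<And>x. x \<in> \<Gamma>1 \<Longrightarrow> (norm (grad u x))\<^sup>2 \<le> 2 * m * Tm n \<xi>) \<Longrightarrow> (n - 1) * sqrt (Qm n \<xi> / 2) \<le> - h * sqrt m"
    and "0 < \<xi> \<Longrightarrow> \<xi> < 1 \<Longrightarrow> (\<And>x. x \<in> \<Gamma>1 \<Longrightarrow> (norm (grad u x))\<^sup>2 \<le> 2 * m * Tm n \<xi>) \<Longrightarrow> h * sqrt m \<le> (n - 1) * sqrt (Qm n \<xi> / 2)"
proof -
  have sm: "sqrt m \<ge> 0" using m_pos by simp
  {
    assume x: "1 < \<xi>" and b: "\<And>x. x \<in> \<Gamma>2 \<Longrightarrow> (norm (grad u x))\<^sup>2 \<le> 2 * m * Tm n \<xi>"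
    then have x': "\<xi> > 0" "\<xi> \<noteq> 1" "\<xi> \<in> outer_branch" by auto
    have "h \<ge> (if outer_branch = outer_branch then 1 else - 1) * (n - 1) / model_scale \<xi>"
      by (rule curvature_bounds(1)[OF p is_branch_outer model_scale_props(1)[OF x'(1,2)]])
        (rule comparison_2[OF is_branch_outer x'(3,2) b])
    then have "(n - 1) / model_scale \<xi> * sqrt m \<le> h * sqrt m" using sm by (intro mult_right_mono) auto
    then show "(n - 1) * sqrt (Qm n \<xi> / 2) \<le> h * sqrt m" unfolding model_scale_props(3)[OF x'(1,2)] .
  }
  {
    assume x: "1 < \<xi>" and b: "\<And>x. x \<in> \<Gamma>1 \<Longrightarrow> (norm (grad u x))\<^sup>2 \<le> 2 * m * Tm n \<xi>"
    then have x': "\<xi> > 0" "\<xi> \<noteq> 1" "\<xi> \<in> outer_branch" by auto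
    have "- h \<ge> (if outer_branch = outer_branch then 1 else - 1) * (n - 1) / model_scale \<xi>"
      by (rule curvature_bounds(2)[OF p is_branch_outer model_scale_props(1)[OF x'(1,2)]])
        (rule comparison_1[OF is_branch_outer x'(3,2) b])
    then have "(n - 1) / model_scale \<xi> * sqrt m \<le> - h * sqrt m" using sm by (intro mult_right_mono) auto
    then show "(n - 1) * sqrt (Qm n \<xi> / 2) \<le> - h * sqrt m" unfolding model_scale_props(3)[OF x'(1,2)] .
  }
  {
    assume x: "0 < \<xi>" "\<xi> < 1" and b: "\<And>x. x \<in> \<Gamma>1 \<Longrightarrow> (norm (grad u x))\<^sup>2 \<le> 2 * m * Tm n \<xi>"
    then have x': "\<xi> > 0" "\<xi> \<noteq> 1" "\<xi> \<in> inner_branch" by auto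
    have "- h \<ge> (if inner_branch = outer_branch then 1 else - 1) * (n - 1) / model_scale \<xi>"
      by (rule curvature_bounds(2)[OF p is_branch_inner model_scale_props(1)[OF x'(1,2)]])
        (rule comparison_1[OF is_branch_inner x'(3,2) b])
    moreover have ne: "inner_branch \<noteq> outer_branch"
    proof -
      have "(2::real) \<notin> inner_branch" "(2::real) \<in> outer_branch" by auto
      then show ?thesis by blast
    qed
    ultimately have "- h \<ge> (- 1) * (n - 1) / model_scale \<xi>" by (simp only: if_False)
    moreover have "(- 1) * (n - 1) / model_scale \<xi> = - ((n - 1) / model_scale \<xi>)"
      by (simp only: minus_divide_left mult_minus_left mult_1_left)
    ultimately have "h \<le> (n - 1) / model_scale \<xi>" by linarith
    then have "h * sqrt m \<le> (n - 1) / model_scale \<xi> * sqrt m" using sm by (intro mult_right_mono) auto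
    then show "h * sqrt m \<le> (n - 1) * sqrt (Qm n \<xi> / 2)" unfolding model_scale_props(3)[OF x'(1,2)] .
  }
qed

section \<open>Wall shear stresses of the two boundary components\<close>

lemma norm_grad_cont: "continuous_on (closure \<Omega>) (\<lambda>x. norm (grad u x))"
  using continuous_on_real_sqrt[OF W_cont] by simp

lemma nwss_bound:
  assumes "\<Gamma> \<subseteq> closure \<Omega>" "x \<in> \<Gamma>"
  shows "(norm (grad u x))\<^sup>2 \<le> 2 * m * (nwss \<Omega> u \<Gamma>)\<^sup>2" "nwss \<Omega> u \<Gamma> \<ge> 0"
proof -
  have "compact ((\<lambda>x. norm (grad u x)) ` closure \<Omega>)"
    by (rule compact_continuous_image[OF norm_grad_cont compact_closure])
  then have "bdd_above ((\<lambda>x. norm (grad u x)) ` closure \<Omega>)" by (intro bounded_imp_bdd_above compact_imp_bounded)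
  then have bdd: "bdd_above ((\<lambda>x. norm (grad u x)) ` \<Gamma>)" by (rule bdd_above_mono) (use assms in auto)
  have le: "norm (grad u x) \<le> (SUP x\<in>\<Gamma>. norm (grad u x))" by (rule cSUP_upper[OF assms(2) bdd])
  have s: "sqrt (2 * m) > 0" using m_pos by simp
  have n1: "nwss \<Omega> u \<Gamma> * sqrt (2 * m) = (SUP x\<in>\<Gamma>. norm (grad u x))"
    using m_pos by (simp add: nwss_def m_eq[symmetric])
  then have "norm (grad u x) \<le> nwss \<Omega> u \<Gamma> * sqrt (2 * m)" using le by simp
  then have "(norm (grad u x))\<^sup>2 \<le> (nwss \<Omega> u \<Gamma> * sqrt (2 * m))\<^sup>2" by (intro power_mono) auto
  also have "\<dots> = 2 * m * (nwss \<Omega> u \<Gamma>)\<^sup>2" using m_pos by (simp add: power_mult_distrib)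
  finally show "(norm (grad u x))\<^sup>2 \<le> 2 * m * (nwss \<Omega> u \<Gamma>)\<^sup>2" .
  have "0 \<le> nwss \<Omega> u \<Gamma> * sqrt (2 * m)" using n1 le norm_ge_zero[of "grad u x"] by linarith
  then show "nwss \<Omega> u \<Gamma> \<ge> 0" using s by (simp add: zero_le_mult_iff)
qed

lemma Gamma_components: "\<Gamma>1 \<in> components (frontier \<Omega>)" "\<Gamma>2 \<in> components (frontier \<Omega>)"
  using comps(1) by auto

lemma Gamma_nonempty: "\<Gamma>1 \<noteq> {}" "\<Gamma>2 \<noteq> {}"
  using Gamma_components in_components_nonempty by blast+

lemma Gamma_disjoint: "\<Gamma>1 \<inter> \<Gamma>2 = {}"
  using components_nonoverlap[OF Gamma_components] comps(2) by blast

lemma unbounded_outer: "\<exists>\<xi>>1. (n - 1) * sqrt (Qm n \<xi> / 2) > B"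
proof -
  obtain \<xi> where \<xi>: "\<xi> \<in> outer_branch" "Qm n \<xi> \<ge> 2 * (\<bar>B\<bar> + 1)\<^sup>2"
    using Qm_unbounded_branch[OF is_branch_outer n_gt_2] by blast
  have "(\<bar>B\<bar> + 1)\<^sup>2 > 0" by (simp add: power2_eq_square add_nonneg_pos)
  then have "\<xi> \<noteq> 1" using \<xi>(2) Qm_1[OF n_gt_2] by auto
  then have x: "\<xi> > 1" using \<xi> by simp
  have "\<bar>B\<bar> + 1 \<le> sqrt (Qm n \<xi> / 2)" by (rule real_le_rsqrt) (use \<xi> in simp)
  also have "\<dots> \<le> (n - 1) * sqrt (Qm n \<xi> / 2)"
    using n_gt_2 Qm_nonneg[OF n_gt_2, of \<xi>] x by (simp add: mult_le_cancel_right1)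
  finally have "B < (n - 1) * sqrt (Qm n \<xi> / 2)" by linarith
  then show ?thesis using x by blast
qed

lemma small_inner: assumes "\<epsilon> > 0" shows "\<exists>\<xi>. 0 < \<xi> \<and> \<xi> < 1 \<and> (n - 1) * sqrt (Qm n \<xi> / 2) < \<epsilon>"
proof -
  define s where "s = (\<epsilon> / (n - 1))\<^sup>2"
  have e: "\<epsilon> / (n - 1) > 0" using assms n_gt_2 by simp
  have s: "s > 0" unfolding s_def using e by (rule zero_less_power)
  define \<xi> where "\<xi> = chi n inner_branch s"
  have x: "0 < \<xi>" "\<xi> < 1" using chi_inner_range[OF n_gt_2 s] by (auto simp: \<xi>_def)
  have Q: "Qm n \<xi> = s" unfolding \<xi>_def by (rule chi_props(2)[OF is_branch_inner n_gt_2 less_imp_le[OF s]])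
  have "sqrt (Qm n \<xi> / 2) < sqrt s" unfolding Q using s by simp
  also have "sqrt s = \<epsilon> / (n - 1)" unfolding s_def real_sqrt_abs using e by (rule abs_of_pos)
  finally have "(n - 1) * sqrt (Qm n \<xi> / 2) < (n - 1) * (\<epsilon> / (n - 1))" using n_gt_2 by (intro mult_strict_left_mono) auto
  then show ?thesis using x n_gt_2 by (intro exI[of _ \<xi>]) auto
qed

text \<open>As \<open>Tm n \<xi> > 1\<close> for every outer \<open>\<xi>\<close>, a stress of at
  most 1 would make all outer models admissible; those with a small core radius contradict the
  finite curvature at the point from \<open>good_point\<close>.\<close>

lemma nwss_gt_1: "nwss \<Omega> u \<Gamma>1 > 1" "nwss \<Omega> u \<Gamma>2 > 1"
proof -
  obtain p h where p: "p \<in> \<Sigma>" "mean_curvature_at \<Sigma> \<Omega>1 p h" using good_point by blast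
  have bd: "(norm (grad u x))\<^sup>2 \<le> 2 * m * Tm n \<xi>" if "nwss \<Omega> u \<Gamma> \<le> 1" "\<xi> > 1" "\<Gamma> \<subseteq> closure \<Omega>" "x \<in> \<Gamma>" for \<xi> x \<Gamma>
  proof -
    have "(nwss \<Omega> u \<Gamma>)\<^sup>2 \<le> 1" using that(1) nwss_bound(2)[OF that(3,4)] by (simp add: power_le_one)
    also have "1 \<le> Tm n \<xi>" using Tm_bounds_outer(1)[OF that(2) n_gt_2] by simp
    finally have "2 * m * (nwss \<Omega> u \<Gamma>)\<^sup>2 \<le> 2 * m * Tm n \<xi>" using m_pos by (intro mult_left_mono) auto
    then show ?thesis using nwss_bound(1)[OF that(3,4)] by linarith
  qed
  show "nwss \<Omega> u \<Gamma>1 > 1"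
  proof (rule ccontr)
    assume "\<not> nwss \<Omega> u \<Gamma>1 > 1"
    then have le: "nwss \<Omega> u \<Gamma>1 \<le> 1" by simp
    obtain \<xi> where x: "\<xi> > 1" "(n - 1) * sqrt (Qm n \<xi> / 2) > - h * sqrt m" using unbounded_outer by blast
    have "(n - 1) * sqrt (Qm n \<xi> / 2) \<le> - h * sqrt m"
      by (rule curvature_claims(2)[OF p x(1)]) (rule bd[OF le x(1) Gamma_closure(1)])
    then show False using x by simp
  qed
  show "nwss \<Omega> u \<Gamma>2 > 1"
  proof (rule ccontr)
    assume "\<not> nwss \<Omega> u \<Gamma>2 > 1"
    then have le: "nwss \<Omega> u \<Gamma>2 \<le> 1" by simp
    obtain \<xi> where x: "\<xi> > 1" "(n - 1) * sqrt (Qm n \<xi> / 2) > h * sqrt m" using unbounded_outer by blast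
    have "(n - 1) * sqrt (Qm n \<xi> / 2) \<le> h * sqrt m"
      by (rule curvature_claims(1)[OF p x(1)]) (rule bd[OF le x(1) Gamma_closure(2)])
    then show False using x by simp
  qed
qed

text \<open>The closure of \<open>\<Omega>2\<close> meets the frontier in \<open>\<Gamma>2\<close>
  alone, so the supremum runs over a single component.\<close>

lemma nwss_region_2: "nwss_region \<Omega> u \<Omega>2 = nwss \<Omega> u \<Gamma>2"
proof -
  have "\<Gamma>2 \<subseteq> closure \<Omega>2" using sides(2) by blast
  moreover have "\<not> \<Gamma>1 \<subseteq> closure \<Omega>2" using sides(2) Gamma_frontier(1) Gamma_disjoint Gamma_nonempty(1) by blast
  ultimately have "{S\<in>components (frontier \<Omega>). S \<subseteq> closure \<Omega>2} = {\<Gamma>2}" unfolding comps(1) by auto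
  then show ?thesis by (simp add: nwss_region_def)
qed

text \<open>The outer comparison forces \<open>h > 0\<close>. A stress of at most
  \<open>sqrt n\<close> on \<open>\<Gamma>1\<close> would make every inner model admissible, since
  \<open>Tm n \<xi> > n\<close>, and those with \<open>\<xi>\<close> near 1 have arbitrarily small
  curvature.\<close>

lemma nwss_1_gt_sqrt:
  assumes t2: "nwss \<Omega> u \<Gamma>2 < sqrt n" shows "nwss \<Omega> u \<Gamma>1 > sqrt n"
proof (rule ccontr)
  assume "\<not> ?thesis"
  then have le: "nwss \<Omega> u \<Gamma>1 \<le> sqrt n" by simp
  obtain p h where p: "p \<in> \<Sigma>" "mean_curvature_at \<Sigma> \<Omega>1 p h" using good_point by blast
  obtain x2 R2 where x2: "1 < x2" "Tm n x2 = (nwss \<Omega> u \<Gamma>2)\<^sup>2"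
    using outer_core_radius_ex[OF n_gt_2 nwss_gt_1(2) t2] by metis
  have "(n - 1) * sqrt (Qm n x2 / 2) \<le> h * sqrt m"
    by (rule curvature_claims(1)[OF p x2(1)]) (use nwss_bound(1)[OF Gamma_closure(2)] x2(2) in simp)
  moreover have "(n - 1) * sqrt (Qm n x2 / 2) > 0" using n_gt_2 Qm_pos[of x2 n] x2 by simp
  ultimately have hp: "h * sqrt m > 0" by linarith
  obtain \<xi> where x: "0 < \<xi>" "\<xi> < 1" "(n - 1) * sqrt (Qm n \<xi> / 2) < h * sqrt m" using small_inner[OF hp] by blast
  have "h * sqrt m \<le> (n - 1) * sqrt (Qm n \<xi> / 2)"
  proof (rule curvature_claims(3)[OF p x(1,2)])
    fix y assume y: "y \<in> \<Gamma>1"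
    have "(nwss \<Omega> u \<Gamma>1)\<^sup>2 \<le> (sqrt n)\<^sup>2" using le nwss_bound(2)[OF Gamma_closure(1) y] by (intro power_mono) auto
    also have "\<dots> \<le> Tm n \<xi>" using Tm_gt_inner[OF x(1,2) n_gt_2] n_gt_2 by simp
    finally have "2 * m * (nwss \<Omega> u \<Gamma>1)\<^sup>2 \<le> 2 * m * Tm n \<xi>" using m_pos by (intro mult_left_mono) auto
    then show "(norm (grad u y))\<^sup>2 \<le> 2 * m * Tm n \<xi>" using nwss_bound(1)[OF Gamma_closure(1) y] by linarith
  qed
  then show False using x by simp
qed

text \<open>If the comparison on \<open>\<Omega>2\<close> were strict on the level set \<open>u = m / 2\<close>, a smaller core radius could be used on
  \<open>{u > m / 2}\<close>, and the lower curvature bound would become strict.\<close>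

lemma contact_point:
  assumes p: "p \<in> \<Sigma>" "mean_curvature_at \<Sigma> \<Omega>1 p h" and \<rho>: "\<rho> > 0" and h: "h \<le> (n - 1) / \<rho>"
    and le: "\<And>x. x \<in> \<Omega>2 \<Longrightarrow> (norm (grad u x))\<^sup>2 \<le> ym n outer_branch \<rho> m (u x)"
  shows "\<exists>q\<in>\<Omega>2. u q = m / 2 \<and> (norm (grad u q))\<^sup>2 = ym n outer_branch \<rho> m (u q)"
proof (rule ccontr)
  assume neg: "\<not> ?thesis"
  note n = n_gt_2 and J = is_branch_outer
  have O2c: "closure \<Omega>2 \<subseteq> closure \<Omega>" using Omega_i by (intro closure_mono)
  define K where "K = {x\<in>closure \<Omega>2. u x = m / 2}"
  \<comment> \<open>The level is intermediate: on the frontier of \<open>\<Omega>2\<close> the only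
    values of \<open>u\<close> are \<open>m\<close> and 0.\<close>
  have KO: "x \<in> \<Omega>2" if "x \<in> K" for x
  proof (rule ccontr)
    assume "x \<notin> \<Omega>2"
    then have "x \<in> frontier \<Omega>2" using that divide(4) by (simp add: K_def frontier_def interior_open)
    then have "u x = m \<or> u x = 0" using frontier_2 Sigma_sub(2) bc Gamma_frontier(2) by blast
    then show False using that m_pos by (auto simp: K_def)
  qed
  have "closed K" unfolding K_def
    by (rule continuous_closed_preimage_constant[OF continuous_on_subset[OF u_cont O2c] closed_closure])
  moreover have "K \<subseteq> closure \<Omega>" using O2c by (auto simp: K_def)
  ultimately have cK: "compact K" using compact_closure compact_Int_closed[of "closure \<Omega>" K] by (simp add: Int_absorb1)
  \<comment> \<open>The scaled radius of the level \<open>m / 2\<close> in the model with core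
    radius \<open>\<rho>\<close>.\<close>
  define \<xi> where "\<xi> = chi n outer_branch (m / \<rho>\<^sup>2)"
  have s: "m / \<rho>\<^sup>2 > 0" using m_pos \<rho> by simp
  have x: "1 < \<xi>" using chi_outer_range[OF n s] by (simp add: \<xi>_def)
  have Qx: "Qm n \<xi> = m / \<rho>\<^sup>2" unfolding \<xi>_def by (rule chi_props(2)[OF J n less_imp_le[OF s]])
  have ymh: "ym n outer_branch r m (m / 2) = m * Tm n y" if "1 < y" "r > 0" "Qm n y = m / r\<^sup>2" for y r
  proof -
    have "chi n outer_branch (2 * (m - m / 2) / r\<^sup>2) = y" using chi_Qm[OF J n, of y] that by simp
    then have "ym n outer_branch r m (m / 2) = r\<^sup>2 * (Pm n y)\<^sup>2" by (simp add: ym_def)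
    moreover have "r\<^sup>2 = m / Qm n y" using that m_pos by simp
    ultimately show ?thesis by (simp add: Tm_def)
  qed
  have "\<exists>\<mu>. \<mu> < m * Tm n \<xi> \<and> (\<forall>x\<in>K. (norm (grad u x))\<^sup>2 \<le> \<mu>)"
  proof (cases "K = {}")
    case True
    then show ?thesis by (intro exI[of _ "m * Tm n \<xi> - 1"]) auto
  next
    case False
    have "continuous_on K (\<lambda>x. (norm (grad u x))\<^sup>2)" by (rule continuous_on_subset[OF W_cont \<open>K \<subseteq> closure \<Omega>\<close>])
    then obtain z where z: "z \<in> K" "\<And>x. x \<in> K \<Longrightarrow> (norm (grad u x))\<^sup>2 \<le> (norm (grad u z))\<^sup>2"
      using continuous_attains_sup[OF cK False] by blast
    have zO: "z \<in> \<Omega>2" "u z = m / 2" using KO z(1) by (auto simp: K_def)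
    have "(norm (grad u z))\<^sup>2 \<noteq> ym n outer_branch \<rho> m (u z)" using neg zO by blast
    then have "(norm (grad u z))\<^sup>2 < ym n outer_branch \<rho> m (u z)" using le[OF zO(1)] by linarith
    then show ?thesis using z(2) zO(2) ymh[OF x \<rho> Qx] by (intro exI[of _ "(norm (grad u z))\<^sup>2"]) auto
  qed
  then obtain \<mu> where \<mu>: "\<mu> < m * Tm n \<xi>" "\<And>x. x \<in> K \<Longrightarrow> (norm (grad u x))\<^sup>2 \<le> \<mu>" by blast
  \<comment> \<open>By continuity of \<open>T\<close> the strict gap leaves room for a larger scaled
    radius at this level. A larger \<open>Q\<close> means a smaller core radius, which will be
    \<open>r\<close>.\<close>
  have "\<exists>y>\<xi>. m * Tm n y \<ge> \<mu>"
  proof -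
    have "isCont (Tm n) \<xi>" by (rule DERIV_isCont[OF Tm_deriv]) (use x n in auto)
    then have "(Tm n \<longlongrightarrow> Tm n \<xi>) (at \<xi>)" by (simp add: isCont_def)
    moreover have "\<mu> / m < Tm n \<xi>" using \<mu>(1) m_pos by (simp add: field_simps)
    ultimately have "\<forall>\<^sub>F y in at \<xi>. \<mu> / m < Tm n y" by (rule order_tendstoD(1))
    then obtain d where d: "d > 0" "\<And>y. y \<noteq> \<xi> \<Longrightarrow> dist y \<xi> < d \<Longrightarrow> \<mu> / m < Tm n y" unfolding eventually_at by auto
    have "\<mu> / m < Tm n (\<xi> + d / 2)" using d(1) by (intro d(2)) (auto simp: dist_real_def)
    then show ?thesis using d(1) m_pos by (intro exI[of _ "\<xi> + d / 2"]) (auto simp: field_simps)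
  qed
  then obtain y where y: "y > \<xi>" "m * Tm n y \<ge> \<mu>" by blast
  have y1: "1 < y" using x y by simp
  have Qy: "Qm n y > m / \<rho>\<^sup>2" using Qm_strict_increasing[of \<xi> y n] x y n Qx by simp
  then have Qy0: "Qm n y > 0" using s by linarith
  define r where "r = sqrt (m / Qm n y)"
  have r: "r > 0" "r\<^sup>2 = m / Qm n y" using Qy0 m_pos by (auto simp: r_def)
  have Qr: "Qm n y = m / r\<^sup>2" using r m_pos Qy0 by simp
  have rr: "r < \<rho>"
  proof -
    have "m / r\<^sup>2 > m / \<rho>\<^sup>2" using Qy Qr by simp
    then have "r\<^sup>2 < \<rho>\<^sup>2" using m_pos \<rho> r(1) by (simp add: field_simps)
    then show ?thesis by (rule power2_less_imp_less) (use \<rho> in simp)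
  qed
  define N where "N = \<Omega>2 \<inter> u -` {m / 2<..}"
  have O2cc: "\<Omega>2 \<subseteq> closure \<Omega>" using Omega_i closure_subset by blast
  have oN: "open N" unfolding N_def
    by (rule continuous_open_preimage[OF continuous_on_subset[OF u_cont O2cc] divide(4)]) simp
  have cmp: "(norm (grad u x))\<^sup>2 \<le> ym n outer_branch r m (u x)" if "x \<in> N" for x
  proof (rule region_comparison[OF oN _ J r(1) _ that])
    show "N \<subseteq> \<Omega>" using Omega_i by (auto simp: N_def)
    fix z assume z: "z \<in> frontier N"
    then have zN: "z \<in> closure N" "z \<notin> N" using oN by (auto simp: frontier_def interior_open)
    have "closure N \<subseteq> closure \<Omega>2" by (intro closure_mono) (auto simp: N_def)
    then have z2: "z \<in> closure \<Omega>2" using zN by blast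
    have uz: "u z \<ge> m / 2"
    proof -
      have "closure N \<subseteq> {x\<in>closure \<Omega>2. m / 2 \<le> u x}"
      proof (rule closure_minimal)
        show "N \<subseteq> {x\<in>closure \<Omega>2. m / 2 \<le> u x}" using closure_subset by (auto simp: N_def)
        show "closed {x\<in>closure \<Omega>2. m / 2 \<le> u x}"
          using continuous_closed_preimage[OF continuous_on_subset[OF u_cont O2c] closed_closure, of "{m / 2..}"]
          by (simp add: vimage_def Int_def)
      qed
      then show ?thesis using zN by blast
    qed
    show "z \<in> \<Sigma> \<or> (norm (grad u z))\<^sup>2 \<le> ym n outer_branch r m (u z)"
    proof (cases "z \<in> \<Omega>2")
      case True
      then have "u z = m / 2" using uz zN(2) by (simp add: N_def)
      then have "z \<in> K" using z2 by (simp add: K_def)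
      then have "(norm (grad u z))\<^sup>2 \<le> m * Tm n y" using \<mu>(2) y(2) by fastforce
      then show ?thesis unfolding \<open>u z = m / 2\<close> ymh[OF y1 r(1) Qr] by simp
    next
      case False
      then have "z \<in> frontier \<Omega>2" using z2 divide(4) by (simp add: frontier_def interior_open)
      then have "z \<in> \<Sigma> \<or> u z = 0" using frontier_2 bc Gamma_frontier(2) by blast
      then show ?thesis using uz m_pos by auto
    qed
  qed
  have "h \<ge> (if outer_branch = outer_branch then 1 else - 1) * (n - 1) / r"
    by (rule curvature_bounds(1)[OF p J r(1)]) (rule cmp, simp add: N_def)
  then have "h \<ge> (n - 1) / r" by simp
  moreover have "(n - 1) / r > (n - 1) / \<rho>" using rr r(1) n by (intro divide_strict_left_mono) auto
  ultimately show False using h by linarith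
qed

text \<open>Equal radii give \<open>Qm n x1 = Qm n x2\<close>, so the upper curvature bound from
  \<open>\<Gamma>1\<close> is exactly what \<open>contact_point\<close> requires. Once rigidity has
  produced an annulus around \<open>x0\<close> with core radius \<open>\<rho>\<close>, the
  equivalence is the dilation by \<open>R / \<rho>\<close> that sends \<open>x0\<close> to the
  origin.\<close>

lemma model_profile_annulus:
  assumes t2: "nwss \<Omega> u \<Gamma>2 < sqrt n"
    and R: "0 < R" "R < Rmax n" "core_radius n (nwss \<Omega> u \<Gamma>1) = R" "core_radius n (nwss \<Omega> u \<Gamma>2) = R"
  shows "equivalent_sol \<Omega> u (OmegaR n R) (uR n R)"
proof -
  note n = n_gt_2
  define s where "s = core_param n R"
  have s: "s > 0" unfolding s_def by (rule core_param_pos[OF n R(1,2)])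
  obtain x1 R1 where x1: "0 < x1" "x1 < 1" "Tm n x1 = (nwss \<Omega> u \<Gamma>1)\<^sup>2" "core_param n R1 = Qm n x1" "core_radius n (nwss \<Omega> u \<Gamma>1) = R1"
    by (rule inner_core_radius_ex[OF n nwss_1_gt_sqrt[OF t2]])
  obtain x2 R2 where x2: "1 < x2" "Tm n x2 = (nwss \<Omega> u \<Gamma>2)\<^sup>2" "core_param n R2 = Qm n x2" "core_radius n (nwss \<Omega> u \<Gamma>2) = R2"
    by (rule outer_core_radius_ex[OF n nwss_gt_1(2) t2])
  have Q1: "Qm n x1 = s" using x1 R by (simp add: s_def)
  have Q2: "Qm n x2 = s" using x2 R by (simp add: s_def)
  obtain p h where p: "p \<in> \<Sigma>" "mean_curvature_at \<Sigma> \<Omega>1 p h" using good_point by blast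
  define \<rho> where "\<rho> = model_scale x2"
  have x2': "x2 > 0" "x2 \<noteq> 1" "x2 \<in> outer_branch" using x2 by auto
  note sp = model_scale_props[OF x2'(1,2), folded \<rho>_def]
  have le: "(norm (grad u x))\<^sup>2 \<le> ym n outer_branch \<rho> m (u x)" if "x \<in> \<Omega>2" for x
    unfolding \<rho>_def
    by (rule comparison_2[OF is_branch_outer x2'(3,2) _ that]) (use nwss_bound(1)[OF Gamma_closure(2)] x2(2) in simp)
  have "h * sqrt m \<le> (n - 1) * sqrt (Qm n x1 / 2)"
    by (rule curvature_claims(3)[OF p x1(1,2)]) (use nwss_bound(1)[OF Gamma_closure(1)] x1(3) in simp)
  then have "h * sqrt m \<le> (n - 1) / \<rho> * sqrt m" using sp(3) Q1 Q2 by simp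
  then have "h \<le> (n - 1) / \<rho>" by (rule mult_right_le_imp_le) (use m_pos in simp)
  from contact_point[OF p sp(1) this le]
  obtain q where q: "q \<in> \<Omega>2" "u q = m / 2" "(norm (grad u q))\<^sup>2 = ym n outer_branch \<rho> m (u q)" by blast
  have "u q < m" using q m_pos by simp
  from rigidity_near_contact[OF sp(1) le q(1) this q(3)]
  obtain x0 \<delta> where \<delta>: "\<delta> > 0" "ball q \<delta> \<subseteq> \<Omega>"
    "\<And>x. x \<in> ball q \<delta> \<Longrightarrow> x \<noteq> x0 \<and> u x = model_profile n m \<rho> x0 x" unfolding model_profile_def by blast
  have sr: "2 * m / \<rho>\<^sup>2 = s" using sp(2) Q2 by simp
  note glob = rigidity_global[OF sp(1) \<delta>, unfolded sr]
  define \<xi>1 \<xi>2 where "\<xi>1 = chi n inner_branch s" and "\<xi>2 = chi n outer_branch s"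
  have Om: "\<Omega> = {x. \<rho> * \<xi>1 < norm (x - x0) \<and> norm (x - x0) < \<rho> * \<xi>2}" using glob(1) by (simp add: \<xi>1_def \<xi>2_def)
  have \<xi>1: "\<xi>1 > 0" using chi_inner_range[OF n s] by (simp add: \<xi>1_def)
  define lam where "lam = R / \<rho>"
  have lam: "lam > 0" "lam * \<rho> = R" using R sp(1) by (auto simp: lam_def)
  have r12: "r1 n R = R * \<xi>1" "r2 n R = R * \<xi>2"
    using r1_eq[OF n R(1,2)] r2_eq[OF n R(1,2)] by (auto simp: \<xi>1_def \<xi>2_def s_def)
  define c where "c = - (lam *\<^sub>R x0)"
  have nrm: "norm (lam *\<^sub>R x + c) = lam * norm (x - x0)" for x
  proof -
    have "lam *\<^sub>R x + c = lam *\<^sub>R (x - x0)" by (simp add: c_def scaleR_diff_right)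
    then show ?thesis using lam by simp
  qed
  have mem: "lam *\<^sub>R x + c \<in> OmegaR n R \<longleftrightarrow> x \<in> \<Omega>" for x
  proof -
    have "R * \<xi>1 < lam * norm (x - x0) \<longleftrightarrow> \<rho> * \<xi>1 < norm (x - x0)"
      using lam mult_less_cancel_left_pos[OF lam(1), of "\<rho> * \<xi>1" "norm (x - x0)"] by (simp add: mult.assoc[symmetric])
    moreover have "lam * norm (x - x0) < R * \<xi>2 \<longleftrightarrow> norm (x - x0) < \<rho> * \<xi>2"
      using lam mult_less_cancel_left_pos[OF lam(1), of "norm (x - x0)" "\<rho> * \<xi>2"] by (simp add: mult.assoc[symmetric])
    ultimately show ?thesis unfolding OmegaR_def Om r12 by (simp add: nrm)
  qed
  have inv: "lam *\<^sub>R ((1 / lam) *\<^sub>R (y - c)) + c = y" for y using lam by simp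
  show ?thesis unfolding equivalent_sol_def
  proof (intro exI[of _ lam] exI[of _ c] conjI lam(1) ballI)
    show "OmegaR n R = (\<lambda>x. lam *\<^sub>R x + c) ` \<Omega>"
    proof (intro equalityI subsetI)
      fix y :: "real^'n" assume "y \<in> OmegaR n R"
      then have "(1 / lam) *\<^sub>R (y - c) \<in> \<Omega>" using mem[of "(1 / lam) *\<^sub>R (y - c)"] unfolding inv by simp
      then show "y \<in> (\<lambda>x. lam *\<^sub>R x + c) ` \<Omega>" using inv[of y] by (metis image_eqI)
    next
      fix y assume "y \<in> (\<lambda>x. lam *\<^sub>R x + c) ` \<Omega>"
      then show "y \<in> OmegaR n R" using mem by auto
    qed
    fix y :: "real^'n" assume y: "y \<in> OmegaR n R"
    define x where "x = (1 / lam) *\<^sub>R (y - c)"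
    have yx: "y = lam *\<^sub>R x + c" using inv[of y] by (simp add: x_def)
    have xO: "x \<in> \<Omega>" using mem[of x] y yx by simp
    have ny: "norm y = lam * norm (x - x0)" using nrm yx by simp
    have "R * \<xi>1 > 0" using R(1) \<xi>1 by simp
    moreover have "R * \<xi>1 < norm y" using y r12 by (simp add: OmegaR_def)
    ultimately have y0: "y \<noteq> 0" by auto
    have rat: "norm y / R = norm (x - x0) / \<rho>" unfolding ny lam(2)[symmetric] using lam(1) by simp
    have "uR n R y = R\<^sup>2 / 2 * (s - Qm n (norm (x - x0) / \<rho>))"
      unfolding uR_eq[OF n R(1) y0] rat s_def ..
    also have "\<dots> = lam\<^sup>2 * (\<rho>\<^sup>2 / 2 * (s - Qm n (norm (x - x0) / \<rho>)))"
      unfolding lam(2)[symmetric] by (simp add: power_mult_distrib)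
    also have "\<rho>\<^sup>2 / 2 * (s - Qm n (norm (x - x0) / \<rho>)) = model_profile n m \<rho> x0 x"
      unfolding model_profile_def sr[symmetric] using sp(1) by (simp add: right_diff_distrib)
    also have "\<dots> = u x" using glob(2)[OF _ xO] by simp
    finally show "uR n R y = lam\<^sup>2 * u ((1 / lam) *\<^sub>R (y - c))" by (simp add: x_def)
  qed
qed

lemma model_profile_gradient:
  assumes "\<rho> > 0" "x \<noteq> x0"
  shows "\<exists>g. has_grad (model_profile n m \<rho> x0) g x \<and> (norm g)\<^sup>2 = \<rho>\<^sup>2 * (Pm n (norm (x - x0) / \<rho>))\<^sup>2"
proof -
  define t where "t = norm (x - x0)"
  have t: "t > 0" using assms by (simp add: t_def)
  have "((\<lambda>w. m - \<rho>\<^sup>2 / 2 * Qm n (sqrt w / \<rho>)) has_real_derivative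
     0 - \<rho>\<^sup>2 / 2 * (2 * Pm n (sqrt (t\<^sup>2) / \<rho>) * (inverse (sqrt (t\<^sup>2)) / 2 / \<rho>))) (at (t\<^sup>2))"
  proof (intro DERIV_diff DERIV_const DERIV_cmult)
    have a: "((\<lambda>w. sqrt w / \<rho>) has_real_derivative inverse (sqrt (t\<^sup>2)) / 2 / \<rho>) (at (t\<^sup>2))"
      by (rule DERIV_cdivide[OF DERIV_real_sqrt]) (use t in simp)
    have b: "(Qm n has_real_derivative 2 * Pm n (sqrt (t\<^sup>2) / \<rho>)) (at (sqrt (t\<^sup>2) / \<rho>))"
      by (rule Qm_deriv) (use t assms n_gt_2 in auto)
    show "((\<lambda>w. Qm n (sqrt w / \<rho>)) has_real_derivative 2 * Pm n (sqrt (t\<^sup>2) / \<rho>) * (inverse (sqrt (t\<^sup>2)) / 2 / \<rho>)) (at (t\<^sup>2))"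
      by (rule DERIV_chain2[OF b a])
  qed
  moreover have "0 - \<rho>\<^sup>2 / 2 * (2 * Pm n (sqrt (t\<^sup>2) / \<rho>) * (inverse (sqrt (t\<^sup>2)) / 2 / \<rho>)) = - (\<rho> * Pm n (t / \<rho>) / (2 * t))"
    using t assms by (simp add: power2_eq_square field_simps)
  ultimately have d: "((\<lambda>w. m - \<rho>\<^sup>2 / 2 * Qm n (sqrt w / \<rho>)) has_real_derivative - (\<rho> * Pm n (t / \<rho>) / (2 * t))) (at ((norm (x - x0))\<^sup>2))"
    unfolding t_def by simp
  have "has_grad (\<lambda>y. m - \<rho>\<^sup>2 / 2 * Qm n (sqrt ((norm (y - x0))\<^sup>2) / \<rho>)) (- (\<rho> * Pm n (t / \<rho>) / (2 * t)) *\<^sub>R (2 *\<^sub>R (x - x0))) x"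
    by (rule has_grad_compose[OF has_grad_norm_sq d])
  then have "has_grad (model_profile n m \<rho> x0) (- (\<rho> * Pm n (t / \<rho>) / (2 * t)) *\<^sub>R (2 *\<^sub>R (x - x0))) x"
    by (simp add: model_profile_def [abs_def])
  moreover have "(norm (- (\<rho> * Pm n (t / \<rho>) / (2 * t)) *\<^sub>R (2 *\<^sub>R (x - x0))))\<^sup>2 = \<rho>\<^sup>2 * (Pm n (t / \<rho>))\<^sup>2"
  proof -
    have "norm (- (\<rho> * Pm n (t / \<rho>) / (2 * t)) *\<^sub>R (2 *\<^sub>R (x - x0))) = \<bar>\<rho> * Pm n (t / \<rho>) / (2 * t)\<bar> * (2 * t)"
      by (simp add: t_def)
    also have "\<dots> = \<bar>\<rho> * Pm n (t / \<rho>)\<bar>" using t by (simp add: abs_mult)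
    finally show ?thesis by (simp add: power_mult_distrib)
  qed
  ultimately show ?thesis by (auto simp: t_def)
qed

text \<open>Which boundary component lies on which sphere is not decided geometrically. By
  connectedness each lies on one of the two spheres and so has one of the two model stresses; the
  position relative to \<open>sqrt n\<close>, given by \<open>t2\<close> and
  \<open>nwss_1_gt_sqrt\<close>, tells them apart.\<close>

lemma equivalent_core_radius:
  assumes t2: "nwss \<Omega> u \<Gamma>2 < sqrt n" and R: "0 < R" "R < Rmax n"
    and eqv: "equivalent_sol \<Omega> u (OmegaR n R) (uR n R)"
  shows "core_radius n (nwss \<Omega> u \<Gamma>1) = R" "core_radius n (nwss \<Omega> u \<Gamma>2) = R"
proof -
  note n = n_gt_2
  define s where "s = core_param n R"
  have s: "s > 0" unfolding s_def by (rule core_param_pos[OF n R])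
  define \<xi>1 \<xi>2 where "\<xi>1 = chi n inner_branch s" and "\<xi>2 = chi n outer_branch s"
  have \<xi>: "0 < \<xi>1" "\<xi>1 < 1" "1 < \<xi>2" using chi_inner_range[OF n s] chi_outer_range[OF n s] by (auto simp: \<xi>1_def \<xi>2_def)
  have Q: "Qm n \<xi>1 = s" "Qm n \<xi>2 = s"
    using chi_props(2)[OF is_branch_inner n less_imp_le[OF s]] chi_props(2)[OF is_branch_outer n less_imp_le[OF s]]
    by (auto simp: \<xi>1_def \<xi>2_def)
  obtain lam c where lam: "lam > 0" and Oeq: "OmegaR n R = (\<lambda>x. lam *\<^sub>R x + c) ` \<Omega>"
    and ueq: "\<And>y. y \<in> OmegaR n R \<Longrightarrow> uR n R y = lam\<^sup>2 * u ((1 / lam) *\<^sub>R (y - c))"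
    using eqv unfolding equivalent_sol_def by blast
  define \<rho> where "\<rho> = R / lam"
  have \<rho>: "\<rho> > 0" "lam * \<rho> = R" using R lam by (auto simp: \<rho>_def)
  define x0 where "x0 = - ((1 / lam) *\<^sub>R c)"
  have nrm: "norm (lam *\<^sub>R x + c) = lam * norm (x - x0)" for x
  proof -
    have "lam *\<^sub>R x + c = lam *\<^sub>R (x - x0)" using lam by (simp add: x0_def scaleR_add_right)
    then show ?thesis using lam by simp
  qed
  have r12: "r1 n R = R * \<xi>1" "r2 n R = R * \<xi>2"
    using r1_eq[OF n R] r2_eq[OF n R] by (auto simp: \<xi>1_def \<xi>2_def s_def)
  have inj: "x \<in> \<Omega> \<longleftrightarrow> lam *\<^sub>R x + c \<in> OmegaR n R" for x
  proof -
    have "inj (\<lambda>x. lam *\<^sub>R x + c)" using lam by (auto simp: inj_def)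
    then show ?thesis unfolding Oeq using inj_image_mem_iff[of "\<lambda>x. lam *\<^sub>R x + c" x \<Omega>] by simp
  qed
  have mem: "x \<in> \<Omega> \<longleftrightarrow> \<rho> * \<xi>1 < norm (x - x0) \<and> norm (x - x0) < \<rho> * \<xi>2" for x
  proof -
    have "R * \<xi>1 < lam * norm (x - x0) \<longleftrightarrow> \<rho> * \<xi>1 < norm (x - x0)"
      using \<rho> mult_less_cancel_left_pos[OF lam, of "\<rho> * \<xi>1" "norm (x - x0)"] by (simp add: mult.assoc[symmetric])
    moreover have "lam * norm (x - x0) < R * \<xi>2 \<longleftrightarrow> norm (x - x0) < \<rho> * \<xi>2"
      using \<rho> mult_less_cancel_left_pos[OF lam, of "norm (x - x0)" "\<rho> * \<xi>2"] by (simp add: mult.assoc[symmetric])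
    ultimately show ?thesis unfolding inj OmegaR_def r12 by (simp add: nrm)
  qed
  have ne: "x \<noteq> x0" if "x \<in> \<Omega>" for x
  proof -
    have "\<rho> * \<xi>1 > 0" using \<rho> \<xi> by simp
    then show ?thesis using that mem[of x] by auto
  qed
  have uform: "u x = \<rho>\<^sup>2 / 2 * (s - Qm n (norm (x - x0) / \<rho>))" if x: "x \<in> \<Omega>" for x
  proof -
    define y where "y = lam *\<^sub>R x + c"
    have y: "y \<in> OmegaR n R" using inj x by (simp add: y_def)
    have y0: "y \<noteq> 0" using nrm[of x] ne[OF x] lam by (auto simp: y_def[symmetric])
    have "norm y / R = norm (x - x0) / \<rho>" unfolding y_def nrm \<rho>(2)[symmetric] using lam by simp
    then have "uR n R y = R\<^sup>2 / 2 * (s - Qm n (norm (x - x0) / \<rho>))" using uR_eq[OF n R(1) y0] by (simp add: s_def)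
    moreover have "uR n R y = lam\<^sup>2 * u x" using ueq[OF y] lam by (simp add: y_def)
    moreover have "R\<^sup>2 = lam\<^sup>2 * \<rho>\<^sup>2" unfolding \<rho>(2)[symmetric] by (simp add: power_mult_distrib)
    ultimately have "lam\<^sup>2 * u x = lam\<^sup>2 * (\<rho>\<^sup>2 / 2 * (s - Qm n (norm (x - x0) / \<rho>)))" by simp
    then show ?thesis using lam by (simp only: mult_cancel_left) simp
  qed
  \<comment> \<open>One inequality comes from a point of \<open>\<Sigma>\<close>, since
    \<open>Q\<close> is nonnegative; the other from a point at distance \<open>\<rho>\<close> from
    the centre, where \<open>Q = 0\<close>.\<close>
  have m: "m = \<rho>\<^sup>2 / 2 * s"
  proof (rule antisym)
    obtain p where p: "p \<in> \<Sigma>" using Sigma_nonempty by blast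
    have "norm (p - x0) / \<rho> > 0" using ne[of p] Sigma_sub(1) p \<rho> by auto
    then have "Qm n (norm (p - x0) / \<rho>) \<ge> 0" by (rule Qm_nonneg[OF n])
    then have "\<rho>\<^sup>2 / 2 * (s - Qm n (norm (p - x0) / \<rho>)) \<le> \<rho>\<^sup>2 / 2 * s" by (intro mult_left_mono) auto
    then show "m \<le> \<rho>\<^sup>2 / 2 * s" using uform[of p] Sigma_sub p by auto
    obtain e :: "real^'n" where e: "norm e = 1" using norm_axis_1 by blast
    define y where "y = x0 + \<rho> *\<^sub>R e"
    have ny: "norm (y - x0) = \<rho>" using e \<rho> by (simp add: y_def)
    have "y \<in> \<Omega>" unfolding mem ny using \<rho> \<xi> by simp
    then have "u y \<le> m" "u y = \<rho>\<^sup>2 / 2 * (s - Qm n (norm (y - x0) / \<rho>))" by (fact u_le_m, fact uform)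
    then show "\<rho>\<^sup>2 / 2 * s \<le> m" unfolding ny using \<rho> n by simp
  qed
  have prof: "u x = model_profile n m \<rho> x0 x" if "x \<in> \<Omega>" for x
    unfolding model_profile_def uform[OF that] m by (simp add: right_diff_distrib)
  have WO: "(norm (grad u x))\<^sup>2 = \<rho>\<^sup>2 * (Pm n (norm (x - x0) / \<rho>))\<^sup>2" if x: "x \<in> \<Omega>" for x
  proof -
    obtain g where g: "has_grad (model_profile n m \<rho> x0) g x" "(norm g)\<^sup>2 = \<rho>\<^sup>2 * (Pm n (norm (x - x0) / \<rho>))\<^sup>2"
      using model_profile_gradient[OF \<rho>(1) ne[OF x]] by blast
    have "has_grad u g x" by (rule has_grad_cong_open[OF g(1) dom(1) x]) (simp add: prof)
    then show ?thesis using g(2) has_grad_grad by blast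
  qed
  have fr: "norm (x - x0) = \<rho> * \<xi>1 \<or> norm (x - x0) = \<rho> * \<xi>2" if x: "x \<in> frontier \<Omega>" for x
  proof -
    have xc: "x \<in> closure \<Omega>" "x \<notin> \<Omega>" using x Omega_not_frontier by (auto simp: frontier_def)
    have "closure \<Omega> \<subseteq> {x. \<rho> * \<xi>1 \<le> norm (x - x0) \<and> norm (x - x0) \<le> \<rho> * \<xi>2}"
    proof (rule closure_minimal)
      show "\<Omega> \<subseteq> {x. \<rho> * \<xi>1 \<le> norm (x - x0) \<and> norm (x - x0) \<le> \<rho> * \<xi>2}" using mem by auto
      show "closed {x. \<rho> * \<xi>1 \<le> norm (x - x0) \<and> norm (x - x0) \<le> \<rho> * \<xi>2}"
        by (intro closed_Collect_conj closed_Collect_le continuous_intros)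
    qed
    then show ?thesis using xc mem[of x] by force
  qed
  \<comment> \<open>Extends the gradient formula to the frontier by continuity, as \<open>u\<close>
    agrees with the model only inside \<open>\<Omega>\<close>.\<close>
  have Wfr: "(norm (grad u x))\<^sup>2 = \<rho>\<^sup>2 * (Pm n (norm (x - x0) / \<rho>))\<^sup>2" if x: "x \<in> frontier \<Omega>" for x
  proof -
    have xc: "x \<in> closure \<Omega>" using x by (simp add: frontier_def)
    then obtain z where z: "\<And>k. z k \<in> \<Omega>" "z \<longlonglongrightarrow> x" using closure_sequential by blast
    have xV: "x \<in> V" using xc u_smooth(1) by auto
    have "isCont (\<lambda>x. (norm (grad u x))\<^sup>2) x" by (rule has_grad_continuous[OF norm_grad_sq_grad[OF u_smooth(2) xV]])
    then have "(\<lambda>k. (norm (grad u (z k)))\<^sup>2) \<longlonglongrightarrow> (norm (grad u x))\<^sup>2" by (rule isCont_tendsto_compose[OF _ z(2)])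
    then have a: "(\<lambda>k. \<rho>\<^sup>2 * (Pm n (norm (z k - x0) / \<rho>))\<^sup>2) \<longlonglongrightarrow> (norm (grad u x))\<^sup>2" using WO[OF z(1)] by simp
    have pos: "norm (x - x0) / \<rho> > 0" using fr[OF x] \<rho> \<xi> by auto
    have "isCont (Pm n) (norm (x - x0) / \<rho>)" by (rule DERIV_isCont[OF Pm_deriv[OF pos n]])
    moreover have "(\<lambda>k. norm (z k - x0) / \<rho>) \<longlonglongrightarrow> norm (x - x0) / \<rho>" using \<rho> by (intro tendsto_intros z(2)) auto
    ultimately have "(\<lambda>k. Pm n (norm (z k - x0) / \<rho>)) \<longlonglongrightarrow> Pm n (norm (x - x0) / \<rho>)" by (rule isCont_tendsto_compose)
    then have "(\<lambda>k. \<rho>\<^sup>2 * (Pm n (norm (z k - x0) / \<rho>))\<^sup>2) \<longlonglongrightarrow> \<rho>\<^sup>2 * (Pm n (norm (x - x0) / \<rho>))\<^sup>2" by (intro tendsto_intros)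
    with a show ?thesis by (rule LIMSEQ_unique)
  qed
  have grad_val: "norm (grad u x) = sqrt (Tm n \<xi>') * sqrt (2 * m)"
    if "x \<in> frontier \<Omega>" "norm (x - x0) = \<rho> * \<xi>'" "Qm n \<xi>' = s" for x \<xi>'
  proof -
    have "norm (x - x0) / \<rho> = \<xi>'" using that(2) \<rho> by simp
    then have "(norm (grad u x))\<^sup>2 = \<rho>\<^sup>2 * (Pm n \<xi>')\<^sup>2" using Wfr[OF that(1)] by simp
    also have "\<dots> = Tm n \<xi>' * (2 * m)" unfolding Tm_def that(3) m using s by simp
    finally have "norm (grad u x) = sqrt (Tm n \<xi>' * (2 * m))" by (metis norm_ge_zero real_sqrt_unique)
    then show ?thesis by (simp only: real_sqrt_mult)
  qed
  have one: "nwss \<Omega> u \<Gamma> = sqrt (Tm n \<xi>1) \<or> nwss \<Omega> u \<Gamma> = sqrt (Tm n \<xi>2)"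
    if G: "\<Gamma> \<in> components (frontier \<Omega>)" for \<Gamma>
  proof -
    have Gs: "\<Gamma> \<subseteq> frontier \<Omega>" "\<Gamma> \<noteq> {}" "connected \<Gamma>"
      using in_components_subset[OF G] in_components_nonempty[OF G] in_components_connected[OF G] by auto
    have val: "nwss \<Omega> u \<Gamma> = sqrt (Tm n \<xi>')" if "\<And>x. x \<in> \<Gamma> \<Longrightarrow> norm (x - x0) = \<rho> * \<xi>'" "Qm n \<xi>' = s" for \<xi>'
    proof -
      have "norm (grad u x) = sqrt (Tm n \<xi>') * sqrt (2 * m)" if "x \<in> \<Gamma>" for x
        by (rule grad_val) (use Gs that \<open>\<And>x. x \<in> \<Gamma> \<Longrightarrow> norm (x - x0) = \<rho> * \<xi>'\<close> \<open>Qm n \<xi>' = s\<close> in auto)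
      then have "(SUP x\<in>\<Gamma>. norm (grad u x)) = (SUP x\<in>\<Gamma>. sqrt (Tm n \<xi>') * sqrt (2 * m))" by (intro SUP_cong) auto
      also have "\<dots> = sqrt (Tm n \<xi>') * sqrt (2 * m)" using Gs(2) by simp
      finally have "nwss \<Omega> u \<Gamma> = sqrt (Tm n \<xi>') * sqrt (2 * m) / sqrt (2 * m)" by (simp only: nwss_def m_eq)
      then show ?thesis using m_pos by simp
    qed
    \<comment> \<open>The two spheres lie on different sides of the sphere of radius
      \<open>\<rho>\<close>, so a connected set of frontier points cannot meet both.\<close>
    define A where "A = {x. norm (x - x0) < \<rho>}"
    define B where "B = {x. norm (x - x0) > \<rho>}"
    have op: "open A" "open B" unfolding A_def B_def by (intro open_Collect_less continuous_intros)+
    have G1: "norm (x - x0) = \<rho> * \<xi>1" if "x \<in> \<Gamma>" "x \<in> A" for x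
    proof -
      have "\<rho> * \<xi>2 > \<rho>" using \<rho> \<xi> by simp
      then show ?thesis using fr[of x] Gs that by (auto simp: A_def)
    qed
    have G2: "norm (x - x0) = \<rho> * \<xi>2" if "x \<in> \<Gamma>" "x \<in> B" for x
    proof -
      have "\<rho> * \<xi>1 < \<rho>" using \<rho> \<xi> by simp
      then show ?thesis using fr[of x] Gs that by (auto simp: B_def)
    qed
    have cov: "\<Gamma> \<subseteq> A \<union> B"
    proof
      fix x assume "x \<in> \<Gamma>"
      moreover have "\<rho> * \<xi>1 < \<rho>" "\<rho> * \<xi>2 > \<rho>" using \<rho> \<xi> by auto
      ultimately show "x \<in> A \<union> B" using fr[of x] Gs by (auto simp: A_def B_def)
    qed
    have "A \<inter> B \<inter> \<Gamma> = {}" by (auto simp: A_def B_def)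
    then have "A \<inter> \<Gamma> = {} \<or> B \<inter> \<Gamma> = {}" using connectedD[OF Gs(3) op] cov by blast
    then show ?thesis
    proof
      assume "A \<inter> \<Gamma> = {}"
      then have "norm (x - x0) = \<rho> * \<xi>2" if "x \<in> \<Gamma>" for x using G2 cov that by blast
      then show ?thesis using val Q(2) by blast
    next
      assume "B \<inter> \<Gamma> = {}"
      then have "norm (x - x0) = \<rho> * \<xi>1" if "x \<in> \<Gamma>" for x using G1 cov that by blast
      then show ?thesis using val Q(1) by blast
    qed
  qed
  have T1: "sqrt (Tm n \<xi>1) > sqrt n" using Tm_gt_inner[OF \<xi>(1,2) n] by simp
  have T2: "sqrt (Tm n \<xi>2) < sqrt n" using Tm_bounds_outer[OF \<xi>(3) n] by simp
  have "nwss \<Omega> u \<Gamma>1 = sqrt (Tm n \<xi>1)" using one[OF Gamma_components(1)] nwss_1_gt_sqrt[OF t2] T2 by linarith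
  then show "core_radius n (nwss \<Omega> u \<Gamma>1) = R"
    using inner_core_radius(2)[OF n \<xi>(1,2) R] Q(1) by (simp add: s_def)
  have "nwss \<Omega> u \<Gamma>2 = sqrt (Tm n \<xi>2)" using one[OF Gamma_components(2)] t2 T1 by linarith
  then show "core_radius n (nwss \<Omega> u \<Gamma>2) = R"
    using outer_core_radius(2)[OF n \<xi>(3) R] Q(2) by (simp add: s_def)
qed

section \<open>Order of the core radii and conclusion\<close>

lemma core_radius_wd_both: "core_radius_wd n (nwss \<Omega> u \<Gamma>1)" "core_radius_wd n (nwss \<Omega> u \<Gamma>2)"
  using core_radius_wd_gt_1[OF n_gt_2] nwss_gt_1 by auto

text \<open>The order of the radii is read off at a point from \<open>good_point\<close>, where the
  lower and the upper bound hold for the same \<open>h\<close>; \<open>core_param\<close> reverses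
  the order.\<close>

lemma curvature_and_radii:
  assumes t2: "nwss \<Omega> u \<Gamma>2 < sqrt n"
  defines "R1 \<equiv> core_radius n (nwss \<Omega> u \<Gamma>1)" and "R2 \<equiv> core_radius n (nwss \<Omega> u \<Gamma>2)"
  shows "\<And>p h. p \<in> \<Sigma> \<Longrightarrow> mean_curvature_at \<Sigma> \<Omega>1 p h \<Longrightarrow>
      (n - 1) / R2 * sqrt (uRmax n R2) \<le> h * sqrt m \<and> h * sqrt m \<le> (n - 1) / R1 * sqrt (uRmax n R1)"
    and "R1 \<le> R2" and "0 < R2" and "R2 < Rmax n"
proof -
  note n = n_gt_2
  obtain x1 S1 where x1: "0 < x1" "x1 < 1" "Tm n x1 = (nwss \<Omega> u \<Gamma>1)\<^sup>2" "0 < S1" "S1 < Rmax n" "core_param n S1 = Qm n x1"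
    "core_radius_wd n (nwss \<Omega> u \<Gamma>1)" "core_radius n (nwss \<Omega> u \<Gamma>1) = S1"
    by (rule inner_core_radius_ex[OF n nwss_1_gt_sqrt[OF t2]])
  obtain x2 S2 where x2: "1 < x2" "Tm n x2 = (nwss \<Omega> u \<Gamma>2)\<^sup>2" "0 < S2" "S2 < Rmax n" "core_param n S2 = Qm n x2"
    "core_radius_wd n (nwss \<Omega> u \<Gamma>2)" "core_radius n (nwss \<Omega> u \<Gamma>2) = S2"
    by (rule outer_core_radius_ex[OF n nwss_gt_1(2) t2])
  have R: "R1 = S1" "R2 = S2" using x1 x2 by (auto simp: R1_def R2_def)
  have c1: "(n - 1) / R1 * sqrt (uRmax n R1) = (n - 1) * sqrt (Qm n x1 / 2)"
    unfolding R by (rule model_curvature[OF n x1(4,6)])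
  have c2: "(n - 1) / R2 * sqrt (uRmax n R2) = (n - 1) * sqrt (Qm n x2 / 2)"
    unfolding R by (rule model_curvature[OF n x2(3,5)])
  have l: "(n - 1) * sqrt (Qm n x2 / 2) \<le> h * sqrt m" if "p \<in> \<Sigma>" "mean_curvature_at \<Sigma> \<Omega>1 p h" for p h
    by (rule curvature_claims(1)[OF that x2(1)]) (use nwss_bound(1)[OF Gamma_closure(2)] x2(2) in simp)
  have r: "h * sqrt m \<le> (n - 1) * sqrt (Qm n x1 / 2)" if "p \<in> \<Sigma>" "mean_curvature_at \<Sigma> \<Omega>1 p h" for p h
    by (rule curvature_claims(3)[OF that x1(1,2)]) (use nwss_bound(1)[OF Gamma_closure(1)] x1(3) in simp)
  show "(n - 1) / R2 * sqrt (uRmax n R2) \<le> h * sqrt m \<and> h * sqrt m \<le> (n - 1) / R1 * sqrt (uRmax n R1)"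
    if "p \<in> \<Sigma>" "mean_curvature_at \<Sigma> \<Omega>1 p h" for p h
    unfolding c1 c2 using l[OF that] r[OF that] by simp
  obtain p h where p: "p \<in> \<Sigma>" "mean_curvature_at \<Sigma> \<Omega>1 p h" using good_point by blast
  have "(n - 1) * sqrt (Qm n x2 / 2) \<le> (n - 1) * sqrt (Qm n x1 / 2)" using l[OF p] r[OF p] by linarith
  then have "sqrt (Qm n x2 / 2) \<le> sqrt (Qm n x1 / 2)" by (rule mult_left_le_imp_le) (use n in simp)
  then have "core_param n S2 \<le> core_param n S1" unfolding x1(6) x2(5) by simp
  then show "R1 \<le> R2" unfolding R using core_param_le_iff[OF x1(4) x2(3)] by blast
  show "0 < R2" "R2 < Rmax n" unfolding R using x2 by auto
qed

end

theorem theorem6p1: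
  fixes \<Omega> \<Sigma> \<Omega>1 \<Omega>2 \<Gamma>1 \<Gamma>2 :: "(real^'n::finite) set"
    and u :: "real^'n \<Rightarrow> real"
    and V :: "(real^'n) set"
  defines "n \<equiv> real CARD('n)"
  assumes n3: "CARD('n) \<ge> 3"
    and dom: "smooth_bounded_domain \<Omega>"
    and comps: "components (frontier \<Omega>) = {\<Gamma>1, \<Gamma>2}" "\<Gamma>1 \<noteq> \<Gamma>2"
    and inner: "\<exists>C\<in>components (- closure \<Omega>). bounded C \<and> frontier C = \<Gamma>1"
    and u_smooth: "open V" "closure \<Omega> \<subseteq> V" "smooth_on V u"
    and pde: "\<forall>x\<in>\<Omega>. laplacian u x = - n"
    and bc: "\<forall>x\<in>frontier \<Omega>. u x = 0"
    and Sigma: "smooth_hypersurface \<Sigma>" "\<Sigma> \<subseteq> MAXset \<Omega> u"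
    and divide: "\<Omega> - \<Sigma> = \<Omega>1 \<union> \<Omega>2" "\<Omega>1 \<inter> \<Omega>2 = {}"
      "open \<Omega>1" "open \<Omega>2" "connected \<Omega>1" "connected \<Omega>2" "\<Omega>1 \<noteq> {}" "\<Omega>2 \<noteq> {}"
    and sides: "frontier \<Omega> \<inter> closure \<Omega>1 = \<Gamma>1" "frontier \<Omega> \<inter> closure \<Omega>2 = \<Gamma>2"
  shows "core_radius_wd n (nwss \<Omega> u \<Gamma>1) \<and> core_radius_wd n (nwss \<Omega> u \<Gamma>2) \<and>
    (nwss_region \<Omega> u \<Omega>2 < sqrt n \<longrightarrow>
      (let R1 = core_radius n (nwss \<Omega> u \<Gamma>1); R2 = core_radius n (nwss \<Omega> u \<Gamma>2) in
        (\<forall>p\<in>\<Sigma>. \<forall>h. mean_curvature_at \<Sigma> \<Omega>1 p h \<longrightarrow>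
            (n - 1) / R2 * sqrt (uRmax n R2) \<le> h * sqrt (umax \<Omega> u) \<and>
            h * sqrt (umax \<Omega> u) \<le> (n - 1) / R1 * sqrt (uRmax n R1)) \<and>
        R1 \<le> R2 \<and>
        (R1 = R2 \<longleftrightarrow> (\<exists>R. 0 < R \<and> R < Rmax n \<and> equivalent_sol \<Omega> u (OmegaR n R) (uR n R))) \<and>
        (\<forall>R. 0 < R \<and> R < Rmax n \<and> equivalent_sol \<Omega> u (OmegaR n R) (uR n R)
              \<longrightarrow> R1 = R \<and> R2 = R)))"
proof -
  interpret ring_problem \<Omega> \<Sigma> \<Omega>1 \<Omega>2 \<Gamma>1 \<Gamma>2 u V n "umax \<Omega> u"
  proof
    show "n = real CARD('n)" by (simp add: n_def)
    show "open \<Omega>" "connected \<Omega>" "bounded \<Omega>" using dom by (auto simp: smooth_bounded_domain_def)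
  qed (use n3 comps u_smooth pde bc Sigma divide sides in auto)
  define R1 R2 where "R1 = core_radius n (nwss \<Omega> u \<Gamma>1)" and "R2 = core_radius n (nwss \<Omega> u \<Gamma>2)"
  show ?thesis
    unfolding Let_def R1_def[symmetric] R2_def[symmetric] nwss_region_2
  proof (intro conjI impI core_radius_wd_both)
    assume t2: "nwss \<Omega> u \<Gamma>2 < sqrt n"
    note cr = curvature_and_radii[OF t2, folded R1_def R2_def]
    show "\<forall>p\<in>\<Sigma>. \<forall>h. mean_curvature_at \<Sigma> \<Omega>1 p h \<longrightarrow>
            (n - 1) / R2 * sqrt (uRmax n R2) \<le> h * sqrt (umax \<Omega> u) \<and>
            h * sqrt (umax \<Omega> u) \<le> (n - 1) / R1 * sqrt (uRmax n R1)" using cr(1) by blast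
    show "R1 \<le> R2" by (rule cr(2))
    show eqv: "\<forall>R. 0 < R \<and> R < Rmax n \<and> equivalent_sol \<Omega> u (OmegaR n R) (uR n R) \<longrightarrow> R1 = R \<and> R2 = R"
      using equivalent_core_radius[OF t2] unfolding R1_def R2_def by blast
    show "R1 = R2 \<longleftrightarrow> (\<exists>R. 0 < R \<and> R < Rmax n \<and> equivalent_sol \<Omega> u (OmegaR n R) (uR n R))"
    proof
      assume "R1 = R2"
      then have "equivalent_sol \<Omega> u (OmegaR n R2) (uR n R2)"
        using model_profile_annulus[OF t2 cr(3,4)] unfolding R1_def R2_def by simp
      then show "\<exists>R. 0 < R \<and> R < Rmax n \<and> equivalent_sol \<Omega> u (OmegaR n R) (uR n R)" using cr(3,4) by blast
    next
      assume "\<exists>R. 0 < R \<and> R < Rmax n \<and> equivalent_sol \<Omega> u (OmegaR n R) (uR n R)"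
      then show "R1 = R2" using eqv by blast
    qed
  qed
qed

end
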